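(* Let $\mathcal{M}_2(E)$ denote the set of positive measures of mass at most $2$ on $E$. Under the assumptions in the context (in particular $f,g$ defined and monotone on $\mathcal{M}_2(\mathbb{T})$), assume that there exists a classical solution $U$ of the continuous master equation with common noise on $[0,T]\times\mathbb{T}\times\mathcal{M}_2(\mathbb{T})$, and let $\omega$ be a modulus of continuity of $\partial_xU$, $\partial_{xx}U$, $D_mU$ and $\partial_yD_mU(\cdot,y)$. Let $U^n$ be the monotone solution of the discrete master equation with common noise on $[0,T]\times S^n\times\mathcal{M}_2(S^n)$, and let $V^n(t,x,m)=U(t,x,m)$ for $(t,x,m)\in[0,T]\times S^n\times\mathcal{M}_2(S^n)$. Then there exists $C>0$, independent of $n$, such that $$\sup_{t\in[0,T],\,x\in S^n,\,m\in\mathcal{P}(S^n)}|U^n(t,x,m)-V^n(t,x,m)|\le C\left(\omega\left(\tfrac1n\right)\right)^{1/3}.$$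
   Context: Notation. $\mathbb{T}$ is the unit circle (torus $\mathbb{R}/\mathbb{Z}$). $\mathcal{P}(E)$, $\mathcal{M}(E)$: probability measures and (finite) Borel measures on $E$. On $\mathcal{M}_2(\mathbb{T})$, $W_1(\mu,\nu)=\sup_\phi\langle\phi,\mu-\nu\rangle$ over $1$-Lipschitz functions $\phi$ with $\phi(0)=0$. $\|\cdot\|_{k+\alpha}$ is the Hölder norm of $\mathcal{C}^{k+\alpha}(\mathbb{T})$; $\langle\cdot,\cdot\rangle$ is the $L^2$/duality pairing. $\frac{\delta U}{\delta m}(m,x)=\lim_{\theta\to0}\frac{U((1-\theta)m+\theta\delta_x)-U(m)}{\theta}$ and $D_mU(m;y)=\partial_y\frac{\delta U}{\delta m}(m,y)$. Standing assumptions. $\sigma>0,\lambda>0,T>0$. $L(x,a)$ is smooth, uniformly convex in $a$ on compact sets, $H(x,p)=\sup_a\{-ap-L(x,a)\}$ is $\mathcal{C}^2$ and uniformly convex in $p$ on all compact sets. $f,g$, $f(m)(x)=f(x,m)$, take values in $\mathcal{C}^\gamma(\mathbb{T})$ ($\gamma\in(0,1)$), are defined and monotone on $\mathcal{M}_2(\mathbb{T})$ ($\int(f(x,m)-f(x,\tilde m))(m-\tilde m)(dx)\ge0$, same for $g$), $W_1$-Lipschitz in $m$ uniformly in $x$; $f$ is Lipschitz in $x$ uniformly in $m$; $g$ is bounded in $\mathcal{C}^{2+\gamma}(\mathbb{T})$ uniformly in $m$. Further assumptions (with $W_1(\mu,\nu)=\sup_\phi\langle\phi,\mu-\nu\rangle$,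 the supremum being over $1$-Lipschitz functions $\phi:\mathbb{T}\to\mathbb{R}$ with $\phi(0)=0$, for $\mu,\nu\in\mathcal{M}_2(\mathbb{T})$). $K:\mathbb{T}^2\to\mathbb{R}$ is smooth, $K\ge0$, $\int K(x,y)dx=1$ for all $y$. For some $\alpha\in(0,1]$: $\sup_m\|f(\cdot,m)\|_{1+\alpha}+\sup_{m,\nu}\frac{\|f(\cdot,m)-f(\cdot,\nu)\|_{1+\alpha}}{W_1(m,\nu)}<\infty$ and $\sup_m\|g(\cdot,m)\|_{2+\alpha}+\sup_{m,\nu}\frac{\|g(\cdot,m)-g(\cdot,\nu)\|_{2+\alpha}}{W_1(m,\nu)}<\infty$. $f,g$ are defined on $\mathcal{M}(\mathbb{T})$ with values in $\mathcal{C}(\mathbb{T},\mathbb{R})$ and are differentiable in $m$, with $\frac{\delta f(x,m,y)}{\delta m}=\lim_{h\to0^+}\frac{f(x,m+h\delta_y)-f(x,m)}{h}$ (same for $g$). There is $\theta>0$ such that for all $m$ and all $\nu\in L^2(\mathbb{T})$, $\int_{\mathbb{T}}\int_{\mathbb{T}}\frac{\delta f(x,m,y)}{\delta m}\nu(x)\nu(y)dxdy\ge\theta\int_{\mathbb{T}}\big(\int_{\mathbb{T}}\frac{\delta f(x,m,y)}{\delta m}\nu(y)dy\big)^2dx$, and the same holds for $g$. Continuous master equation with common noise. $\mathcal{A}m=\int_{\mathbb{T}}K(\cdot,y)m(dy)$ with adjoint $\mathcal{A}^*\varphi(y)=\int_{\mathbb{T}}K(x,y)\varphi(x)dx$ ($\mathcal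 A^*$ acts on the $x$ variable of $U$). For $U(t,x,m)$ on $[0,T]\times\mathbb{T}\times\mathcal{M}_2(\mathbb{T})$, with $U(T,x,m)=g(x,m)$: $$-\partial_tU-\sigma\partial_{xx}U+H(x,\partial_xU)+\int_{\mathbb{T}}\partial_pH(y,\partial_xU(t,y,m))D_mU(t,x,m;y)m(dy)-\sigma\int_{\mathbb{T}}\partial_yD_mU(t,x,m;y)m(dy)+\lambda(U-\mathcal{A}^*U(t,x,\mathcal{A}m))=f(m)(x).$$ A classical solution satisfies the equation with $U$ and all derivatives appearing in it continuous in their arguments ($\mathcal M_2(\mathbb T)$ carrying $W_1$). Discrete master equation with common noise. $S^n=\{x_1,\dots,x_n\}=\{1/n,\dots,1=0\}$, $\Delta x_n=1/n$, indices modulo $n$; $m\in\mathcal{M}_2(S^n)$ is identified with $\sum_jm_j\delta_{x_j}$, and $p\in\mathbb{R}^n$ with a function on $S^n$. $\Delta^n_\pm u(x)=\frac{u(x\pm\Delta x_n)-u(x)}{\Delta x_n}$, $\Delta^n_2u(x)=\frac{u(x+\Delta x_n)-2u(x)+u(x-\Delta x_n)}{\Delta x_n^2}$. $H_\uparrow(x,p)=-\inf_{\alpha\ge0}\{L(x,\alpha)+\alpha p\}$, $H_\downarrow(x,p)=-\inf_{\alpha\ge0}\{L(x,-\alpha)-\alpha p\}+L(x,0)$. $(A_nm)_i=\frac1n\sum_jK_{i,j}m_j$, $A_n^*$ its adjoint (transpose), where $(K_{i,j})$ is a suitable discretization of $K$ with $\sum_iK_{i,j}=n$ for all $j$ (suitable: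 $K_{i,j}\ge0$, $\max_{i,j}|K_{i,j}-K(x_i,x_j)|\to0$, and discrete difference quotients of $K_{i,j}$ in $i,j$ of any fixed order bounded uniformly in $n$, e.g. $K_{i,j}=n^2\times$ the integral of $K$ over the product of the cells of length $1/n$ centred at $x_i,x_j$, and accurate enough that $V^n$ solves the discrete equation below up to an error bounded by $C\omega(1/n)$). Define $G^n,F^n:\mathcal{M}_2(S^n)\times\mathbb{R}^n\to\mathbb{R}^n$ by $$(G^n(m,p))_i=f(x_i,m)-H_\uparrow(x_i,\Delta^n_+p(x_i))-H_\downarrow(x_i,-\Delta^n_-p(x_i))+\sigma\Delta^n_2p(x_i),\quad(F^n(m,p))_i=-\sum_{j=1}^n\partial_{p_i}(G^n(m,p))_jm_j.$$ The equation is $-\partial_tU(t,\cdot,m)+(F^n(m,U)\cdot\nabla_m)U+\lambda(U-A_n^*U(t,A_nm))=G^n(m,U)$, $U(T,x,m)=g(m)(x)$. Monotone solution: a continuous $U:[0,T]\times\mathcal{M}_2(S^n)\to\mathbb{R}^n$ (with the terminal condition) such that for any $\nu\in\mathcal{M}(S^n)$, $a\in\mathbb{R}^n$, $C^1$ function $\psi$ of $t$, and $(t_*,m_* )\in[0,T)\times\mathcal{M}_2(S^n)$ point of strict minimum of $(t,m)\mapsto\langle U(t,m)-a,m-\nu\rangle-\psi(t)$, $$-\tfrac{d\psi(t_* )}{dt}+\lambda\langle U-A_n^*U(A_nm_* ),m_*-\nu\rangle\ge\langle G^n(m_*,U(t_*,m_* )),m_*-\nu\rangle+\langle F^n(m_*,U(t_*,m_*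 )),U(t_*,m_* )-a\rangle.$$ *)

theory Defs
  imports "HOL-Probability.Probability"
begin

text \<open>
  The torus \<open>\<real>/\<int>\<close> is handled through representatives: functions on it are 1-periodic functions
  on \<open>\<real>\<close>, and Borel measures on it are Borel measures on \<open>\<real>\<close> carried by the fundamental
  domain \<open>[0,1)\<close>. A 1-periodic function is 1-Lipschitz for the distance of the torus
  iff it is 1-Lipschitz on \<open>\<real>\<close>; likewise for Hoelder seminorms and moduli of continuity.
\<close>

section \<open>Functions on the torus\<close>

definition periodic :: "(real \<Rightarrow> 'b) \<Rightarrow> bool" where
  "periodic \<phi> \<longleftrightarrow> (\<forall>x. \<phi> (x + 1) = \<phi> x)"

abbreviation torus_integral :: "(real \<Rightarrow> real) \<Rightarrow> real" where
  "torus_integral \<phi> \<equiv> (LINT x:{0..<1}|lborel. \<phi> x)"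

fun C_k :: "nat \<Rightarrow> ('a::euclidean_space \<Rightarrow> real) \<Rightarrow> bool" where
  "C_k 0 F \<longleftrightarrow> continuous_on UNIV F"
| "C_k (Suc k) F \<longleftrightarrow>
     (\<exists>F'. (\<forall>z. (F has_derivative F' z) (at z)) \<and> (\<forall>v. C_k k (\<lambda>z. F' z v)))"

definition smooth :: "('a::euclidean_space \<Rightarrow> real) \<Rightarrow> bool" where
  "smooth F \<longleftrightarrow> (\<forall>k. C_k k F)"

definition holder_norm :: "nat \<Rightarrow> real \<Rightarrow> (real \<Rightarrow> real) \<Rightarrow> ennreal" where
  "holder_norm k \<beta> \<phi> =
     (if periodic \<phi> \<and> C_k k \<phi>
      then (\<Sum>j\<le>k. SUP x. ennreal \<bar>(deriv ^^ j) \<phi> x\<bar>)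
         + (SUP (x, y)\<in>{(x, y). x \<noteq> y}.
              ennreal (\<bar>(deriv ^^ k) \<phi> x - (deriv ^^ k) \<phi> y\<bar> / \<bar>x - y\<bar> powr \<beta>))
      else \<top>)"

section \<open>Measures on the torus\<close>

definition MT :: "real measure set" where
  "MT = {m. sets m = sets borel \<and> emeasure m (- {0..<1}) = 0 \<and> emeasure m UNIV < \<top>}"

definition M2T :: "real measure set" where
  "M2T = {m \<in> MT. emeasure m UNIV \<le> 2}"

definition dirac :: "real \<Rightarrow> real measure" where
  "dirac y = return borel (frac y)"

definition lincomb :: "real \<Rightarrow> real measure \<Rightarrow> real \<Rightarrow> real measure \<Rightarrow> real measure" where
  "lincomb a \<mu> b \<nu> =
     measure_of UNIV (sets borel) (\<lambda>A. ennreal a * emeasure \<mu> A + ennreal b * emeasure \<nu> A)"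

text \<open>On measures of different masses this is only a pseudometric: because of the normalisation
  \<open>\<phi> 0 = 0\<close> it does not see mass added at the point 0.\<close>

definition W1 :: "real measure \<Rightarrow> real measure \<Rightarrow> real" where
  "W1 \<mu> \<nu> = (SUP \<phi>\<in>{\<phi>. periodic \<phi> \<and> 1-lipschitz_on UNIV \<phi> \<and> \<phi> 0 = 0}.
               (LINT x|\<mu>. \<phi> x) - (LINT x|\<nu>. \<phi> x))"

section \<open>Lagrangian and Hamiltonian\<close>

definition uniformly_convex_on_compacts :: "(real \<Rightarrow> real \<Rightarrow> real) \<Rightarrow> bool" where
  "uniformly_convex_on_compacts \<Phi> \<longleftrightarrow>
     (\<forall>R>0. \<exists>c>0. \<forall>x. \<forall>a\<in>{-R..R}. \<forall>b\<in>{-R..R}. \<forall>s\<in>{0..1}.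
        \<Phi> x (s * a + (1 - s) * b)
          \<le> s * \<Phi> x a + (1 - s) * \<Phi> x b - c * s * (1 - s) * (a - b)\<^sup>2)"

definition Ham :: "(real \<Rightarrow> real \<Rightarrow> real) \<Rightarrow> real \<Rightarrow> real \<Rightarrow> real" where
  "Ham L x p = (SUP a. - a * p - L x a)"

definition Ham_up :: "(real \<Rightarrow> real \<Rightarrow> real) \<Rightarrow> real \<Rightarrow> real \<Rightarrow> real" where
  "Ham_up L x p = - (INF a\<in>{0..}. L x a + a * p)"

definition Ham_down :: "(real \<Rightarrow> real \<Rightarrow> real) \<Rightarrow> real \<Rightarrow> real \<Rightarrow> real" where
  "Ham_down L x p = - (INF a\<in>{0..}. L x (- a) - a * p) + L x 0"

definition Lagrangian_assms :: "(real \<Rightarrow> real \<Rightarrow> real) \<Rightarrow> bool" where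
  "Lagrangian_assms L \<longleftrightarrow>
     periodic L \<and> smooth (\<lambda>(x, a). L x a) \<and> uniformly_convex_on_compacts L
     \<and> (\<forall>x p. bdd_above (range (\<lambda>a. - a * p - L x a)))
     \<and> C_k 2 (\<lambda>(x, p). Ham L x p) \<and> uniformly_convex_on_compacts (Ham L)"

section \<open>Couplings\<close>

definition monotone_coupling :: "(real \<Rightarrow> real measure \<Rightarrow> real) \<Rightarrow> bool" where
  "monotone_coupling f \<longleftrightarrow> (\<forall>m\<in>M2T. \<forall>m'\<in>M2T.
     (LINT x|m. f x m - f x m') - (LINT x|m'. f x m - f x m') \<ge> 0)"

definition coupling_assms :: "real \<Rightarrow> (real \<Rightarrow> real measure \<Rightarrow> real) \<Rightarrow> bool" where
  "coupling_assms \<gamma> f \<longleftrightarrow>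
     (\<forall>m\<in>M2T. holder_norm 0 \<gamma> (\<lambda>x. f x m) < \<top>)
     \<and> monotone_coupling f
     \<and> (\<exists>B. \<forall>x. \<forall>m\<in>M2T. \<forall>\<nu>\<in>M2T. \<bar>f x m - f x \<nu>\<bar> \<le> B * W1 m \<nu>)"

definition holder_W1_lipschitz ::
    "nat \<Rightarrow> real \<Rightarrow> (real \<Rightarrow> real measure \<Rightarrow> real) \<Rightarrow> bool" where
  "holder_W1_lipschitz k \<alpha> f \<longleftrightarrow>
     (\<exists>B. \<forall>m\<in>M2T. holder_norm k \<alpha> (\<lambda>x. f x m) \<le> ennreal B)
     \<and> (\<exists>B. \<forall>m\<in>M2T. \<forall>\<nu>\<in>M2T.
          holder_norm k \<alpha> (\<lambda>x. f x m - f x \<nu>) \<le> ennreal (B * W1 m \<nu>))"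

text \<open>\<open>df x m y\<close> is the derivative of \<open>f\<close> in \<open>m\<close>, in the direction \<open>\<delta>\<^sub>y\<close>.\<close>

definition differentiable_coupling ::
    "(real \<Rightarrow> real measure \<Rightarrow> real) \<Rightarrow> (real \<Rightarrow> real measure \<Rightarrow> real \<Rightarrow> real) \<Rightarrow> bool" where
  "differentiable_coupling f df \<longleftrightarrow>
     (\<forall>m\<in>MT. periodic (\<lambda>x. f x m) \<and> continuous_on UNIV (\<lambda>x. f x m))
     \<and> (\<forall>m\<in>MT. \<forall>x y.
          ((\<lambda>h. (f x (lincomb 1 m h (dirac y)) - f x m) / h) \<longlongrightarrow> df x m y) (at_right 0))"

definition strongly_monotone_derivative ::
    "(real \<Rightarrow> real measure \<Rightarrow> real \<Rightarrow> real) \<Rightarrow> real \<Rightarrow> bool" where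
  "strongly_monotone_derivative df \<theta> \<longleftrightarrow>
     (\<forall>m\<in>MT. \<forall>\<nu>. \<nu> \<in> borel_measurable borel
          \<longrightarrow> set_integrable lborel {0..<1} (\<lambda>x. (\<nu> x)\<^sup>2) \<longrightarrow>
        torus_integral (\<lambda>y. torus_integral (\<lambda>x. df x m y * \<nu> x * \<nu> y))
          \<ge> \<theta> * torus_integral (\<lambda>x. (torus_integral (\<lambda>y. df x m y * \<nu> y))\<^sup>2))"

section \<open>Common noise\<close>

definition kernel_assms :: "(real \<Rightarrow> real \<Rightarrow> real) \<Rightarrow> bool" where
  "kernel_assms K \<longleftrightarrow>
     periodic K \<and> (\<forall>x. periodic (K x)) \<and> smooth (\<lambda>(x, y). K x y)
     \<and> (\<forall>x y. K x y \<ge> 0) \<and> (\<forall>y. torus_integral (\<lambda>x. K x y) = 1)"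

definition A_op :: "(real \<Rightarrow> real \<Rightarrow> real) \<Rightarrow> real measure \<Rightarrow> real measure" where
  "A_op K m = density lborel (\<lambda>x. indicator {0..<1} x * ennreal (LINT y|m. K x y))"

definition A_adj :: "(real \<Rightarrow> real \<Rightarrow> real) \<Rightarrow> (real \<Rightarrow> real) \<Rightarrow> real \<Rightarrow> real" where
  "A_adj K \<phi> y = torus_integral (\<lambda>x. K x y * \<phi> x)"

section \<open>Classical solutions of the continuous master equation\<close>

text \<open>Functions of \<open>(t, x, m, y)\<close> on \<open>[0,T] \<times> \<real>/\<int> \<times> M2T \<times> \<real>/\<int>\<close>; functions
  not depending on \<open>y\<close> are treated as constant in \<open>y\<close>. The product carries the sum distance.\<close>

definition state_dist ::
    "real \<Rightarrow> real \<Rightarrow> real measure \<Rightarrow> real \<Rightarrow> real \<Rightarrow> real \<Rightarrow> real measure \<Rightarrow> real \<Rightarrow> real" where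
  "state_dist t x m y t' x' m' y' = \<bar>t - t'\<bar> + \<bar>x - x'\<bar> + W1 m m' + \<bar>y - y'\<bar>"

definition continuous_in_args ::
    "real \<Rightarrow> (real \<Rightarrow> real \<Rightarrow> real measure \<Rightarrow> real \<Rightarrow> real) \<Rightarrow> bool" where
  "continuous_in_args T F \<longleftrightarrow>
     (\<forall>t\<in>{0..T}. \<forall>x. \<forall>m\<in>M2T. \<forall>y. \<forall>\<epsilon>>0. \<exists>\<delta>>0.
        \<forall>t'\<in>{0..T}. \<forall>x'. \<forall>m'\<in>M2T. \<forall>y'.
          state_dist t x m y t' x' m' y' < \<delta> \<longrightarrow> \<bar>F t x m y - F t' x' m' y'\<bar> < \<epsilon>)"

definition modulus :: "(real \<Rightarrow> real) \<Rightarrow> bool" where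
  "modulus \<omega> \<longleftrightarrow> mono_on {0..} \<omega> \<and> \<omega> 0 = 0 \<and> (\<omega> \<longlongrightarrow> 0) (at_right 0)"

definition modulus_of ::
    "real \<Rightarrow> (real \<Rightarrow> real) \<Rightarrow> (real \<Rightarrow> real \<Rightarrow> real measure \<Rightarrow> real \<Rightarrow> real) \<Rightarrow> bool" where
  "modulus_of T \<omega> F \<longleftrightarrow>
     (\<forall>t\<in>{0..T}. \<forall>x. \<forall>m\<in>M2T. \<forall>y. \<forall>t'\<in>{0..T}. \<forall>x'. \<forall>m'\<in>M2T. \<forall>y'.
        \<bar>F t x m y - F t' x' m' y'\<bar> \<le> \<omega> (state_dist t x m y t' x' m' y'))"

text \<open>\<open>Ut\<close>, \<open>Ux\<close>, \<open>Uxx\<close> are the partial derivatives of \<open>U\<close>, \<open>dU\<close> is its derivative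
  \<open>\<delta>U/\<delta>m\<close>, \<open>DU = \<partial>\<^sub>y dU\<close> is the intrinsic derivative in \<open>m\<close>, and \<open>DyDU = \<partial>\<^sub>y DU\<close>.
  The limit defining \<open>dU\<close> is one-sided, since \<open>(1 - \<theta>) m + \<theta> \<delta>\<^sub>y\<close> is in general a positive
  measure for \<open>\<theta> \<ge> 0\<close> only.\<close>

definition has_master_derivatives ::
    "real \<Rightarrow> (real \<Rightarrow> real \<Rightarrow> real measure \<Rightarrow> real)
      \<Rightarrow> (real \<Rightarrow> real \<Rightarrow> real measure \<Rightarrow> real) \<Rightarrow> (real \<Rightarrow> real \<Rightarrow> real measure \<Rightarrow> real)
      \<Rightarrow> (real \<Rightarrow> real \<Rightarrow> real measure \<Rightarrow> real)
      \<Rightarrow> (real \<Rightarrow> real \<Rightarrow> real measure \<Rightarrow> real \<Rightarrow> real)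
      \<Rightarrow> (real \<Rightarrow> real \<Rightarrow> real measure \<Rightarrow> real \<Rightarrow> real)
      \<Rightarrow> (real \<Rightarrow> real \<Rightarrow> real measure \<Rightarrow> real \<Rightarrow> real) \<Rightarrow> bool" where
  "has_master_derivatives T U Ut Ux Uxx dU DU DyDU \<longleftrightarrow>
     (\<forall>t\<in>{0..T}. \<forall>x. \<forall>m\<in>M2T.
        ((\<lambda>s. U s x m) has_real_derivative Ut t x m) (at t within {0..T})
        \<and> ((\<lambda>z. U t z m) has_real_derivative Ux t x m) (at x)
        \<and> ((\<lambda>z. Ux t z m) has_real_derivative Uxx t x m) (at x)
        \<and> (\<forall>y. ((\<lambda>\<theta>. (U t x (lincomb (1 - \<theta>) m \<theta> (dirac y)) - U t x m) / \<theta>)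
                   \<longlongrightarrow> dU t x m y) (at_right 0)
             \<and> ((\<lambda>z. dU t x m z) has_real_derivative DU t x m y) (at y)
             \<and> ((\<lambda>z. DU t x m z) has_real_derivative DyDU t x m y) (at y)))"

definition classical_solution ::
    "real \<Rightarrow> real \<Rightarrow> real \<Rightarrow> (real \<Rightarrow> real \<Rightarrow> real) \<Rightarrow> (real \<Rightarrow> real \<Rightarrow> real)
      \<Rightarrow> (real \<Rightarrow> real measure \<Rightarrow> real) \<Rightarrow> (real \<Rightarrow> real measure \<Rightarrow> real)
      \<Rightarrow> (real \<Rightarrow> real \<Rightarrow> real measure \<Rightarrow> real)
      \<Rightarrow> (real \<Rightarrow> real \<Rightarrow> real measure \<Rightarrow> real) \<Rightarrow> (real \<Rightarrow> real \<Rightarrow> real measure \<Rightarrow> real)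
      \<Rightarrow> (real \<Rightarrow> real \<Rightarrow> real measure \<Rightarrow> real)
      \<Rightarrow> (real \<Rightarrow> real \<Rightarrow> real measure \<Rightarrow> real \<Rightarrow> real)
      \<Rightarrow> (real \<Rightarrow> real \<Rightarrow> real measure \<Rightarrow> real \<Rightarrow> real)
      \<Rightarrow> (real \<Rightarrow> real \<Rightarrow> real measure \<Rightarrow> real \<Rightarrow> real) \<Rightarrow> bool" where
  "classical_solution T \<sigma> lam L K f g U Ut Ux Uxx dU DU DyDU \<longleftrightarrow>
     (\<forall>t\<in>{0..T}. \<forall>m\<in>M2T. periodic (\<lambda>x. U t x m))
     \<and> has_master_derivatives T U Ut Ux Uxx dU DU DyDU
     \<and> continuous_in_args T (\<lambda>t x m y. U t x m)
     \<and> continuous_in_args T (\<lambda>t x m y. Ut t x m)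
     \<and> continuous_in_args T (\<lambda>t x m y. Ux t x m)
     \<and> continuous_in_args T (\<lambda>t x m y. Uxx t x m)
     \<and> continuous_in_args T dU
     \<and> continuous_in_args T DU
     \<and> continuous_in_args T DyDU
     \<and> (\<forall>x. \<forall>m\<in>M2T. U T x m = g x m)
     \<and> (\<forall>t\<in>{0..T}. \<forall>x. \<forall>m\<in>M2T.
          - Ut t x m - \<sigma> * Uxx t x m + Ham L x (Ux t x m)
          + (LINT y|m. deriv (Ham L y) (Ux t y m) * DU t x m y)
          - \<sigma> * (LINT y|m. DyDU t x m y)
          + lam * (U t x m - A_adj K (\<lambda>z. U t z (A_op K m)) x)
          = f x m)"

section \<open>The discrete problem\<close>

text \<open>A vector of \<open>\<real>\<^sup>n\<close> is a function \<open>nat \<Rightarrow> real\<close> of which only the entries with index in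
  \<open>{1..n}\<close> matter; \<open>next_idx\<close> and \<open>prev_idx\<close> are successor and predecessor modulo \<open>n\<close>.
  Measures on the grid vanish outside \<open>{1..n}\<close>, so that on them the product topology of
  \<open>nat \<Rightarrow> real\<close> is the Euclidean one.\<close>

definition grid :: "nat \<Rightarrow> nat \<Rightarrow> real" where
  "grid n i = real i / real n"

definition next_idx :: "nat \<Rightarrow> nat \<Rightarrow> nat" where
  "next_idx n i = (if i = n then 1 else i + 1)"

definition prev_idx :: "nat \<Rightarrow> nat \<Rightarrow> nat" where
  "prev_idx n i = (if i = 1 then n else i - 1)"

definition pairing :: "nat \<Rightarrow> (nat \<Rightarrow> real) \<Rightarrow> (nat \<Rightarrow> real) \<Rightarrow> real" where
  "pairing n p q = (\<Sum>i=1..n. p i * q i)"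

definition MS :: "nat \<Rightarrow> (nat \<Rightarrow> real) set" where
  "MS n = {m. (\<forall>i\<in>{1..n}. m i \<ge> 0) \<and> (\<forall>i. i \<notin> {1..n} \<longrightarrow> m i = 0)}"

definition M2S :: "nat \<Rightarrow> (nat \<Rightarrow> real) set" where
  "M2S n = {m \<in> MS n. (\<Sum>i=1..n. m i) \<le> 2}"

definition PS :: "nat \<Rightarrow> (nat \<Rightarrow> real) set" where
  "PS n = {m \<in> MS n. (\<Sum>i=1..n. m i) = 1}"

text \<open>The measure \<open>\<Sum>\<^sub>j m\<^sub>j \<delta>\<^bsub>x\<^sub>j\<^esub>\<close> on the torus.\<close>

definition emb :: "nat \<Rightarrow> (nat \<Rightarrow> real) \<Rightarrow> real measure" where
  "emb n m = distr (point_measure {1..n} (\<lambda>j. ennreal (m j))) borel (\<lambda>j. frac (grid n j))"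

definition D_plus :: "nat \<Rightarrow> (nat \<Rightarrow> real) \<Rightarrow> nat \<Rightarrow> real" where
  "D_plus n u i = (u (next_idx n i) - u i) / (1 / real n)"

definition D_minus :: "nat \<Rightarrow> (nat \<Rightarrow> real) \<Rightarrow> nat \<Rightarrow> real" where
  "D_minus n u i = (u (prev_idx n i) - u i) / (1 / real n)"

definition D_two :: "nat \<Rightarrow> (nat \<Rightarrow> real) \<Rightarrow> nat \<Rightarrow> real" where
  "D_two n u i = (u (next_idx n i) - 2 * u i + u (prev_idx n i)) / (1 / real n)\<^sup>2"

definition G_disc :: "real \<Rightarrow> (real \<Rightarrow> real \<Rightarrow> real) \<Rightarrow> (real \<Rightarrow> real measure \<Rightarrow> real) \<Rightarrow> nat
    \<Rightarrow> (nat \<Rightarrow> real) \<Rightarrow> (nat \<Rightarrow> real) \<Rightarrow> nat \<Rightarrow> real" where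
  "G_disc \<sigma> L f n m p i =
     f (grid n i) (emb n m) - Ham_up L (grid n i) (D_plus n p i)
     - Ham_down L (grid n i) (- D_minus n p i) + \<sigma> * D_two n p i"

definition F_disc :: "real \<Rightarrow> (real \<Rightarrow> real \<Rightarrow> real) \<Rightarrow> (real \<Rightarrow> real measure \<Rightarrow> real) \<Rightarrow> nat
    \<Rightarrow> (nat \<Rightarrow> real) \<Rightarrow> (nat \<Rightarrow> real) \<Rightarrow> nat \<Rightarrow> real" where
  "F_disc \<sigma> L f n m p i =
     - (\<Sum>j=1..n. deriv (\<lambda>s. G_disc \<sigma> L f n m (p(i := s)) j) (p i) * m j)"

definition A_disc :: "(nat \<Rightarrow> nat \<Rightarrow> real) \<Rightarrow> nat \<Rightarrow> (nat \<Rightarrow> real) \<Rightarrow> nat \<Rightarrow> real" where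
  "A_disc M n m i = (if i \<in> {1..n} then (1 / real n) * (\<Sum>j=1..n. M i j * m j) else 0)"

definition A_disc_adj :: "(nat \<Rightarrow> nat \<Rightarrow> real) \<Rightarrow> nat \<Rightarrow> (nat \<Rightarrow> real) \<Rightarrow> nat \<Rightarrow> real" where
  "A_disc_adj M n p j = (1 / real n) * (\<Sum>i=1..n. M i j * p i)"

definition diff_quot1 :: "nat \<Rightarrow> (nat \<Rightarrow> nat \<Rightarrow> real) \<Rightarrow> nat \<Rightarrow> nat \<Rightarrow> real" where
  "diff_quot1 n M i j = D_plus n (\<lambda>k. M k j) i"

definition diff_quot2 :: "nat \<Rightarrow> (nat \<Rightarrow> nat \<Rightarrow> real) \<Rightarrow> nat \<Rightarrow> nat \<Rightarrow> real" where
  "diff_quot2 n M i j = D_plus n (M i) j"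

definition discretization :: "(real \<Rightarrow> real \<Rightarrow> real) \<Rightarrow> (nat \<Rightarrow> nat \<Rightarrow> nat \<Rightarrow> real) \<Rightarrow> bool" where
  "discretization K Kn \<longleftrightarrow>
     (\<forall>n\<ge>1. \<forall>i\<in>{1..n}. \<forall>j\<in>{1..n}. Kn n i j \<ge> 0)
     \<and> (\<forall>n\<ge>1. \<forall>j\<in>{1..n}. (\<Sum>i=1..n. Kn n i j) = real n)
     \<and> (\<lambda>n. MAX (i, j)\<in>{1..n} \<times> {1..n}. \<bar>Kn n i j - K (grid n i) (grid n j)\<bar>) \<longlonglongrightarrow> 0
     \<and> (\<forall>k l. \<exists>B. \<forall>n\<ge>1. \<forall>i\<in>{1..n}. \<forall>j\<in>{1..n}.
          \<bar>((diff_quot1 n ^^ k) ((diff_quot2 n ^^ l) (Kn n))) i j\<bar> \<le> B)"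

text \<open>The defect of \<open>V\<^sup>n(t, x, m) = U(t, x, m)\<close> in the discrete master equation. The gradient of
  \<open>V\<^sup>n\<close> in \<open>m\<close> is \<open>(\<delta>U/\<delta>m(m, x\<^sub>k))\<^sub>k\<close>: \<open>\<delta>U/\<delta>m\<close> differs from the derivative in the
  direction of a Dirac mass by a constant in \<open>y\<close>, which does not matter as the entries of
  \<open>F_disc\<close> sum to 0.\<close>

definition V_disc :: "(real \<Rightarrow> real \<Rightarrow> real measure \<Rightarrow> real) \<Rightarrow> nat
    \<Rightarrow> real \<Rightarrow> (nat \<Rightarrow> real) \<Rightarrow> nat \<Rightarrow> real" where
  "V_disc U n t m i = U t (grid n i) (emb n m)"

definition defect ::
    "real \<Rightarrow> real \<Rightarrow> (real \<Rightarrow> real \<Rightarrow> real) \<Rightarrow> (nat \<Rightarrow> nat \<Rightarrow> nat \<Rightarrow> real)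
      \<Rightarrow> (real \<Rightarrow> real measure \<Rightarrow> real)
      \<Rightarrow> (real \<Rightarrow> real \<Rightarrow> real measure \<Rightarrow> real) \<Rightarrow> (real \<Rightarrow> real \<Rightarrow> real measure \<Rightarrow> real)
      \<Rightarrow> (real \<Rightarrow> real \<Rightarrow> real measure \<Rightarrow> real \<Rightarrow> real)
      \<Rightarrow> nat \<Rightarrow> real \<Rightarrow> (nat \<Rightarrow> real) \<Rightarrow> nat \<Rightarrow> real" where
  "defect \<sigma> lam L Kn f U Ut dU n t m i =
     - Ut t (grid n i) (emb n m)
     + (\<Sum>k=1..n. F_disc \<sigma> L f n m (V_disc U n t m) k * dU t (grid n i) (emb n m) (grid n k))
     + lam * (V_disc U n t m i - A_disc_adj (Kn n) n (V_disc U n t (A_disc (Kn n) n m)) i)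
     - G_disc \<sigma> L f n m (V_disc U n t m) i"

section \<open>Monotone solutions of the discrete master equation\<close>

definition strict_min_on :: "('a \<Rightarrow> real) \<Rightarrow> 'a set \<Rightarrow> 'a \<Rightarrow> bool" where
  "strict_min_on \<Phi> S z \<longleftrightarrow> z \<in> S \<and> (\<forall>w\<in>S. w \<noteq> z \<longrightarrow> \<Phi> z < \<Phi> w)"

definition monotone_solution ::
    "real \<Rightarrow> real \<Rightarrow> real \<Rightarrow> (real \<Rightarrow> real \<Rightarrow> real) \<Rightarrow> (nat \<Rightarrow> nat \<Rightarrow> nat \<Rightarrow> real)
      \<Rightarrow> (real \<Rightarrow> real measure \<Rightarrow> real) \<Rightarrow> (real \<Rightarrow> real measure \<Rightarrow> real)
      \<Rightarrow> nat \<Rightarrow> (real \<Rightarrow> (nat \<Rightarrow> real) \<Rightarrow> nat \<Rightarrow> real) \<Rightarrow> bool" where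
  "monotone_solution T \<sigma> lam L Kn f g n W \<longleftrightarrow>
     (\<forall>i\<in>{1..n}. continuous_on ({0..T} \<times> M2S n) (\<lambda>(t, m). W t m i))
     \<and> (\<forall>m\<in>M2S n. \<forall>i\<in>{1..n}. W T m i = g (grid n i) (emb n m))
     \<and> (\<forall>\<nu>\<in>MS n. \<forall>a \<psi> \<psi>'.
          (\<forall>t\<in>{0..T}. (\<psi> has_real_derivative \<psi>' t) (at t within {0..T}))
          \<longrightarrow> continuous_on {0..T} \<psi>'
          \<longrightarrow> (\<forall>t\<in>{0..<T}. \<forall>m\<in>M2S n.
                strict_min_on
                  (\<lambda>(t, m). pairing n (\<lambda>i. W t m i - a i) (\<lambda>i. m i - \<nu> i) - \<psi> t)
                  ({0..T} \<times> M2S n) (t, m)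
                \<longrightarrow>
                - \<psi>' t
                + lam * pairing n
                    (\<lambda>i. W t m i - A_disc_adj (Kn n) n (W t (A_disc (Kn n) n m)) i)
                    (\<lambda>i. m i - \<nu> i)
                \<ge> pairing n (G_disc \<sigma> L f n m (W t m)) (\<lambda>i. m i - \<nu> i)
                  + pairing n (F_disc \<sigma> L f n m (W t m)) (\<lambda>i. W t m i - a i)))"

end

theory Submission
  imports Defs
begin

text \<open>
  Doubling the variables shows that any two functions satisfying the inequality of monotone solutions up to
  errors \<open>e1\<close>, \<open>e2\<close> compare: \<open>\<langle>U1(t,m) - U2(t,m'), m - m'\<rangle> \<ge> - (e1 + e2) (T - t)\<close>; the minimum is made strict
  by subtracting a small multiple of \<open>\<bar>m\<bar>\<^sup>2\<close>. A time discretisation of the forward-backward system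
  with jump source \<open>A* W(t, A m)\<close>, solvable by Brouwer's theorem, gives approximate characteristics, and
  comparing them with \<open>W\<close> shows by Minty's argument that they start from \<open>W\<close> at interior points.

  With \<open>eps\<close> the defect of \<open>V\<close>, the comparison of \<open>W\<close> with \<open>V\<close> and the Lasry--Lions identity bound
  \<open>\<integral> \<Sum> m gap\<close> along a characteristic by \<open>C eps\<close>. Strong convexity bounds the difference \<open>x\<close> of the
  drifts through \<open>min x (x\<^sup>2) \<le> C gap\<close>, hence its integral by \<open>C sqrt eps\<close>; this controls the distance
  of the two flows of measures in \<open>W1\<close>, and then \<open>\<bar>W - V\<bar> \<le> C sqrt eps\<close> by the maximum principle. As \<open>\<omega>(1/n) \<le> \<omega>(1)\<close>,
  the exponent 1/2 is stronger than the exponent 1/3.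
\<close>

section \<open>Compactness and Brouwer fixed points\<close>

text \<open>Comparing \<open>W\<close> with \<open>V\<close> gives only a pairing inequality,
  \<open>\<langle>W - V, m - \<nu>\<rangle> \<ge> - C eps\<close>. Minty's argument converts it into
  pointwise bounds only through a modulus of continuity of \<open>W\<close>, which is not controlled
  uniformly in \<open>n\<close>. Hence the detour through characteristics: along them the
  Lasry-Lions identity also returns the strict convexity of the Hamiltonian. Minty's argument merely
  identifies their starting value, at fixed \<open>n\<close> and with arbitrarily small error; it
  perturbs single entries of a probability measure, which is where masses other than 1 are needed.

  Two kinds of constants must be kept apart. Bounds on rates and moduli obtained by compactness may
  depend on \<open>n\<close>; they enter only step sizes and auxiliary small parameters that vanish
  from the result. The final constant is built from bounds on \<open>V\<close> and the data: the
  one-sided Lipschitz bound of its drift, the \<open>W1\<close> Lipschitz constants, and the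
  convexity constant near the bounded difference quotients of \<open>V\<close>. The difference
  quotients of a characteristic have no such bound, which is why convexity appears as
  \<open>min x (x\<^sup>2)\<close>.\<close>

lemma compact_gauge:
  fixes a b :: "'a::t2_space \<Rightarrow> real"
  assumes K: "compact K" and a: "continuous_on K a" and b: "continuous_on K b"
    and nonneg: "\<And>z. z \<in> K \<Longrightarrow> b z \<ge> 0"
    and zero: "\<And>z. z \<in> K \<Longrightarrow> b z = 0 \<Longrightarrow> a z \<le> 0"
    and e: "e > 0"
  shows "\<exists>d>0. \<forall>z\<in>K. b z < d \<longrightarrow> a z < e"
proof -
  \<comment> \<open>On the compact set where \<open>a \<ge> e\<close> the function \<open>b\<close>
    has no zero, so its minimum there serves as \<open>d\<close>. With \<open>b\<close> a distance
    and \<open>a\<close> an oscillation this is uniform continuity.\<close>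
  define K' where "K' = K \<inter> a -` {e..}"
  have "closedin (top_of_set K) K'"
    unfolding K'_def using a by (intro continuous_closedin_preimage) auto
  then have K': "compact K'" using K closedin_compact by blast
  show ?thesis
  proof (cases "K' = {}")
    case True
    then have "\<forall>z\<in>K. a z < e" unfolding K'_def by (auto simp: not_le)
    then show ?thesis by (intro exI[of _ 1]) auto
  next
    case False
    have "continuous_on K' b" using b by (rule continuous_on_subset) (auto simp: K'_def)
    from continuous_attains_inf[OF K' False this]
    obtain z where z: "z \<in> K'" "\<forall>y\<in>K'. b z \<le> b y" by blast
    have "b z \<noteq> 0" using zero[of z] z(1) e unfolding K'_def by auto
    then have "b z > 0" using nonneg[of z] z(1) unfolding K'_def by auto
    moreover have "a y < e" if "y \<in> K" "b y < b z" for y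
      using z(2) that unfolding K'_def by (auto simp: not_le[symmetric])
    ultimately show ?thesis by blast
  qed
qed

section \<open>Boxes in function spaces and Brouwer's theorem\<close>

definition box_fun :: "'i set \<Rightarrow> real \<Rightarrow> real \<Rightarrow> ('i \<Rightarrow> real) set" where
  "box_fun I a b = {x. (\<forall>i\<in>I. a \<le> x i \<and> x i \<le> b) \<and> (\<forall>i. i \<notin> I \<longrightarrow> x i = 0)}"

lemma compact_box_fun: "compact (box_fun I a b)"
proof -
  define J where "J = (\<lambda>i. if i \<in> I then {a..b} else {0::real})"
  have "compactin (product_topology (\<lambda>i. euclidean) UNIV) (PiE UNIV J)"
    unfolding compactin_PiE by (auto simp: J_def)
  then have "compact (PiE UNIV J)"
    by (simp add: euclidean_product_topology)
  moreover have "PiE UNIV J = box_fun I a b"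
    by (auto simp: J_def box_fun_def PiE_def Pi_def split: if_splits)
  ultimately show ?thesis by simp
qed

text \<open>\<open>compact_gauge\<close> on pairs of points. The l1 sum separates points because
  members of \<open>C\<close> vanish off the finite set \<open>I\<close>.\<close>

lemma l1_unif_cont:
  fixes h :: "('i::countable \<Rightarrow> real) \<Rightarrow> real"
  assumes fin: "finite I" and C: "compact C" "continuous_on C h"
    and supp: "\<And>x i. x \<in> C \<Longrightarrow> i \<notin> I \<Longrightarrow> x i = 0"
    and e: "e > 0"
  shows "\<exists>d>0. \<forall>x\<in>C. \<forall>y\<in>C. (\<Sum>i\<in>I. \<bar>x i - y i\<bar>) < d \<longrightarrow> \<bar>h x - h y\<bar> < e"
proof -
  have "\<exists>d>0. \<forall>z\<in>C\<times>C. (\<lambda>(x,y). \<Sum>i\<in>I. \<bar>x i - y i\<bar>) z < d \<longrightarrow> (\<lambda>(x,y). \<bar>h x - h y\<bar>) z < e"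
  proof (rule compact_gauge)
    show "compact (C \<times> C)" using C by (intro compact_Times)
    have "continuous_on (C\<times>C) (\<lambda>z. h (fst z))" "continuous_on (C\<times>C) (\<lambda>z. h (snd z))"
      by (rule continuous_on_compose2[OF C(2)], intro continuous_on_fst continuous_on_snd continuous_on_id, force)+
    then show "continuous_on (C\<times>C) (\<lambda>(x,y). \<bar>h x - h y\<bar>)"
      by (auto simp: case_prod_beta intro!: continuous_intros)
    have "continuous_on (C\<times>C) (\<lambda>z. fst z i)" "continuous_on (C\<times>C) (\<lambda>z. snd z i)" for i
      by (rule continuous_on_product_then_coordinatewise, intro continuous_on_fst continuous_on_snd continuous_on_id)+
    then show "continuous_on (C\<times>C) (\<lambda>(x,y). \<Sum>i\<in>I. \<bar>x i - y i\<bar>)"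
      by (auto simp: case_prod_beta intro!: continuous_intros)
    fix z assume z: "z \<in> C \<times> C" "(\<lambda>(x,y). \<Sum>i\<in>I. \<bar>x i - y i\<bar>) z = 0"
    obtain x y where xy: "z = (x,y)" by fastforce
    have "\<forall>i\<in>I. \<bar>x i - y i\<bar> = 0" using z(2) fin unfolding xy
      by (simp add: sum_nonneg_eq_0_iff)
    moreover have "x i = y i" if "i \<notin> I" for i using supp[of x i] supp[of y i] that z(1) unfolding xy by auto
    ultimately have "x i = y i" for i by (cases "i \<in> I") auto
    then have "x = y" by (rule ext)
    then show "(\<lambda>(x,y). \<bar>h x - h y\<bar>) z \<le> 0" by (simp add: xy)
  qed (use e in \<open>auto intro: sum_nonneg\<close>)
  then show ?thesis by auto
qed

text \<open>The number of coordinates is a variable here (later: time steps times grid points), so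
  the cube lives in a function space and the fixed point is drawn from \<open>kuhn_lemma\<close>
  directly. If the displacement had a positive minimum, a cell of a fine grid whose corners carry
  both labels in every coordinate would fall below that minimum.\<close>

theorem brouwer_box_fun:
  fixes \<Theta> :: "('i::countable \<Rightarrow> real) \<Rightarrow> 'i \<Rightarrow> real"
  assumes fin: "finite I"
    and cont: "\<And>i. i \<in> I \<Longrightarrow> continuous_on (box_fun I 0 1) (\<lambda>x. \<Theta> x i)"
    and maps: "\<And>x i. x \<in> box_fun I 0 1 \<Longrightarrow> i \<in> I \<Longrightarrow> 0 \<le> \<Theta> x i \<and> \<Theta> x i \<le> 1"
  shows "\<exists>x\<in>box_fun I 0 1. \<forall>i\<in>I. \<Theta> x i = x i"
proof (rule ccontr)
  assume no: "\<not> ?thesis"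
  let ?C = "box_fun I 0 1 :: ('i \<Rightarrow> real) set"
  let ?d = "\<lambda>x. \<Sum>i\<in>I. \<bar>\<Theta> x i - x i\<bar>"
  have ne: "?C \<noteq> {}" by (auto simp: box_fun_def intro!: exI[of _ "\<lambda>_. 0"])
  have "continuous_on ?C (\<lambda>x. x i)" for i
    by (rule continuous_on_product_then_coordinatewise) (rule continuous_on_id)
  then have "continuous_on ?C ?d"
    using cont by (intro continuous_intros) auto
  from continuous_attains_inf[OF compact_box_fun ne this]
  obtain x0 where x0: "x0 \<in> ?C" "\<And>x. x \<in> ?C \<Longrightarrow> ?d x0 \<le> ?d x" by blast
  have d0: "?d x0 > 0"
  proof -
    obtain i where "i \<in> I" "\<Theta> x0 i \<noteq> x0 i" using no x0(1) by blast
    then show ?thesis using fin by (intro sum_pos2[of _ i]) auto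
  qed
  define n where "n = card I"
  have n0: "n > 0" using d0 fin unfolding n_def by (auto simp: card_gt_0_iff)
  obtain b where b: "bij_betw b {0..<n} I"
    using ex_bij_betw_nat_finite[OF fin] unfolding n_def by blast
  \<comment> \<open>If each of the \<open>n\<close> coordinates moves by less than
    \<open>2 * c\<close>, the total displacement is below its supposed minimum
    \<open>?d x0\<close>.\<close>
  define c where "c = ?d x0 / (2 * real n)"
  have c0: "c > 0" unfolding c_def using d0 n0 by simp
  have "\<forall>i\<in>I. \<exists>d>0. \<forall>x\<in>?C. \<forall>y\<in>?C. (\<Sum>i\<in>I. \<bar>x i - y i\<bar>) < d \<longrightarrow> \<bar>\<Theta> x i - \<Theta> y i\<bar> < c"
    using c0 by (intro ballI l1_unif_cont[OF fin compact_box_fun] cont) (auto simp: box_fun_def)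
  from bchoice[OF this] obtain dd where dd': "\<forall>i\<in>I. dd i > 0 \<and> (\<forall>x\<in>?C. \<forall>y\<in>?C.
      (\<Sum>j\<in>I. \<bar>x j - y j\<bar>) < dd i \<longrightarrow> \<bar>\<Theta> x i - \<Theta> y i\<bar> < c)" by blast
  then have dd: "\<And>i. i \<in> I \<Longrightarrow> dd i > 0"
    "\<And>i x y. i \<in> I \<Longrightarrow> x \<in> ?C \<Longrightarrow> y \<in> ?C \<Longrightarrow> (\<Sum>j\<in>I. \<bar>x j - y j\<bar>) < dd i \<Longrightarrow> \<bar>\<Theta> x i - \<Theta> y i\<bar> < c"
    by blast+
  define dl where "dl = Min (insert c (dd ` I))"
  have dl0: "dl > 0" unfolding dl_def using fin dd c0 by auto
  have dlc: "dl \<le> c" unfolding dl_def using fin by auto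
  have dli: "dl \<le> dd i" if "i \<in> I" for i unfolding dl_def using fin that by auto
  \<comment> \<open>Mesh width \<open>1 / p\<close>: changing all \<open>n\<close> coordinates by
    one mesh width stays within the modulus \<open>dl\<close>.\<close>
  obtain p :: nat where p: "real p > real n / dl" using reals_Archimedean2 by blast
  have p0: "p > 0" using p n0 dl0 by (metis divide_pos_pos less_trans of_nat_0_less_iff)
  have np: "real n / real p < dl" using p p0 dl0 by (simp add: field_simps)
  have p1: "1 / real p < c"
  proof -
    have "1 / real p \<le> real n / real p" using n0 by (intro divide_right_mono) auto
    then show ?thesis using np dlc by linarith
  qed
  define X where "X = (\<lambda>r::nat\<Rightarrow>nat. \<lambda>i. if i \<in> I then real (r (inv_into {0..<n} b i)) / real p else 0)"
  have Xb: "X r (b j) = real (r j) / real p" if "j < n" for r j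
  proof -
    have "b j \<in> I" using b that by (auto simp: bij_betw_def)
    moreover have "inv_into {0..<n} b (b j) = j"
      using b that by (auto simp: bij_betw_def)
    ultimately show ?thesis unfolding X_def by simp
  qed
  have XC: "X r \<in> ?C" if "\<And>j. j < n \<Longrightarrow> r j \<le> p" for r
  proof -
    have "inv_into {0..<n} b i < n" if "i \<in> I" for i
      using b that by (metis atLeastLessThan_iff bij_betw_def inv_into_into)
    then show ?thesis using that p0 unfolding box_fun_def X_def by (auto simp: divide_le_eq)
  qed
  have Xsum: "(\<Sum>i\<in>I. \<bar>X r i - X s i\<bar>) = (\<Sum>j<n. \<bar>real (r j) - real (s j)\<bar> / real p)" for r s
  proof -
    have "(\<Sum>i\<in>I. \<bar>X r i - X s i\<bar>) = (\<Sum>j\<in>{0..<n}. \<bar>X r (b j) - X s (b j)\<bar>)"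
      using sum.reindex_bij_betw[OF b, of "\<lambda>i. \<bar>X r i - X s i\<bar>"] by simp
    also have "\<dots> = (\<Sum>j<n. \<bar>real (r j) - real (s j)\<bar> / real p)"
      by (intro sum.cong) (auto simp: Xb diff_divide_distrib[symmetric])
    finally show ?thesis .
  qed
  \<comment> \<open>Label 0 marks a coordinate that \<open>\<Theta>\<close> does not decrease. The
    first two cases are the values that \<open>kuhn_lemma\<close> demands on opposite faces; they
    agree with this rule because \<open>\<Theta>\<close> maps into the cube.\<close>
  define label where "label = (\<lambda>r j. if r j = 0 then 0::nat else if r j = p then 1
      else if \<Theta> (X r) (b j) \<ge> X r (b j) then 0 else 1)"
  obtain q where q: "\<forall>i<n. q i < p"
    "\<forall>i<n. \<exists>r s. (\<forall>j<n. q j \<le> r j \<and> r j \<le> q j + 1) \<and> (\<forall>j<n. q j \<le> s j \<and> s j \<le> q j + 1)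
        \<and> label r i \<noteq> label s i"
    by (rule kuhn_lemma[of p n label]) (use p0 in \<open>auto simp: label_def\<close>)
  have qC: "X q \<in> ?C" using q(1) by (intro XC) (auto intro: less_imp_le)
  have lab: "label r j = 0 \<Longrightarrow> \<Theta> (X r) (b j) \<ge> X r (b j)" "label r j \<noteq> 0 \<Longrightarrow> \<Theta> (X r) (b j) \<le> X r (b j)"
    if "X r \<in> ?C" "j < n" for r j
    using maps[OF that(1), of "b j"] b that p0 unfolding label_def
    by (auto simp: Xb bij_betw_def split: if_splits)
  have near: "X r \<in> ?C \<and> \<bar>\<Theta> (X r) (b i) - \<Theta> (X q) (b i)\<bar> < c \<and> \<bar>X r (b i) - X q (b i)\<bar> < c"
    if r: "\<forall>j<n. q j \<le> r j \<and> r j \<le> q j + 1" and i: "i < n" for r i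
  proof -
    have rC: "X r \<in> ?C"
    proof (rule XC)
      fix j assume "j < n"
      then have "r j \<le> q j + 1" "q j < p" using r q(1) by auto
      then show "r j \<le> p" by simp
    qed
    have le1: "\<bar>real (r j) - real (q j)\<bar> / real p \<le> 1 / real p" if "j < n" for j
    proof -
      have "q j \<le> r j" "r j \<le> q j + 1" using r that by auto
      then have "real (q j) \<le> real (r j)" "real (r j) \<le> real (q j) + 1" by linarith+
      then show ?thesis by (intro divide_right_mono) auto
    qed
    have "(\<Sum>j<n. \<bar>real (r j) - real (q j)\<bar> / real p) \<le> (\<Sum>j<n. 1 / real p)"
      by (intro sum_mono le1) auto
    also have "\<dots> = real n / real p" by simp
    finally have s: "(\<Sum>i\<in>I. \<bar>X r i - X q i\<bar>) < dl" using np Xsum[of r q] by linarith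
    have bi: "b i \<in> I" using b i by (auto simp: bij_betw_def)
    have "\<bar>\<Theta> (X r) (b i) - \<Theta> (X q) (b i)\<bar> < c"
      using s dli[OF bi] by (intro dd(2)[OF bi rC qC]) auto
    moreover have "\<bar>X r (b i) - X q (b i)\<bar> < c"
      using le1[OF i] p1 i by (simp add: Xb diff_divide_distrib[symmetric])
    ultimately show ?thesis using rC by blast
  qed
  \<comment> \<open>Two corners of the cell have different labels, so coordinate \<open>i\<close> of
    the displacement takes both signs. Each corner differs from \<open>X q\<close> by less than
    \<open>c\<close> in the point and in its image.\<close>
  have small: "\<bar>\<Theta> (X q) (b i) - X q (b i)\<bar> < 2 * c" if i: "i < n" for i
  proof -
    obtain r s where rs: "\<forall>j<n. q j \<le> r j \<and> r j \<le> q j + 1" "\<forall>j<n. q j \<le> s j \<and> s j \<le> q j + 1"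
      "label r i \<noteq> label s i" using q(2) i by blast
    note R = near[OF rs(1) i] and S = near[OF rs(2) i]
    show ?thesis
    proof (cases "label r i = 0")
      case True
      then have "\<Theta> (X r) (b i) \<ge> X r (b i)" "\<Theta> (X s) (b i) \<le> X s (b i)"
        using lab[of r i] lab[of s i] R S i rs(3) by auto
      then show ?thesis using R S by linarith
    next
      case False
      have "label r i \<in> {0,1}" "label s i \<in> {0,1}" by (auto simp: label_def)
      then have "label s i = 0" using False rs(3) by auto
      then have "\<Theta> (X r) (b i) \<le> X r (b i)" "\<Theta> (X s) (b i) \<ge> X s (b i)"
        using lab[of r i] lab[of s i] R S i False by auto
      then show ?thesis using R S by linarith
    qed
  qed
  have "?d (X q) = (\<Sum>j\<in>{0..<n}. \<bar>\<Theta> (X q) (b j) - X q (b j)\<bar>)"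
    using sum.reindex_bij_betw[OF b, of "\<lambda>i. \<bar>\<Theta> (X q) i - X q i\<bar>"] by simp
  also have "\<dots> < (\<Sum>j\<in>{0..<n}. 2 * c)"
    using small n0 by (intro sum_strict_mono) auto
  also have "\<dots> = ?d x0" unfolding c_def using n0 by simp
  finally show False using x0(2)[OF qC] by linarith
qed

section \<open>Mean value inequalities for right derivatives\<close>

lemma right_derivative_lower_bound:
  fixes h D :: "real \<Rightarrow> real"
  assumes ab: "a \<le> b" and cont: "continuous_on {a..b} h"
    and der: "\<And>x. x \<in> {a..<b} \<Longrightarrow> ((\<lambda>s. (h (x + s) - h x) / s) \<longlongrightarrow> D x) (at_right 0)"
    and lb: "\<And>x. x \<in> {a..<b} \<Longrightarrow> c \<le> D x"
  shows "c * (b - a) \<le> h b - h a"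
proof (rule ccontr)
  assume "\<not> ?thesis"
  then have neg: "h b - h a < c * (b - a)" by simp
  then have "a < b" using ab by (cases "a = b") auto
  define e where "e = (c * (b - a) - (h b - h a)) / (2 * (b - a))"
  have e0: "e > 0" unfolding e_def using neg \<open>a < b\<close> by (intro divide_pos_pos) auto
  \<comment> \<open>Tilting by the slope \<open>c - e\<close> puts the end value below the initial
    value although every right derivative of \<open>k\<close> is at least \<open>e\<close>.\<close>
  define k where "k = (\<lambda>x. h x - (c - e) * x)"
  have kb: "k b < k a"
  proof -
    have "e * (b - a) = (c * (b - a) - (h b - h a)) / 2"
      unfolding e_def using \<open>a < b\<close> by (simp add: field_simps)
    then show ?thesis using neg unfolding k_def by (simp add: algebra_simps)
  qed
  have kcont: "continuous_on {a..b} k" unfolding k_def by (intro continuous_intros cont)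
  define S where "S = {a..b} \<inter> k -` {k a..}"
  have "closedin (top_of_set {a..b}) S"
    unfolding S_def by (intro continuous_closedin_preimage kcont) auto
  then have Scomp: "compact S" using closedin_compact compact_Icc by blast
  have aS: "a \<in> S" unfolding S_def using ab by auto
  \<comment> \<open>The last point at which \<open>k\<close> has not dropped below its initial
    value. The positive right derivative there produces a later such point.\<close>
  obtain s where s: "s \<in> S" "\<forall>t\<in>S. t \<le> s"
    using compact_attains_sup[OF Scomp] aS by blast
  have sb: "s \<in> {a..<b}" using s(1) kb unfolding S_def by (cases "s = b") auto
  have "((\<lambda>r. (h (s + r) - h s) / r - (c - e)) \<longlongrightarrow> D s - (c - e)) (at_right 0)"
    using der[OF sb] by (intro tendsto_intros)
  moreover have "D s - (c - e) > 0" using lb[OF sb] e0 by simp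
  ultimately have "\<forall>\<^sub>F r in at_right 0. (h (s + r) - h s) / r - (c - e) > 0"
    by (rule order_tendstoD)
  moreover have "\<forall>\<^sub>F r in at_right 0. r < b - s" using sb
    by (auto simp: eventually_at_right_field intro!: exI[of _ "b - s"])
  moreover have "\<forall>\<^sub>F r in at_right (0::real). r > 0" by (simp add: eventually_at_right_less)
  ultimately have "\<forall>\<^sub>F r in at_right 0. (h (s + r) - h s) / r - (c - e) > 0 \<and> r < b - s \<and> r > 0"
    by eventually_elim auto
  then obtain r where r: "(h (s + r) - h s) / r - (c - e) > 0" "r < b - s" "r > 0"
    using eventually_happens' trivial_limit_at_right_real by blast
  have "h (s + r) - h s > (c - e) * r" using r(1,3) by (simp add: field_simps)
  then have "k (s + r) > k s" unfolding k_def by (simp add: algebra_simps)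
  then have "s + r \<in> S" using s(1) sb r unfolding S_def by auto
  then show False using s(2) r(3) by force
qed

lemma right_derivative_abs_bound:
  fixes h D :: "real \<Rightarrow> real"
  assumes ab: "a \<le> b" and cont: "continuous_on {a..b} h"
    and der: "\<And>x. x \<in> {a..<b} \<Longrightarrow> ((\<lambda>s. (h (x + s) - h x) / s) \<longlongrightarrow> D x) (at_right 0)"
    and bd: "\<And>x. x \<in> {a..<b} \<Longrightarrow> \<bar>D x - c\<bar> \<le> e"
  shows "\<bar>h b - h a - c * (b - a)\<bar> \<le> e * (b - a)"
proof -
  have "(c - e) * (b - a) \<le> h b - h a"
    by (rule right_derivative_lower_bound[OF ab cont der]) (use bd in \<open>auto simp: abs_le_iff\<close>, fastforce)
  moreover have "(- c - e) * (b - a) \<le> - h b - - h a"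
  proof (rule right_derivative_lower_bound[OF ab, where D="\<lambda>x. - D x"])
    show "continuous_on {a..b} (\<lambda>x. - h x)" by (intro continuous_intros cont)
    fix x assume x: "x \<in> {a..<b}"
    have "((\<lambda>s. - ((h (x + s) - h x) / s)) \<longlongrightarrow> - D x) (at_right 0)"
      by (intro tendsto_intros der x)
    then show "((\<lambda>s. (- h (x + s) - - h x) / s) \<longlongrightarrow> - D x) (at_right 0)"
      by (simp add: minus_divide_left)
    show "- c - e \<le> - D x" using bd[OF x] by (auto simp: abs_le_iff)
  qed
  ultimately show ?thesis by (simp add: abs_le_iff algebra_simps)
qed

section \<open>The discrete problem\<close>

lemma next_idx_in: "i \<in> {1..n} \<Longrightarrow> next_idx n i \<in> {1..n}"
  and prev_idx_in: "i \<in> {1..n} \<Longrightarrow> prev_idx n i \<in> {1..n}"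
  by (auto simp: next_idx_def prev_idx_def)

lemma prev_next_idx: "i \<in> {1..n} \<Longrightarrow> prev_idx n (next_idx n i) = i"
  and next_prev_idx: "i \<in> {1..n} \<Longrightarrow> next_idx n (prev_idx n i) = i"
  by (auto simp: next_idx_def prev_idx_def)

lemma pairing_diff_left: "pairing n (\<lambda>i. p i - q i) r = pairing n p r - pairing n q r"
  and pairing_diff_right: "pairing n r (\<lambda>i. p i - q i) = pairing n r p - pairing n r q"
  and pairing_add_left: "pairing n (\<lambda>i. p i + q i) r = pairing n p r + pairing n q r"
  and pairing_add_right: "pairing n r (\<lambda>i. p i + q i) = pairing n r p + pairing n r q"
  and pairing_scale_left: "pairing n (\<lambda>i. c * p i) r = c * pairing n p r"
  and pairing_scale_right: "pairing n r (\<lambda>i. c * p i) = c * pairing n r p"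
  and pairing_uminus_left: "pairing n (\<lambda>i. - p i) r = - pairing n p r"
  by (simp_all add: pairing_def sum_subtractf sum.distrib sum_distrib_left sum_negf algebra_simps)

lemma pairing_cong:
  "(\<And>i. i \<in> {1..n} \<Longrightarrow> p i = p' i) \<Longrightarrow> (\<And>i. i \<in> {1..n} \<Longrightarrow> q i = q' i) \<Longrightarrow> pairing n p q = pairing n p' q'"
  unfolding pairing_def by (intro sum.cong) auto

lemma pairing_commute: "pairing n p q = pairing n q p"
  by (simp add: pairing_def mult.commute)

lemma abs_pairing_le:
  assumes "\<And>i. i \<in> {1..n} \<Longrightarrow> \<bar>p i\<bar> \<le> c" and "(\<Sum>i=1..n. \<bar>q i\<bar>) \<le> d" and "0 \<le> c"
  shows "\<bar>pairing n p q\<bar> \<le> c * d"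
proof -
  have "\<bar>pairing n p q\<bar> \<le> (\<Sum>i=1..n. \<bar>p i * q i\<bar>)" unfolding pairing_def by (rule sum_abs)
  also have "\<dots> \<le> (\<Sum>i=1..n. c * \<bar>q i\<bar>)"
    using assms(1) by (intro sum_mono) (auto simp: abs_mult intro!: mult_right_mono)
  also have "\<dots> = c * (\<Sum>i=1..n. \<bar>q i\<bar>)" by (simp add: sum_distrib_left)
  also have "\<dots> \<le> c * d" using assms(2,3) by (intro mult_left_mono) auto
  finally show ?thesis .
qed

lemma M2S_nonneg: "m \<in> M2S n \<Longrightarrow> m i \<ge> 0"
  unfolding M2S_def MS_def by (cases "i \<in> {1..n}") auto

lemma M2S_mass: "m \<in> M2S n \<Longrightarrow> (\<Sum>i=1..n. m i) \<le> 2"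
  unfolding M2S_def by auto

lemma M2S_abs_mass: "m \<in> M2S n \<Longrightarrow> (\<Sum>i=1..n. \<bar>m i\<bar>) \<le> 2"
  using M2S_mass[of m n] M2S_nonneg[of m n] by simp

lemma M2S_le: "m \<in> M2S n \<Longrightarrow> m i \<le> 2"
proof (cases "i \<in> {1..n}")
  assume m: "m \<in> M2S n" and i: "i \<in> {1..n}"
  have "m i \<le> (\<Sum>i=1..n. m i)" using i M2S_nonneg[OF m] by (intro member_le_sum) auto
  then show ?thesis using M2S_mass[OF m] by linarith
qed (auto simp: M2S_def MS_def)

lemma PS_M2S: "m \<in> PS n \<Longrightarrow> m \<in> M2S n"
  unfolding PS_def M2S_def by auto

lemma M2S_diff_abs_mass:
  assumes "m \<in> M2S n" "m' \<in> M2S n" shows "(\<Sum>i=1..n. \<bar>m i - m' i\<bar>) \<le> 4"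
proof -
  have "(\<Sum>i=1..n. \<bar>m i - m' i\<bar>) \<le> (\<Sum>i=1..n. \<bar>m i\<bar> + \<bar>m' i\<bar>)" by (intro sum_mono) auto
  then show ?thesis using M2S_abs_mass[OF assms(1)] M2S_abs_mass[OF assms(2)]
    by (simp add: sum.distrib)
qed

lemma M2S_sum_squares:
  assumes "m \<in> M2S n" shows "pairing n m m \<le> 4" and "pairing n m m \<ge> 0"
proof -
  have "pairing n m m \<le> (\<Sum>i=1..n. 2 * m i)" unfolding pairing_def
    using M2S_le[OF assms] M2S_nonneg[OF assms] by (intro sum_mono mult_right_mono) auto
  then show "pairing n m m \<le> 4" using M2S_mass[OF assms] by (simp add: sum_distrib_left[symmetric])
  show "pairing n m m \<ge> 0" unfolding pairing_def by (intro sum_nonneg) auto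
qed

lemma continuous_coord: "continuous_on S (\<lambda>m::'i\<Rightarrow>real. m i)"
  by (rule continuous_on_product_then_coordinatewise) (rule continuous_on_id)

lemma continuous_on_coord:
  "continuous_on S h \<Longrightarrow> continuous_on S (\<lambda>z. (h z :: 'i \<Rightarrow> real) i)"
  by (rule continuous_on_product_then_coordinatewise)

lemma compact_M2S: "compact (M2S n)" and compact_PS: "compact (PS n)"
proof -
  have c: "continuous_on (box_fun {1..n} 0 2) (\<lambda>m::nat\<Rightarrow>real. \<Sum>i=1..n. m i)"
    by (intro continuous_intros continuous_coord)
  have "M2S n = box_fun {1..n} 0 2 \<inter> (\<lambda>m. \<Sum>i=1..n. m i) -` {..2}"
    using M2S_le by (auto simp: box_fun_def M2S_def MS_def)
  moreover have "closedin (top_of_set (box_fun {1..n} 0 2)) (box_fun {1..n} 0 2 \<inter> (\<lambda>m. \<Sum>i=1..n. m i) -` {..2})"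
    by (intro continuous_closedin_preimage c) auto
  ultimately show "compact (M2S n)" using closedin_compact[OF compact_box_fun] by metis
  have "PS n = box_fun {1..n} 0 2 \<inter> (\<lambda>m. \<Sum>i=1..n. m i) -` {1}"
    using M2S_le[OF PS_M2S] by (auto simp: box_fun_def PS_def MS_def)
  moreover have "closedin (top_of_set (box_fun {1..n} 0 2)) (box_fun {1..n} 0 2 \<inter> (\<lambda>m. \<Sum>i=1..n. m i) -` {1})"
    by (intro continuous_closedin_preimage c) auto
  ultimately show "compact (PS n)" using closedin_compact[OF compact_box_fun] by metis
qed

lemma real_has_max_bound:
  fixes h :: "'a::topological_space \<Rightarrow> real"
  assumes "compact K" "continuous_on K h"
  shows "\<exists>C\<ge>0. \<forall>z\<in>K. \<bar>h z\<bar> \<le> C"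
proof -
  have "compact (h ` K)" using assms by (intro compact_continuous_image)
  then have "bounded (h ` K)" by (rule compact_imp_bounded)
  then obtain C where "\<forall>z\<in>K. \<bar>h z\<bar> \<le> C" unfolding bounded_iff by auto
  then show ?thesis by (intro exI[of _ "max 0 C"]) auto
qed

lemma finite_bound:
  assumes "finite I" "\<And>i. i \<in> I \<Longrightarrow> \<exists>C::real. \<forall>z\<in>K. h i z \<le> C"
  shows "\<exists>C\<ge>0. \<forall>i\<in>I. \<forall>z\<in>K. h i z \<le> C"
proof -
  from assms(2) have "\<forall>i\<in>I. \<exists>C. \<forall>z\<in>K. h i z \<le> C" by blast
  from bchoice[OF this] obtain C where C: "\<forall>i\<in>I. \<forall>z\<in>K. h i z \<le> C i" by blast
  show ?thesis
  proof (intro exI conjI ballI)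
    show "0 \<le> Max (insert 0 (C ` I))" using assms(1) by auto
    fix i z assume "i \<in> I" "z \<in> K"
    then have "h i z \<le> C i" using C by blast
    also have "\<dots> \<le> Max (insert 0 (C ` I))" using \<open>i \<in> I\<close> assms(1) by auto
    finally show "h i z \<le> Max (insert 0 (C ` I))" .
  qed
qed

text \<open>The Hamiltonian and the second difference enter only through the concave functions \<open>b1 i\<close>, \<open>b2 i\<close>
  of the increments of \<open>p\<close> to the neighbours of \<open>i\<close>; their derivatives \<open>ca i\<close>, \<open>cb i\<close> are the jump rates
  of the controlled chain.\<close>

locale discrete_mfg =
  fixes n :: nat and lam T :: real
    and fn :: "(nat \<Rightarrow> real) \<Rightarrow> nat \<Rightarrow> real"
    and b1 b2 ca cb :: "nat \<Rightarrow> real \<Rightarrow> real"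
    and M :: "nat \<Rightarrow> nat \<Rightarrow> real"
  assumes n1: "n \<ge> 1" and lam0: "lam > 0" and T0: "T > 0"
    and ca0: "i \<in> {1..n} \<Longrightarrow> ca i x \<ge> 0" and cb0: "i \<in> {1..n} \<Longrightarrow> cb i x \<ge> 0"
    and ca_cont: "i \<in> {1..n} \<Longrightarrow> continuous_on UNIV (ca i)"
    and cb_cont: "i \<in> {1..n} \<Longrightarrow> continuous_on UNIV (cb i)"
    and b1_cont: "i \<in> {1..n} \<Longrightarrow> continuous_on UNIV (b1 i)"
    and b2_cont: "i \<in> {1..n} \<Longrightarrow> continuous_on UNIV (b2 i)"
    and b1_concave: "i \<in> {1..n} \<Longrightarrow> b1 i x - b1 i y \<le> ca i y * (x - y)"
    and b2_concave: "i \<in> {1..n} \<Longrightarrow> b2 i x - b2 i y \<le> cb i y * (x - y)"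
    and fn_cont: "i \<in> {1..n} \<Longrightarrow> continuous_on (M2S n) (\<lambda>m. fn m i)"
    and fn_mono: "m \<in> M2S n \<Longrightarrow> m' \<in> M2S n \<Longrightarrow>
      0 \<le> pairing n (\<lambda>i. fn m i - fn m' i) (\<lambda>i. m i - m' i)"
    and M0: "i \<in> {1..n} \<Longrightarrow> j \<in> {1..n} \<Longrightarrow> M i j \<ge> 0"
    and Msum: "j \<in> {1..n} \<Longrightarrow> (\<Sum>i=1..n. M i j) = real n"
begin

section \<open>Generator, Hamiltonian and Lasry-Lions duality\<close>

definition al :: "(nat \<Rightarrow> real) \<Rightarrow> nat \<Rightarrow> real" where
  "al p i = ca i (p (next_idx n i) - p i)"

definition be :: "(nat \<Rightarrow> real) \<Rightarrow> nat \<Rightarrow> real" where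
  "be p i = cb i (p (prev_idx n i) - p i)"

definition gen :: "(nat \<Rightarrow> real) \<Rightarrow> (nat \<Rightarrow> real) \<Rightarrow> nat \<Rightarrow> real" where
  "gen p q i = al p i * (q (next_idx n i) - q i) + be p i * (q (prev_idx n i) - q i)"

definition B :: "(nat \<Rightarrow> real) \<Rightarrow> nat \<Rightarrow> real" where
  "B p i = b1 i (p (next_idx n i) - p i) + b2 i (p (prev_idx n i) - p i)"

definition G :: "(nat \<Rightarrow> real) \<Rightarrow> (nat \<Rightarrow> real) \<Rightarrow> nat \<Rightarrow> real" where
  "G m p i = fn m i + B p i"

text \<open>Minus the adjoint of \<open>gen p\<close> applied to \<open>m\<close>: the Fokker-Planck
  equation of the chain with rates \<open>al p\<close>, \<open>be p\<close> reads dm/dt = -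
  F.\<close>

definition F :: "(nat \<Rightarrow> real) \<Rightarrow> (nat \<Rightarrow> real) \<Rightarrow> nat \<Rightarrow> real" where
  "F m p i = - (\<Sum>j=1..n. gen p (\<lambda>k. if k = i then 1 else 0) j * m j)"

text \<open>The Bregman divergence of the convex function \<open>- B\<close> with base point
  \<open>p\<close>: the loss when \<open>B q\<close> is replaced by its linearisation at
  \<open>p\<close>.\<close>

definition gap :: "(nat \<Rightarrow> real) \<Rightarrow> (nat \<Rightarrow> real) \<Rightarrow> nat \<Rightarrow> real" where
  "gap p q i = B p i - B q i - gen p (\<lambda>j. p j - q j) i"

abbreviation A :: "(nat \<Rightarrow> real) \<Rightarrow> nat \<Rightarrow> real" where "A m \<equiv> A_disc M n m"
abbreviation As :: "(nat \<Rightarrow> real) \<Rightarrow> nat \<Rightarrow> real" where "As p \<equiv> A_disc_adj M n p"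

lemma al0: "i \<in> {1..n} \<Longrightarrow> al p i \<ge> 0" and be0: "i \<in> {1..n} \<Longrightarrow> be p i \<ge> 0"
  using ca0 cb0 by (auto simp: al_def be_def)

lemma gen_cong:
  assumes "i \<in> {1..n}" "\<And>j. j \<in> {1..n} \<Longrightarrow> p j = p' j" "\<And>j. j \<in> {1..n} \<Longrightarrow> q j = q' j"
  shows "gen p q i = gen p' q' i" "al p i = al p' i" "be p i = be p' i" "B p i = B p' i"
  using assms next_idx_in[OF assms(1)] prev_idx_in[OF assms(1)]
  by (auto simp: gen_def al_def be_def B_def)

lemma gap_nonneg: "i \<in> {1..n} \<Longrightarrow> gap p q i \<ge> 0"
  using b1_concave[of i "q (next_idx n i) - q i" "p (next_idx n i) - p i"]
    b2_concave[of i "q (prev_idx n i) - q i" "p (prev_idx n i) - p i"]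
  by (simp add: gap_def B_def gen_def al_def be_def algebra_simps)

text \<open>\<open>gen q\<close> is a supergradient of the concave \<open>B\<close> at
  \<open>q\<close>. Since the upper and the lower bound linearise at different end points, both lead
  to a generator of a Markov chain, and the maximum principle applies to nonlinear
  differences.\<close>

lemma B_gen_le: "i \<in> {1..n} \<Longrightarrow> B p i - B q i \<le> gen q (\<lambda>j. p j - q j) i"
  and B_gen_ge: "i \<in> {1..n} \<Longrightarrow> gen p (\<lambda>j. p j - q j) i \<le> B p i - B q i"
proof -
  assume i: "i \<in> {1..n}"
  show "gen p (\<lambda>j. p j - q j) i \<le> B p i - B q i"
    using gap_nonneg[OF i, of p q] by (simp add: gap_def)
  show "B p i - B q i \<le> gen q (\<lambda>j. p j - q j) i"
    using gap_nonneg[OF i, of q p] by (simp add: gap_def gen_def algebra_simps)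
qed

text \<open>By linearity of \<open>gen p\<close>: \<open>q\<close> is expanded in the unit vectors
  that occur in the definition of \<open>F\<close>.\<close>

lemma pairing_F: "pairing n (F m p) q = - pairing n m (gen p q)"
proof -
  have delta: "(\<Sum>i=1..n. q i * (if k = i then 1 else 0)) = q k" if "k \<in> {1..n}" for k
  proof -
    have "(\<Sum>i=1..n. q i * (if k = i then 1 else 0)) = (\<Sum>i=1..n. if k = i then q i else 0)"
      by (intro sum.cong) auto
    then show ?thesis using that by simp
  qed
  have g: "(\<Sum>i=1..n. gen p (\<lambda>k. if k = i then 1 else 0) j * q i) = gen p q j" if j: "j \<in> {1..n}" for j
  proof -
    have "(\<Sum>i=1..n. gen p (\<lambda>k. if k = i then 1 else 0) j * q i)
      = al p j * ((\<Sum>i=1..n. q i * (if next_idx n j = i then 1 else 0)) - (\<Sum>i=1..n. q i * (if j = i then 1 else 0)))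
      + be p j * ((\<Sum>i=1..n. q i * (if prev_idx n j = i then 1 else 0)) - (\<Sum>i=1..n. q i * (if j = i then 1 else 0)))"
      unfolding gen_def by (simp only: sum_distrib_left sum_subtractf[symmetric] sum.distrib[symmetric])
        (intro sum.cong, auto simp: algebra_simps)
    then show ?thesis unfolding delta[OF j] delta[OF next_idx_in[OF j]] delta[OF prev_idx_in[OF j]]
      by (simp add: gen_def)
  qed
  have "pairing n (F m p) q = - (\<Sum>i=1..n. \<Sum>j=1..n. gen p (\<lambda>k. if k = i then 1 else 0) j * m j * q i)"
    by (simp add: pairing_def F_def sum_distrib_right sum_negf)
  also have "\<dots> = - (\<Sum>j=1..n. \<Sum>i=1..n. gen p (\<lambda>k. if k = i then 1 else 0) j * m j * q i)"
    by (subst sum.swap) simp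
  also have "\<dots> = - (\<Sum>j=1..n. m j * gen p q j)"
  proof -
    have "(\<Sum>i=1..n. gen p (\<lambda>k. if k = i then 1 else 0) j * m j * q i) = m j * gen p q j" if "j \<in> {1..n}" for j
      unfolding g[OF that, symmetric] sum_distrib_left by (intro sum.cong) (auto simp: algebra_simps)
    then show ?thesis by simp
  qed
  finally show ?thesis by (simp add: pairing_def)
qed

lemma F_outside: "i \<notin> {1..n} \<Longrightarrow> F m p i = 0"
proof -
  assume i: "i \<notin> {1..n}"
  have "gen p (\<lambda>k. if k = i then 1 else 0) j = 0" if "j \<in> {1..n}" for j
    using next_idx_in[OF that] prev_idx_in[OF that] that i by (auto simp: gen_def)
  then show ?thesis by (simp add: F_def)
qed

lemma F_sum: "(\<Sum>i=1..n. F m p i) = 0"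
  using pairing_F[of m p "\<lambda>_. 1"] by (simp add: pairing_def gen_def)

text \<open>After integration by parts through \<open>pairing_F\<close>, the Hamiltonian differences
  weighted with \<open>m\<close> and \<open>m'\<close> combine with the transport terms into one
  Bregman divergence for each measure.\<close>

lemma lasry_lions:
  "pairing n (\<lambda>i. G m p i - G m' q i) (\<lambda>i. m i - m' i)
     + pairing n (\<lambda>i. F m p i - F m' q i) (\<lambda>i. p i - q i)
   = pairing n (\<lambda>i. fn m i - fn m' i) (\<lambda>i. m i - m' i) + pairing n m (gap p q) + pairing n m' (gap q p)"
proof -
  have [simp]: "gen q (\<lambda>j. q j - p j) i = - gen q (\<lambda>j. p j - q j) i" for i
    by (simp add: gen_def algebra_simps)
  show ?thesis
    unfolding pairing_diff_left[of n "F m p"] pairing_F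
    unfolding pairing_def gap_def G_def
    by (simp add: sum.distrib[symmetric] sum_subtractf[symmetric] sum_negf[symmetric])
      (intro sum.cong, auto simp: algebra_simps)
qed

lemma pairing_gap_nonneg: "m \<in> M2S n \<Longrightarrow> pairing n m (gap p q) \<ge> 0"
  unfolding pairing_def using gap_nonneg M2S_nonneg by (intro sum_nonneg) auto

lemma lasry_lions_nonneg:
  assumes "m \<in> M2S n" "m' \<in> M2S n"
  shows "0 \<le> pairing n (\<lambda>i. G m p i - G m' q i) (\<lambda>i. m i - m' i)
     + pairing n (\<lambda>i. F m p i - F m' q i) (\<lambda>i. p i - q i)"
  unfolding lasry_lions using fn_mono[OF assms] pairing_gap_nonneg assms by simp

lemma pairing_As: "pairing n (As p) m = pairing n p (A m)"
proof -
  have "pairing n (As p) m = (\<Sum>j=1..n. \<Sum>i=1..n. 1 / real n * M i j * p i * m j)"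
    by (simp add: pairing_def A_disc_adj_def sum_distrib_left sum_distrib_right mult.assoc)
  also have "\<dots> = (\<Sum>i=1..n. \<Sum>j=1..n. 1 / real n * M i j * p i * m j)" by (rule sum.swap)
  also have "\<dots> = pairing n p (A m)"
    unfolding pairing_def A_disc_def by (intro sum.cong) (auto simp: sum_distrib_left algebra_simps)
  finally show ?thesis .
qed

lemma pairing_As_diff: "pairing n (As p) (\<lambda>i. m i - m' i) = pairing n p (\<lambda>i. A m i - A m' i)"
  by (simp add: pairing_diff_right pairing_As)

lemma A_mass: "(\<Sum>i=1..n. A m i) = (\<Sum>i=1..n. m i)"
proof -
  have "(\<Sum>i=1..n. A m i) = pairing n (As (\<lambda>_. 1)) m" by (simp add: pairing_As) (simp add: pairing_def)
  also have "\<dots> = (\<Sum>i=1..n. m i)" unfolding pairing_def A_disc_adj_def using n1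
    by (intro sum.cong) (simp_all only: mult_1_right Msum, simp_all)
  finally show ?thesis .
qed

lemma A_MS: assumes "m \<in> MS n" shows "A m \<in> MS n"
proof -
  have "(\<Sum>j=1..n. M i j * m j) \<ge> 0" if "i \<in> {1..n}" for i
    using assms M0[OF that] unfolding MS_def by (intro sum_nonneg) auto
  then show ?thesis unfolding MS_def A_disc_def by auto
qed

lemma A_M2S: "m \<in> M2S n \<Longrightarrow> A m \<in> M2S n"
  using A_MS A_mass by (auto simp: M2S_def)

lemma A_PS: "m \<in> PS n \<Longrightarrow> A m \<in> PS n"
  using A_MS A_mass by (auto simp: PS_def)

text \<open>The columns of \<open>M\<close> are nonnegative with sum \<open>n\<close>, so
  \<open>As\<close> takes averages.\<close>

lemma As_bound:
  assumes "\<And>i. i \<in> {1..n} \<Longrightarrow> \<bar>p i\<bar> \<le> c" "j \<in> {1..n}"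
  shows "\<bar>As p j\<bar> \<le> c"
proof -
  have "\<bar>As p j\<bar> = (1 / real n) * \<bar>\<Sum>i=1..n. M i j * p i\<bar>"
    unfolding A_disc_adj_def by (simp add: abs_mult)
  also have "\<bar>\<Sum>i=1..n. M i j * p i\<bar> \<le> (\<Sum>i=1..n. M i j * c)"
    using assms M0[OF _ assms(2)]
    by (intro order.trans[OF sum_abs] sum_mono) (auto simp: abs_mult intro!: mult_left_mono)
  also have "\<dots> = real n * c" using Msum[OF assms(2)] by (simp add: sum_distrib_right[symmetric])
  finally show ?thesis using n1 by (simp add: field_simps mult_left_mono)
qed

lemma As_diff: "As (\<lambda>i. p i - q i) j = As p j - As q j"
  by (simp add: A_disc_adj_def sum_subtractf algebra_simps)

text \<open>The bound may depend on \<open>n\<close>: it serves to choose time steps and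
  penalisation parameters and never reaches the final constant. The range \<open>2 * R\<close> is
  that of a difference of two entries.\<close>

lemma rates_bounded:
  "\<exists>C\<ge>0. \<forall>p. (\<forall>i\<in>{1..n}. \<bar>p i\<bar> \<le> R) \<longrightarrow> (\<forall>i\<in>{1..n}. al p i \<le> C \<and> be p i \<le> C)"
proof -
  have "\<exists>C\<ge>0. \<forall>i\<in>{1..n}. \<forall>x\<in>{-2*R..2*R}. ca i x \<le> C"
  proof (rule finite_bound)
    fix i assume i: "i \<in> {1..n}"
    show "\<exists>C. \<forall>x\<in>{-2*R..2*R}. ca i x \<le> C"
      using real_has_max_bound[OF compact_Icc continuous_on_subset[OF ca_cont[OF i]], of "-2*R" "2*R"]
      by (auto simp: abs_le_iff)
  qed simp
  moreover have "\<exists>C\<ge>0. \<forall>i\<in>{1..n}. \<forall>x\<in>{-2*R..2*R}. cb i x \<le> C"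
  proof (rule finite_bound)
    fix i assume i: "i \<in> {1..n}"
    show "\<exists>C. \<forall>x\<in>{-2*R..2*R}. cb i x \<le> C"
      using real_has_max_bound[OF compact_Icc continuous_on_subset[OF cb_cont[OF i]], of "-2*R" "2*R"]
      by (auto simp: abs_le_iff)
  qed simp
  ultimately obtain C1 C2 where C: "C1 \<ge> 0" "C2 \<ge> 0"
    "\<And>i x. i\<in>{1..n} \<Longrightarrow> x\<in>{-2*R..2*R} \<Longrightarrow> ca i x \<le> C1" "\<And>i x. i\<in>{1..n} \<Longrightarrow> x\<in>{-2*R..2*R} \<Longrightarrow> cb i x \<le> C2"
    by blast
  show ?thesis
  proof (intro exI conjI allI impI ballI)
    show "0 \<le> max C1 C2" using C by auto
    fix p :: "nat \<Rightarrow> real" and i assume p: "\<forall>i\<in>{1..n}. \<bar>p i\<bar> \<le> R" and i: "i \<in> {1..n}"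
    have a: "\<bar>p i\<bar> \<le> R" "\<bar>p (next_idx n i)\<bar> \<le> R" "\<bar>p (prev_idx n i)\<bar> \<le> R"
      using p i next_idx_in[OF i] prev_idx_in[OF i] by blast+
    have "p (next_idx n i) - p i \<in> {-2*R..2*R}" "p (prev_idx n i) - p i \<in> {-2*R..2*R}"
      using a by (auto simp: abs_le_iff)
    then show "al p i \<le> max C1 C2" "be p i \<le> max C1 C2"
      using C(3)[OF i, of "p (next_idx n i) - p i"] C(4)[OF i, of "p (prev_idx n i) - p i"]
      unfolding al_def be_def by linarith+
  qed
qed

lemma gen_bound:
  assumes "i \<in> {1..n}" "al p i \<le> C" "be p i \<le> C" "\<And>j. j \<in> {1..n} \<Longrightarrow> \<bar>q j\<bar> \<le> c"
  shows "\<bar>gen p q i\<bar> \<le> 4 * C * c"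
proof -
  have "\<bar>q (next_idx n i) - q i\<bar> \<le> 2 * c" "\<bar>q (prev_idx n i) - q i\<bar> \<le> 2 * c"
    using assms(4)[OF assms(1)] assms(4)[OF next_idx_in[OF assms(1)]] assms(4)[OF prev_idx_in[OF assms(1)]] by linarith+
  then have "al p i * \<bar>q (next_idx n i) - q i\<bar> \<le> C * (2 * c)" "be p i * \<bar>q (prev_idx n i) - q i\<bar> \<le> C * (2 * c)"
    using al0[OF assms(1), of p] be0[OF assms(1), of p] assms by (intro mult_mono; simp)+
  moreover have "\<bar>gen p q i\<bar> \<le> al p i * \<bar>q (next_idx n i) - q i\<bar> + be p i * \<bar>q (prev_idx n i) - q i\<bar>"
    unfolding gen_def using al0[OF assms(1), of p] be0[OF assms(1), of p]
    by (intro order.trans[OF abs_triangle_ineq]) (simp add: abs_mult)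
  ultimately show ?thesis by linarith
qed

text \<open>The inequality of monotone solutions up to an error \<open>e\<close>, for functions on a subset \<open>D\<close> of the state space
  and with a prescribed value \<open>Y\<close> after a jump. Besides the monotone solution itself, it is satisfied by the
  approximate classical solution on probability measures, and by a single approximate characteristic.\<close>

definition test_property ::
  "(real \<times> (nat \<Rightarrow> real)) set \<Rightarrow> (real \<Rightarrow> (nat \<Rightarrow> real) \<Rightarrow> nat \<Rightarrow> real) \<Rightarrow>
   (real \<Rightarrow> (nat \<Rightarrow> real) \<Rightarrow> nat \<Rightarrow> real) \<Rightarrow> real \<Rightarrow> real \<Rightarrow> bool" where
  "test_property D U Y e R \<longleftrightarrow>
    (\<forall>\<mu>\<in>M2S n. \<forall>a \<psi> \<psi>'. (\<forall>i\<in>{1..n}. \<bar>a i\<bar> \<le> R) \<longrightarrow>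
      (\<forall>t\<in>{0..T}. (\<psi> has_real_derivative \<psi>' t) (at t within {0..T})) \<longrightarrow>
      continuous_on {0..T} \<psi>' \<longrightarrow>
      (\<forall>t m. (t, m) \<in> D \<longrightarrow> t < T \<longrightarrow>
        strict_min_on (\<lambda>(t, m). pairing n (\<lambda>i. U t m i - a i) (\<lambda>i. m i - \<mu> i) - \<psi> t) D (t, m) \<longrightarrow>
        pairing n (G m (U t m)) (\<lambda>i. m i - \<mu> i) + pairing n (F m (U t m)) (\<lambda>i. U t m i - a i)
        \<le> - \<psi>' t + lam * pairing n (\<lambda>i. U t m i - As (Y t m) i) (\<lambda>i. m i - \<mu> i) + e))"

text \<open>Subtracting \<open>c \<bar>m\<bar>\<^sup>2\<close> and then linearising it at the minimum point makes the minimum strict,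
  while only shifting the vector \<open>b\<close> of the test function.\<close>

lemma test_property_apply:
  assumes tp: "test_property D U Y e R" and D: "D \<subseteq> {0..T} \<times> M2S n"
    and z: "(t, m) \<in> D" "t < T" and \<mu>: "\<mu> \<in> M2S n"
    and b: "\<And>i. i \<in> {1..n} \<Longrightarrow> \<bar>b i\<bar> + 4 \<le> R" and c: "0 < c" "c \<le> 1"
    and h: "\<And>s. (h has_real_derivative h' s) (at s)" "continuous_on UNIV h'"
    and min: "\<And>s m'. (s, m') \<in> D \<Longrightarrow>
        pairing n (\<lambda>i. U t m i - b i) (\<lambda>i. m i - \<mu> i) + h t - c * pairing n m m
        \<le> pairing n (\<lambda>i. U s m' i - b i) (\<lambda>i. m' i - \<mu> i) + h s - c * pairing n m' m'"
  shows "pairing n (G m (U t m)) (\<lambda>i. m i - \<mu> i) + pairing n (F m (U t m)) (\<lambda>i. U t m i - b i)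
      - 2 * c * pairing n (F m (U t m)) m
      \<le> h' t + lam * pairing n (\<lambda>i. U t m i - As (Y t m) i) (\<lambda>i. m i - \<mu> i) + e"
proof -
  \<comment> \<open>\<open>2 * c * m\<close> is the gradient of the quadratic penalty at the minimum
    point.\<close>
  define a where "a = (\<lambda>i. b i + 2 * c * m i)"
  \<comment> \<open>The square makes the minimum strict in time; its derivative vanishes at
    \<open>t\<close>, so the inequality does not feel it.\<close>
  define \<psi> where "\<psi> = (\<lambda>s. - h s - (s - t)\<^sup>2)"
  define \<psi>' where "\<psi>' = (\<lambda>s. - h' s - 2 * (s - t))"
  have m: "m \<in> M2S n" using z D by auto
  have aR: "\<bar>a i\<bar> \<le> R" if "i \<in> {1..n}" for i
  proof -
    \<comment> \<open>Entries are at most 2 and \<open>c \<le> 1\<close>: the origin of the 4 in the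
      assumption on \<open>b\<close>.\<close>
    have "\<bar>2 * c * m i\<bar> \<le> 4"
      using M2S_nonneg[OF m, of i] M2S_le[OF m, of i] c mult_mono[of c 1 "m i" 2] by (simp add: abs_mult)
    then show ?thesis using b[OF that] unfolding a_def by linarith
  qed
  have d1: "(\<psi> has_real_derivative \<psi>' s) (at s within {0..T})" for s
    unfolding \<psi>_def \<psi>'_def
    by (rule derivative_eq_intros has_field_derivative_at_within[OF h(1)] refl | simp)+
  have d2: "continuous_on {0..T} \<psi>'" unfolding \<psi>'_def
    by (intro continuous_intros continuous_on_subset[OF h(2)]) auto
  \<comment> \<open>Completing the square: replacing the penalty by its linearisation adds
    \<open>c\<close> times the squared distance of \<open>m'\<close> from \<open>m\<close>, up to
    constants, and this is what makes the minimum strict in \<open>m\<close>.\<close>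
  have lin: "pairing n (\<lambda>i. U s m' i - a i) (\<lambda>i. m' i - \<mu> i) - \<psi> s
    = pairing n (\<lambda>i. U s m' i - b i) (\<lambda>i. m' i - \<mu> i) + h s - c * pairing n m' m'
      + (s - t)\<^sup>2 + c * pairing n (\<lambda>i. m' i - m i) (\<lambda>i. m' i - m i) - c * pairing n m m
      + 2 * c * pairing n m \<mu>" for s m'
    unfolding a_def \<psi>_def pairing_diff_left pairing_diff_right pairing_add_left
      pairing_scale_left pairing_commute[of n m' m] by (simp add: algebra_simps)
  have strict: "strict_min_on (\<lambda>(t, m). pairing n (\<lambda>i. U t m i - a i) (\<lambda>i. m i - \<mu> i) - \<psi> t) D (t, m)"
    unfolding strict_min_on_def
  proof (intro conjI ballI impI z)
    fix w assume w: "w \<in> D" "w \<noteq> (t, m)"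
    obtain s m' where sm: "w = (s, m')" by fastforce
    have sq: "pairing n (\<lambda>i. m' i - m i) (\<lambda>i. m' i - m i) \<ge> 0"
      unfolding pairing_def by (intro sum_nonneg) auto
    have "(s - t)\<^sup>2 + c * pairing n (\<lambda>i. m' i - m i) (\<lambda>i. m' i - m i) > 0"
    proof (cases "s = t")
      case False
      then have "(s - t)\<^sup>2 > 0" by simp
      then show ?thesis using sq c by (smt (verit) mult_nonneg_nonneg)
    next
      case True
      then have "m' \<noteq> m" using w sm by auto
      then obtain i where i: "m' i \<noteq> m i" by auto
      have m': "m' \<in> M2S n" using w sm D by auto
      have "i \<in> {1..n}" using i m m' unfolding M2S_def MS_def by force
      then have "pairing n (\<lambda>i. m' i - m i) (\<lambda>i. m' i - m i) > 0"
        unfolding pairing_def using i by (intro sum_pos2[of _ i]) (auto simp: zero_less_mult_iff linorder_neq_iff)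
      then show ?thesis using c True by simp
    qed
    moreover have "pairing n (\<lambda>i. m i - m i) (\<lambda>i. m i - m i) = 0" by (simp add: pairing_def)
    ultimately show "(case (t, m) of (t, m) \<Rightarrow> pairing n (\<lambda>i. U t m i - a i) (\<lambda>i. m i - \<mu> i) - \<psi> t)
      < (case w of (t, m) \<Rightarrow> pairing n (\<lambda>i. U t m i - a i) (\<lambda>i. m i - \<mu> i) - \<psi> t)"
      using min[of s m'] w(1) unfolding sm prod.case lin[of t m] lin[of s m'] by simp
  qed
  have "pairing n (G m (U t m)) (\<lambda>i. m i - \<mu> i) + pairing n (F m (U t m)) (\<lambda>i. U t m i - a i)
        \<le> - \<psi>' t + lam * pairing n (\<lambda>i. U t m i - As (Y t m) i) (\<lambda>i. m i - \<mu> i) + e"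
    using tp[unfolded test_property_def, rule_format, OF \<mu> aR d1 d2 z strict] by simp
  moreover have "pairing n (F m (U t m)) (\<lambda>i. U t m i - a i)
    = pairing n (F m (U t m)) (\<lambda>i. U t m i - b i) - 2 * c * pairing n (F m (U t m)) m"
    unfolding a_def pairing_diff_right pairing_add_right pairing_scale_right by simp
  ultimately show ?thesis unfolding \<psi>'_def by simp
qed

text \<open>If the claim fails, a penalised pairing has a negative minimum, and the two test
  inequalities at the minimum point, each taken with the other solution as test vector, add up to a
  contradiction with Lasry-Lions monotonicity. The nonlocal jump term needs one of two arguments,
  and \<open>jump\<close> allows either: the pairing after the jump is almost nonnegative by other
  knowledge, or the states after the jump are competitors in the same minimisation.\<close>

lemma doubling:
  assumes K1: "compact D1" "D1 \<subseteq> {0..T} \<times> M2S n" and K2: "compact D2" "D2 \<subseteq> {0..T} \<times> M2S n"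
    and U1: "\<And>i. i \<in> {1..n} \<Longrightarrow> continuous_on D1 (\<lambda>(t, m). U1 t m i)"
    and U2: "\<And>i. i \<in> {1..n} \<Longrightarrow> continuous_on D2 (\<lambda>(t, m). U2 t m i)"
    and tp1: "test_property D1 U1 Y1 e1 R" and tp2: "test_property D2 U2 Y2 e2 R"
    and R1: "\<And>t m i. (t, m) \<in> D1 \<Longrightarrow> i \<in> {1..n} \<Longrightarrow> \<bar>U1 t m i\<bar> + 4 \<le> R"
    and R2: "\<And>t m i. (t, m) \<in> D2 \<Longrightarrow> i \<in> {1..n} \<Longrightarrow> \<bar>U2 t m i\<bar> + 4 \<le> R"
    and terminal: "\<And>m m'. (T, m) \<in> D1 \<Longrightarrow> (T, m') \<in> D2 \<Longrightarrow>
        0 \<le> pairing n (\<lambda>i. U1 T m i - U2 T m' i) (\<lambda>i. m i - m' i)"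
    and jump: "\<And>\<zeta>. \<zeta> > 0 \<Longrightarrow> \<exists>d>0. \<forall>t m s m'. (t, m) \<in> D1 \<longrightarrow> (s, m') \<in> D2 \<longrightarrow> \<bar>t - s\<bar> < d \<longrightarrow>
        - \<zeta> \<le> pairing n (\<lambda>i. Y1 t m i - Y2 s m' i) (\<lambda>i. A m i - A m' i) \<or>
        (t, A m) \<in> D1 \<and> (s, A m') \<in> D2 \<and>
        pairing n (\<lambda>i. Y1 t m i - Y2 s m' i) (\<lambda>i. A m i - A m' i)
          = pairing n (\<lambda>i. U1 t (A m) i - U2 s (A m') i) (\<lambda>i. A m i - A m' i)"
    and e: "e1 \<ge> 0" "e2 \<ge> 0"
    and z0: "(t0, m0) \<in> D1" "(t0, m0') \<in> D2"
  shows "- ((e1 + e2) * (T - t0)) \<le> pairing n (\<lambda>i. U1 t0 m0 i - U2 t0 m0' i) (\<lambda>i. m0 i - m0' i)"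
proof (rule ccontr)
  define \<Phi> where "\<Phi> = (\<lambda>t m s m'. pairing n (\<lambda>i. U1 t m i - U2 s m' i) (\<lambda>i. m i - m' i))"
  assume "\<not> ?thesis"
  then have neg: "\<Phi> t0 m0 t0 m0' < - ((e1 + e2) * (T - t0))" unfolding \<Phi>_def by simp
  define v where "v = - ((e1 + e2) * (T - t0)) - \<Phi> t0 m0 t0 m0'"
  have v0: "v > 0" using neg unfolding v_def by simp
  have t0: "0 \<le> t0" "t0 \<le> T" using z0 K1 by auto
  define \<zeta> where "\<zeta> = v / 4 / (T + 1)"
  have \<zeta>0: "\<zeta> > 0" unfolding \<zeta>_def using v0 T0 by simp
  have \<zeta>T: "\<zeta> * (T - t0) \<le> v / 4"
  proof -
    have "\<zeta> * (T - t0) \<le> \<zeta> * (T + 1)" using \<zeta>0 t0 by (intro mult_left_mono) auto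
    also have "\<dots> = v / 4"
    proof -
      have "T + 1 \<noteq> 0" using T0 by simp
      then show ?thesis unfolding \<zeta>_def by (rule nonzero_mult_div_cancel_right[of "T + 1" "v / 4", folded times_divide_eq_left])
    qed
    finally show ?thesis .
  qed
  obtain C where C: "C \<ge> 0" "\<And>p i. (\<And>i. i \<in> {1..n} \<Longrightarrow> \<bar>p i\<bar> \<le> R) \<Longrightarrow> i \<in> {1..n} \<Longrightarrow> al p i \<le> C \<and> be p i \<le> C"
    using rates_bounded[of R] by blast
  have Fm: "\<bar>pairing n (F m p) m\<bar> \<le> 16 * C" if m: "m \<in> M2S n" and p: "\<And>i. i \<in> {1..n} \<Longrightarrow> \<bar>p i\<bar> \<le> R" for m p
  proof -
    have "\<bar>gen p m i\<bar> \<le> 4 * C * 2" if "i \<in> {1..n}" for i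
      using C(2)[OF p that] M2S_nonneg[OF m] M2S_le[OF m] that by (intro gen_bound) auto
    then have "\<bar>pairing n (gen p m) m\<bar> \<le> 4 * C * 2 * 2"
      using C(1) by (intro abs_pairing_le M2S_abs_mass m) auto
    then show ?thesis unfolding pairing_F pairing_commute[of n m "gen p m"] by simp
  qed
  \<comment> \<open>The four bounds: admissibility in \<open>test_property_apply\<close>; total
    penalty \<open>8 * c \<le> v / 4\<close>, as squared norms are at most 4; the same amount times
    \<open>lam\<close> at most \<open>\<zeta> / 4\<close>; and twice the linearisation cost
    \<open>2 * c * (16 * C)\<close> at most \<open>\<zeta> / 4\<close>.\<close>
  define c where "c = Min {1, v / 32, \<zeta> / (32 * lam), \<zeta> / (256 * C + 1)}"
  have c0: "c > 0" unfolding c_def using v0 \<zeta>0 lam0 C(1) by (simp add: add_nonneg_pos)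
  have c1: "c \<le> 1" "c \<le> v / 32" "c \<le> \<zeta> / (32 * lam)" "c \<le> \<zeta> / (256 * C + 1)" unfolding c_def by (rule Min_le; simp)+
  have c2: "8 * c \<le> v / 4" using c1 by simp
  have c3: "lam * (8 * c) \<le> \<zeta> / 4" using c1(3) lam0 by (simp add: field_simps)
  have c4: "64 * C * c \<le> \<zeta> / 4"
  proof -
    have "c * (256 * C + 1) \<le> \<zeta>" using c1(4) C(1) by (simp add: field_simps)
    then show ?thesis using c0 by (simp add: algebra_simps)
  qed
  define D where "D = D1 \<times> D2"
  have D: "compact D" unfolding D_def using K1 K2 by (intro compact_Times)
  have zD: "((t0, m0), (t0, m0')) \<in> D" using z0 unfolding D_def by auto
  have cont_fst: "continuous_on D (\<lambda>z. U1 (fst (fst z)) (snd (fst z)) i)" if "i \<in> {1..n}" for i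
  proof -
    have "continuous_on D1 (\<lambda>z. U1 (fst z) (snd z) i)" using U1[OF that] by (simp add: case_prod_beta')
    then show ?thesis
      by (rule continuous_on_compose2[where g="\<lambda>z. U1 (fst z) (snd z) i" and f=fst])
        (auto intro: continuous_on_fst continuous_on_id simp: D_def)
  qed
  have cont_snd: "continuous_on D (\<lambda>z. U2 (fst (snd z)) (snd (snd z)) i)" if "i \<in> {1..n}" for i
  proof -
    have "continuous_on D2 (\<lambda>z. U2 (fst z) (snd z) i)" using U2[OF that] by (simp add: case_prod_beta')
    then show ?thesis
      by (rule continuous_on_compose2[where g="\<lambda>z. U2 (fst z) (snd z) i" and f=snd])
        (auto intro: continuous_on_snd continuous_on_id simp: D_def)
  qed
  have cm: "continuous_on D (\<lambda>z. snd (fst z) i)" "continuous_on D (\<lambda>z. snd (snd z) i)" for i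
    by (rule continuous_on_coord, intro continuous_on_fst continuous_on_snd continuous_on_id)+
  have ct: "continuous_on D (\<lambda>z. fst (fst z))" "continuous_on D (\<lambda>z. fst (snd z))"
    by (intro continuous_on_fst continuous_on_snd continuous_on_id)+
  have cphi: "continuous_on D (\<lambda>z. \<Phi> (fst (fst z)) (snd (fst z)) (fst (snd z)) (snd (snd z)))"
    unfolding \<Phi>_def pairing_def by (intro continuous_on_sum continuous_on_mult continuous_on_diff cont_fst cont_snd cm) auto
  \<comment> \<open>Near the terminal time the pairing exceeds \<open>- v / 4\<close>, so the
    minimum point found below has both times before \<open>T\<close>, where the test inequalities
    hold.\<close>
  obtain d1 where d1: "d1 > 0" "\<And>t m s m'. (t, m) \<in> D1 \<Longrightarrow> (s, m') \<in> D2 \<Longrightarrow> (T - t) + (T - s) < d1 \<Longrightarrow> - \<Phi> t m s m' < v / 4"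
  proof -
    have "\<exists>d>0. \<forall>z\<in>D. (T - fst (fst z)) + (T - fst (snd z)) < d \<longrightarrow>
        - \<Phi> (fst (fst z)) (snd (fst z)) (fst (snd z)) (snd (snd z)) < v / 4"
    proof (rule compact_gauge[OF D])
      show "continuous_on D (\<lambda>z. - \<Phi> (fst (fst z)) (snd (fst z)) (fst (snd z)) (snd (snd z)))"
        by (intro continuous_on_minus cphi)
      show "continuous_on D (\<lambda>z. (T - fst (fst z)) + (T - fst (snd z)))"
        by (intro continuous_on_add continuous_on_diff continuous_on_const ct)
      fix z assume z: "z \<in> D"
      obtain t m s m' where zz: "z = ((t, m), (s, m'))" by (metis surj_pair)
      then have zz': "(t, m) \<in> D1" "(s, m') \<in> D2" using z by (auto simp: D_def)
      then have ts: "t \<le> T" "s \<le> T" using K1 K2 by auto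
      then show "0 \<le> (T - fst (fst z)) + (T - fst (snd z))" by (simp add: zz)
      assume "(T - fst (fst z)) + (T - fst (snd z)) = 0"
      then have "t = T" "s = T" using ts by (auto simp: zz)
      then show "- \<Phi> (fst (fst z)) (snd (fst z)) (fst (snd z)) (snd (snd z)) \<le> 0"
        using terminal zz' unfolding \<Phi>_def zz by auto
    qed (use v0 in auto)
    then obtain d where d: "d > 0" "\<forall>z\<in>D. (T - fst (fst z)) + (T - fst (snd z)) < d \<longrightarrow>
        - \<Phi> (fst (fst z)) (snd (fst z)) (fst (snd z)) (snd (snd z)) < v / 4" by blast
    show ?thesis
    proof (rule that[OF d(1)])
      fix t m s m' assume "(t, m) \<in> D1" "(s, m') \<in> D2" "(T - t) + (T - s) < d"
      then show "- \<Phi> t m s m' < v / 4" using d(2)[rule_format, of "((t, m), (s, m'))"] by (simp add: D_def)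
    qed
  qed
  obtain d2 where d2: "d2 > 0" "\<And>t m s m'. (t, m) \<in> D1 \<Longrightarrow> (s, m') \<in> D2 \<Longrightarrow> \<bar>t - s\<bar> < d2 \<Longrightarrow>
        - (v / 2) \<le> pairing n (\<lambda>i. Y1 t m i - Y2 s m' i) (\<lambda>i. A m i - A m' i) \<or>
        (t, A m) \<in> D1 \<and> (s, A m') \<in> D2 \<and>
        pairing n (\<lambda>i. Y1 t m i - Y2 s m' i) (\<lambda>i. A m i - A m' i) = \<Phi> t (A m) s (A m')"
    using jump[of "v / 2"] v0 unfolding \<Phi>_def by (meson half_gt_zero)
  obtain C\<Phi> where C\<Phi>: "C\<Phi> \<ge> 0" "\<And>t m s m'. (t, m) \<in> D1 \<Longrightarrow> (s, m') \<in> D2 \<Longrightarrow> \<bar>\<Phi> t m s m'\<bar> \<le> C\<Phi>"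
  proof -
    obtain C' where C': "C' \<ge> 0" "\<forall>z\<in>D. \<bar>\<Phi> (fst (fst z)) (snd (fst z)) (fst (snd z)) (snd (snd z))\<bar> \<le> C'"
      using real_has_max_bound[OF D cphi] by blast
    show ?thesis
    proof (rule that[OF C'(1)])
      fix t m s m' assume "(t, m) \<in> D1" "(s, m') \<in> D2"
      then show "\<bar>\<Phi> t m s m'\<bar> \<le> C'" using C'(2)[rule_format, of "((t, m), (s, m'))"] by (simp add: D_def)
    qed
  qed
  define d where "d = min d1 d2"
  have d0: "d > 0" using d1 d2 unfolding d_def by auto
  \<comment> \<open>Since the pairing is bounded by \<open>C\<Phi>\<close>, this weight forces the
    two times of the minimum point to differ by less than \<open>d\<close>.\<close>
  define k where "k = (C\<Phi> + 1) / d\<^sup>2"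
  have k0: "k > 0" unfolding k_def using C\<Phi> d0 by simp
  \<comment> \<open>The term linear in \<open>T - t\<close> gives a slope exceeding the two errors
    by \<open>\<zeta>\<close>. All remaining errors will cost at most half of
    \<open>\<zeta>\<close>.\<close>
  define \<Psi> where "\<Psi> = (\<lambda>t m s m'. \<Phi> t m s m' + k * (t - s)\<^sup>2 + (e1 + e2 + \<zeta>) * (T - t)
      - c * (pairing n m m + pairing n m' m'))"
  have "continuous_on D (\<lambda>z. \<Psi> (fst (fst z)) (snd (fst z)) (fst (snd z)) (snd (snd z)))"
    unfolding \<Psi>_def pairing_def
    by (intro continuous_on_add continuous_on_diff continuous_on_mult continuous_on_const continuous_on_sum
      continuous_on_power cphi ct cm)
  from continuous_attains_inf[OF D _ this] zD obtain z where z: "z \<in> D"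
    "\<And>w. w \<in> D \<Longrightarrow> \<Psi> (fst (fst z)) (snd (fst z)) (fst (snd z)) (snd (snd z)) \<le> \<Psi> (fst (fst w)) (snd (fst w)) (fst (snd w)) (snd (snd w))"
    by blast
  obtain t m s m' where zz: "z = ((t, m), (s, m'))" by (metis surj_pair)
  have z1: "(t, m) \<in> D1" and z2: "(s, m') \<in> D2" using z(1) unfolding zz D_def by auto
  have min: "\<Psi> t m s m' \<le> \<Psi> t' n' s' n''" if "(t', n') \<in> D1" "(s', n'') \<in> D2" for t' n' s' n''
    using z(2)[of "((t', n'), (s', n''))"] that unfolding zz D_def by simp
  have m: "m \<in> M2S n" "m' \<in> M2S n" "0 \<le> t" "t \<le> T" "0 \<le> s" "s \<le> T" using z1 z2 K1 K2 by auto
  have sq: "0 \<le> pairing n x x" "pairing n x x \<le> 4" if "x \<in> M2S n" for x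
    using M2S_sum_squares that by blast+
  have m0: "m0 \<in> M2S n" "m0' \<in> M2S n" using z0 K1 K2 by auto
  have "\<Psi> t m s m' \<le> \<Psi> t0 m0 t0 m0'" using min z0 by blast
  also have "\<dots> \<le> \<Phi> t0 m0 t0 m0' + (e1 + e2 + \<zeta>) * (T - t0)"
    unfolding \<Psi>_def using sq[OF m0(1)] sq[OF m0(2)] c0 by simp
  also have "\<dots> = - v + \<zeta> * (T - t0)" unfolding v_def by (simp add: algebra_simps)
  also have "\<dots> \<le> - (3 * v / 4)" using \<zeta>T by simp
  finally have Psi_neg: "\<Psi> t m s m' \<le> - (3 * v / 4)" .
  have c8: "c * (pairing n m m + pairing n m' m') \<le> c * 8"
  proof (rule mult_left_mono)
    show "pairing n m m + pairing n m' m' \<le> 8" using sq(2)[OF m(1)] sq(2)[OF m(2)] by linarith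
  qed (use c0 in simp)
  have csq: "c * (pairing n m m + pairing n m' m') \<le> v / 4"
    using c8 c2 by linarith
  have e\<zeta>: "(e1 + e2 + \<zeta>) * (T - t) \<ge> 0" using e \<zeta>0 m by simp
  have kts: "k * (t - s)\<^sup>2 \<ge> 0" using k0 by simp
  have Phi_neg: "\<Phi> t m s m' \<le> - (v / 2)" and kPhi: "k * (t - s)\<^sup>2 \<le> - \<Phi> t m s m'"
    using Psi_neg csq e\<zeta> kts v0 unfolding \<Psi>_def by linarith+
  have ts: "\<bar>t - s\<bar> < d"
  proof (rule ccontr)
    assume "\<not> \<bar>t - s\<bar> < d"
    then have "d\<^sup>2 \<le> (t - s)\<^sup>2" using d0 by (metis abs_le_square_iff abs_of_pos not_le)
    then have "k * d\<^sup>2 \<le> k * (t - s)\<^sup>2" using k0 by (intro mult_left_mono) auto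
    moreover have "k * d\<^sup>2 = C\<Phi> + 1" unfolding k_def using d0 by simp
    ultimately show False using kPhi C\<Phi>(2)[OF z1 z2] by linarith
  qed
  have tT: "t < T" "s < T"
  proof -
    have "\<not> ((T - t) + (T - s) < d)" using d1(2)[OF z1 z2] Phi_neg v0 unfolding d_def by linarith
    then show "t < T" "s < T" using ts m by linarith+
  qed
  have T1: "pairing n (G m (U1 t m)) (\<lambda>i. m i - m' i) + pairing n (F m (U1 t m)) (\<lambda>i. U1 t m i - U2 s m' i)
      - 2 * c * pairing n (F m (U1 t m)) m
      \<le> (2 * k * (t - s) - (e1 + e2 + \<zeta>)) + lam * pairing n (\<lambda>i. U1 t m i - As (Y1 t m) i) (\<lambda>i. m i - m' i) + e1"
  proof (rule test_property_apply[OF tp1 K1(2) z1 tT(1) m(2) R2[OF z2] c0 c1(1),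
        where h="\<lambda>t. k * (t - s)\<^sup>2 + (e1 + e2 + \<zeta>) * (T - t)" and h'="\<lambda>t. 2 * k * (t - s) - (e1 + e2 + \<zeta>)"])
    fix t' x assume "(t', x) \<in> D1"
    from min[OF this z2]
    show "pairing n (\<lambda>i. U1 t m i - U2 s m' i) (\<lambda>i. m i - m' i) + (k * (t - s)\<^sup>2 + (e1 + e2 + \<zeta>) * (T - t)) - c * pairing n m m
         \<le> pairing n (\<lambda>i. U1 t' x i - U2 s m' i) (\<lambda>i. x i - m' i) + (k * (t' - s)\<^sup>2 + (e1 + e2 + \<zeta>) * (T - t')) - c * pairing n x x"
      unfolding \<Psi>_def \<Phi>_def by (simp add: algebra_simps)
  next
    show "((\<lambda>t. k * (t - s)\<^sup>2 + (e1 + e2 + \<zeta>) * (T - t)) has_real_derivative 2 * k * (t' - s) - (e1 + e2 + \<zeta>)) (at t')" for t'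
      by (rule derivative_eq_intros refl | simp)+
  qed (auto intro!: continuous_intros)
  have T2: "pairing n (G m' (U2 s m')) (\<lambda>i. m' i - m i) + pairing n (F m' (U2 s m')) (\<lambda>i. U2 s m' i - U1 t m i)
      - 2 * c * pairing n (F m' (U2 s m')) m'
      \<le> - (2 * k * (t - s)) + lam * pairing n (\<lambda>i. U2 s m' i - As (Y2 s m') i) (\<lambda>i. m' i - m i) + e2"
  proof (rule test_property_apply[OF tp2 K2(2) z2 tT(2) m(1) R1[OF z1] c0 c1(1),
        where h="\<lambda>s. k * (t - s)\<^sup>2" and h'="\<lambda>s. - (2 * k * (t - s))"])
    have swap: "pairing n (\<lambda>i. p i - q i) (\<lambda>i. x i - y i) = pairing n (\<lambda>i. q i - p i) (\<lambda>i. y i - x i)" for p q x y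
      unfolding pairing_def by (intro sum.cong) (auto simp: algebra_simps)
    fix s' x assume "(s', x) \<in> D2"
    from min[OF z1 this]
    show "pairing n (\<lambda>i. U2 s m' i - U1 t m i) (\<lambda>i. m' i - m i) + k * (t - s)\<^sup>2 - c * pairing n m' m'
         \<le> pairing n (\<lambda>i. U2 s' x i - U1 t m i) (\<lambda>i. x i - m i) + k * (t - s')\<^sup>2 - c * pairing n x x"
      unfolding \<Psi>_def \<Phi>_def swap[of _ "U1 t m"] by (simp add: algebra_simps)
  next
    show "((\<lambda>s. k * (t - s)\<^sup>2) has_real_derivative - (2 * k * (t - s'))) (at s')" for s'
      by (rule derivative_eq_intros refl | simp add: algebra_simps)+
  qed (auto intro!: continuous_intros)
  define J where "J = pairing n (\<lambda>i. Y1 t m i - Y2 s m' i) (\<lambda>i. A m i - A m' i)"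
  have Jpart: "pairing n (\<lambda>i. U1 t m i - As (Y1 t m) i) (\<lambda>i. m i - m' i) + pairing n (\<lambda>i. U2 s m' i - As (Y2 s m') i) (\<lambda>i. m' i - m i)
      = \<Phi> t m s m' - J"
    unfolding J_def \<Phi>_def pairing_diff_left pairing_diff_right pairing_As by simp
  \<comment> \<open>First alternative: the jump pairing is at least \<open>- (v / 2)\<close>, which
    already exceeds the pairing at the minimum. Second: compare the minimum with the states after
    the jump at unchanged times; all time penalties cancel and only the quadratic ones
    remain.\<close>
  have PhiJ: "lam * (\<Phi> t m s m' - J) \<le> \<zeta> / 4"
  proof -
    have "\<bar>t - s\<bar> < d2" using ts unfolding d_def by simp
    from d2(2)[OF z1 z2 this] have "\<Phi> t m s m' - J \<le> 8 * c"
    proof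
      assume "- (v / 2) \<le> pairing n (\<lambda>i. Y1 t m i - Y2 s m' i) (\<lambda>i. A m i - A m' i)"
      then show ?thesis using Phi_neg c0 unfolding J_def by linarith
    next
      assume a: "(t, A m) \<in> D1 \<and> (s, A m') \<in> D2 \<and>
        pairing n (\<lambda>i. Y1 t m i - Y2 s m' i) (\<lambda>i. A m i - A m' i) = \<Phi> t (A m) s (A m')"
      then have "\<Psi> t m s m' \<le> \<Psi> t (A m) s (A m')" using min by blast
      moreover note c8
      moreover have "c * (pairing n (A m) (A m) + pairing n (A m') (A m')) \<ge> 0"
        using sq(1)[OF A_M2S] m c0 by simp
      ultimately show ?thesis using a unfolding \<Psi>_def J_def by linarith
    qed
    then have "lam * (\<Phi> t m s m' - J) \<le> lam * (8 * c)" using lam0 by (intro mult_left_mono) auto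
    then show ?thesis using c3 by linarith
  qed
  have R1': "\<bar>U1 t m i\<bar> \<le> R" "\<bar>U2 s m' i\<bar> \<le> R" if "i \<in> {1..n}" for i using R1[OF z1 that] R2[OF z2 that] by auto
  have F12: "2 * c * pairing n (F m (U1 t m)) m + 2 * c * pairing n (F m' (U2 s m')) m' \<le> \<zeta> / 4"
  proof -
    have "2 * c * pairing n (F m (U1 t m)) m \<le> 2 * c * (16 * C)"
      using Fm[OF m(1) R1'(1)] c0 by (intro mult_left_mono) (auto simp: abs_le_iff)
    moreover have "2 * c * pairing n (F m' (U2 s m')) m' \<le> 2 * c * (16 * C)"
      using Fm[OF m(2) R1'(2)] c0 by (intro mult_left_mono) (auto simp: abs_le_iff)
    ultimately show ?thesis using c4 by (simp add: algebra_simps)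
  qed
  have "pairing n (G m (U1 t m)) (\<lambda>i. m i - m' i) + pairing n (G m' (U2 s m')) (\<lambda>i. m' i - m i)
     + pairing n (F m (U1 t m)) (\<lambda>i. U1 t m i - U2 s m' i) + pairing n (F m' (U2 s m')) (\<lambda>i. U2 s m' i - U1 t m i)
     = pairing n (\<lambda>i. G m (U1 t m) i - G m' (U2 s m') i) (\<lambda>i. m i - m' i)
     + pairing n (\<lambda>i. F m (U1 t m) i - F m' (U2 s m') i) (\<lambda>i. U1 t m i - U2 s m' i)"
    unfolding pairing_diff_left pairing_diff_right by simp
  then have LL: "0 \<le> pairing n (G m (U1 t m)) (\<lambda>i. m i - m' i) + pairing n (G m' (U2 s m')) (\<lambda>i. m' i - m i)
     + pairing n (F m (U1 t m)) (\<lambda>i. U1 t m i - U2 s m' i) + pairing n (F m' (U2 s m')) (\<lambda>i. U2 s m' i - U1 t m i)"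
    using lasry_lions_nonneg[OF m(1,2)] by simp
  have "lam * pairing n (\<lambda>i. U1 t m i - As (Y1 t m) i) (\<lambda>i. m i - m' i) + lam * pairing n (\<lambda>i. U2 s m' i - As (Y2 s m') i) (\<lambda>i. m' i - m i)
     \<le> \<zeta> / 4" using PhiJ unfolding Jpart[symmetric] by (simp add: distrib_left)
  then show False using T1 T2 LL F12 \<zeta>0 by linarith
qed

section \<open>Continuity of the coefficients and explicit Euler steps\<close>

lemma cont_al:
  assumes "\<And>j. j \<in> {1..n} \<Longrightarrow> continuous_on S (\<lambda>x. p x j)" "i \<in> {1..n}"
  shows "continuous_on S (\<lambda>x. al (p x) i)" "continuous_on S (\<lambda>x. be (p x) i)"
    "continuous_on S (\<lambda>x. B (p x) i)"
proof -
  note c = assms(1)[OF assms(2)] assms(1)[OF next_idx_in[OF assms(2)]] assms(1)[OF prev_idx_in[OF assms(2)]]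
  note d = continuous_on_diff[OF c(2) c(1)] continuous_on_diff[OF c(3) c(1)]
  show "continuous_on S (\<lambda>x. al (p x) i)"
    unfolding al_def by (rule continuous_on_compose2[OF ca_cont[OF assms(2)] d(1)]) auto
  show "continuous_on S (\<lambda>x. be (p x) i)"
    unfolding be_def by (rule continuous_on_compose2[OF cb_cont[OF assms(2)] d(2)]) auto
  show "continuous_on S (\<lambda>x. B (p x) i)"
    unfolding B_def
    by (rule continuous_on_add;
      rule continuous_on_compose2[OF b1_cont[OF assms(2)] d(1)] continuous_on_compose2[OF b2_cont[OF assms(2)] d(2)]; auto)
qed

lemma cont_gen:
  assumes "\<And>j. j \<in> {1..n} \<Longrightarrow> continuous_on S (\<lambda>x. p x j)" "\<And>j. j \<in> {1..n} \<Longrightarrow> continuous_on S (\<lambda>x. q x j)" "i \<in> {1..n}"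
  shows "continuous_on S (\<lambda>x. gen (p x) (q x) i)"
  unfolding gen_def
  by (intro continuous_on_add continuous_on_mult continuous_on_diff cont_al assms next_idx_in prev_idx_in)

lemma cont_F:
  assumes "\<And>j. j \<in> {1..n} \<Longrightarrow> continuous_on S (\<lambda>x. m x j)" "\<And>j. j \<in> {1..n} \<Longrightarrow> continuous_on S (\<lambda>x. p x j)"
  shows "continuous_on S (\<lambda>x. F (m x) (p x) i)"
  unfolding F_def
  by (intro continuous_on_minus continuous_on_sum continuous_on_mult cont_gen continuous_on_const assms)

lemma cont_G:
  assumes "continuous_on S m" "m ` S \<subseteq> M2S n" "\<And>j. j \<in> {1..n} \<Longrightarrow> continuous_on S (\<lambda>x. p x j)" "i \<in> {1..n}"
  shows "continuous_on S (\<lambda>x. G (m x) (p x) i)"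
  unfolding G_def
  by (intro continuous_on_add cont_al assms continuous_on_compose2[OF fn_cont[OF assms(4)] assms(1,2)])

lemma cont_As:
  assumes "\<And>j. j \<in> {1..n} \<Longrightarrow> continuous_on S (\<lambda>x. p x j)"
  shows "continuous_on S (\<lambda>x. As (p x) i)"
  unfolding A_disc_adj_def
  by (intro continuous_on_mult continuous_on_sum continuous_on_const assms)

lemma cont_A:
  assumes "continuous_on S m"
  shows "continuous_on S (\<lambda>x. A (m x))"
proof (rule continuous_on_coordinatewise_then_product)
  fix i
  show "continuous_on S (\<lambda>x. A (m x) i)"
  proof (cases "i \<in> {1..n}")
    case True
    have "continuous_on S (\<lambda>x. 1 / real n * (\<Sum>j=1..n. M i j * m x j))"
      by (intro continuous_on_mult continuous_on_sum continuous_on_const continuous_on_coord[OF assms])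
    then show ?thesis using True by (simp add: A_disc_def)
  next
    case False
    then show ?thesis unfolding A_disc_def by (subst if_not_P) auto
  qed
qed

text \<open>Under the step size condition an explicit Euler step is a combination of the value at
  \<open>i\<close> and its two neighbours with nonnegative weights of sum
  \<open>1 - \<tau> * \<kappa>\<close>: a discrete maximum principle with killing rate
  \<open>\<kappa>\<close>.\<close>

lemma euler_upper:
  assumes i: "i \<in> {1..n}" and \<tau>: "0 \<le> \<tau>" "\<tau> * (al p i + be p i + \<kappa>) \<le> 1"
    and q: "\<And>j. j \<in> {1..n} \<Longrightarrow> q j \<le> c"
  shows "q i + \<tau> * (gen p q i - \<kappa> * q i) \<le> (1 - \<tau> * \<kappa>) * c"
proof -
  have a: "\<tau> * al p i \<ge> 0" "\<tau> * be p i \<ge> 0" using al0[OF i] be0[OF i] \<tau> by auto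
  have "q i + \<tau> * (gen p q i - \<kappa> * q i) =
     (1 - \<tau> * (al p i + be p i + \<kappa>)) * q i + \<tau> * al p i * q (next_idx n i) + \<tau> * be p i * q (prev_idx n i)"
    by (simp add: gen_def algebra_simps)
  also have "\<dots> \<le> (1 - \<tau> * (al p i + be p i + \<kappa>)) * c + \<tau> * al p i * c + \<tau> * be p i * c"
    using q[OF i] q[OF next_idx_in[OF i]] q[OF prev_idx_in[OF i]] a \<tau>(2)
    by (intro add_mono mult_left_mono) auto
  also have "\<dots> = (1 - \<tau> * \<kappa>) * c" by (simp add: algebra_simps)
  finally show ?thesis .
qed

lemma gen_uminus: "gen p (\<lambda>j. - q j) i = - gen p q i"
  by (simp add: gen_def algebra_simps)

lemma euler_lower:
  assumes i: "i \<in> {1..n}" and \<tau>: "0 \<le> \<tau>" "\<tau> * (al p i + be p i + \<kappa>) \<le> 1"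
    and q: "\<And>j. j \<in> {1..n} \<Longrightarrow> c \<le> q j"
  shows "(1 - \<tau> * \<kappa>) * c \<le> q i + \<tau> * (gen p q i - \<kappa> * q i)"
  using euler_upper[OF i \<tau>, of "\<lambda>j. - q j" "- c"] q by (simp add: gen_uminus algebra_simps)

lemma euler_upper0:
  assumes i: "i \<in> {1..n}" and \<tau>: "0 \<le> \<tau>" "\<tau> * (al p i + be p i) \<le> 1"
    and q: "\<And>j. j \<in> {1..n} \<Longrightarrow> q j \<le> c"
  shows "q i + \<tau> * gen p q i \<le> c"
  using euler_upper[of i \<tau> p 0 q c] assms by simp

lemma euler_lower0:
  assumes i: "i \<in> {1..n}" and \<tau>: "0 \<le> \<tau>" "\<tau> * (al p i + be p i) \<le> 1"
    and q: "\<And>j. j \<in> {1..n} \<Longrightarrow> c \<le> q j"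
  shows "c \<le> q i + \<tau> * gen p q i"
  using euler_lower[of i \<tau> p 0 c q] assms by simp

definition fp_step :: "real \<Rightarrow> (nat \<Rightarrow> real) \<Rightarrow> (nat \<Rightarrow> real) \<Rightarrow> nat \<Rightarrow> real" where
  "fp_step \<tau> m p = (\<lambda>i. m i - \<tau> * F m p i)"

lemma pairing_fp_step: "pairing n q (fp_step \<tau> m p) = pairing n (\<lambda>i. q i + \<tau> * gen p q i) m"
proof -
  have "pairing n q (fp_step \<tau> m p) = pairing n q m - \<tau> * pairing n (F m p) q"
    unfolding fp_step_def pairing_diff_right pairing_scale_right pairing_commute[of n q "F m p"] ..
  then show ?thesis unfolding pairing_F pairing_add_left pairing_scale_left pairing_commute[of n m "gen p q"] by simp
qed

text \<open>Nonnegativity by duality: the entry at \<open>k\<close> is \<open>m\<close> paired with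
  one Euler step applied to the indicator of \<open>k\<close>, and such steps preserve
  nonnegativity. Mass is kept because \<open>F\<close> sums to 0.\<close>

lemma fp_step_PS:
  assumes m: "m \<in> PS n" and \<tau>: "0 \<le> \<tau>" "\<And>i. i \<in> {1..n} \<Longrightarrow> \<tau> * (al p i + be p i) \<le> 1"
  shows "fp_step \<tau> m p \<in> PS n"
proof -
  have "fp_step \<tau> m p i = 0" if "i \<notin> {1..n}" for i
    using m that F_outside[OF that] unfolding fp_step_def PS_def MS_def by simp
  moreover have "(\<Sum>i=1..n. fp_step \<tau> m p i) = 1"
    using m F_sum unfolding fp_step_def PS_def by (simp add: sum_subtractf sum_distrib_left[symmetric])
  moreover have "fp_step \<tau> m p k \<ge> 0" if k: "k \<in> {1..n}" for k
  proof -
    let ?q = "\<lambda>i. if i = k then 1 else (0::real)"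
    have "fp_step \<tau> m p k = pairing n ?q (fp_step \<tau> m p)"
    proof -
      have "pairing n ?q (fp_step \<tau> m p) = (\<Sum>i=1..n. if i = k then fp_step \<tau> m p i else 0)"
        unfolding pairing_def by (intro sum.cong) auto
      then show ?thesis using k by simp
    qed
    also have "\<dots> = pairing n (\<lambda>i. ?q i + \<tau> * gen p ?q i) m" by (rule pairing_fp_step)
    also have "\<dots> \<ge> 0"
      unfolding pairing_def
    proof (rule sum_nonneg)
      fix i assume i: "i \<in> {1..n}"
      have "0 \<le> ?q i + \<tau> * gen p ?q i" by (rule euler_lower0[OF i \<tau>(1) \<tau>(2)[OF i]]) auto
      then show "0 \<le> (?q i + \<tau> * gen p ?q i) * m i" using M2S_nonneg[OF PS_M2S[OF m]] by simp
    qed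
    finally show ?thesis .
  qed
  ultimately show ?thesis unfolding PS_def MS_def by blast
qed

lemma fn_bound: "\<exists>C\<ge>0. \<forall>i\<in>{1..n}. \<forall>m\<in>M2S n. \<bar>fn m i\<bar> \<le> C"
  using real_has_max_bound[OF compact_M2S fn_cont] by (intro finite_bound) auto

text \<open>Concavity bounds \<open>B p\<close> from above through the generator at 0 and from below
  through the generator at \<open>p\<close>. Either way the step is an Euler step with a bounded
  source, so the sup norm grows at most linearly in time, at a rate that does not involve the size
  of \<open>p\<close>.\<close>

lemma backward_step_bound:
  assumes i: "i \<in> {1..n}" and \<tau>: "0 \<le> \<tau>" "\<tau> * (al p i + be p i + lam) \<le> 1" "\<tau> * (al (\<lambda>_. 0) i + be (\<lambda>_. 0) i + lam) \<le> 1"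
    and p: "\<And>j. j \<in> {1..n} \<Longrightarrow> \<bar>p j\<bar> \<le> c"
    and C: "\<bar>fn m i\<bar> \<le> Cf" "\<bar>B (\<lambda>_. 0) i\<bar> \<le> CB" "\<bar>y\<bar> \<le> Cy"
  shows "\<bar>p i + \<tau> * (G m p i - lam * (p i - y))\<bar> \<le> c + \<tau> * (Cf + CB + lam * Cy)"
proof -
  have c0: "c \<ge> 0" using p[OF i] by linarith
  have ly: "\<bar>lam * y\<bar> \<le> lam * Cy" using C(3) lam0 by (simp add: abs_mult)
  have l: "(1 - \<tau> * lam) * c \<le> c" using c0 \<tau>(1) lam0 by (simp add: algebra_simps)
  have "G m p i - lam * (p i - y) \<le> gen (\<lambda>_. 0) p i - lam * p i + (Cf + CB + lam * Cy)"
    using B_gen_le[OF i, of p "\<lambda>_. 0"] C(1,2) ly unfolding G_def by (simp add: algebra_simps)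
  then have "\<tau> * (G m p i - lam * (p i - y)) \<le> \<tau> * (gen (\<lambda>_. 0) p i - lam * p i + (Cf + CB + lam * Cy))"
    using \<tau>(1) by (rule mult_left_mono)
  moreover have "p i + \<tau> * (gen (\<lambda>_. 0) p i - lam * p i) \<le> (1 - \<tau> * lam) * c"
    using p by (intro euler_upper[OF i \<tau>(1,3)]) (auto simp: abs_le_iff)
  moreover have "gen p p i - lam * p i - (Cf + CB + lam * Cy) \<le> G m p i - lam * (p i - y)"
    using B_gen_ge[OF i, of p "\<lambda>_. 0"] C(1,2) ly unfolding G_def by (simp add: algebra_simps)
  then have "\<tau> * (gen p p i - lam * p i - (Cf + CB + lam * Cy)) \<le> \<tau> * (G m p i - lam * (p i - y))"
    using \<tau>(1) by (rule mult_left_mono)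
  moreover have "(1 - \<tau> * lam) * (- c) \<le> p i + \<tau> * (gen p p i - lam * p i)"
  proof (intro euler_lower[OF i \<tau>(1,2)])
    fix j assume "j \<in> {1..n}" then show "- c \<le> p j" using p[of j] by linarith
  qed
  ultimately show ?thesis using l by (simp add: abs_le_iff algebra_simps)
qed

end

section \<open>Characteristics of a monotone solution\<close>

locale discrete_solution = discrete_mfg +
  fixes W :: "real \<Rightarrow> (nat \<Rightarrow> real) \<Rightarrow> nat \<Rightarrow> real" and gn :: "(nat \<Rightarrow> real) \<Rightarrow> nat \<Rightarrow> real"
  assumes W_cont: "i \<in> {1..n} \<Longrightarrow> continuous_on ({0..T} \<times> M2S n) (\<lambda>(t, m). W t m i)"
    and W_terminal: "m \<in> M2S n \<Longrightarrow> i \<in> {1..n} \<Longrightarrow> W T m i = gn m i"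
    and W_test: "test_property ({0..T} \<times> M2S n) W (\<lambda>t m. W t (A m)) 0 R"
    and gn_mono: "m \<in> M2S n \<Longrightarrow> m' \<in> M2S n \<Longrightarrow>
      0 \<le> pairing n (\<lambda>i. gn m i - gn m' i) (\<lambda>i. m i - m' i)"
begin

section \<open>Monotonicity of \<open>W\<close> and existence of discrete characteristics\<close>

lemma W_bound: "\<exists>C\<ge>0. \<forall>i\<in>{1..n}. \<forall>z\<in>{0..T} \<times> M2S n. \<bar>W (fst z) (snd z) i\<bar> \<le> C"
proof (rule finite_bound)
  fix i assume "i \<in> {1..n}"
  from real_has_max_bound[OF compact_Times[OF compact_Icc compact_M2S] W_cont[OF this]]
  show "\<exists>C. \<forall>z\<in>{0..T} \<times> M2S n. \<bar>W (fst z) (snd z) i\<bar> \<le> C" by (auto simp: case_prod_beta')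
qed simp

lemma W_cont_compose:
  assumes "continuous_on S h" "continuous_on S m" "\<And>x. x \<in> S \<Longrightarrow> 0 \<le> h x \<and> h x \<le> T \<and> m x \<in> M2S n" "i \<in> {1..n}"
  shows "continuous_on S (\<lambda>x. W (h x) (m x) i)"
proof -
  have "continuous_on ({0..T} \<times> M2S n) (\<lambda>z. W (fst z) (snd z) i)"
    using W_cont[OF assms(4)] by (simp add: case_prod_beta')
  then have "continuous_on S (\<lambda>x. W (fst (h x, m x)) (snd (h x, m x)) i)"
    by (rule continuous_on_compose2[where f="\<lambda>x. (h x, m x)"])
      (use assms in \<open>auto intro: continuous_on_Pair\<close>)
  then show ?thesis by simp
qed

text \<open>\<open>doubling\<close> of \<open>W\<close> with itself. \<open>A\<close> maps the
  domain into itself, so the second alternative for the jump term applies.\<close>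

lemma W_mono:
  assumes "t \<in> {0..T}" "m \<in> M2S n" "m' \<in> M2S n"
  shows "0 \<le> pairing n (\<lambda>i. W t m i - W t m' i) (\<lambda>i. m i - m' i)"
proof -
  obtain C where C: "C \<ge> 0" "\<And>i t m. i \<in> {1..n} \<Longrightarrow> t \<in> {0..T} \<Longrightarrow> m \<in> M2S n \<Longrightarrow> \<bar>W t m i\<bar> \<le> C"
    using W_bound by fastforce
  have "- ((0 + 0) * (T - t)) \<le> pairing n (\<lambda>i. W t m i - W t m' i) (\<lambda>i. m i - m' i)"
  proof (rule doubling[OF _ _ _ _ W_cont W_cont W_test W_test, where R="C + 4"])
    show "compact ({0..T} \<times> M2S n)" by (intro compact_Times compact_Icc compact_M2S)
    then show "compact ({0..T} \<times> M2S n)" .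
    fix m m' assume "(T, m) \<in> {0..T} \<times> M2S n" "(T, m') \<in> {0..T} \<times> M2S n"
    then have mm: "m \<in> M2S n" "m' \<in> M2S n" by auto
    have "pairing n (\<lambda>i. W T m i - W T m' i) (\<lambda>i. m i - m' i) = pairing n (\<lambda>i. gn m i - gn m' i) (\<lambda>i. m i - m' i)"
      by (intro pairing_cong) (auto simp: W_terminal mm)
    then show "0 \<le> pairing n (\<lambda>i. W T m i - W T m' i) (\<lambda>i. m i - m' i)" using gn_mono[OF mm] by simp
  next
    fix \<zeta> :: real
    show "\<exists>d>0. \<forall>t m s m'. (t, m) \<in> {0..T} \<times> M2S n \<longrightarrow> (s, m') \<in> {0..T} \<times> M2S n \<longrightarrow> \<bar>t - s\<bar> < d \<longrightarrow>
        - \<zeta> \<le> pairing n (\<lambda>i. W t (A m) i - W s (A m') i) (\<lambda>i. A m i - A m' i) \<or>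
        (t, A m) \<in> {0..T} \<times> M2S n \<and> (s, A m') \<in> {0..T} \<times> M2S n \<and>
        pairing n (\<lambda>i. W t (A m) i - W s (A m') i) (\<lambda>i. A m i - A m' i)
          = pairing n (\<lambda>i. W t (A m) i - W s (A m') i) (\<lambda>i. A m i - A m' i)"
      by (intro exI[of _ 1]) (auto simp: A_M2S)
  qed (use assms C in auto)
  then show ?thesis by simp
qed

definition char_val :: "real \<Rightarrow> real \<Rightarrow> (nat \<Rightarrow> real) \<Rightarrow> (nat \<Rightarrow> real) \<Rightarrow> nat \<Rightarrow> real" where
  "char_val t \<tau> m p i = p i + \<tau> * (G m p i - lam * (p i - As (W t (A m)) i))"

text \<open>The system is coupled at both ends: \<open>m\<close> is given initially,
  \<open>u\<close> at the end. All values of \<open>u\<close> together are taken as unknown; the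
  forward equation is solved for them and the backward equation becomes a fixed point equation on a
  cube. Values are clipped to stay in the cube, and the a priori bound shows that the clipping is
  inactive. The jump source is a known function of \<open>m\<close> since it is taken from
  \<open>W\<close>.\<close>

lemma characteristic_scheme_exists:
  "\<exists>R0\<ge>0. \<exists>\<tau>0>0. \<forall>m0\<in>PS n. \<forall>t0\<in>{0..<T}. \<forall>N\<ge>1. (T - t0) / real N \<le> \<tau>0 \<longrightarrow>
    (\<exists>m u. m 0 = m0 \<and> (\<forall>k<N. m (Suc k) = fp_step ((T - t0) / real N) (m k) (u (Suc k)))
      \<and> (\<forall>k\<le>N. m k \<in> PS n)
      \<and> (\<forall>k<N. \<forall>i\<in>{1..n}. u k i = char_val (t0 + real k * ((T - t0) / real N)) ((T - t0) / real N) (m k) (u (Suc k)) i)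
      \<and> (\<forall>i\<in>{1..n}. u N i = gn (m N) i)
      \<and> (\<forall>k\<le>N. u k \<in> box_fun {1..n} (- R0) R0))"
proof -
  obtain CW where CW: "CW \<ge> 0" "\<And>i t m. i \<in> {1..n} \<Longrightarrow> t \<in> {0..T} \<Longrightarrow> m \<in> M2S n \<Longrightarrow> \<bar>W t m i\<bar> \<le> CW"
    using W_bound by fastforce
  obtain Cf where Cf: "Cf \<ge> 0" "\<And>i m. i \<in> {1..n} \<Longrightarrow> m \<in> M2S n \<Longrightarrow> \<bar>fn m i\<bar> \<le> Cf"
    using fn_bound by blast
  obtain CB where CB: "CB \<ge> 0" "\<And>i. i \<in> {1..n} \<Longrightarrow> \<bar>B (\<lambda>_. 0) i\<bar> \<le> CB"
  proof -
    have "\<exists>C\<ge>0. \<forall>i\<in>{1..n}. \<forall>z\<in>{()}. \<bar>B (\<lambda>_. 0) i\<bar> \<le> C"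
      by (rule finite_bound) auto
    then show ?thesis using that by auto
  qed
  define K where "K = Cf + CB + lam * CW"
  have K0: "K \<ge> 0" unfolding K_def using Cf CB CW lam0 by simp
  \<comment> \<open>The sup norm is at most \<open>CW\<close> at time \<open>T\<close> and grows at
    rate at most \<open>K\<close> backwards in time.\<close>
  define R0 where "R0 = CW + T * K + 1"
  have R00: "R0 > 0" unfolding R0_def using CW K0 T0 by (simp add: add_nonneg_pos)
  obtain C where C: "C \<ge> 0" "\<And>p i. (\<And>i. i \<in> {1..n} \<Longrightarrow> \<bar>p i\<bar> \<le> R0) \<Longrightarrow> i \<in> {1..n} \<Longrightarrow> al p i \<le> C \<and> be p i \<le> C"
    using rates_bounded[of R0] by blast
  define \<tau>0 where "\<tau>0 = 1 / (2 * C + lam)"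
  have \<tau>00: "\<tau>0 > 0" unfolding \<tau>0_def using C lam0 by (simp add: add_nonneg_pos)
  have main: "\<exists>m u. m 0 = m0 \<and> (\<forall>k<N. m (Suc k) = fp_step \<tau> (m k) (u (Suc k)))
      \<and> (\<forall>k\<le>N. m k \<in> PS n)
      \<and> (\<forall>k<N. \<forall>i\<in>{1..n}. u k i = char_val (t0 + real k * \<tau>) \<tau> (m k) (u (Suc k)) i)
      \<and> (\<forall>i\<in>{1..n}. u N i = gn (m N) i)
      \<and> (\<forall>k\<le>N. u k \<in> box_fun {1..n} (- R0) R0)"
    if m0: "m0 \<in> PS n" and t0: "t0 \<in> {0..<T}" and N: "N \<ge> 1" and \<tau>: "\<tau> = (T - t0) / real N" "\<tau> \<le> \<tau>0" for m0 t0 N \<tau>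
  proof -
    have \<tau>p: "\<tau> > 0" unfolding \<tau> using t0 N by simp
    have N\<tau>: "real N * \<tau> = T - t0" unfolding \<tau> using N by simp
    have rate: "\<tau> * (al p i + be p i + lam) \<le> 1" if "\<And>i. i \<in> {1..n} \<Longrightarrow> \<bar>p i\<bar> \<le> R0" "i \<in> {1..n}" for p i
    proof -
      have "al p i \<le> C" "be p i \<le> C" using C(2)[OF that] by auto
      then have "al p i + be p i + lam \<le> 2 * C + lam" by linarith
      then have "\<tau> * (al p i + be p i + lam) \<le> \<tau>0 * (2 * C + lam)"
        using \<tau> \<tau>p al0[OF that(2), of p] be0[OF that(2), of p] lam0 by (intro mult_mono) auto
      also have "\<dots> = 1" unfolding \<tau>0_def using C lam0
        by (metis \<tau>00 \<tau>0_def less_numeral_extra(3) nonzero_eq_divide_eq divide_eq_0_iff)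
      finally show ?thesis .
    qed
    have rate': "\<tau> * (al p i + be p i) \<le> 1" if "\<And>i. i \<in> {1..n} \<Longrightarrow> \<bar>p i\<bar> \<le> R0" "i \<in> {1..n}" for p i
    proof -
      have "\<tau> * (al p i + be p i) \<le> \<tau> * (al p i + be p i + lam)" using \<tau>p lam0 by simp
      then show ?thesis using rate[of p i, OF that] by (rule order.trans)
    qed
    define I where "I = {0..N} \<times> {1..n}"
    \<comment> \<open>Coordinates of the unit cube rescaled to values in
      \<open>{- R0..R0}\<close>.\<close>
    define usc where "usc = (\<lambda>(x::nat\<times>nat\<Rightarrow>real) k i. if (k, i) \<in> I then R0 * (2 * x (k, i) - 1) else 0)"
    define ms where "ms = (\<lambda>x. rec_nat m0 (\<lambda>k m. fp_step \<tau> m (usc x (Suc k))))"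
    define val where "val = (\<lambda>x k i. if k = N then gn (ms x N) i else
        char_val (t0 + real k * \<tau>) \<tau> (ms x k) (usc x (Suc k)) i)"
    \<comment> \<open>The inverse rescaling followed by clipping to the unit interval.\<close>
    define \<Theta> where "\<Theta> = (\<lambda>x (k, i). max 0 (min 1 ((1 + val x k i / R0) / 2)))"
    have ms0: "ms x 0 = m0" and msS: "ms x (Suc k) = fp_step \<tau> (ms x k) (usc x (Suc k))" for x k
      unfolding ms_def by simp_all
    have usc_b: "\<bar>usc x k i\<bar> \<le> R0" if "x \<in> box_fun I 0 1" for x k i
    proof (cases "(k, i) \<in> I")
      case True
      then have "0 \<le> x (k, i)" "x (k, i) \<le> 1" using that unfolding box_fun_def by auto
      then have "\<bar>2 * x (k, i) - 1\<bar> \<le> 1" by (simp add: abs_le_iff)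
      then have "R0 * \<bar>2 * x (k, i) - 1\<bar> \<le> R0 * 1" using R00 by (intro mult_left_mono) auto
      then show ?thesis using True R00 by (simp add: usc_def abs_mult)
    qed (use R00 in \<open>auto simp: usc_def\<close>)
    have msPS: "ms x k \<in> PS n" if "x \<in> box_fun I 0 1" for x k
    proof (induction k)
      case 0 then show ?case using m0 by (simp add: ms0)
    next
      case (Suc k)
      show ?case unfolding msS using \<tau>p
        by (intro fp_step_PS Suc rate' usc_b[OF that]) auto
    qed
    let ?X = "box_fun I 0 1 :: (nat \<times> nat \<Rightarrow> real) set"
    have c_usc: "continuous_on ?X (\<lambda>x. usc x k i)" for k i
      unfolding usc_def by (cases "(k, i) \<in> I") (auto intro!: continuous_intros continuous_coord)
    have c_ms: "continuous_on ?X (\<lambda>x. ms x k)" for k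
    proof (induction k)
      case 0 then show ?case by (simp add: ms0)
    next
      case (Suc k)
      show ?case unfolding msS fp_step_def
        by (intro continuous_on_coordinatewise_then_product continuous_on_diff continuous_on_mult
          continuous_on_const cont_F c_usc continuous_on_coord[OF Suc])
    qed
    have t_k: "0 \<le> t0 + real k * \<tau>" "t0 + real k * \<tau> \<le> T" if "k \<le> N" for k
    proof -
      show "0 \<le> t0 + real k * \<tau>" using t0 \<tau>p by simp
      have "real k * \<tau> \<le> real N * \<tau>" using that \<tau>p by (intro mult_right_mono) auto
      then show "t0 + real k * \<tau> \<le> T" using N\<tau> by linarith
    qed
    have c_gn: "continuous_on ?X (\<lambda>x. gn (ms x N) i)" if "i \<in> {1..n}" for i
    proof -
      \<comment> \<open>Continuity of \<open>gn\<close> is inherited from \<open>W\<close> at the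
        terminal time.\<close>
      have "continuous_on ?X (\<lambda>x. W T (ms x N) i)"
        using T0 msPS PS_M2S by (intro W_cont_compose c_ms continuous_on_const that) auto
      then show ?thesis using W_terminal[OF PS_M2S[OF msPS] that] by (simp cong: continuous_on_cong)
    qed
    have c_val: "continuous_on ?X (\<lambda>x. val x k i)" if "k \<le> N" "i \<in> {1..n}" for k i
    proof (cases "k = N")
      case True then show ?thesis using c_gn that by (simp add: val_def)
    next
      case False
      have "continuous_on ?X (\<lambda>x. G (ms x k) (usc x (Suc k)) i)"
        by (intro cont_G c_ms c_usc that) (use msPS PS_M2S in auto)
      moreover have "continuous_on ?X (\<lambda>x. As (W (t0 + real k * \<tau>) (A (ms x k))) i)"
        by (intro cont_As W_cont_compose continuous_on_const cont_A c_ms)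
          (use t_k that msPS PS_M2S A_M2S in auto)
      ultimately show ?thesis using False unfolding val_def char_val_def
        by (auto intro!: continuous_on_add continuous_on_mult continuous_on_diff continuous_on_const c_usc)
    qed
    have "\<exists>x\<in>box_fun I 0 1. \<forall>z\<in>I. \<Theta> x z = x z"
    proof (rule brouwer_box_fun)
      show "finite I" by (simp add: I_def)
      fix z assume z: "z \<in> I"
      obtain k i where ki: "z = (k, i)" by fastforce
      then have "k \<le> N" "i \<in> {1..n}" using z by (auto simp: I_def)
      from c_val[OF this] show "continuous_on ?X (\<lambda>x. \<Theta> x z)"
        unfolding \<Theta>_def ki using R00 by (auto intro!: continuous_intros)
    next
      fix x z assume "x \<in> ?X" "z \<in> I"
      then show "0 \<le> \<Theta> x z \<and> \<Theta> x z \<le> 1" unfolding \<Theta>_def by (auto split: prod.splits)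
    qed
    then obtain x where x: "x \<in> ?X" "\<And>k i. k \<le> N \<Longrightarrow> i \<in> {1..n} \<Longrightarrow> \<Theta> x (k, i) = x (k, i)"
      unfolding I_def by fastforce
    have unclip: "usc x k i = val x k i" if "k \<le> N" "i \<in> {1..n}" "\<bar>val x k i\<bar> \<le> R0" for k i
    proof -
      have "- 1 \<le> val x k i / R0" "val x k i / R0 \<le> 1" using that(3) R00 by (auto simp: abs_le_iff field_simps)
      then have "\<Theta> x (k, i) = (1 + val x k i / R0) / 2" unfolding \<Theta>_def by simp
      then have "x (k, i) = (1 + val x k i / R0) / 2" using x(2)[OF that(1,2)] by simp
      then show ?thesis using that R00 unfolding usc_def I_def by (simp add: field_simps)
    qed
    \<comment> \<open>Backwards from the end: as long as the bound stays below \<open>R0\<close>,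
      the values already treated are unclipped, and one more step of the true scheme can be
      estimated.\<close>
    have vb: "\<forall>i\<in>{1..n}. \<bar>val x (N - l) i\<bar> \<le> CW + real l * \<tau> * K" if "l \<le> N" for l
      using that
    proof (induction l)
      case 0
      show ?case
      proof
        fix i assume i: "i \<in> {1..n}"
        have "gn (ms x N) i = W T (ms x N) i" using W_terminal[OF PS_M2S[OF msPS[OF x(1)]] i] by simp
        then show "\<bar>val x (N - 0) i\<bar> \<le> CW + real 0 * \<tau> * K"
          using CW(2)[OF i _ PS_M2S[OF msPS[OF x(1)]], of T] T0 by (simp add: val_def)
      qed
    next
      case (Suc l)
      have lN: "real l * \<tau> * K \<le> T * K"
      proof -
        have "real l * \<tau> \<le> real N * \<tau>" using Suc.prems \<tau>p by (intro mult_right_mono) auto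
        then have "real l * \<tau> \<le> T" using N\<tau> t0 by auto
        then show ?thesis using K0 by (intro mult_right_mono) auto
      qed
      have kS: "Suc (N - Suc l) = N - l" using Suc.prems by auto
      have IH: "\<bar>val x (N - l) i\<bar> \<le> CW + real l * \<tau> * K" if "i \<in> {1..n}" for i using Suc that by auto
      have us: "usc x (N - l) i = val x (N - l) i" if "i \<in> {1..n}" for i
        using IH[OF that] lN by (intro unclip that) (auto simp: R0_def)
      show ?case
      proof
        fix i assume i: "i \<in> {1..n}"
        let ?k = "N - Suc l"
        have "val x ?k i = usc x (N - l) i + \<tau> * (G (ms x ?k) (usc x (N - l)) i - lam * (usc x (N - l) i - As (W (t0 + real ?k * \<tau>) (A (ms x ?k))) i))"
          using Suc.prems kS unfolding val_def char_val_def by auto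
        also have "\<bar>\<dots>\<bar> \<le> (CW + real l * \<tau> * K) + \<tau> * (Cf + CB + lam * CW)"
        proof (rule backward_step_bound[OF i])
          show "\<bar>As (W (t0 + real ?k * \<tau>) (A (ms x ?k))) i\<bar> \<le> CW"
            using t_k[of ?k] msPS[OF x(1)] by (intro As_bound CW(2) A_M2S PS_M2S i) auto
          show "\<tau> * (al (usc x (N - l)) i + be (usc x (N - l)) i + lam) \<le> 1"
            by (intro rate usc_b[OF x(1)] i)
          show "\<tau> * (al (\<lambda>_. 0) i + be (\<lambda>_. 0) i + lam) \<le> 1"
            using R00 by (intro rate i) auto
        qed (use \<tau>p us IH Cf(2)[OF i PS_M2S[OF msPS[OF x(1)]]] CB(2)[OF i] in auto)
        finally show "\<bar>val x ?k i\<bar> \<le> CW + real (Suc l) * \<tau> * K" unfolding K_def by (simp add: algebra_simps)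
      qed
    qed
    have vb': "\<bar>val x k i\<bar> \<le> R0" if "k \<le> N" "i \<in> {1..n}" for k i
    proof -
      have "\<bar>val x (N - (N - k)) i\<bar> \<le> CW + real (N - k) * \<tau> * K" using vb[of "N - k"] that by auto
      moreover have "real (N - k) * \<tau> * K \<le> T * K"
      proof -
        have "real (N - k) * \<tau> \<le> real N * \<tau>" using \<tau>p by (intro mult_right_mono) auto
        then have "real (N - k) * \<tau> \<le> T" using N\<tau> t0 by auto
        then show ?thesis using K0 by (intro mult_right_mono) auto
      qed
      ultimately show ?thesis using that unfolding R0_def by simp
    qed
    have eq: "usc x k i = val x k i" if "k \<le> N" "i \<in> {1..n}" for k i
      by (rule unclip[OF that vb'[OF that]])
    show ?thesis
    proof (intro exI conjI allI impI ballI)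
      show "ms x 0 = m0" by (rule ms0)
      show "ms x (Suc k) = fp_step \<tau> (ms x k) (usc x (Suc k))" for k by (rule msS)
      show "ms x k \<in> PS n" for k by (rule msPS[OF x(1)])
      show "usc x k i = char_val (t0 + real k * \<tau>) \<tau> (ms x k) (usc x (Suc k)) i" if "k < N" "i \<in> {1..n}" for k i
        using eq[of k i] that by (simp add: val_def)
      show "usc x N i = gn (ms x N) i" if "i \<in> {1..n}" for i using eq[of N i] that by (simp add: val_def)
      show "usc x k \<in> box_fun {1..n} (- R0) R0" if "k \<le> N" for k
      proof -
        have "- R0 \<le> usc x k i \<and> usc x k i \<le> R0" for i using usc_b[OF x(1), of k i] by (simp add: abs_le_iff)
        moreover have "usc x k i = 0" if "i \<notin> {1..n}" for i using that unfolding usc_def I_def by auto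
        ultimately show ?thesis unfolding box_fun_def by blast
      qed
    qed
  qed
  show ?thesis
    by (intro exI[of _ R0] conjI exI[of _ \<tau>0] ballI allI impI \<tau>00 less_imp_le[OF R00] main) auto
qed

end

text \<open>The piecewise linear path through \<open>x 0, \<dots>, x N\<close> at the times \<open>t0, t0 + \<tau>, \<dots>, t0 + N * \<tau>\<close>.\<close>

definition pl_path :: "real \<Rightarrow> real \<Rightarrow> nat \<Rightarrow> (nat \<Rightarrow> real) \<Rightarrow> real \<Rightarrow> real" where
  "pl_path t0 \<tau> N x s = x 0 + (\<Sum>l<N. max 0 (min 1 ((s - t0) / \<tau> - real l)) * (x (Suc l) - x l))"

lemma continuous_pl_path: "continuous_on S (\<lambda>s. pl_path t0 \<tau> N x s)"
  unfolding pl_path_def by (cases "\<tau> = 0") (auto intro!: continuous_intros)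

text \<open>The clipped factors are 1 for completed steps, \<open>\<theta>\<close> for the current
  one and 0 for later ones, so the sum telescopes.\<close>

lemma pl_path_at:
  assumes "k < N" "0 \<le> \<theta>" "\<theta> \<le> 1" "\<tau> > 0"
  shows "pl_path t0 \<tau> N x (t0 + (real k + \<theta>) * \<tau>) = x k + \<theta> * (x (Suc k) - x k)"
proof -
  let ?c = "\<lambda>l. max 0 (min 1 (real k + \<theta> - real l))"
  have "pl_path t0 \<tau> N x (t0 + (real k + \<theta>) * \<tau>) = x 0 + (\<Sum>l<N. ?c l * (x (Suc l) - x l))"
    unfolding pl_path_def using assms by simp
  also have "(\<Sum>l<N. ?c l * (x (Suc l) - x l)) = (\<Sum>l<Suc k. ?c l * (x (Suc l) - x l))"
  proof (rule sum.mono_neutral_right)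
    show "\<forall>l\<in>{..<N} - {..<Suc k}. ?c l * (x (Suc l) - x l) = 0"
    proof
      fix l assume "l \<in> {..<N} - {..<Suc k}"
      then have "real l \<ge> real k + 1" by auto
      then have "?c l = 0" using assms by (simp add: max_def min_def)
      then show "?c l * (x (Suc l) - x l) = 0" by simp
    qed
  qed (use assms in auto)
  also have "\<dots> = (\<Sum>l<k. x (Suc l) - x l) + \<theta> * (x (Suc k) - x k)"
  proof -
    have "?c l = 1" if "l < k" for l
    proof -
      have "real l + 1 \<le> real k" using that by simp
      then have "1 \<le> real k + \<theta> - real l" using assms by linarith
      then show ?thesis by simp
    qed
    moreover have "?c k = \<theta>" using assms by simp
    ultimately show ?thesis by (simp add: sum.lessThan_Suc)
  qed
  also have "(\<Sum>l<k. x (Suc l) - x l) = x k - x 0" by (rule sum_lessThan_telescope)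
  finally show ?thesis by simp
qed

section \<open>Approximate characteristics and their comparison with \<open>W\<close>\<close>

lemma grid_decomposition:
  fixes N :: nat
  assumes "\<tau> > 0" "real N * \<tau> = T - t0" "t0 \<le> s" "s < T"
  obtains k \<theta> where "k < N" "0 \<le> \<theta>" "\<theta> < 1" "s = t0 + (real k + \<theta>) * \<tau>"
proof -
  define r where "r = (s - t0) / \<tau>"
  have r: "0 \<le> r" "r < real N" using assms unfolding r_def by (auto simp: field_simps)
  define k where "k = nat \<lfloor>r\<rfloor>"
  have k: "real k = of_int \<lfloor>r\<rfloor>" using r(1) unfolding k_def by simp
  have "real k \<le> r" "r < real k + 1" unfolding k by linarith+
  moreover have "s = t0 + r * \<tau>" unfolding r_def using assms by simp
  ultimately show ?thesis using r by (intro that[of k "r - real k"]) auto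
qed

lemma box_fun_abs: "x \<in> box_fun I (- R) R \<Longrightarrow> i \<in> I \<Longrightarrow> \<bar>x i\<bar> \<le> R"
  unfolding box_fun_def by (simp add: abs_le_iff minus_le_iff)

context discrete_solution
begin

text \<open>Only the jump part of the backward equation, without its factor \<open>lam\<close>; the
  rest is \<open>G\<close>.\<close>

definition char_rhs :: "real \<Rightarrow> (nat \<Rightarrow> real) \<Rightarrow> (nat \<Rightarrow> real) \<Rightarrow> nat \<Rightarrow> real" where
  "char_rhs s m p i = p i - As (W s (A m)) i"

text \<open>By compactness of the set of all \<open>(s, m, p)\<close> concerned, so one time step
  suits every starting point. The moduli may depend on \<open>n\<close>.\<close>

lemma char_modulus:
  assumes "\<eta> > 0"
  shows "\<exists>d>0. \<forall>s m p s' m' p'. s \<in> {0..T} \<longrightarrow> s' \<in> {0..T} \<longrightarrow> m \<in> M2S n \<longrightarrow> m' \<in> M2S n \<longrightarrow>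
    p \<in> box_fun {1..n} (- R) R \<longrightarrow> p' \<in> box_fun {1..n} (- R) R \<longrightarrow>
    \<bar>s - s'\<bar> + (\<Sum>i=1..n. \<bar>m i - m' i\<bar>) + (\<Sum>i=1..n. \<bar>p i - p' i\<bar>) < d \<longrightarrow>
    (\<Sum>i=1..n. \<bar>G m p i - G m' p' i\<bar> + \<bar>F m p i - F m' p' i\<bar> + \<bar>char_rhs s m p i - char_rhs s' m' p' i\<bar>) < \<eta>"
    (is "\<exists>d>0. ?P d")
  and "\<exists>C\<ge>0. \<forall>s m p. s \<in> {0..T} \<longrightarrow> m \<in> M2S n \<longrightarrow> p \<in> box_fun {1..n} (- R) R \<longrightarrow>
    (\<Sum>i=1..n. \<bar>G m p i\<bar> + \<bar>F m p i\<bar> + \<bar>char_rhs s m p i\<bar>) \<le> C" (is "\<exists>C\<ge>0. ?Q C")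
proof -
  define K where "K = {0..T} \<times> M2S n \<times> (box_fun {1..n} (- R) R :: (nat \<Rightarrow> real) set)"
  have K: "compact K" unfolding K_def by (intro compact_Times compact_Icc compact_M2S compact_box_fun)
  have cs: "continuous_on K (\<lambda>z. fst z)" "continuous_on K (\<lambda>z. fst (snd z))" "continuous_on K (\<lambda>z. snd (snd z))"
    by (intro continuous_on_fst continuous_on_snd continuous_on_id)+
  have cG: "continuous_on K (\<lambda>z. G (fst (snd z)) (snd (snd z)) i)" if "i \<in> {1..n}" for i
    by (intro cont_G cs continuous_on_coord[OF cs(3)] that) (auto simp: K_def)
  have cF: "continuous_on K (\<lambda>z. F (fst (snd z)) (snd (snd z)) i)" for i
    by (intro cont_F continuous_on_coord[OF cs(2)] continuous_on_coord[OF cs(3)])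
  have cD: "continuous_on K (\<lambda>z. char_rhs (fst z) (fst (snd z)) (snd (snd z)) i)" for i
    unfolding char_rhs_def
    by (intro continuous_on_diff continuous_on_coord[OF cs(3)] cont_As W_cont_compose cont_A cs)
      (auto simp: K_def A_M2S)
  let ?b = "\<lambda>z. \<Sum>i=1..n. \<bar>G (fst (snd z)) (snd (snd z)) i\<bar> + \<bar>F (fst (snd z)) (snd (snd z)) i\<bar>
      + \<bar>char_rhs (fst z) (fst (snd z)) (snd (snd z)) i\<bar>"
  have "continuous_on K ?b"
    by (intro continuous_on_sum continuous_on_add continuous_on_rabs cG cF cD) auto
  from real_has_max_bound[OF K this] obtain C where C: "C \<ge> 0" "\<forall>z\<in>K. \<bar>?b z\<bar> \<le> C" by blast
  have "?Q C"
  proof (intro allI impI)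
    fix s m p assume "s \<in> {0..T}" "m \<in> M2S n" "p \<in> box_fun {1..n} (- R) R"
    then show "(\<Sum>i=1..n. \<bar>G m p i\<bar> + \<bar>F m p i\<bar> + \<bar>char_rhs s m p i\<bar>) \<le> C"
      using C(2)[rule_format, of "(s, m, p)"] by (auto simp: K_def)
  qed
  with C(1) show "\<exists>C\<ge>0. ?Q C" by blast
  let ?a = "\<lambda>z. \<Sum>i=1..n. \<bar>G (fst (snd (fst z))) (snd (snd (fst z))) i - G (fst (snd (snd z))) (snd (snd (snd z))) i\<bar>
      + \<bar>F (fst (snd (fst z))) (snd (snd (fst z))) i - F (fst (snd (snd z))) (snd (snd (snd z))) i\<bar>
      + \<bar>char_rhs (fst (fst z)) (fst (snd (fst z))) (snd (snd (fst z))) i - char_rhs (fst (snd z)) (fst (snd (snd z))) (snd (snd (snd z))) i\<bar>"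
  let ?g = "\<lambda>z. \<bar>fst (fst z) - fst (snd z)\<bar> + (\<Sum>i=1..n. \<bar>fst (snd (fst z)) i - fst (snd (snd z)) i\<bar>)
      + (\<Sum>i=1..n. \<bar>snd (snd (fst z)) i - snd (snd (snd z)) i\<bar>)"
  have lift1: "continuous_on (K \<times> K) (\<lambda>z. h (fst z))" and lift2: "continuous_on (K \<times> K) (\<lambda>z. h (snd z))"
    if "continuous_on K h" for h :: "_ \<Rightarrow> real"
    by (rule continuous_on_compose2[OF that], intro continuous_on_fst continuous_on_snd continuous_on_id, force)+
  have ca: "continuous_on (K \<times> K) ?a"
    by (intro continuous_on_sum continuous_on_add continuous_on_rabs continuous_on_diff)
      (rule lift1[OF cG] lift2[OF cG] lift1[OF cF] lift2[OF cF] lift1[OF cD] lift2[OF cD]; assumption?)+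
  have cg: "continuous_on (K \<times> K) ?g"
    by (intro continuous_on_sum continuous_on_add continuous_on_rabs continuous_on_diff)
      (rule lift1[OF cs(1)] lift2[OF cs(1)] lift1[OF continuous_on_coord[OF cs(2)]] lift2[OF continuous_on_coord[OF cs(2)]]
        lift1[OF continuous_on_coord[OF cs(3)]] lift2[OF continuous_on_coord[OF cs(3)]])+
  have "\<exists>d>0. \<forall>z\<in>K\<times>K. ?g z < d \<longrightarrow> ?a z < \<eta>"
  proof (rule compact_gauge[OF compact_Times[OF K K] ca cg _ _ assms])
    fix z assume z: "z \<in> K \<times> K"
    show "0 \<le> ?g z" by (intro add_nonneg_nonneg sum_nonneg) auto
    assume g: "?g z = 0"
    obtain s m p s' m' p' where zz: "z = ((s, m, p), (s', m', p'))" by (metis surj_pair)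
    have nn: "(\<Sum>i=1..n. \<bar>m i - m' i\<bar>) \<ge> 0" "(\<Sum>i=1..n. \<bar>p i - p' i\<bar>) \<ge> 0" by (intro sum_nonneg; simp)+
    have g': "\<bar>s - s'\<bar> + (\<Sum>i=1..n. \<bar>m i - m' i\<bar>) + (\<Sum>i=1..n. \<bar>p i - p' i\<bar>) = 0" using g unfolding zz by simp
    have "s = s'" using g' nn by linarith
    moreover have "(\<Sum>i=1..n. \<bar>m i - m' i\<bar>) = 0" "(\<Sum>i=1..n. \<bar>p i - p' i\<bar>) = 0" using g' nn by linarith+
    then have e: "m i = m' i" "p i = p' i" if "i \<in> {1..n}" for i using that by (auto simp: sum_nonneg_eq_0_iff)
    have "m i = m' i" "p i = p' i" for i
      using e z unfolding zz K_def M2S_def MS_def box_fun_def by (cases "i \<in> {1..n}"; auto)+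
    then have "m = m'" "p = p'" by auto
    ultimately show "?a z \<le> 0" unfolding zz by simp
  qed
  then obtain d where d: "d > 0" "\<forall>z\<in>K\<times>K. ?g z < d \<longrightarrow> ?a z < \<eta>" by blast
  have "?P d"
  proof (intro allI impI)
    fix s m p s' m' p'
    assume "s \<in> {0..T}" "s' \<in> {0..T}" "m \<in> M2S n" "m' \<in> M2S n" "p \<in> box_fun {1..n} (- R) R" "p' \<in> box_fun {1..n} (- R) R"
      "\<bar>s - s'\<bar> + (\<Sum>i=1..n. \<bar>m i - m' i\<bar>) + (\<Sum>i=1..n. \<bar>p i - p' i\<bar>) < d"
    then show "(\<Sum>i=1..n. \<bar>G m p i - G m' p' i\<bar> + \<bar>F m p i - F m' p' i\<bar> + \<bar>char_rhs s m p i - char_rhs s' m' p' i\<bar>) < \<eta>"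
      using d(2)[rule_format, of "((s, m, p), (s', m', p'))"] unfolding K_def by simp
  qed
  with d(1) show "\<exists>d>0. ?P d" by blast
qed

definition char_scheme ::
  "real \<Rightarrow> real \<Rightarrow> nat \<Rightarrow> real \<Rightarrow> (nat \<Rightarrow> real) \<Rightarrow> (nat \<Rightarrow> nat \<Rightarrow> real) \<Rightarrow> (nat \<Rightarrow> nat \<Rightarrow> real) \<Rightarrow> bool" where
  "char_scheme R0 t0 N \<tau> m0 m u \<longleftrightarrow> t0 \<in> {0..<T} \<and> N \<ge> 1 \<and> \<tau> = (T - t0) / real N \<and> m 0 = m0
      \<and> (\<forall>k<N. m (Suc k) = fp_step \<tau> (m k) (u (Suc k)))
      \<and> (\<forall>k\<le>N. m k \<in> PS n)
      \<and> (\<forall>k<N. \<forall>i\<in>{1..n}. u k i = char_val (t0 + real k * \<tau>) \<tau> (m k) (u (Suc k)) i)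
      \<and> (\<forall>i\<in>{1..n}. u N i = gn (m N) i)
      \<and> (\<forall>k\<le>N. u k \<in> box_fun {1..n} (- R0) R0)"

lemma char_schemeD:
  assumes "char_scheme R0 t0 N \<tau> m0 m u"
  shows "t0 \<in> {0..<T}" "N \<ge> 1" "\<tau> = (T - t0) / real N" "m 0 = m0" "\<tau> > 0" "real N * \<tau> = T - t0"
    and "k < N \<Longrightarrow> m (Suc k) = fp_step \<tau> (m k) (u (Suc k))"
    and "k \<le> N \<Longrightarrow> m k \<in> PS n"
    and "k < N \<Longrightarrow> i \<in> {1..n} \<Longrightarrow> u k i = char_val (t0 + real k * \<tau>) \<tau> (m k) (u (Suc k)) i"
    and "i \<in> {1..n} \<Longrightarrow> u N i = gn (m N) i"
    and "k \<le> N \<Longrightarrow> u k \<in> box_fun {1..n} (- R0) R0"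
    and "k \<le> N \<Longrightarrow> t0 + real k * \<tau> \<in> {0..T}"
proof -
  note S = assms[unfolded char_scheme_def]
  show a: "t0 \<in> {0..<T}" "N \<ge> 1" "\<tau> = (T - t0) / real N" "m 0 = m0" using S by blast+
  show "k < N \<Longrightarrow> m (Suc k) = fp_step \<tau> (m k) (u (Suc k))" "k \<le> N \<Longrightarrow> m k \<in> PS n"
    "k < N \<Longrightarrow> i \<in> {1..n} \<Longrightarrow> u k i = char_val (t0 + real k * \<tau>) \<tau> (m k) (u (Suc k)) i"
    "i \<in> {1..n} \<Longrightarrow> u N i = gn (m N) i" "k \<le> N \<Longrightarrow> u k \<in> box_fun {1..n} (- R0) R0"
    using S by blast+
  show \<tau>: "\<tau> > 0" "real N * \<tau> = T - t0" using a by auto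
  show "t0 + real k * \<tau> \<in> {0..T}" if "k \<le> N"
  proof -
    have "real k * \<tau> \<le> real N * \<tau>" using that \<tau> by (intro mult_right_mono) auto
    moreover have "real k * \<tau> \<ge> 0" using \<tau> by simp
    ultimately show ?thesis using \<tau>(2) a(1) by auto
  qed
qed

lemma box_fun_convex:
  assumes "x \<in> box_fun I a b" "y \<in> box_fun I a b" "0 \<le> \<theta>" "\<theta> \<le> 1"
  shows "(\<lambda>i. x i + \<theta> * (y i - x i)) \<in> box_fun I a b"
proof -
  have "a \<le> x i + \<theta> * (y i - x i) \<and> x i + \<theta> * (y i - x i) \<le> b" if "i \<in> I" for i
  proof -
    have "a \<le> x i" "x i \<le> b" "a \<le> y i" "y i \<le> b" using assms that by (auto simp: box_fun_def)
    then have "(1 - \<theta>) * a + \<theta> * a \<le> (1 - \<theta>) * x i + \<theta> * y i" "(1 - \<theta>) * x i + \<theta> * y i \<le> (1 - \<theta>) * b + \<theta> * b"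
      using assms by (intro add_mono mult_left_mono; simp)+
    then show ?thesis by (simp add: algebra_simps)
  qed
  moreover have "x i + \<theta> * (y i - x i) = 0" if "i \<notin> I" for i using assms that by (auto simp: box_fun_def)
  ultimately show ?thesis unfolding box_fun_def by blast
qed

lemma PS_convex:
  assumes "x \<in> PS n" "y \<in> PS n" "0 \<le> \<theta>" "\<theta> \<le> 1"
  shows "(\<lambda>i. x i + \<theta> * (y i - x i)) \<in> PS n"
proof -
  have "x i + \<theta> * (y i - x i) \<ge> 0" for i
  proof -
    have "x i \<ge> 0" "y i \<ge> 0" using assms M2S_nonneg PS_M2S by blast+
    then have "(1 - \<theta>) * x i + \<theta> * y i \<ge> 0" using assms by simp
    then show ?thesis by (simp add: algebra_simps)
  qed
  moreover have "x i + \<theta> * (y i - x i) = 0" if "i \<notin> {1..n}" for i using assms that by (auto simp: PS_def MS_def)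
  moreover have "(\<Sum>i=1..n. x i + \<theta> * (y i - x i)) = 1"
    using assms by (simp add: PS_def sum.distrib sum_distrib_left[symmetric] sum_subtractf)
  ultimately show ?thesis unfolding PS_def MS_def by blast
qed

lemma PS_diff_abs_le:
  assumes "m \<in> PS n" "m' \<in> PS n" shows "(\<Sum>i=1..n. \<bar>m i - m' i\<bar>) \<le> 2"
proof -
  have "(\<Sum>i=1..n. \<bar>m i - m' i\<bar>) \<le> (\<Sum>i=1..n. m i + m' i)"
    using M2S_nonneg[OF PS_M2S[OF assms(1)]] M2S_nonneg[OF PS_M2S[OF assms(2)]]
    by (intro sum_mono) (simp add: abs_le_iff add_increasing)
  then show ?thesis using assms by (simp add: sum.distrib PS_def)
qed

text \<open>On the graph of a single curve a minimum can be tested only along the curve. There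
  \<open>m\<close> moves by \<open>- F\<close> and \<open>u\<close> by minus the right-hand side of
  the backward equation, up to discretisation, and the one-sided derivative of the pairing in
  forward time is exactly the required inequality.\<close>

lemma curve_test_property:
  assumes \<eta>: "\<eta> > 0" and R: "R \<ge> R0"
  shows "\<exists>\<tau>1>0. \<forall>t0 N \<tau> m0 m u. char_scheme R0 t0 N \<tau> m0 m u \<longrightarrow> \<tau> \<le> \<tau>1 \<longrightarrow>
    test_property ((\<lambda>s. (s, \<lambda>i. pl_path t0 \<tau> N (\<lambda>k. m k i) s)) ` {t0..T})
      (\<lambda>s _ i. pl_path t0 \<tau> N (\<lambda>k. u k i) s) (\<lambda>s m. W s (A m)) \<eta> R"
proof -
  \<comment> \<open>Collects the weights with which a coefficient error enters: 4 for
    \<open>G\<close>, paired with a difference of measures; \<open>2 * \<bar>R\<bar>\<close> for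
    \<open>F\<close>, paired with \<open>uc s - a\<close>; \<open>4 * lam\<close> for the jump part.
    The bound on \<open>a\<close> in \<open>test_property\<close> is what controls the second
    one.\<close>
  define Q where "Q = 4 + 2 * \<bar>R\<bar> + 4 * lam"
  have Q0: "Q > 0" unfolding Q_def using lam0 by (simp add: add_pos_nonneg add_nonneg_pos)
  have \<eta>Q0: "\<eta> / Q > 0" using \<eta> Q0 by simp
  from char_modulus(1)[OF this, of R0] obtain d where d: "d > 0" and dd': "\<forall>s m p s' m' p'. s \<in> {0..T} \<longrightarrow> s' \<in> {0..T} \<longrightarrow> m \<in> M2S n \<longrightarrow> m' \<in> M2S n \<longrightarrow>
    p \<in> box_fun {1..n} (- R0) R0 \<longrightarrow> p' \<in> box_fun {1..n} (- R0) R0 \<longrightarrow>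
    \<bar>s - s'\<bar> + (\<Sum>i=1..n. \<bar>m i - m' i\<bar>) + (\<Sum>i=1..n. \<bar>p i - p' i\<bar>) < d \<longrightarrow>
    (\<Sum>i=1..n. \<bar>G m p i - G m' p' i\<bar> + \<bar>F m p i - F m' p' i\<bar> + \<bar>char_rhs s m p i - char_rhs s' m' p' i\<bar>) < \<eta> / Q"
    by (elim exE conjE)
  note dd = dd'[rule_format]
  from char_modulus(2)[OF \<eta>, of R0] obtain C where C: "C \<ge> 0" and CC': "\<forall>s m p. s \<in> {0..T} \<longrightarrow> m \<in> M2S n \<longrightarrow> p \<in> box_fun {1..n} (- R0) R0 \<longrightarrow>
    (\<Sum>i=1..n. \<bar>G m p i\<bar> + \<bar>F m p i\<bar> + \<bar>char_rhs s m p i\<bar>) \<le> C"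
    by (elim exE conjE)
  note CC = CC'[rule_format]
  \<comment> \<open>Within one step, time, measure and value together move by at most
    \<open>\<tau> * C'\<close>.\<close>
  define C' where "C' = 1 + C + (C + lam * C)"
  have C': "C' > 0" unfolding C'_def using C mult_nonneg_nonneg[of lam C] lam0 by linarith
  define \<tau>1 where "\<tau>1 = d / (2 * C')"
  have \<tau>10: "\<tau>1 > 0" unfolding \<tau>1_def using d C' by simp
  show ?thesis
  proof (intro exI[of _ \<tau>1] conjI \<tau>10 allI impI)
    fix t0 N \<tau> m0 m u
    assume sch: "char_scheme R0 t0 N \<tau> m0 m u" and \<tau>: "\<tau> \<le> \<tau>1"
    note S = char_schemeD[OF sch]
    have t0: "0 \<le> t0" "t0 < T" and N: "N \<ge> 1" using S(1,2) by auto
    note \<tau>p = S(5) and N\<tau> = S(6)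
    define mc where "mc = (\<lambda>s i. pl_path t0 \<tau> N (\<lambda>k. m k i) s)"
    define uc where "uc = (\<lambda>s i. pl_path t0 \<tau> N (\<lambda>k. u k i) s)"
    define D where "D = (\<lambda>s. (s, mc s)) ` {t0..T}"
    have "test_property D (\<lambda>s _. uc s) (\<lambda>s m. W s (A m)) \<eta> R"
      unfolding test_property_def
    proof (intro ballI allI impI)
      fix \<mu> a \<psi> \<psi>' s x
      assume \<mu>: "\<mu> \<in> M2S n" and a: "\<forall>i\<in>{1..n}. \<bar>a i\<bar> \<le> R"
        and \<psi>: "\<forall>t\<in>{0..T}. (\<psi> has_real_derivative \<psi>' t) (at t within {0..T})"
        and sx: "(s, x) \<in> D" "s < T"
        and min: "strict_min_on (\<lambda>(t, m). pairing n (\<lambda>i. uc t i - a i) (\<lambda>i. m i - \<mu> i) - \<psi> t) D (s, x)"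
      have x: "x = mc s" and s: "t0 \<le> s" "s \<le> T" using sx unfolding D_def by auto
      obtain k \<theta> where k: "k < N" "0 \<le> \<theta>" "\<theta> < 1" "s = t0 + (real k + \<theta>) * \<tau>"
        using grid_decomposition[OF \<tau>p N\<tau> s(1) sx(2)] .
      define \<Delta>m where "\<Delta>m = (\<lambda>i. m (Suc k) i - m k i)"
      define \<Delta>u where "\<Delta>u = (\<lambda>i. u (Suc k) i - u k i)"
      define tk where "tk = t0 + real k * \<tau>"
      have path: "mc (s + h * \<tau>) = (\<lambda>i. m k i + (\<theta> + h) * \<Delta>m i)" "uc (s + h * \<tau>) = (\<lambda>i. u k i + (\<theta> + h) * \<Delta>u i)"
        if "0 \<le> h" "\<theta> + h \<le> 1" for h
      proof -
        have "s + h * \<tau> = t0 + (real k + (\<theta> + h)) * \<tau>" unfolding k(4) by (simp add: algebra_simps)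
        then show "mc (s + h * \<tau>) = (\<lambda>i. m k i + (\<theta> + h) * \<Delta>m i)" "uc (s + h * \<tau>) = (\<lambda>i. u k i + (\<theta> + h) * \<Delta>u i)"
          unfolding mc_def uc_def \<Delta>m_def \<Delta>u_def using pl_path_at[OF k(1) _ that(2) \<tau>p] that k(2) by auto
      qed
      have at_s: "mc s = (\<lambda>i. m k i + \<theta> * \<Delta>m i)" "uc s = (\<lambda>i. u k i + \<theta> * \<Delta>u i)"
        using path[of 0] k by auto
      have mk: "m k \<in> PS n" "m (Suc k) \<in> PS n" and uk: "u k \<in> box_fun {1..n} (- R0) R0" "u (Suc k) \<in> box_fun {1..n} (- R0) R0"
        using S(8)[of k] S(8)[of "Suc k"] S(11)[of k] S(11)[of "Suc k"] k(1) by simp_all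
      have mcs: "mc s \<in> PS n" unfolding at_s \<Delta>m_def using k by (intro PS_convex mk) auto
      have ucs: "uc s \<in> box_fun {1..n} (- R0) R0" unfolding at_s \<Delta>u_def using k by (intro box_fun_convex uk) auto
      have "real k * \<tau> \<le> real N * \<tau>" using k \<tau>p by (intro mult_right_mono) auto
      then have tk: "tk \<in> {0..T}" unfolding tk_def using N\<tau> t0 \<tau>p by auto
      have sT: "s \<in> {0..T}" using s t0 by auto
      have \<Delta>m_eq: "\<Delta>m i = - (\<tau> * F (m k) (u (Suc k)) i)" for i
        unfolding \<Delta>m_def S(7)[OF k(1)] fp_step_def by simp
      have \<Delta>u_eq: "\<Delta>u i = - (\<tau> * (G (m k) (u (Suc k)) i - lam * char_rhs tk (m k) (u (Suc k)) i))" if "i \<in> {1..n}" for i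
        unfolding \<Delta>u_def tk_def S(9)[OF k(1) that] by (simp add: char_val_def char_rhs_def)
      note bd = CC[OF tk PS_M2S[OF mk(1)] uk(2)]
      have bF: "(\<Sum>i=1..n. \<bar>F (m k) (u (Suc k)) i\<bar>) \<le> C"
        by (rule order.trans[OF sum_mono bd]) simp
      have bU: "(\<Sum>i=1..n. \<bar>G (m k) (u (Suc k)) i - lam * char_rhs tk (m k) (u (Suc k)) i\<bar>) \<le> C + lam * C"
      proof -
        have "(\<Sum>i=1..n. \<bar>G (m k) (u (Suc k)) i - lam * char_rhs tk (m k) (u (Suc k)) i\<bar>)
          \<le> (\<Sum>i=1..n. \<bar>G (m k) (u (Suc k)) i\<bar> + lam * \<bar>char_rhs tk (m k) (u (Suc k)) i\<bar>)"
          using lam0 by (intro sum_mono order.trans[OF abs_triangle_ineq4]) (simp add: abs_mult)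
        also have "\<dots> = (\<Sum>i=1..n. \<bar>G (m k) (u (Suc k)) i\<bar>) + lam * (\<Sum>i=1..n. \<bar>char_rhs tk (m k) (u (Suc k)) i\<bar>)"
          by (simp add: sum.distrib sum_distrib_left)
        also have "\<dots> \<le> C + lam * C"
        proof (intro add_mono mult_left_mono)
          show "(\<Sum>i=1..n. \<bar>G (m k) (u (Suc k)) i\<bar>) \<le> C" by (rule order.trans[OF sum_mono bd]) simp
          show "(\<Sum>i=1..n. \<bar>char_rhs tk (m k) (u (Suc k)) i\<bar>) \<le> C" by (rule order.trans[OF sum_mono bd]) simp
        qed (use lam0 in simp)
        finally show ?thesis .
      qed
      \<comment> \<open>The scheme takes its coefficients at \<open>(tk, m k, u (Suc k))\<close>,
        the test inequality needs them at \<open>s\<close>. Both lie in the same time step.\<close>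
      have near: "(\<Sum>i=1..n. \<bar>G (m k) (u (Suc k)) i - G (mc s) (uc s) i\<bar> + \<bar>F (m k) (u (Suc k)) i - F (mc s) (uc s) i\<bar>
          + \<bar>char_rhs tk (m k) (u (Suc k)) i - char_rhs s (mc s) (uc s) i\<bar>) < \<eta> / Q"
      proof (rule dd[OF tk sT PS_M2S[OF mk(1)] PS_M2S[OF mcs] uk(2) ucs])
        have "\<bar>tk - s\<bar> = \<theta> * \<tau>" unfolding tk_def k(4) using k \<tau>p by (simp add: algebra_simps)
        also have "\<dots> \<le> 1 * \<tau>" using k \<tau>p by (intro mult_right_mono) auto
        finally have 1: "\<bar>tk - s\<bar> \<le> \<tau>" by simp
        have "(\<Sum>i=1..n. \<bar>m k i - mc s i\<bar>) = (\<Sum>i=1..n. \<theta> * \<tau> * \<bar>F (m k) (u (Suc k)) i\<bar>)"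
          unfolding at_s \<Delta>m_eq using k \<tau>p by (intro sum.cong) (auto simp: abs_mult)
        also have "\<dots> = \<theta> * \<tau> * (\<Sum>i=1..n. \<bar>F (m k) (u (Suc k)) i\<bar>)" by (simp add: sum_distrib_left)
        also have "\<dots> \<le> 1 * \<tau> * C" using k \<tau>p bF by (intro mult_mono mult_nonneg_nonneg sum_nonneg) auto
        finally have 2: "(\<Sum>i=1..n. \<bar>m k i - mc s i\<bar>) \<le> \<tau> * C" by simp
        have "(\<Sum>i=1..n. \<bar>u (Suc k) i - uc s i\<bar>)
          = (\<Sum>i=1..n. (1 - \<theta>) * \<tau> * \<bar>G (m k) (u (Suc k)) i - lam * char_rhs tk (m k) (u (Suc k)) i\<bar>)"
        proof (intro sum.cong refl)
          fix i assume i: "i \<in> {1..n}"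
          have "u (Suc k) i - uc s i = (1 - \<theta>) * \<Delta>u i" unfolding at_s \<Delta>u_def by (simp add: algebra_simps)
          then show "\<bar>u (Suc k) i - uc s i\<bar> = (1 - \<theta>) * \<tau> * \<bar>G (m k) (u (Suc k)) i - lam * char_rhs tk (m k) (u (Suc k)) i\<bar>"
            unfolding \<Delta>u_eq[OF i] using k \<tau>p by (simp add: abs_mult)
        qed
        also have "\<dots> = (1 - \<theta>) * \<tau> * (\<Sum>i=1..n. \<bar>G (m k) (u (Suc k)) i - lam * char_rhs tk (m k) (u (Suc k)) i\<bar>)"
          by (simp add: sum_distrib_left)
        also have "\<dots> \<le> 1 * \<tau> * (C + lam * C)" using k \<tau>p bU by (intro mult_mono mult_nonneg_nonneg sum_nonneg) auto
        finally have 3: "(\<Sum>i=1..n. \<bar>u (Suc k) i - uc s i\<bar>) \<le> \<tau> * (C + lam * C)" by simp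
        have "\<tau> * C' \<le> d / 2" using mult_right_mono[OF \<tau>, of C'] C' unfolding \<tau>1_def by simp
        then show "\<bar>tk - s\<bar> + (\<Sum>i=1..n. \<bar>m k i - mc s i\<bar>) + (\<Sum>i=1..n. \<bar>u (Suc k) i - uc s i\<bar>) < d"
          using 1 2 3 d unfolding C'_def by (simp add: algebra_simps)
      qed
      define P where "P = pairing n \<Delta>u (\<lambda>i. mc s i - \<mu> i) + pairing n (\<lambda>i. uc s i - a i) \<Delta>m"
      define P2 where "P2 = pairing n \<Delta>u \<Delta>m"
      \<comment> \<open>Along a linear piece the pairing is quadratic in \<open>h\<close>, with
        first-order coefficient \<open>P\<close>. Comparing with later points of the curve bounds
        the right difference quotient of \<open>\<psi>\<close>.\<close>
      have ineq: "(\<psi> (s + h * \<tau>) - \<psi> s) / (h * \<tau>) \<le> (P + h * P2) / \<tau>" if h: "0 < h" "h < 1 - \<theta>" for h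
      proof -
        have "\<theta> + h \<le> 1" using h by simp
        have "(real k + (\<theta> + h)) * \<tau> \<le> real N * \<tau>"
        proof (rule mult_right_mono)
          have "real k + 1 \<le> real N" using k(1) by simp
          then show "real k + (\<theta> + h) \<le> real N" using h by linarith
        qed (use \<tau>p in simp)
        then have "s + h * \<tau> \<le> T" unfolding k(4) using N\<tau> by (simp add: algebra_simps)
        moreover have "t0 \<le> s + h * \<tau>" using s(1) h \<tau>p by (simp add: add_increasing2)
        ultimately have "s + h * \<tau> \<in> {t0..T}" by simp
        then have "(s + h * \<tau>, mc (s + h * \<tau>)) \<in> D" unfolding D_def by (rule imageI)
        moreover have "(s + h * \<tau>, mc (s + h * \<tau>)) \<noteq> (s, x)" using h \<tau>p by simp
        ultimately have "pairing n (\<lambda>i. uc s i - a i) (\<lambda>i. mc s i - \<mu> i) - \<psi> s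
          < pairing n (\<lambda>i. uc (s + h * \<tau>) i - a i) (\<lambda>i. mc (s + h * \<tau>) i - \<mu> i) - \<psi> (s + h * \<tau>)"
          using min unfolding strict_min_on_def x by (auto dest: bspec[of D])
        also have "pairing n (\<lambda>i. uc (s + h * \<tau>) i - a i) (\<lambda>i. mc (s + h * \<tau>) i - \<mu> i)
          = pairing n (\<lambda>i. uc s i - a i) (\<lambda>i. mc s i - \<mu> i) + h * P + h * h * P2"
          unfolding path[OF less_imp_le[OF h(1)] \<open>\<theta> + h \<le> 1\<close>] at_s P_def P2_def
          unfolding pairing_def sum_distrib_left sum.distrib[symmetric]
          by (intro sum.cong) (auto simp: algebra_simps)
        finally have "\<psi> (s + h * \<tau>) - \<psi> s \<le> h * (P + h * P2)" by (simp add: algebra_simps)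
        then have "(\<psi> (s + h * \<tau>) - \<psi> s) / (h * \<tau>) \<le> h * (P + h * P2) / (h * \<tau>)"
          using h \<tau>p by (intro divide_right_mono) auto
        then show ?thesis using h by simp
      qed
      have "\<psi>' s \<le> P / \<tau>"
      proof (rule tendsto_le[where F="at_right 0"])
        have "(\<psi> has_real_derivative \<psi>' s) (at s within {0..T})" using \<psi> sT by blast
        then have dl: "((\<lambda>y. (\<psi> y - \<psi> s) / (y - s)) \<longlongrightarrow> \<psi>' s) (at s within {0..T})"
          by (simp add: has_field_derivative_iff)
        have "filterlim (\<lambda>h. s + h * \<tau>) (at s within {0..T}) (at_right 0)"
          unfolding filterlim_at
        proof
          have "((\<lambda>h. s + h * \<tau>) \<longlongrightarrow> s + 0 * \<tau>) (at_right 0)" by (intro tendsto_intros)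
          then show "((\<lambda>h. s + h * \<tau>) \<longlongrightarrow> s) (at_right 0)" by simp
          have "\<forall>\<^sub>F h in at_right 0. h < (T - s) / \<tau>"
            using sx(2) \<tau>p by (intro order_tendstoD(2)[OF tendsto_ident_at]) auto
          moreover have "\<forall>\<^sub>F h in at_right (0::real). h > 0" by (simp add: eventually_at_right_less)
          ultimately show "\<forall>\<^sub>F h in at_right 0. s + h * \<tau> \<in> {0..T} \<and> s + h * \<tau> \<noteq> s"
          proof eventually_elim
            case (elim h)
            then have "h * \<tau> < T - s" using \<tau>p by (simp add: field_simps)
            then show ?case using elim \<tau>p sT by auto
          qed
        qed
        from filterlim_compose[OF dl this]
        show "((\<lambda>h. (\<psi> (s + h * \<tau>) - \<psi> s) / (h * \<tau>)) \<longlongrightarrow> \<psi>' s) (at_right 0)" by simp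
        have "((\<lambda>h. (P + h * P2) / \<tau>) \<longlongrightarrow> (P + 0 * P2) / \<tau>) (at_right 0)" using \<tau>p by (intro tendsto_intros) auto
        then show "((\<lambda>h. (P + h * P2) / \<tau>) \<longlongrightarrow> P / \<tau>) (at_right 0)" by simp
        have "\<forall>\<^sub>F h in at_right 0. h < 1 - \<theta>"
          using k by (intro order_tendstoD(2)[OF tendsto_ident_at]) auto
        moreover have "\<forall>\<^sub>F h in at_right (0::real). h > 0" by (simp add: eventually_at_right_less)
        ultimately show "\<forall>\<^sub>F h in at_right 0. (\<psi> (s + h * \<tau>) - \<psi> s) / (h * \<tau>) \<le> (P + h * P2) / \<tau>"
          by eventually_elim (use ineq in auto)
      qed simp
      moreover have "P / \<tau> = - pairing n (\<lambda>i. G (m k) (u (Suc k)) i - lam * char_rhs tk (m k) (u (Suc k)) i) (\<lambda>i. mc s i - \<mu> i)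
          - pairing n (F (m k) (u (Suc k))) (\<lambda>i. uc s i - a i)"
      proof -
        have "pairing n \<Delta>u (\<lambda>i. mc s i - \<mu> i) = pairing n (\<lambda>i. - (\<tau> * (G (m k) (u (Suc k)) i - lam * char_rhs tk (m k) (u (Suc k)) i))) (\<lambda>i. mc s i - \<mu> i)"
          by (intro pairing_cong) (auto simp: \<Delta>u_eq)
        moreover have "pairing n (\<lambda>i. uc s i - a i) \<Delta>m = pairing n (\<lambda>i. - (\<tau> * F (m k) (u (Suc k)) i)) (\<lambda>i. uc s i - a i)"
          unfolding pairing_commute[of n _ \<Delta>m] by (intro pairing_cong) (auto simp: \<Delta>m_eq)
        ultimately have "P = \<tau> * (- pairing n (\<lambda>i. G (m k) (u (Suc k)) i - lam * char_rhs tk (m k) (u (Suc k)) i) (\<lambda>i. mc s i - \<mu> i)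
          - pairing n (F (m k) (u (Suc k))) (\<lambda>i. uc s i - a i))"
          unfolding P_def pairing_uminus_left pairing_scale_left by (simp add: algebra_simps)
        then show ?thesis using \<tau>p by simp
      qed
      ultimately have main: "pairing n (G (m k) (u (Suc k))) (\<lambda>i. mc s i - \<mu> i) + pairing n (F (m k) (u (Suc k))) (\<lambda>i. uc s i - a i)
        \<le> - \<psi>' s + lam * pairing n (char_rhs tk (m k) (u (Suc k))) (\<lambda>i. mc s i - \<mu> i)"
        unfolding pairing_diff_left pairing_scale_left by linarith
      have le_near: "\<bar>G (m k) (u (Suc k)) i - G (mc s) (uc s) i\<bar> + \<bar>F (m k) (u (Suc k)) i - F (mc s) (uc s) i\<bar>
          + \<bar>char_rhs tk (m k) (u (Suc k)) i - char_rhs s (mc s) (uc s) i\<bar> \<le> \<eta> / Q" if "i \<in> {1..n}" for i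
        using member_le_sum[OF that, of "\<lambda>i. \<bar>G (m k) (u (Suc k)) i - G (mc s) (uc s) i\<bar> + \<bar>F (m k) (u (Suc k)) i - F (mc s) (uc s) i\<bar>
          + \<bar>char_rhs tk (m k) (u (Suc k)) i - char_rhs s (mc s) (uc s) i\<bar>"] near by auto
      have \<mu>m: "(\<Sum>i=1..n. \<bar>mc s i - \<mu> i\<bar>) \<le> 4" by (rule M2S_diff_abs_mass[OF PS_M2S[OF mcs] \<mu>])
      have \<eta>Q: "\<eta> / Q \<ge> 0" using \<eta> Q0 by simp
      have e1: "\<bar>pairing n (\<lambda>i. G (mc s) (uc s) i - G (m k) (u (Suc k)) i) (\<lambda>i. mc s i - \<mu> i)\<bar> \<le> \<eta> / Q * 4"
      proof (rule abs_pairing_le[OF _ \<mu>m \<eta>Q])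
        fix i assume "i \<in> {1..n}" from le_near[OF this] show "\<bar>G (mc s) (uc s) i - G (m k) (u (Suc k)) i\<bar> \<le> \<eta> / Q" by linarith
      qed
      have e2: "\<bar>pairing n (\<lambda>i. char_rhs tk (m k) (u (Suc k)) i - char_rhs s (mc s) (uc s) i) (\<lambda>i. mc s i - \<mu> i)\<bar> \<le> \<eta> / Q * 4"
      proof (rule abs_pairing_le[OF _ \<mu>m \<eta>Q])
        fix i assume "i \<in> {1..n}" from le_near[OF this] show "\<bar>char_rhs tk (m k) (u (Suc k)) i - char_rhs s (mc s) (uc s) i\<bar> \<le> \<eta> / Q" by linarith
      qed
      have e3: "\<bar>pairing n (\<lambda>i. uc s i - a i) (\<lambda>i. F (mc s) (uc s) i - F (m k) (u (Suc k)) i)\<bar> \<le> 2 * \<bar>R\<bar> * (\<eta> / Q)"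
      proof (rule abs_pairing_le)
        show "(\<Sum>i=1..n. \<bar>F (mc s) (uc s) i - F (m k) (u (Suc k)) i\<bar>) \<le> \<eta> / Q"
          by (rule order.trans[OF sum_mono less_imp_le[OF near]]) (simp add: abs_minus_commute)
        fix i assume i: "i \<in> {1..n}"
        have "\<bar>uc s i\<bar> \<le> R" using box_fun_abs[OF ucs i] R by linarith
        then show "\<bar>uc s i - a i\<bar> \<le> 2 * \<bar>R\<bar>" using a[rule_format, OF i] by linarith
      qed simp
      have lam_e2: "lam * pairing n (\<lambda>i. char_rhs tk (m k) (u (Suc k)) i - char_rhs s (mc s) (uc s) i) (\<lambda>i. mc s i - \<mu> i) \<le> lam * (\<eta> / Q * 4)"
        using e2 lam0 by (intro mult_left_mono) (auto simp: abs_le_iff)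
      have Qe: "\<eta> / Q * 4 + 2 * \<bar>R\<bar> * (\<eta> / Q) + lam * (\<eta> / Q * 4) = \<eta>"
      proof -
        have "\<eta> / Q * 4 + 2 * \<bar>R\<bar> * (\<eta> / Q) + lam * (\<eta> / Q * 4) = \<eta> / Q * Q" unfolding Q_def by (simp only: distrib_left distrib_right ac_simps)
        then show ?thesis using Q0 by simp
      qed
      have "pairing n (G (mc s) (uc s)) (\<lambda>i. mc s i - \<mu> i) + pairing n (F (mc s) (uc s)) (\<lambda>i. uc s i - a i)
        \<le> - \<psi>' s + lam * pairing n (char_rhs s (mc s) (uc s)) (\<lambda>i. mc s i - \<mu> i) + \<eta>"
        using main e1 e3 lam_e2 Qe
        unfolding pairing_diff_left[of n "G (mc s) (uc s)"] pairing_diff_left[of n "char_rhs tk (m k) (u (Suc k))"]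
          pairing_diff_right[of n _ "F (mc s) (uc s)"] pairing_commute[of n _ "F (mc s) (uc s)"]
          pairing_commute[of n _ "F (m k) (u (Suc k))"] right_diff_distrib abs_le_iff by linarith
      then show "pairing n (G x (uc s)) (\<lambda>i. x i - \<mu> i) + pairing n (F x (uc s)) (\<lambda>i. uc s i - a i)
        \<le> - \<psi>' s + lam * pairing n (\<lambda>i. uc s i - As (W s (A x)) i) (\<lambda>i. x i - \<mu> i) + \<eta>"
        unfolding x char_rhs_def[abs_def] .
    qed
    then show "test_property ((\<lambda>s. (s, \<lambda>i. pl_path t0 \<tau> N (\<lambda>k. m k i) s)) ` {t0..T})
      (\<lambda>s _ i. pl_path t0 \<tau> N (\<lambda>k. u k i) s) (\<lambda>s m. W s (A m)) \<eta> R"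
      unfolding D_def mc_def uc_def .
  qed
qed

text \<open>\<open>W_mono\<close> compares equal times, while \<open>doubling\<close> produces two
  different ones; compactness bridges small differences.\<close>

lemma W_jump_mono:
  assumes "\<zeta> > 0"
  shows "\<exists>d>0. \<forall>t m s m'. t \<in> {0..T} \<longrightarrow> s \<in> {0..T} \<longrightarrow> m \<in> M2S n \<longrightarrow> m' \<in> M2S n \<longrightarrow> \<bar>t - s\<bar> < d \<longrightarrow>
        - \<zeta> \<le> pairing n (\<lambda>i. W t m i - W s m' i) (\<lambda>i. m i - m' i)" (is "\<exists>d>0. ?P d")
proof -
  define K where "K = ({0..T} \<times> M2S n) \<times> ({0..T} \<times> M2S n)"
  have K: "compact K" unfolding K_def by (intro compact_Times compact_Icc compact_M2S)
  have c: "continuous_on K (\<lambda>z. fst (fst z))" "continuous_on K (\<lambda>z. fst (snd z))"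
    "continuous_on K (\<lambda>z. snd (fst z))" "continuous_on K (\<lambda>z. snd (snd z))"
    by (intro continuous_on_fst continuous_on_snd continuous_on_id)+
  have "\<exists>d>0. \<forall>z\<in>K. \<bar>fst (fst z) - fst (snd z)\<bar> < d \<longrightarrow>
     - pairing n (\<lambda>i. W (fst (fst z)) (snd (fst z)) i - W (fst (snd z)) (snd (snd z)) i) (\<lambda>i. snd (fst z) i - snd (snd z) i) < \<zeta>"
  proof (rule compact_gauge[OF K _ _ _ _ assms])
    show "continuous_on K (\<lambda>z. - pairing n (\<lambda>i. W (fst (fst z)) (snd (fst z)) i - W (fst (snd z)) (snd (snd z)) i) (\<lambda>i. snd (fst z) i - snd (snd z) i))"
      unfolding pairing_def
      by (intro continuous_on_minus continuous_on_sum continuous_on_mult continuous_on_diff W_cont_compose c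
          continuous_on_coord[OF c(3)] continuous_on_coord[OF c(4)]) (auto simp: K_def)
    show "continuous_on K (\<lambda>z. \<bar>fst (fst z) - fst (snd z)\<bar>)"
      by (intro continuous_on_rabs continuous_on_diff c)
    fix z assume "z \<in> K" "\<bar>fst (fst z) - fst (snd z)\<bar> = 0"
    then have e: "fst (snd z) = fst (fst z)" "fst (fst z) \<in> {0..T}" "snd (fst z) \<in> M2S n" "snd (snd z) \<in> M2S n"
      by (auto simp: K_def)
    show "- pairing n (\<lambda>i. W (fst (fst z)) (snd (fst z)) i - W (fst (snd z)) (snd (snd z)) i) (\<lambda>i. snd (fst z) i - snd (snd z) i) \<le> 0"
      unfolding e(1) using W_mono[OF e(2-4)] by simp
  qed simp
  then obtain d where d: "d > 0" "\<forall>z\<in>K. \<bar>fst (fst z) - fst (snd z)\<bar> < d \<longrightarrow>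
     - pairing n (\<lambda>i. W (fst (fst z)) (snd (fst z)) i - W (fst (snd z)) (snd (snd z)) i) (\<lambda>i. snd (fst z) i - snd (snd z) i) < \<zeta>"
    by blast
  have "?P d"
  proof (intro allI impI)
    fix t m s m' assume "t \<in> {0..T}" "s \<in> {0..T}" "m \<in> M2S n" "m' \<in> M2S n" "\<bar>t - s\<bar> < d"
    then show "- \<zeta> \<le> pairing n (\<lambda>i. W t m i - W s m' i) (\<lambda>i. m i - m' i)"
      using d(2)[rule_format, of "((t, m), (s, m'))"] by (simp add: K_def)
  qed
  with d(1) show ?thesis by blast
qed

text \<open>\<open>doubling\<close> of \<open>W\<close> with the curve. The graph of a curve is not
  invariant under \<open>A\<close>, so the first alternative for the jump is used: both sides jump
  to values of \<open>W\<close>, whose pairing is almost nonnegative by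
  \<open>W_jump_mono\<close>.\<close>

lemma curve_comparison:
  assumes \<eta>: "\<eta> > 0"
  shows "\<exists>\<tau>1>0. \<forall>t0 N \<tau> m0 m u. char_scheme R0 t0 N \<tau> m0 m u \<longrightarrow> \<tau> \<le> \<tau>1 \<longrightarrow>
    (\<forall>x\<in>M2S n. - (\<eta> * T) \<le> pairing n (\<lambda>i. W t0 x i - u 0 i) (\<lambda>i. x i - m0 i))"
proof -
  obtain CW where CW: "CW \<ge> 0" "\<And>i t m. i \<in> {1..n} \<Longrightarrow> t \<in> {0..T} \<Longrightarrow> m \<in> M2S n \<Longrightarrow> \<bar>W t m i\<bar> \<le> CW"
    using W_bound by fastforce
  define R where "R = max CW R0 + 4"
  have R: "R \<ge> R0" "R \<ge> CW + 4" "R \<ge> R0 + 4" unfolding R_def by auto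
  from curve_test_property[OF \<eta> R(1)] obtain \<tau>1 where \<tau>1: "\<tau>1 > 0" and tp: "\<forall>t0 N \<tau> m0 m u. char_scheme R0 t0 N \<tau> m0 m u \<longrightarrow> \<tau> \<le> \<tau>1 \<longrightarrow>
    test_property ((\<lambda>s. (s, \<lambda>i. pl_path t0 \<tau> N (\<lambda>k. m k i) s)) ` {t0..T})
      (\<lambda>s _ i. pl_path t0 \<tau> N (\<lambda>k. u k i) s) (\<lambda>s m. W s (A m)) \<eta> R" by (elim exE conjE)
  show ?thesis
  proof (intro exI[of _ \<tau>1] conjI \<tau>1 allI impI ballI)
    fix t0 N \<tau> m0 m u x
    assume sch: "char_scheme R0 t0 N \<tau> m0 m u" and \<tau>: "\<tau> \<le> \<tau>1" and x: "x \<in> M2S n"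
    note S = char_schemeD[OF sch]
    define mc where "mc = (\<lambda>s i. pl_path t0 \<tau> N (\<lambda>k. m k i) s)"
    define uc where "uc = (\<lambda>s i. pl_path t0 \<tau> N (\<lambda>k. u k i) s)"
    define D where "D = (\<lambda>s. (s, mc s)) ` {t0..T}"
    have tpD: "test_property D (\<lambda>s _. uc s) (\<lambda>s m. W s (A m)) \<eta> R"
      using tp[rule_format, OF sch \<tau>] unfolding D_def mc_def uc_def .
    have t0: "0 \<le> t0" "t0 < T" and N: "N \<ge> 1" using S(1,2) by auto
    have path: "mc s \<in> PS n \<and> uc s \<in> box_fun {1..n} (- R0) R0" if s: "s \<in> {t0..T}" for s
    proof -
      have "\<exists>k \<theta>. k < N \<and> 0 \<le> \<theta> \<and> \<theta> \<le> 1 \<and> s = t0 + (real k + \<theta>) * \<tau>"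
      proof (cases "s = T")
        case True
        have "T = t0 + (real (N - 1) + 1) * \<tau>" using S(6) N by (simp add: of_nat_diff)
        then show ?thesis using True N by (intro exI[of _ "N - 1"] exI[of _ 1]) auto
      next
        case False
        then obtain k \<theta> where "k < N" "0 \<le> \<theta>" "\<theta> < 1" "s = t0 + (real k + \<theta>) * \<tau>"
          using grid_decomposition[OF S(5,6)] s by (metis atLeastAtMost_iff order_le_less)
        then show ?thesis using less_imp_le by blast
      qed
      then obtain k \<theta> where k: "k < N" "0 \<le> \<theta>" "\<theta> \<le> 1" "s = t0 + (real k + \<theta>) * \<tau>" by blast
      have "mc s = (\<lambda>i. m k i + \<theta> * (m (Suc k) i - m k i))" "uc s = (\<lambda>i. u k i + \<theta> * (u (Suc k) i - u k i))"
        unfolding mc_def uc_def k(4) by (intro ext pl_path_at k S(5))+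
      then show ?thesis using k S(8)[of k] S(8)[of "Suc k"] S(11)[of k] S(11)[of "Suc k"]
        by (auto intro: PS_convex box_fun_convex)
    qed
    have ends: "mc t0 = m 0" "uc t0 = u 0" "mc T = m N" "uc T = u N"
    proof -
      show "mc t0 = m 0" "uc t0 = u 0" unfolding mc_def uc_def using pl_path_at[of 0 N 0 \<tau> t0] N S(5) by auto
      have "T = t0 + (real (N - 1) + 1) * \<tau>" using S(6) N by (simp add: of_nat_diff)
      then have "pl_path t0 \<tau> N z T = z N" for z
        using pl_path_at[of "N - 1" N 1 \<tau> t0 z] N S(5) by simp
      then show "mc T = m N" "uc T = u N" unfolding mc_def uc_def by auto
    qed
    have cmc: "continuous_on {t0..T} mc"
      unfolding mc_def by (intro continuous_on_coordinatewise_then_product continuous_pl_path)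
    have "- ((0 + \<eta>) * (T - t0)) \<le> pairing n (\<lambda>i. W t0 x i - uc t0 i) (\<lambda>i. x i - m0 i)"
    proof (rule doubling[OF _ _ _ _ W_cont _ W_test tpD])
      show "compact ({0..T} \<times> M2S n)" by (intro compact_Times compact_Icc compact_M2S)
      show "compact D" unfolding D_def
        by (intro compact_continuous_image continuous_on_Pair continuous_on_id cmc compact_Icc)
      show "D \<subseteq> {0..T} \<times> M2S n" unfolding D_def using path t0 PS_M2S by auto
      show "continuous_on D (\<lambda>(t, m). uc t i)" for i
      proof -
        have "continuous_on D (\<lambda>z. uc (fst z) i)"
          unfolding uc_def by (rule continuous_on_compose2[OF continuous_pl_path[of UNIV]])
            (auto intro: continuous_on_fst continuous_on_id)
        then show ?thesis by (simp add: case_prod_beta')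
      qed
      show "\<bar>W t m i\<bar> + 4 \<le> R" if "(t, m) \<in> {0..T} \<times> M2S n" "i \<in> {1..n}" for t m i
        using CW(2)[of i t m] that R(2) by auto
      show "\<bar>uc t i\<bar> + 4 \<le> R" if "(t, m) \<in> D" "i \<in> {1..n}" for t m i
      proof -
        have "t \<in> {t0..T}" using that unfolding D_def by auto
        then show ?thesis using box_fun_abs[of "uc t" "{1..n}" R0 i] path[of t] that R(3) by auto
      qed
      show "0 \<le> pairing n (\<lambda>i. W T y i - uc T i) (\<lambda>i. y i - y' i)" if "(T, y) \<in> {0..T} \<times> M2S n" "(T, y') \<in> D" for y y'
      proof -
        have y: "y \<in> M2S n" and y': "y' = m N" using that ends unfolding D_def by auto
        have mN: "m N \<in> M2S n" using S(8)[of N] PS_M2S by auto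
        have "pairing n (\<lambda>i. W T y i - uc T i) (\<lambda>i. y i - y' i) = pairing n (\<lambda>i. gn y i - gn y' i) (\<lambda>i. y i - y' i)"
          unfolding ends by (intro pairing_cong) (auto simp: W_terminal[OF y] S(10) y')
        then show ?thesis using gn_mono[OF y mN] y' by simp
      qed
      show "\<exists>d>0. \<forall>t m s m'. (t, m) \<in> {0..T} \<times> M2S n \<longrightarrow> (s, m') \<in> D \<longrightarrow> \<bar>t - s\<bar> < d \<longrightarrow>
        - \<zeta> \<le> pairing n (\<lambda>i. W t (A m) i - W s (A m') i) (\<lambda>i. A m i - A m' i) \<or>
        (t, A m) \<in> {0..T} \<times> M2S n \<and> (s, A m') \<in> D \<and>
        pairing n (\<lambda>i. W t (A m) i - W s (A m') i) (\<lambda>i. A m i - A m' i)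
          = pairing n (\<lambda>i. W t (A m) i - uc s i) (\<lambda>i. A m i - A m' i)" if z: "\<zeta> > 0" for \<zeta>
      proof -
        from W_jump_mono[OF z] obtain d where d: "d > 0" "\<forall>t m s m'. t \<in> {0..T} \<longrightarrow> s \<in> {0..T} \<longrightarrow> m \<in> M2S n \<longrightarrow> m' \<in> M2S n \<longrightarrow> \<bar>t - s\<bar> < d \<longrightarrow>
          - \<zeta> \<le> pairing n (\<lambda>i. W t m i - W s m' i) (\<lambda>i. m i - m' i)" by (elim exE conjE)
        show ?thesis
        proof (intro exI[of _ d] conjI d(1) allI impI disjI1)
          fix t y s y' assume a: "(t, y) \<in> {0..T} \<times> M2S n" "(s, y') \<in> D" "\<bar>t - s\<bar> < d"
          have "s \<in> {0..T}" "y' \<in> M2S n" using a(2) path t0 PS_M2S unfolding D_def by auto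
          then show "- \<zeta> \<le> pairing n (\<lambda>i. W t (A y) i - W s (A y') i) (\<lambda>i. A y i - A y' i)"
            using d(2)[rule_format, of t s "A y" "A y'"] a A_M2S by auto
        qed
      qed
      show "(t0, x) \<in> {0..T} \<times> M2S n" using t0 x by auto
      show "(t0, m0) \<in> D" unfolding D_def using ends S(4) t0 by (auto intro!: image_eqI[of _ _ t0])
    qed (use \<eta> in auto)
    moreover have "\<eta> * (T - t0) \<le> \<eta> * T" using \<eta> t0 by (intro mult_left_mono) auto
    ultimately show "- (\<eta> * T) \<le> pairing n (\<lambda>i. W t0 x i - u 0 i) (\<lambda>i. x i - m0 i)"
      unfolding ends by simp
  qed
qed

text \<open>Minty's argument: an interior \<open>m0\<close> may be perturbed by \<open>\<plusminus> h\<close> in every coordinate, so the comparison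
  inequality pins down every entry of the initial value of the scheme.\<close>

lemma characteristic_initial_value:
  assumes t0: "t0 \<in> {0..<T}" and m0: "m0 \<in> PS n" and pos: "\<And>i. i \<in> {1..n} \<Longrightarrow> m0 i > 0" and \<zeta>: "\<zeta> > 0"
  shows "\<exists>\<tau>1>0. \<forall>N \<tau> m u. char_scheme R0 t0 N \<tau> m0 m u \<longrightarrow> \<tau> \<le> \<tau>1 \<longrightarrow> (\<forall>i\<in>{1..n}. \<bar>u 0 i - W t0 m0 i\<bar> \<le> \<zeta>)"
proof -
  have "\<exists>d>0. \<forall>x\<in>M2S n. \<forall>y\<in>M2S n. (\<Sum>i=1..n. \<bar>x i - y i\<bar>) < d \<longrightarrow> \<bar>W t0 x i - W t0 y i\<bar> < \<zeta> / 2" if i: "i \<in> {1..n}" for i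
  proof (rule l1_unif_cont)
    show "continuous_on (M2S n) (\<lambda>x. W t0 x i)"
      using t0 i by (intro W_cont_compose continuous_on_const continuous_on_id) auto
  qed (use \<zeta> compact_M2S in \<open>auto simp: M2S_def MS_def\<close>)
  then have "\<forall>i\<in>{1..n}. \<exists>d>0. \<forall>x\<in>M2S n. \<forall>y\<in>M2S n. (\<Sum>i=1..n. \<bar>x i - y i\<bar>) < d \<longrightarrow> \<bar>W t0 x i - W t0 y i\<bar> < \<zeta> / 2"
    by blast
  from bchoice[OF this] obtain dd where dd: "\<forall>i\<in>{1..n}. dd i > 0 \<and> (\<forall>x\<in>M2S n. \<forall>y\<in>M2S n. (\<Sum>j=1..n. \<bar>x j - y j\<bar>) < dd i \<longrightarrow> \<bar>W t0 x i - W t0 y i\<bar> < \<zeta> / 2)"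
    by blast
  \<comment> \<open>\<open>h \<le> m0 i\<close> keeps the perturbed entry nonnegative,
    \<open>h \<le> 1\<close> keeps the mass at most 2, and \<open>dd i / 2\<close> keeps
    \<open>W\<close> within \<open>\<zeta> / 2\<close>.\<close>
  define h where "h = Min (insert 1 ((\<lambda>i. min (dd i / 2) (m0 i)) ` {1..n}))"
  have h0: "h > 0" unfolding h_def using dd pos by (subst Min_gr_iff) auto
  have h1: "h \<le> 1" unfolding h_def by (intro Min_le) auto
  have hi: "h \<le> min (dd i / 2) (m0 i)" if "i \<in> {1..n}" for i unfolding h_def using that by (intro Min_le) auto
  \<comment> \<open>Chosen so that the error \<open>\<eta> * T\<close>, divided by the perturbation
    \<open>h\<close>, is \<open>\<zeta> / 2\<close>.\<close>
  define \<eta> where "\<eta> = h * \<zeta> / 2 / T"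
  have \<eta>: "\<eta> > 0" unfolding \<eta>_def using h0 \<zeta> T0 by simp
  have \<eta>T: "\<eta> * T = h * (\<zeta> / 2)" unfolding \<eta>_def using T0 by simp
  from curve_comparison[OF \<eta>, of R0] obtain \<tau>1 where \<tau>1: "\<tau>1 > 0" and cmp: "\<forall>t0 N \<tau> m0 m u. char_scheme R0 t0 N \<tau> m0 m u \<longrightarrow> \<tau> \<le> \<tau>1 \<longrightarrow>
    (\<forall>x\<in>M2S n. - (\<eta> * T) \<le> pairing n (\<lambda>i. W t0 x i - u 0 i) (\<lambda>i. x i - m0 i))" by (elim exE conjE)
  show ?thesis
  proof (intro exI[of _ \<tau>1] conjI \<tau>1 allI impI ballI)
    fix N \<tau> m u i assume sch: "char_scheme R0 t0 N \<tau> m0 m u" "\<tau> \<le> \<tau>1" and i: "i \<in> {1..n}"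
    note c = cmp[rule_format, OF sch]
    have pert: "\<bar>W t0 (m0(i := m0 i + r)) i - W t0 m0 i\<bar> < \<zeta> / 2 \<and> - (h * (\<zeta> / 2)) \<le> r * (W t0 (m0(i := m0 i + r)) i - u 0 i)"
      if r: "\<bar>r\<bar> = h" for r
    proof -
      let ?x = "m0(i := m0 i + r)"
      have diff: "?x j - m0 j = (if j = i then r else 0)" for j by auto
      have "(\<Sum>j=1..n. ?x j) = (\<Sum>j=1..n. m0 j + (if j = i then r else 0))" by (intro sum.cong) auto
      also have "\<dots> = 1 + r" using m0 i by (simp add: sum.distrib PS_def)
      finally have mass: "(\<Sum>j=1..n. ?x j) \<le> 2" using r h1 by auto
      have "?x j \<ge> 0" if "j \<in> {1..n}" for j
        using M2S_nonneg[OF PS_M2S[OF m0], of j] hi[OF i] r by auto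
      then have x: "?x \<in> M2S n" using mass m0 i unfolding M2S_def PS_def MS_def by auto
      have "(\<Sum>j=1..n. \<bar>?x j - m0 j\<bar>) = (\<Sum>j=1..n. if j = i then \<bar>r\<bar> else 0)"
        unfolding diff by (intro sum.cong) auto
      also have "\<dots> = h" using i r by simp
      also have "\<dots> < dd i" using hi[OF i] dd[rule_format, OF i] by auto
      finally have 1: "\<bar>W t0 ?x i - W t0 m0 i\<bar> < \<zeta> / 2"
        using dd[rule_format, OF i] x PS_M2S[OF m0] by blast
      have "pairing n (\<lambda>j. W t0 ?x j - u 0 j) (\<lambda>j. ?x j - m0 j) = (\<Sum>j=1..n. if j = i then r * (W t0 ?x j - u 0 j) else 0)"
        unfolding pairing_def diff by (intro sum.cong) auto
      also have "\<dots> = r * (W t0 ?x i - u 0 i)" using i by simp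
      finally show ?thesis using c[OF x] 1 unfolding \<eta>T by simp
    qed
    \<comment> \<open>The perturbation by \<open>h\<close> bounds \<open>u 0 i\<close> from above,
      the one by \<open>- h\<close> from below.\<close>
    have "- (h * (\<zeta> / 2)) \<le> h * (W t0 (m0(i := m0 i + h)) i - u 0 i)" using pert[of h] h0 by simp
    then have "h * (- (\<zeta> / 2)) \<le> h * (W t0 (m0(i := m0 i + h)) i - u 0 i)" by simp
    then have up: "- (\<zeta> / 2) \<le> W t0 (m0(i := m0 i + h)) i - u 0 i" using h0 by (simp only: mult_le_cancel_left_pos)
    have "- (h * (\<zeta> / 2)) \<le> - h * (W t0 (m0(i := m0 i - h)) i - u 0 i)" using pert[of "- h"] h0 by simp
    then have "h * (W t0 (m0(i := m0 i - h)) i - u 0 i) \<le> h * (\<zeta> / 2)" by simp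
    then have lo: "W t0 (m0(i := m0 i - h)) i - u 0 i \<le> \<zeta> / 2" using h0 by (simp only: mult_le_cancel_left_pos)
    have "\<bar>W t0 (m0(i := m0 i + h)) i - W t0 m0 i\<bar> < \<zeta> / 2" "\<bar>W t0 (m0(i := m0 i - h)) i - W t0 m0 i\<bar> < \<zeta> / 2"
      using pert[of h] pert[of "- h"] h0 by auto
    then show "\<bar>u 0 i - W t0 m0 i\<bar> \<le> \<zeta>" using up lo by linarith
  qed
qed

end

section \<open>Comparison with an approximate classical solution\<close>

definition grid_lipschitz :: "nat \<Rightarrow> real \<Rightarrow> (nat \<Rightarrow> real) \<Rightarrow> bool" where
  "grid_lipschitz n l \<phi> \<longleftrightarrow>
     (\<forall>i\<in>{1..n}. \<bar>\<phi> (next_idx n i) - \<phi> i\<bar> \<le> l / real n) \<and> (\<forall>i\<in>{1..n}. \<bar>\<phi> i\<bar> \<le> 1)"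

text \<open>For grid measures of equal mass. Test functions are normalised by \<open>\<bar>\<phi>\<bar> \<le> 1\<close> rather than by their value
  at 0, so that the class is preserved by Markov operators.\<close>

definition W1_close :: "nat \<Rightarrow> (nat \<Rightarrow> real) \<Rightarrow> (nat \<Rightarrow> real) \<Rightarrow> real \<Rightarrow> bool" where
  "W1_close n m \<nu> w \<longleftrightarrow> (\<forall>\<phi>. grid_lipschitz n 1 \<phi> \<longrightarrow> pairing n \<phi> (\<lambda>i. m i - \<nu> i) \<le> w)"

text \<open>Differentiability of \<open>V\<close> enters only as an expansion along one step of its own Fokker--Planck flow,
  where the transport term and the time derivative combine into the equation itself.\<close>

locale approx_classical = discrete_solution +
  fixes V :: "real \<Rightarrow> (nat \<Rightarrow> real) \<Rightarrow> nat \<Rightarrow> real" and eps E0 c0 Lam CV CA :: real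
  assumes V_cont: "i \<in> {1..n} \<Longrightarrow> continuous_on ({0..T} \<times> PS n) (\<lambda>(t, m). V t m i)"
    and V_outside: "i \<notin> {1..n} \<Longrightarrow> V t m i = 0"
    and V_terminal: "m \<in> PS n \<Longrightarrow> i \<in> {1..n} \<Longrightarrow> V T m i = gn m i"
    and V_expand: "\<eta> > 0 \<Longrightarrow> \<exists>h0>0. \<forall>s h \<nu>. 0 \<le> s \<longrightarrow> 0 < h \<longrightarrow> h \<le> h0 \<longrightarrow> s + h \<le> T \<longrightarrow> \<nu> \<in> PS n \<longrightarrow>
        fp_step h \<nu> (V s \<nu>) \<in> PS n \<and> (\<forall>i\<in>{1..n}. \<bar>V (s + h) (fp_step h \<nu> (V s \<nu>)) i - V s \<nu> i
          + h * (G \<nu> (V s \<nu>) i - lam * (V s \<nu> i - As (V s (A \<nu>)) i))\<bar> \<le> h * (eps + \<eta>))"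
    and V_lip: "t \<in> {0..T} \<Longrightarrow> m \<in> PS n \<Longrightarrow> \<nu> \<in> PS n \<Longrightarrow> W1_close n m \<nu> w \<Longrightarrow> i \<in> {1..n} \<Longrightarrow>
        \<bar>V t m i - V t \<nu> i\<bar> \<le> CV * w"
    and fn_lip: "m \<in> PS n \<Longrightarrow> \<nu> \<in> PS n \<Longrightarrow> W1_close n m \<nu> w \<Longrightarrow> i \<in> {1..n} \<Longrightarrow> \<bar>fn m i - fn \<nu> i\<bar> \<le> CV * w"
    and gn_lip: "m \<in> PS n \<Longrightarrow> \<nu> \<in> PS n \<Longrightarrow> W1_close n m \<nu> w \<Longrightarrow> i \<in> {1..n} \<Longrightarrow> \<bar>gn m i - gn \<nu> i\<bar> \<le> CV * w"
    and A_lip: "m \<in> PS n \<Longrightarrow> \<nu> \<in> PS n \<Longrightarrow> W1_close n m \<nu> w \<Longrightarrow> W1_close n (A m) (A \<nu>) (CA * w)"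
    and V_drift: "t \<in> {0..T} \<Longrightarrow> m \<in> PS n \<Longrightarrow> i \<in> {1..n} \<Longrightarrow>
        al (V t m) (next_idx n i) \<le> al (V t m) i + Lam \<and> be (V t m) i \<le> be (V t m) (next_idx n i) + Lam"
    and gap_lower: "t \<in> {0..T} \<Longrightarrow> m \<in> PS n \<Longrightarrow> i \<in> {1..n} \<Longrightarrow> x = \<bar>al p i - al (V t m) i\<bar> / real n \<Longrightarrow>
        y = \<bar>be p i - be (V t m) i\<bar> / real n \<Longrightarrow> c0 * (min x (x\<^sup>2) + min y (y\<^sup>2)) \<le> gap p (V t m) i"
    and pars: "0 < eps" "eps \<le> E0" "0 < c0" "0 \<le> Lam" "0 \<le> CV" "0 \<le> CA"
begin

section \<open>Comparison of \<open>W\<close> with \<open>V\<close>\<close>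

lemma V_bound: "\<exists>C\<ge>0. \<forall>t\<in>{0..T}. \<forall>m\<in>PS n. V t m \<in> box_fun {1..n} (- C) C"
proof -
  have "\<exists>C\<ge>0. \<forall>i\<in>{1..n}. \<forall>z\<in>{0..T} \<times> PS n. \<bar>V (fst z) (snd z) i\<bar> \<le> C"
  proof (rule finite_bound)
    fix i assume "i \<in> {1..n}"
    from real_has_max_bound[OF compact_Times[OF compact_Icc compact_PS] V_cont[OF this]]
    show "\<exists>C. \<forall>z\<in>{0..T} \<times> PS n. \<bar>V (fst z) (snd z) i\<bar> \<le> C" by (auto simp: case_prod_beta')
  qed simp
  then obtain C where C: "C \<ge> 0" "\<forall>i\<in>{1..n}. \<forall>z\<in>{0..T} \<times> PS n. \<bar>V (fst z) (snd z) i\<bar> \<le> C" by blast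
  have "V t m \<in> box_fun {1..n} (- C) C" if "t \<in> {0..T}" "m \<in> PS n" for t m
  proof -
    have "\<bar>V t m i\<bar> \<le> C" if "i \<in> {1..n}" for i
      using C(2)[rule_format, OF that, of "(t, m)"] \<open>t \<in> {0..T}\<close> \<open>m \<in> PS n\<close> by simp
    then have "\<forall>i\<in>{1..n}. - C \<le> V t m i \<and> V t m i \<le> C" by (meson abs_le_iff minus_le_iff)
    then show ?thesis unfolding box_fun_def using V_outside by simp
  qed
  with C(1) show ?thesis by blast
qed

text \<open>The minimum is compared with the point reached after a short step of the Fokker-Planck
  flow driven by \<open>V\<close> itself, where \<open>V_expand\<close> describes the change of
  \<open>V\<close>. The factor 4 is the bound for the l1 norm of
  \<open>\<nu> - \<mu>\<close>.\<close>

lemma V_test_property: "test_property ({0..T} \<times> PS n) V (\<lambda>t m. V t (A m)) (4 * eps) R"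
  unfolding test_property_def
proof (intro ballI allI impI)
  fix \<mu> a \<psi> \<psi>' s \<nu>
  assume \<mu>: "\<mu> \<in> M2S n"
    and \<psi>: "\<forall>t\<in>{0..T}. (\<psi> has_real_derivative \<psi>' t) (at t within {0..T})"
    and z: "(s, \<nu>) \<in> {0..T} \<times> PS n" and sT: "s < T"
    and min: "strict_min_on (\<lambda>(t, m). pairing n (\<lambda>i. V t m i - a i) (\<lambda>i. m i - \<mu> i) - \<psi> t) ({0..T} \<times> PS n) (s, \<nu>)"
  have s: "0 \<le> s" "s \<in> {0..T}" and \<nu>: "\<nu> \<in> PS n" using z by auto
  define Z where "Z = (\<lambda>i. G \<nu> (V s \<nu>) i - lam * (V s \<nu> i - As (V s (A \<nu>)) i))"
  define P where "P = - pairing n Z (\<lambda>i. \<nu> i - \<mu> i) - pairing n (F \<nu> (V s \<nu>)) (\<lambda>i. V s \<nu> i - a i)"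
  have \<mu>\<nu>: "(\<Sum>i=1..n. \<bar>\<nu> i - \<mu> i\<bar>) \<le> 4" by (rule M2S_diff_abs_mass[OF PS_M2S[OF \<nu>] \<mu>])
  have bound: "\<psi>' s \<le> P + 4 * (eps + \<eta>)" if \<eta>: "\<eta> > 0" for \<eta>
  proof -
    from V_expand[OF \<eta>] obtain h0 where h0: "h0 > 0" "\<forall>s h \<nu>. 0 \<le> s \<longrightarrow> 0 < h \<longrightarrow> h \<le> h0 \<longrightarrow> s + h \<le> T \<longrightarrow> \<nu> \<in> PS n \<longrightarrow>
        fp_step h \<nu> (V s \<nu>) \<in> PS n \<and> (\<forall>i\<in>{1..n}. \<bar>V (s + h) (fp_step h \<nu> (V s \<nu>)) i - V s \<nu> i
          + h * (G \<nu> (V s \<nu>) i - lam * (V s \<nu> i - As (V s (A \<nu>)) i))\<bar> \<le> h * (eps + \<eta>))"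
      by (elim exE conjE)
    \<comment> \<open>Bound for the second-order term, the product of the changes of
      \<open>V\<close> and of the measure; it disappears as \<open>h\<close> tends to 0.\<close>
    define Q where "Q = (\<Sum>i=1..n. (\<bar>Z i\<bar> + (eps + \<eta>)) * \<bar>F \<nu> (V s \<nu>) i\<bar>)"
    have ineq: "(\<psi> (s + h) - \<psi> s) / h \<le> P + 4 * (eps + \<eta>) + h * Q" if h: "0 < h" "h < h0" "h < T - s" for h
    proof -
      let ?\<nu>' = "fp_step h \<nu> (V s \<nu>)"
      have ex: "?\<nu>' \<in> PS n" "\<And>i. i \<in> {1..n} \<Longrightarrow> \<bar>V (s + h) ?\<nu>' i - V s \<nu> i + h * Z i\<bar> \<le> h * (eps + \<eta>)"
        unfolding Z_def using h0(2)[rule_format, of s h \<nu>] s(1) \<nu> h by auto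
      define X where "X = (\<lambda>i. (V (s + h) ?\<nu>' i - V s \<nu> i) / h)"
      have XZ: "\<bar>X i + Z i\<bar> \<le> eps + \<eta>" if i: "i \<in> {1..n}" for i
      proof -
        have "V (s + h) ?\<nu>' i - V s \<nu> i + h * Z i = h * (X i + Z i)" unfolding X_def using h by (simp add: distrib_left)
        then have "h * \<bar>X i + Z i\<bar> \<le> h * (eps + \<eta>)" using ex(2)[OF i] h by (simp add: abs_mult)
        then show ?thesis using h by simp
      qed
      have Xeq: "V (s + h) ?\<nu>' i = V s \<nu> i + h * X i" for i unfolding X_def using h by simp
      have "(s + h, ?\<nu>') \<in> {0..T} \<times> PS n" "(s + h, ?\<nu>') \<noteq> (s, \<nu>)" using ex(1) h s by auto
      then have "pairing n (\<lambda>i. V s \<nu> i - a i) (\<lambda>i. \<nu> i - \<mu> i) - \<psi> s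
         < pairing n (\<lambda>i. V (s + h) ?\<nu>' i - a i) (\<lambda>i. ?\<nu>' i - \<mu> i) - \<psi> (s + h)"
        using min unfolding strict_min_on_def by (auto dest: bspec[of _ _ "(s + h, ?\<nu>')"])
      also have "pairing n (\<lambda>i. V (s + h) ?\<nu>' i - a i) (\<lambda>i. ?\<nu>' i - \<mu> i)
         = pairing n (\<lambda>i. V s \<nu> i - a i) (\<lambda>i. \<nu> i - \<mu> i)
           + h * (pairing n X (\<lambda>i. \<nu> i - \<mu> i) - pairing n (F \<nu> (V s \<nu>)) (\<lambda>i. V s \<nu> i - a i))
           - h * (h * pairing n X (F \<nu> (V s \<nu>)))"
        unfolding Xeq unfolding fp_step_def pairing_def
          sum_distrib_left sum.distrib[symmetric] sum_subtractf[symmetric]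
        by (intro sum.cong) (auto simp: algebra_simps)
      finally have 1: "(\<psi> (s + h) - \<psi> s) < h * (pairing n X (\<lambda>i. \<nu> i - \<mu> i) - pairing n (F \<nu> (V s \<nu>)) (\<lambda>i. V s \<nu> i - a i) - h * pairing n X (F \<nu> (V s \<nu>)))"
        by (simp add: algebra_simps)
      have "\<bar>pairing n (\<lambda>i. X i + Z i) (\<lambda>i. \<nu> i - \<mu> i)\<bar> \<le> (eps + \<eta>) * 4"
        using pars \<eta> by (intro abs_pairing_le XZ \<mu>\<nu>) auto
      then have 2: "pairing n X (\<lambda>i. \<nu> i - \<mu> i) \<le> - pairing n Z (\<lambda>i. \<nu> i - \<mu> i) + 4 * (eps + \<eta>)"
        unfolding pairing_add_left by linarith
      have "- pairing n X (F \<nu> (V s \<nu>)) \<le> Q"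
        unfolding pairing_def Q_def sum_negf[symmetric]
      proof (rule sum_mono)
        fix i assume i: "i \<in> {1..n}"
        have "\<bar>X i\<bar> \<le> \<bar>Z i\<bar> + (eps + \<eta>)" using XZ[OF i] by linarith
        then have "\<bar>X i\<bar> * \<bar>F \<nu> (V s \<nu>) i\<bar> \<le> (\<bar>Z i\<bar> + (eps + \<eta>)) * \<bar>F \<nu> (V s \<nu>) i\<bar>" by (intro mult_right_mono) auto
        then show "- (X i * F \<nu> (V s \<nu>) i) \<le> (\<bar>Z i\<bar> + (eps + \<eta>)) * \<bar>F \<nu> (V s \<nu>) i\<bar>"
          by (simp add: abs_mult[symmetric])
      qed
      then have "- (h * pairing n X (F \<nu> (V s \<nu>))) \<le> h * Q"
        using h mult_left_mono[of "- pairing n X (F \<nu> (V s \<nu>))" Q h] by simp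
      then have "pairing n X (\<lambda>i. \<nu> i - \<mu> i) - pairing n (F \<nu> (V s \<nu>)) (\<lambda>i. V s \<nu> i - a i) - h * pairing n X (F \<nu> (V s \<nu>))
        \<le> P + 4 * (eps + \<eta>) + h * Q" using 2 unfolding P_def by linarith
      then have "\<psi> (s + h) - \<psi> s \<le> h * (P + 4 * (eps + \<eta>) + h * Q)"
        using 1 h mult_left_mono[of _ "P + 4 * (eps + \<eta>) + h * Q" h] by (meson less_imp_le order.trans)
      then show ?thesis using h by (simp add: divide_le_eq mult.commute)
    qed
    show ?thesis
    proof (rule tendsto_le[where F="at_right 0"])
      have "(\<psi> has_real_derivative \<psi>' s) (at s within {0..T})" using \<psi> s by blast
      then have dl: "((\<lambda>y. (\<psi> y - \<psi> s) / (y - s)) \<longlongrightarrow> \<psi>' s) (at s within {0..T})"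
        by (simp add: has_field_derivative_iff)
      have ev: "\<forall>\<^sub>F h in at_right 0. h < r" if "r > 0" for r :: real
        using that by (intro order_tendstoD(2)[OF tendsto_ident_at]) auto
      have ev0: "\<forall>\<^sub>F h in at_right (0::real). h > 0" by (simp add: eventually_at_right_less)
      have "filterlim (\<lambda>h. s + h) (at s within {0..T}) (at_right 0)"
        unfolding filterlim_at
      proof
        have "((\<lambda>h. s + h) \<longlongrightarrow> s + 0) (at_right 0)" by (intro tendsto_intros)
        then show "((\<lambda>h. s + h) \<longlongrightarrow> s) (at_right 0)" by simp
        have "\<forall>\<^sub>F h in at_right 0. h < T - s" using ev sT by simp
        with ev0 show "\<forall>\<^sub>F h in at_right 0. s + h \<in> {0..T} \<and> s + h \<noteq> s"
          by eventually_elim (use s in auto)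
      qed
      from filterlim_compose[OF dl this]
      show "((\<lambda>h. (\<psi> (s + h) - \<psi> s) / h) \<longlongrightarrow> \<psi>' s) (at_right 0)" by simp
      have "((\<lambda>h. P + 4 * (eps + \<eta>) + h * Q) \<longlongrightarrow> P + 4 * (eps + \<eta>) + 0 * Q) (at_right 0)"
        by (intro tendsto_intros)
      then show "((\<lambda>h. P + 4 * (eps + \<eta>) + h * Q) \<longlongrightarrow> P + 4 * (eps + \<eta>)) (at_right 0)" by simp
      have "\<forall>\<^sub>F h in at_right 0. h < T - s" "\<forall>\<^sub>F h in at_right 0. h < h0" using ev sT h0(1) by auto
      with ev0 show "\<forall>\<^sub>F h in at_right 0. (\<psi> (s + h) - \<psi> s) / h \<le> P + 4 * (eps + \<eta>) + h * Q"
        by eventually_elim (use ineq in auto)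
    qed simp
  qed
  have "\<psi>' s \<le> P + 4 * eps"
  proof (rule field_le_epsilon)
    fix e :: real assume "e > 0"
    then show "\<psi>' s \<le> P + 4 * eps + e" using bound[of "e / 4"] by simp
  qed
  then show "pairing n (G \<nu> (V s \<nu>)) (\<lambda>i. \<nu> i - \<mu> i) + pairing n (F \<nu> (V s \<nu>)) (\<lambda>i. V s \<nu> i - a i)
        \<le> - \<psi>' s + lam * pairing n (\<lambda>i. V s \<nu> i - As (V s (A \<nu>)) i) (\<lambda>i. \<nu> i - \<mu> i) + 4 * eps"
    unfolding P_def Z_def pairing_diff_left[of n "G \<nu> (V s \<nu>)"] pairing_scale_left by linarith
qed

text \<open>\<open>doubling\<close> with the errors 0 and \<open>4 * eps\<close>. Both domains are
  invariant under \<open>A\<close>, so the states after a jump are competitors.\<close>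

lemma V_comparison:
  assumes "t \<in> {0..T}" "m \<in> M2S n" "\<nu> \<in> PS n"
  shows "- (4 * eps * T) \<le> pairing n (\<lambda>i. W t m i - V t \<nu> i) (\<lambda>i. m i - \<nu> i)"
proof -
  obtain CW where CW: "CW \<ge> 0" "\<And>i t m. i \<in> {1..n} \<Longrightarrow> t \<in> {0..T} \<Longrightarrow> m \<in> M2S n \<Longrightarrow> \<bar>W t m i\<bar> \<le> CW"
    using W_bound by fastforce
  obtain RV where RV: "RV \<ge> 0" "\<forall>t\<in>{0..T}. \<forall>m\<in>PS n. V t m \<in> box_fun {1..n} (- RV) RV"
    using V_bound by blast
  have "- ((0 + 4 * eps) * (T - t)) \<le> pairing n (\<lambda>i. W t m i - V t \<nu> i) (\<lambda>i. m i - \<nu> i)"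
  proof (rule doubling[OF _ _ _ _ W_cont V_cont W_test V_test_property, where R="max CW RV + 4"])
    show "compact ({0..T} \<times> M2S n)" by (intro compact_Times compact_Icc compact_M2S)
    show "compact ({0..T} \<times> PS n)" by (intro compact_Times compact_Icc compact_PS)
    show "{0..T} \<times> PS n \<subseteq> {0..T} \<times> M2S n" using PS_M2S by auto
    show "\<bar>W t m i\<bar> + 4 \<le> max CW RV + 4" if "(t, m) \<in> {0..T} \<times> M2S n" "i \<in> {1..n}" for t m i
      using CW(2)[of i t m] that by auto
    show "\<bar>V t m i\<bar> + 4 \<le> max CW RV + 4" if "(t, m) \<in> {0..T} \<times> PS n" "i \<in> {1..n}" for t m i
      using box_fun_abs[of "V t m" "{1..n}" RV i] RV(2) that by auto
    fix y y' assume y: "(T, y) \<in> {0..T} \<times> M2S n" "(T, y') \<in> {0..T} \<times> PS n"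
    have "pairing n (\<lambda>i. W T y i - V T y' i) (\<lambda>i. y i - y' i) = pairing n (\<lambda>i. gn y i - gn y' i) (\<lambda>i. y i - y' i)"
      using y by (intro pairing_cong) (auto simp: W_terminal V_terminal)
    then show "0 \<le> pairing n (\<lambda>i. W T y i - V T y' i) (\<lambda>i. y i - y' i)" using gn_mono[of y y'] y PS_M2S by auto
  next
    fix \<zeta> :: real
    show "\<exists>d>0. \<forall>t m s m'. (t, m) \<in> {0..T} \<times> M2S n \<longrightarrow> (s, m') \<in> {0..T} \<times> PS n \<longrightarrow> \<bar>t - s\<bar> < d \<longrightarrow>
        - \<zeta> \<le> pairing n (\<lambda>i. W t (A m) i - V s (A m') i) (\<lambda>i. A m i - A m' i) \<or>
        (t, A m) \<in> {0..T} \<times> M2S n \<and> (s, A m') \<in> {0..T} \<times> PS n \<and>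
        pairing n (\<lambda>i. W t (A m) i - V s (A m') i) (\<lambda>i. A m i - A m' i)
          = pairing n (\<lambda>i. W t (A m) i - V s (A m') i) (\<lambda>i. A m i - A m' i)"
      by (intro exI[of _ 1]) (auto simp: A_M2S A_PS)
  qed (use assms pars in auto)
  moreover have "4 * eps * (T - t) \<le> 4 * eps * T" using assms pars by (intro mult_left_mono) auto
  ultimately show ?thesis by simp
qed

end

section \<open>Elementary inequalities for the main estimate\<close>

lemma min_square_le:
  fixes x s :: real
  assumes "s > 0" "x \<ge> 0"
  shows "x \<le> s + (1 + 1 / s) * min x (x\<^sup>2)"
proof (cases "x \<ge> 1")
  case True
  then have "min x (x\<^sup>2) = x" by (simp add: power2_eq_square min_def)
  moreover have "(1 / s) * x \<ge> 0" using assms by simp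
  ultimately show ?thesis using assms by (simp add: distrib_right)
next
  case False
  then have "x\<^sup>2 \<le> x" using assms by (simp add: power2_eq_square mult_left_le)
  then have mn: "min x (x\<^sup>2) = x\<^sup>2" by (rule min_absorb2)
  \<comment> \<open>Young's inequality with a free parameter \<open>s\<close>, which will be
    \<open>sqrt eps\<close>.\<close>
  have "x \<le> s + x\<^sup>2 / s"
  proof -
    have "0 \<le> (x - s)\<^sup>2 + x * s" using assms by simp
    then have "x * s \<le> s * s + x\<^sup>2" by (simp add: power2_eq_square algebra_simps)
    then show ?thesis using assms by (simp add: field_simps power2_eq_square)
  qed
  moreover have "x\<^sup>2 \<ge> 0" by simp
  moreover have "(1 + 1 / s) * x\<^sup>2 = x\<^sup>2 + x\<^sup>2 / s" by (simp add: distrib_right)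
  ultimately show ?thesis unfolding mn by linarith
qed

lemma abs_le_of_scaled:
  fixes x y c \<tau> :: real
  assumes "\<tau> * x = - y" "\<bar>y\<bar> \<le> c" "\<tau> > 0"
  shows "\<tau> * \<bar>x\<bar> \<le> c"
proof -
  have "\<bar>\<tau> * x\<bar> \<le> c" using assms by simp
  then show ?thesis using assms(3) by (simp add: abs_mult)
qed

lemma mult_le_abs_mult:
  fixes a d c :: real
  assumes "\<bar>d\<bar> \<le> c"
  shows "a * d \<le> \<bar>a\<bar> * c"
proof -
  have "a * d \<le> \<bar>a\<bar> * \<bar>d\<bar>" by (metis abs_ge_self abs_mult)
  also have "\<dots> \<le> \<bar>a\<bar> * c" using assms by (intro mult_left_mono) auto
  finally show ?thesis .
qed

text \<open>Relates the residual \<open>e\<close> of a step evaluated at the later value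
  \<open>v'\<close> to the expansion evaluated at the earlier value \<open>v\<close>;
  \<open>a\<close> and \<open>b\<close> stand for the Hamiltonian term at \<open>v'\<close> and at
  \<open>v\<close>.\<close>

lemma consistency_identity:
  fixes a b c e l v v' \<tau> :: real
  assumes "v = v' + \<tau> * (a - l * (v' - c) + e)"
  shows "\<tau> * (e + (a - b) + l * (v - v')) = - (v' - v + \<tau> * (b - l * (v - c)))"
proof -
  have "v - v' = \<tau> * (a - l * (v' - c) + e)" using assms by linarith
  then show ?thesis by algebra
qed

text \<open>Bounds the survival weight \<open>(1 - \<tau> * lam) ^ N\<close> from below
  independently of the number of steps.\<close>

lemma exp_le_one_minus:
  fixes x :: real
  assumes "0 \<le> x" "x \<le> 1 / 2"
  shows "exp (- 2 * x) \<le> 1 - x"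
proof -
  have "1 + 2 * x \<le> exp (2 * x)" by (rule exp_ge_add_one_self)
  moreover have "1 \<le> (1 - x) * (1 + 2 * x)"
  proof -
    have "0 \<le> x * (1 - 2 * x)" using assms by simp
    then show ?thesis by (simp add: algebra_simps)
  qed
  ultimately have "1 \<le> (1 - x) * exp (2 * x)"
    using assms mult_left_mono[of "1 + 2 * x" "exp (2 * x)" "1 - x"] by linarith
  then have "exp (- 2 * x) * 1 \<le> exp (- 2 * x) * ((1 - x) * exp (2 * x))" by (intro mult_left_mono) auto
  also have "\<dots> = 1 - x" by (simp add: exp_minus field_simps)
  finally show ?thesis by simp
qed

context approx_classical
begin

text \<open>\<open>K0\<close>: error rate in the Lasry-Lions step, \<open>4 * lam * T\<close> from
  the comparison after a jump and 3 from the residuals. \<open>rho\<close>: lower bound for the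
  survival weight. \<open>K1 * eps\<close> bounds the accumulated gap, \<open>K2 * sqrt eps\<close>
  the accumulated drift difference, \<open>K3 * sqrt eps\<close> the distance of the two flows,
  where \<open>exp (2 * Lam * T)\<close> is the growth of Lipschitz constants under the backward
  flow. \<open>K4\<close> adds what this distance causes in the terminal value, the jump, the
  coupling and the residual.\<close>

definition K0 where "K0 = 4 * lam * T + 3"
definition rho where "rho = exp (- 2 * (lam * T))"
definition K1 where "K1 = T * K0 / rho"
definition K2 where "K2 = 2 * T + (sqrt E0 + 1) * K1 / c0"
definition K3 where "K3 = exp (2 * Lam * T) * K2 + 1"
definition K4 where "K4 = CV * K3 + T * (lam * (CV * (CA * K3)) + CV * K3 + 2 * sqrt E0)"

lemma K_nonneg: "K0 \<ge> 0" "rho > 0" "rho \<le> 1" "K1 \<ge> 0" "K2 \<ge> 0" "K3 \<ge> 0" "K4 \<ge> 0"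
proof -
  show a: "K0 \<ge> 0" unfolding K0_def using lam0 T0 by simp
  show b: "rho > 0" "rho \<le> 1" unfolding rho_def using lam0 T0 by simp_all
  show c: "K1 \<ge> 0" unfolding K1_def using a b T0 by simp
  have E0: "E0 \<ge> 0" using pars by linarith
  show d: "K2 \<ge> 0" unfolding K2_def using c T0 pars E0 by simp
  show e: "K3 \<ge> 0" unfolding K3_def using d by simp
  show "K4 \<ge> 0" unfolding K4_def using e pars lam0 T0 E0 by simp
qed

text \<open>The characteristic \<open>(m, u)\<close> of \<open>W\<close> and the flow \<open>\<nu>\<close> driven by \<open>V\<close> start from the same \<open>m0\<close>. Lasry--Lions
  bounds the accumulated difference of their drifts by \<open>sqrt eps\<close>, duality turns this into a bound on the
  distance of \<open>m\<close> and \<open>\<nu>\<close>, and the maximum principle compares \<open>u\<close> with \<open>V\<close> along \<open>\<nu>\<close>. The jump term only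
  contributes a fraction \<open>1 - rho < 1\<close> of the global error and can be absorbed.\<close>

lemma interior_estimate:
  assumes t0: "t0 \<in> {0..<T}" and m0: "m0 \<in> PS n" and pos: "\<And>i. i \<in> {1..n} \<Longrightarrow> m0 i > 0" and \<zeta>: "\<zeta> > 0"
    and Ebar: "\<And>t m i. t \<in> {0..T} \<Longrightarrow> m \<in> PS n \<Longrightarrow> i \<in> {1..n} \<Longrightarrow> \<bar>W t m i - V t m i\<bar> \<le> Ebar"
    and i0: "i0 \<in> {1..n}"
  shows "\<bar>W t0 m0 i0 - V t0 m0 i0\<bar> \<le> (1 - rho) * Ebar + K4 * sqrt eps + \<zeta>"
proof -
  define s where "s = sqrt eps"
  have s0: "s > 0" unfolding s_def using pars by simp
  have ss: "s * s = eps" unfolding s_def using pars by simp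
  have sE: "s \<le> sqrt E0" unfolding s_def using pars by simp
  have Ebar0: "Ebar \<ge> 0" using Ebar[of t0 m0 i0] t0 m0 i0 by fastforce
  obtain R0 \<tau>0 where R0: "R0 \<ge> 0" "\<tau>0 > 0" and sch: "\<forall>m0\<in>PS n. \<forall>t0\<in>{0..<T}. \<forall>N\<ge>1. (T - t0) / real N \<le> \<tau>0 \<longrightarrow>
    (\<exists>m u. m 0 = m0 \<and> (\<forall>k<N. m (Suc k) = fp_step ((T - t0) / real N) (m k) (u (Suc k)))
      \<and> (\<forall>k\<le>N. m k \<in> PS n)
      \<and> (\<forall>k<N. \<forall>i\<in>{1..n}. u k i = char_val (t0 + real k * ((T - t0) / real N)) ((T - t0) / real N) (m k) (u (Suc k)) i)
      \<and> (\<forall>i\<in>{1..n}. u N i = gn (m N) i)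
      \<and> (\<forall>k\<le>N. u k \<in> box_fun {1..n} (- R0) R0))"
    using characteristic_scheme_exists by (elim exE conjE)
  obtain RV where RV: "RV \<ge> 0" "\<forall>t\<in>{0..T}. \<forall>m\<in>PS n. V t m \<in> box_fun {1..n} (- RV) RV"
    using V_bound by blast
  define R where "R = max R0 RV"
  have R: "R \<ge> 0" "R0 \<le> R" "RV \<le> R" unfolding R_def using R0 by auto
  have box_mono: "x \<in> box_fun {1..n} (- r) r \<Longrightarrow> r \<le> R \<Longrightarrow> x \<in> box_fun {1..n} (- R) R" for x r
    unfolding box_fun_def by force
  obtain C where C: "C \<ge> 0" "\<And>p i. (\<And>i. i \<in> {1..n} \<Longrightarrow> \<bar>p i\<bar> \<le> R) \<Longrightarrow> i \<in> {1..n} \<Longrightarrow> al p i \<le> C \<and> be p i \<le> C"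
    using rates_bounded[of R] by blast
  \<comment> \<open>All discretisation errors together stay below \<open>eps\<close> in the
    Lasry-Lions step and below \<open>s\<close> in the transport step.\<close>
  define \<eta> where "\<eta> = Min {1, eps / (3 * lam + 6 + 4 * R), s / T}"
  have den: "3 * lam + 6 + 4 * R > 0" using lam0 R by simp
  have \<eta>0: "\<eta> > 0" unfolding \<eta>_def using pars s0 T0 den by simp
  have \<eta>1: "\<eta> \<le> eps / (3 * lam + 6 + 4 * R)" "\<eta> \<le> s / T" unfolding \<eta>_def by (rule Min_le; simp)+
  have \<eta>2: "3 * (lam * \<eta>) + 6 * \<eta> + 4 * (R * \<eta>) \<le> eps"
    using \<eta>1(1) den by (simp add: pos_le_divide_eq algebra_simps)
  have \<eta>3: "T * \<eta> \<le> s" using \<eta>1(2) T0 by (simp add: pos_le_divide_eq mult.commute)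
  have \<eta>4: "2 * \<eta> \<le> eps"
  proof -
    have "lam * \<eta> \<ge> 0" "R * \<eta> \<ge> 0" using lam0 R \<eta>0 by simp_all
    then show ?thesis using \<eta>2 \<eta>0 by linarith
  qed
  from char_modulus(1)[OF \<eta>0, of R] obtain d where d: "d > 0" and dd': "\<forall>s m p s' m' p'. s \<in> {0..T} \<longrightarrow> s' \<in> {0..T} \<longrightarrow> m \<in> M2S n \<longrightarrow> m' \<in> M2S n \<longrightarrow>
    p \<in> box_fun {1..n} (- R) R \<longrightarrow> p' \<in> box_fun {1..n} (- R) R \<longrightarrow>
    \<bar>s - s'\<bar> + (\<Sum>i=1..n. \<bar>m i - m' i\<bar>) + (\<Sum>i=1..n. \<bar>p i - p' i\<bar>) < d \<longrightarrow>
    (\<Sum>i=1..n. \<bar>G m p i - G m' p' i\<bar> + \<bar>F m p i - F m' p' i\<bar> + \<bar>char_rhs s m p i - char_rhs s' m' p' i\<bar>) < \<eta>"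
    by (elim exE conjE)
  from char_modulus(2)[OF \<eta>0, of R] obtain CG where CG: "CG \<ge> 0" and CG': "\<forall>s m p. s \<in> {0..T} \<longrightarrow> m \<in> M2S n \<longrightarrow> p \<in> box_fun {1..n} (- R) R \<longrightarrow>
    (\<Sum>i=1..n. \<bar>G m p i\<bar> + \<bar>F m p i\<bar> + \<bar>char_rhs s m p i\<bar>) \<le> CG"
    by (elim exE conjE)
  from V_expand[OF \<eta>0] obtain h0 where h0: "h0 > 0" and ex': "\<forall>s h \<nu>. 0 \<le> s \<longrightarrow> 0 < h \<longrightarrow> h \<le> h0 \<longrightarrow> s + h \<le> T \<longrightarrow> \<nu> \<in> PS n \<longrightarrow>
        fp_step h \<nu> (V s \<nu>) \<in> PS n \<and> (\<forall>i\<in>{1..n}. \<bar>V (s + h) (fp_step h \<nu> (V s \<nu>)) i - V s \<nu> i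
          + h * (G \<nu> (V s \<nu>) i - lam * (V s \<nu> i - As (V s (A \<nu>)) i))\<bar> \<le> h * (eps + \<eta>))"
    by (elim exE conjE)
  have "\<exists>\<tau>1>0. \<forall>N \<tau> m u. char_scheme R0 t0 N \<tau> m0 m u \<longrightarrow> \<tau> \<le> \<tau>1 \<longrightarrow> (\<forall>i\<in>{1..n}. \<bar>u 0 i - W t0 m0 i\<bar> \<le> \<zeta>)"
    by (rule characteristic_initial_value[OF t0 m0 _ \<zeta>]) (rule pos)
  then obtain \<tau>1 where \<tau>1: "\<tau>1 > 0"
    and init: "\<forall>N \<tau> m u. char_scheme R0 t0 N \<tau> m0 m u \<longrightarrow> \<tau> \<le> \<tau>1 \<longrightarrow> (\<forall>i\<in>{1..n}. \<bar>u 0 i - W t0 m0 i\<bar> \<le> \<zeta>)"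
    by (elim exE conjE)
  define CX where "CX = CG + lam * (2 * R) + (eps + \<eta>)"
  have CX0: "CX > 0" unfolding CX_def using CG lam0 R pars \<eta>0 by (simp add: add_nonneg_pos)
  \<comment> \<open>After the thresholds of scheme, initial value and expansion: the step size
    condition for the rates, \<open>\<tau> * lam \<le> 1 / 2\<close>, changes of \<open>v\<close>
    per step within the modulus \<open>d\<close>, and a small time shift in the pairing
    \<open>Q\<close>.\<close>
  define \<tau>2 where "\<tau>2 = Min {\<tau>0, \<tau>1, h0, 1 / (2 * C + lam), 1 / (2 * lam), d / (2 * real n * CX), \<eta> / (4 * R * CG + 1)}"
  have nCX: "real n * CX > 0" using n1 CX0 by simp
  have den2: "4 * R * CG + 1 > 0" using R CG by (simp add: add_nonneg_pos)
  have den3: "2 * C + lam > 0" using C lam0 by simp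
  have "1 / (2 * C + lam) > 0" "1 / (2 * lam) > 0" "d / (2 * real n * CX) > 0" "\<eta> / (4 * R * CG + 1) > 0"
    using den3 lam0 d nCX den2 \<eta>0 by (simp_all only: zero_less_divide_iff mult.assoc zero_less_mult_iff) auto
  then have \<tau>20: "\<tau>2 > 0" unfolding \<tau>2_def using R0(2) \<tau>1 h0 by (subst Min_gr_iff, simp, simp) (intro ballI, elim insertE emptyE, simp_all only:)
  have \<tau>2_le: "\<tau>2 \<le> \<tau>0" "\<tau>2 \<le> \<tau>1" "\<tau>2 \<le> h0" "\<tau>2 \<le> 1 / (2 * C + lam)" "\<tau>2 \<le> 1 / (2 * lam)" "\<tau>2 \<le> d / (2 * real n * CX)" "\<tau>2 \<le> \<eta> / (4 * R * CG + 1)"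
    unfolding \<tau>2_def by (rule Min_le; simp)+
  obtain N :: nat where N: "real N > (T - t0) / \<tau>2" using reals_Archimedean2 by blast
  have N0: "N \<ge> 1"
  proof -
    have "(T - t0) / \<tau>2 > 0" using t0 \<tau>20 by simp
    then have "real N > 0" using N by linarith
    then show ?thesis by simp
  qed
  define \<tau> where "\<tau> = (T - t0) / real N"
  have \<tau>le2: "\<tau> \<le> \<tau>2"
  proof -
    have "T - t0 < real N * \<tau>2" using N \<tau>20 by (simp add: pos_divide_less_eq)
    then show ?thesis unfolding \<tau>_def using N0 by (simp add: pos_divide_le_eq mult.commute)
  qed
  obtain m u where scheme: "char_scheme R0 t0 N \<tau> m0 m u"
  proof -
    have "(T - t0) / real N \<le> \<tau>0" using \<tau>le2 \<tau>2_le(1) unfolding \<tau>_def by linarith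
    from sch[rule_format, OF m0 t0 N0 this] show ?thesis
      using that t0 N0 unfolding char_scheme_def \<tau>_def by blast
  qed
  note S = char_schemeD[OF scheme]
  note \<tau>p = S(5) and N\<tau> = S(6)
  have N\<tau>T: "real N * \<tau> \<le> T" using N\<tau> t0 by auto
  define tt where "tt = (\<lambda>k. t0 + real k * \<tau>)"
  have tt: "tt k \<in> {0..T}" if "k \<le> N" for k unfolding tt_def by (rule S(12)[OF that])
  have ttS: "tt (Suc k) = tt k + \<tau>" for k unfolding tt_def by (simp add: algebra_simps)
  \<comment> \<open>An explicit step with \<open>V\<close> at the current state, so that
    \<open>V_expand\<close> applies along the whole flow.\<close>
  define \<nu> where "\<nu> = rec_nat m0 (\<lambda>k x. fp_step \<tau> x (V (tt k) x))"
  have \<nu>0: "\<nu> 0 = m0" and \<nu>S: "\<nu> (Suc k) = fp_step \<tau> (\<nu> k) (V (tt k) (\<nu> k))" for k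
    unfolding \<nu>_def by simp_all
  define v where "v = (\<lambda>k. V (tt k) (\<nu> k))"
  have step_ex: "fp_step \<tau> x (V (tt k) x) \<in> PS n \<and> (\<forall>i\<in>{1..n}. \<bar>V (tt k + \<tau>) (fp_step \<tau> x (V (tt k) x)) i - V (tt k) x i
          + \<tau> * (G x (V (tt k) x) i - lam * (V (tt k) x i - As (V (tt k) (A x)) i))\<bar> \<le> \<tau> * (eps + \<eta>))"
    if "k < N" "x \<in> PS n" for k x
    using ex'[rule_format, of "tt k" \<tau> x] tt[of k] tt[of "Suc k"] ttS[of k] that \<tau>p \<tau>le2 \<tau>2_le(3) by auto
  have \<nu>PS: "k \<le> N \<Longrightarrow> \<nu> k \<in> PS n" for k
  proof (induction k)
    case 0 then show ?case using m0 \<nu>0 by simp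
  next
    case (Suc k) then show ?case using step_ex[of k "\<nu> k"] by (simp add: \<nu>S)
  qed
  have vbox: "v k \<in> box_fun {1..n} (- R) R" if "k \<le> N" for k
    unfolding v_def using RV(2) tt[OF that] \<nu>PS[OF that] box_mono[OF _ R(3)] by blast
  have ubox: "u k \<in> box_fun {1..n} (- R) R" if "k \<le> N" for k
    using box_mono[OF S(11)[OF that] R(2)] .
  have absR: "\<bar>x i\<bar> \<le> R" if "x \<in> box_fun {1..n} (- R) R" "i \<in> {1..n}" for x :: "nat \<Rightarrow> real" and i
    by (rule box_fun_abs[OF that])
  have mPS: "m k \<in> PS n" if "k \<le> N" for k using S(8)[OF that] .
  note mM = PS_M2S[OF mPS] and \<nu>M = PS_M2S[OF \<nu>PS]
  have rates: "\<tau> * (al p i + be p j + lam) \<le> 1" "\<tau> * (al p i + be p j) \<le> 1"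
    if "p \<in> box_fun {1..n} (- R) R" "i \<in> {1..n}" "j \<in> {1..n}" for p i j
  proof -
    have a: "al p i \<le> C" "be p j \<le> C" using C(2)[of p i] C(2)[of p j] absR[OF that(1)] that by auto
    have "\<tau> * (al p i + be p j + lam) \<le> 1 / (2 * C + lam) * (2 * C + lam)"
      using a \<tau>le2 \<tau>2_le(4) \<tau>p al0[OF that(2), of p] be0[OF that(3), of p] lam0 den3 by (intro mult_mono) auto
    also have "\<dots> = 1" using den3 by (intro nonzero_eq_divide_eq[THEN iffD1]) auto
    finally show 1: "\<tau> * (al p i + be p j + lam) \<le> 1" .
    have "\<tau> * (al p i + be p j) \<le> \<tau> * (al p i + be p j + lam)" using \<tau>p lam0 by simp
    then show "\<tau> * (al p i + be p j) \<le> 1" using 1 by linarith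
  qed
  define q where "q = 1 - \<tau> * lam"
  have \<tau>lam: "\<tau> * lam \<le> 1 / 2"
  proof -
    have "\<tau> * lam \<le> 1 / (2 * lam) * lam" using \<tau>le2 \<tau>2_le(5) lam0 by (intro mult_right_mono) auto
    then show ?thesis using lam0 by simp
  qed
  have q01: "0 < q" "q \<le> 1" unfolding q_def using \<tau>lam \<tau>p lam0 by simp_all
  have qN: "rho \<le> q ^ N"
  proof -
    have "rho \<le> exp (- 2 * (\<tau> * lam)) ^ N"
    proof -
      have "real N * \<tau> * lam \<le> T * lam" using N\<tau>T lam0 by (intro mult_right_mono) auto
      then have "- 2 * (lam * T) \<le> real N * (- 2 * (\<tau> * lam))" by (simp add: algebra_simps)
      then show ?thesis unfolding rho_def exp_of_nat_mult[symmetric] by simp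
    qed
    also have "\<dots> \<le> q ^ N"
      unfolding q_def using exp_le_one_minus[of "\<tau> * lam"] \<tau>lam \<tau>p lam0 by (intro power_mono) auto
    finally show ?thesis .
  qed
  define y where "y = (\<lambda>k. W (tt k) (A (m k)))"
  define y' where "y' = (\<lambda>k. V (tt k) (A (\<nu> k)))"
  \<comment> \<open>The scheme for \<open>(m, u)\<close> takes \<open>u\<close> at the later time.
    Writing the equations for \<open>(\<nu>, v)\<close> in the same form leaves the residuals
    \<open>r\<close> and \<open>e\<close>.\<close>
  define r where "r = (\<lambda>k i. F (\<nu> k) (v k) i - F (\<nu> k) (v (Suc k)) i)"
  define e where "e = (\<lambda>k i. (v k i - v (Suc k) i) / \<tau> - (G (\<nu> k) (v (Suc k)) i - lam * (v (Suc k) i - As (y' k) i)))"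
  have uk: "u k i = u (Suc k) i + \<tau> * (G (m k) (u (Suc k)) i - lam * (u (Suc k) i - As (y k) i))" if "k < N" "i \<in> {1..n}" for k i
    using S(9)[OF that] unfolding char_val_def y_def tt_def by simp
  have mk: "m (Suc k) i = m k i - \<tau> * F (m k) (u (Suc k)) i" if "k < N" for k i
    using S(7)[OF that] by (simp add: fp_step_def)
  have vk: "v k i = v (Suc k) i + \<tau> * (G (\<nu> k) (v (Suc k)) i - lam * (v (Suc k) i - As (y' k) i) + e k i)" for k i
    unfolding e_def using \<tau>p by (simp add: field_simps)
  have \<nu>k: "\<nu> (Suc k) i = \<nu> k i - \<tau> * (F (\<nu> k) (v (Suc k)) i + r k i)" for k i
    unfolding r_def \<nu>S by (simp add: fp_step_def v_def)
  have ybd: "\<bar>y' k i\<bar> \<le> R" if "k \<le> N" "i \<in> {1..n}" for k i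
    unfolding y'_def using RV(2) tt[OF that(1)] A_PS[OF \<nu>PS[OF that(1)]] box_mono[OF _ R(3)] absR that(2) by blast
  have exp_k: "\<bar>v (Suc k) i - v k i + \<tau> * (G (\<nu> k) (v k) i - lam * (v k i - As (y' k) i))\<bar> \<le> \<tau> * (eps + \<eta>)"
    if "k < N" "i \<in> {1..n}" for k i
    using step_ex[OF that(1), of "\<nu> k"] \<nu>PS[of k] that unfolding v_def y'_def ttS \<nu>S by auto
  have vdiff: "\<bar>v k i - v (Suc k) i\<bar> \<le> \<tau> * CX" if "k < N" "i \<in> {1..n}" for k i
  proof -
    have kN: "k \<le> N" using that by simp
    have "\<bar>G (\<nu> k) (v k) i\<bar> \<le> (\<Sum>i=1..n. \<bar>G (\<nu> k) (v k) i\<bar>)" using that by (intro member_le_sum) auto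
    also have "\<dots> \<le> CG"
      by (rule order.trans[OF sum_mono CG'[rule_format, OF tt[OF kN] \<nu>M[OF kN] vbox[OF kN]]]) simp
    finally have g: "\<bar>G (\<nu> k) (v k) i\<bar> \<le> CG" .
    have "\<bar>v k i - As (y' k) i\<bar> \<le> 2 * R"
      using absR[OF vbox[OF kN] that(2)] As_bound[of "y' k" R i, OF ybd[OF kN] that(2)] by linarith
    then have "\<bar>lam * (v k i - As (y' k) i)\<bar> \<le> lam * (2 * R)" using lam0 by (simp add: abs_mult)
    then have "\<bar>G (\<nu> k) (v k) i - lam * (v k i - As (y' k) i)\<bar> \<le> CG + lam * (2 * R)" using g by linarith
    then have "\<bar>\<tau> * (G (\<nu> k) (v k) i - lam * (v k i - As (y' k) i))\<bar> \<le> \<tau> * (CG + lam * (2 * R))"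
      unfolding abs_mult using \<tau>p by simp
    then show ?thesis using exp_k[OF that] unfolding CX_def distrib_left by linarith
  qed
  have close: "(\<Sum>i=1..n. \<bar>G (\<nu> k) (v k) i - G (\<nu> k) (v (Suc k)) i\<bar> + \<bar>F (\<nu> k) (v k) i - F (\<nu> k) (v (Suc k)) i\<bar>
      + \<bar>char_rhs (tt k) (\<nu> k) (v k) i - char_rhs (tt k) (\<nu> k) (v (Suc k)) i\<bar>) < \<eta>" if k: "k < N" for k
  proof (rule dd'[rule_format])
    have "(\<Sum>i=1..n. \<bar>v k i - v (Suc k) i\<bar>) \<le> (\<Sum>i=1..n. \<tau> * CX)" using vdiff[OF k] by (intro sum_mono) auto
    also have "\<dots> = \<tau> * (real n * CX)" by simp
    also have "\<dots> \<le> d / (2 * real n * CX) * (real n * CX)"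
      using \<tau>le2 \<tau>2_le(6) nCX by (intro mult_right_mono) auto
    also have "\<dots> = d / 2" using n1 CX0 by simp
    finally have "(\<Sum>i=1..n. \<bar>v k i - v (Suc k) i\<bar>) < d" using d by linarith
    then show "\<bar>tt k - tt k\<bar> + (\<Sum>i=1..n. \<bar>\<nu> k i - \<nu> k i\<bar>) + (\<Sum>i=1..n. \<bar>v k i - v (Suc k) i\<bar>) < d" by simp
    show "tt k \<in> {0..T}" "tt k \<in> {0..T}" "\<nu> k \<in> M2S n" "\<nu> k \<in> M2S n"
      "v k \<in> box_fun {1..n} (- R) R" "v (Suc k) \<in> box_fun {1..n} (- R) R"
      using k tt[of k] \<nu>M[of k] vbox[of k] vbox[of "Suc k"] by auto
  qed
  have r_sum: "(\<Sum>i=1..n. \<bar>r k i\<bar>) \<le> \<eta>" if "k < N" for k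
    unfolding r_def by (rule order.trans[OF sum_mono less_imp_le[OF close[OF that]]]) simp
  have e_bd: "\<bar>e k i\<bar> \<le> eps + (2 + lam) * \<eta>" if "k < N" "i \<in> {1..n}" for k i
  proof -
    have "\<bar>G (\<nu> k) (v k) i - G (\<nu> k) (v (Suc k)) i\<bar> + \<bar>F (\<nu> k) (v k) i - F (\<nu> k) (v (Suc k)) i\<bar>
      + \<bar>char_rhs (tt k) (\<nu> k) (v k) i - char_rhs (tt k) (\<nu> k) (v (Suc k)) i\<bar> \<le> \<eta>"
      using member_le_sum[OF that(2), of "\<lambda>i. \<bar>G (\<nu> k) (v k) i - G (\<nu> k) (v (Suc k)) i\<bar> + \<bar>F (\<nu> k) (v k) i - F (\<nu> k) (v (Suc k)) i\<bar>
      + \<bar>char_rhs (tt k) (\<nu> k) (v k) i - char_rhs (tt k) (\<nu> k) (v (Suc k)) i\<bar>"] close[OF that(1)] by auto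
    then have g: "\<bar>G (\<nu> k) (v k) i - G (\<nu> k) (v (Suc k)) i\<bar> \<le> \<eta>" "\<bar>v k i - v (Suc k) i\<bar> \<le> \<eta>"
      unfolding char_rhs_def by linarith+
    have lv: "\<bar>lam * (v k i - v (Suc k) i)\<bar> \<le> lam * \<eta>" using g(2) lam0 by (simp add: abs_mult)
    have "\<tau> * (e k i + (G (\<nu> k) (v (Suc k)) i - G (\<nu> k) (v k) i) + lam * (v k i - v (Suc k) i))
       = - (v (Suc k) i - v k i + \<tau> * (G (\<nu> k) (v k) i - lam * (v k i - As (y' k) i)))"
      by (rule consistency_identity[OF vk[of k i]])
    then have "\<tau> * \<bar>e k i + (G (\<nu> k) (v (Suc k)) i - G (\<nu> k) (v k) i) + lam * (v k i - v (Suc k) i)\<bar> \<le> \<tau> * (eps + \<eta>)"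
      by (rule abs_le_of_scaled[OF _ exp_k[OF that] \<tau>p])
    then have "\<bar>e k i + (G (\<nu> k) (v (Suc k)) i - G (\<nu> k) (v k) i) + lam * (v k i - v (Suc k) i)\<bar> \<le> eps + \<eta>"
      using \<tau>p by simp
    then show ?thesis using g(1) lv by (simp add: distrib_right)
  qed
  have e_bd2: "\<bar>e k i\<bar> \<le> 2 * eps" if "k < N" "i \<in> {1..n}" for k i
  proof -
    have "R * \<eta> \<ge> 0" using R \<eta>0 by simp
    then show ?thesis using e_bd[OF that] \<eta>2 \<eta>0 by (simp add: distrib_right)
  qed
  define z where "z = (\<lambda>k i. u k i - v k i)"
  define \<mu> where "\<mu> = (\<lambda>k i. m k i - \<nu> k i)"
  define Q where "Q = (\<lambda>k. pairing n (z k) (\<mu> k))"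
  define gp where "gp = (\<lambda>k. pairing n (m k) (gap (u (Suc k)) (v (Suc k))))"
  have gp0: "gp k \<ge> 0" if "k \<le> N" for k unfolding gp_def using pairing_gap_nonneg mM[OF that] by blast
  have \<mu>1: "(\<Sum>i=1..n. \<bar>\<mu> k i\<bar>) \<le> 2" if "k \<le> N" for k
    unfolding \<mu>_def by (rule PS_diff_abs_le[OF mPS[OF that] \<nu>PS[OF that]])
  have zR: "\<bar>z k i\<bar> \<le> 2 * R" if "k \<le> N" "i \<in> {1..n}" for k i
    using absR[OF ubox[OF that(1)] that(2)] absR[OF vbox[OF that(1)] that(2)] unfolding z_def by linarith
  \<comment> \<open>Discrete product rule for the pairing of \<open>u - v\<close> with
    \<open>m - \<nu>\<close>; the Lasry-Lions identity makes the increment control the gap.\<close>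
  have LLstep: "q * Q (Suc k) + \<tau> * gp k - \<tau> * (K0 * eps) \<le> Q k" if k: "k < N" for k
  proof -
    have kN: "k \<le> N" "Suc k \<le> N" using k by auto
    let ?u = "u (Suc k)" and ?v = "v (Suc k)"
    define \<Delta> where "\<Delta> = (\<lambda>i. F (m k) ?u i - F (\<nu> k) ?v i - r k i)"
    have zk: "z k i - z (Suc k) i = \<tau> * ((G (m k) ?u i - G (\<nu> k) ?v i) - lam * z (Suc k) i + lam * As (\<lambda>j. y k j - y' k j) i - e k i)" if "i \<in> {1..n}" for i
      unfolding z_def As_diff using uk[OF k that] vk[of k i] by (simp add: algebra_simps)
    have \<mu>k: "\<mu> (Suc k) i = \<mu> k i - \<tau> * \<Delta> i" for i
      unfolding \<mu>_def \<Delta>_def using mk[OF k] \<nu>k[of k i] by (simp add: algebra_simps)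
    have "Q k - Q (Suc k) = pairing n (\<lambda>i. z k i - z (Suc k) i) (\<mu> k) + pairing n (z (Suc k)) (\<lambda>i. \<mu> k i - \<mu> (Suc k) i)"
      unfolding Q_def pairing_diff_left pairing_diff_right by simp
    also have "pairing n (\<lambda>i. z k i - z (Suc k) i) (\<mu> k)
      = \<tau> * (pairing n (\<lambda>i. G (m k) ?u i - G (\<nu> k) ?v i) (\<mu> k) - lam * pairing n (z (Suc k)) (\<mu> k)
         + lam * pairing n (\<lambda>j. y k j - y' k j) (A_disc M n (\<mu> k)) - pairing n (e k) (\<mu> k))"
      unfolding pairing_As[symmetric] pairing_scale_left[symmetric] pairing_diff_left[symmetric] pairing_add_left[symmetric]
      by (intro pairing_cong) (auto simp: zk)
    also have "pairing n (z (Suc k)) (\<lambda>i. \<mu> k i - \<mu> (Suc k) i) = \<tau> * pairing n \<Delta> (z (Suc k))"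
      unfolding pairing_commute[of n "z (Suc k)"] pairing_scale_left[symmetric] by (intro pairing_cong) (auto simp: \<mu>k)
    also have "pairing n \<Delta> (z (Suc k)) = pairing n (\<lambda>i. F (m k) ?u i - F (\<nu> k) ?v i) (\<lambda>i. ?u i - ?v i) - pairing n (r k) (z (Suc k))"
      unfolding \<Delta>_def z_def pairing_diff_left pairing_diff_right by simp
    finally have main: "Q k - Q (Suc k) = \<tau> * ((pairing n (\<lambda>i. G (m k) ?u i - G (\<nu> k) ?v i) (\<mu> k)
        + pairing n (\<lambda>i. F (m k) ?u i - F (\<nu> k) ?v i) (\<lambda>i. ?u i - ?v i))
        - lam * pairing n (z (Suc k)) (\<mu> k) + lam * pairing n (\<lambda>j. y k j - y' k j) (A_disc M n (\<mu> k))
        - pairing n (e k) (\<mu> k) - pairing n (r k) (z (Suc k)))"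
      by (simp add: algebra_simps)
    have 1: "gp k \<le> pairing n (\<lambda>i. G (m k) ?u i - G (\<nu> k) ?v i) (\<mu> k) + pairing n (\<lambda>i. F (m k) ?u i - F (\<nu> k) ?v i) (\<lambda>i. ?u i - ?v i)"
      unfolding \<mu>_def lasry_lions gp_def using fn_mono[OF mM[OF kN(1)] \<nu>M[OF kN(1)]] pairing_gap_nonneg[OF \<nu>M[OF kN(1)]] by simp
    have 2: "\<bar>pairing n (e k) (\<mu> k)\<bar> \<le> (eps + (2 + lam) * \<eta>) * 2"
      using e_bd[OF k] \<mu>1[OF kN(1)] pars lam0 \<eta>0 by (intro abs_pairing_le) auto
    have 3: "\<bar>pairing n (z (Suc k)) (r k)\<bar> \<le> 2 * R * \<eta>"
      using zR[OF kN(2)] r_sum[OF k] R by (intro abs_pairing_le) auto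
    \<comment> \<open>\<open>V_comparison\<close> at the states after the jump: the pairing there is
      negative by no more than \<open>4 * eps * T\<close>.\<close>
    have 4: "- (4 * eps * T) \<le> pairing n (\<lambda>j. y k j - y' k j) (A_disc M n (\<mu> k))"
    proof -
      have "pairing n (\<lambda>j. y k j - y' k j) (A_disc M n (\<mu> k)) = pairing n (\<lambda>j. y k j - y' k j) (\<lambda>i. A (m k) i - A (\<nu> k) i)"
        unfolding pairing_As[symmetric] \<mu>_def pairing_As_diff ..
      then show ?thesis unfolding y_def y'_def
        using V_comparison[OF tt[OF kN(1)] A_M2S[OF mM[OF kN(1)]] A_PS[OF \<nu>PS[OF kN(1)]]] by simp
    qed
    then have 4: "- (lam * (4 * eps * T)) \<le> lam * pairing n (\<lambda>j. y k j - y' k j) (A_disc M n (\<mu> k))"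
      using lam0 mult_left_mono[of "- (4 * eps * T)" _ lam] by simp
    \<comment> \<open>The killing term pairs the later value with the earlier measure; replacing
      this by \<open>Q (Suc k)\<close> costs one time shift.\<close>
    have 5: "\<bar>pairing n (z (Suc k)) (\<mu> k) - Q (Suc k)\<bar> \<le> \<eta> + 2 * R * \<eta> * \<tau>"
    proof -
      have sF: "(\<Sum>i=1..n. \<bar>F (m k) ?u i\<bar>) \<le> CG"
        by (rule order.trans[OF sum_mono CG'[rule_format, OF tt[OF kN(1)] mM[OF kN(1)] ubox[OF kN(2)]]]) simp
      have sF': "(\<Sum>i=1..n. \<bar>F (\<nu> k) ?v i\<bar>) \<le> CG"
        by (rule order.trans[OF sum_mono CG'[rule_format, OF tt[OF kN(1)] \<nu>M[OF kN(1)] vbox[OF kN(2)]]]) simp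
      have "(\<Sum>i=1..n. \<bar>\<Delta> i\<bar>) \<le> (\<Sum>i=1..n. \<bar>F (m k) ?u i\<bar> + \<bar>F (\<nu> k) ?v i\<bar> + \<bar>r k i\<bar>)"
        unfolding \<Delta>_def by (intro sum_mono) linarith
      then have sD: "(\<Sum>i=1..n. \<bar>\<Delta> i\<bar>) \<le> 2 * CG + \<eta>" using sF sF' r_sum[OF k] by (simp add: sum.distrib)
      have "pairing n (z (Suc k)) (\<mu> k) - Q (Suc k) = \<tau> * pairing n (z (Suc k)) \<Delta>"
        unfolding Q_def pairing_diff_right[symmetric] pairing_scale_right[symmetric] by (intro pairing_cong) (auto simp: \<mu>k)
      moreover have "\<bar>pairing n (z (Suc k)) \<Delta>\<bar> \<le> 2 * R * (2 * CG + \<eta>)"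
        using zR[OF kN(2)] sD R by (intro abs_pairing_le) auto
      then have "\<tau> * \<bar>pairing n (z (Suc k)) \<Delta>\<bar> \<le> \<tau> * (2 * R * (2 * CG + \<eta>))" using \<tau>p by (intro mult_left_mono) auto
      moreover have "\<tau> * (4 * R * CG + 1) \<le> \<eta>"
      proof -
        have "\<tau> \<le> \<eta> / (4 * R * CG + 1)" using \<tau>le2 \<tau>2_le(7) by linarith
        then show ?thesis using den2 by (simp add: pos_le_divide_eq)
      qed
      ultimately show ?thesis using \<tau>p by (simp add: abs_mult algebra_simps)
    qed
    have lt: "lam * (2 * R * \<eta> * \<tau>) \<le> R * \<eta>"
    proof -
      have "\<tau> * lam * (2 * R * \<eta>) \<le> 1 / 2 * (2 * R * \<eta>)" using \<tau>lam R \<eta>0 by (intro mult_right_mono) auto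
      then show ?thesis by (simp add: algebra_simps)
    qed
    have 6: "lam * pairing n (z (Suc k)) (\<mu> k) \<le> lam * Q (Suc k) + lam * \<eta> + R * \<eta>"
    proof -
      have "pairing n (z (Suc k)) (\<mu> k) \<le> Q (Suc k) + \<eta> + 2 * R * \<eta> * \<tau>" using 5 by linarith
      then have "lam * pairing n (z (Suc k)) (\<mu> k) \<le> lam * (Q (Suc k) + \<eta> + 2 * R * \<eta> * \<tau>)" using lam0 by (intro mult_left_mono) auto
      then show ?thesis using lt by (simp add: distrib_left)
    qed
    have fin: "lam * \<eta> + R * \<eta> + lam * (4 * eps * T) + (eps + (2 + lam) * \<eta>) * 2 + 2 * R * \<eta> \<le> K0 * eps"
    proof -
      have "R * \<eta> \<ge> 0" using R \<eta>0 by simp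
      then have "3 * (lam * \<eta>) + 4 * \<eta> + 3 * (R * \<eta>) \<le> eps" using \<eta>2 \<eta>0 by linarith
      then show ?thesis unfolding K0_def by (simp add: algebra_simps)
    qed
    have "gp k - lam * Q (Suc k) - K0 * eps \<le> (pairing n (\<lambda>i. G (m k) ?u i - G (\<nu> k) ?v i) (\<mu> k)
        + pairing n (\<lambda>i. F (m k) ?u i - F (\<nu> k) ?v i) (\<lambda>i. ?u i - ?v i))
        - lam * pairing n (z (Suc k)) (\<mu> k) + lam * pairing n (\<lambda>j. y k j - y' k j) (A_disc M n (\<mu> k))
        - pairing n (e k) (\<mu> k) - pairing n (r k) (z (Suc k))"
      using 1 2 3 4 6 fin unfolding pairing_commute[of n "r k"] abs_le_iff by linarith
    then have "\<tau> * (gp k - lam * Q (Suc k) - K0 * eps) \<le> Q k - Q (Suc k)"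
      unfolding main using \<tau>p by (intro mult_left_mono) auto
    then show ?thesis unfolding q_def by (simp add: algebra_simps)
  qed
  have ttN: "tt N = T" unfolding tt_def using N\<tau> by simp
  have zN: "z N i = gn (m N) i - gn (\<nu> N) i" if "i \<in> {1..n}" for i
    unfolding z_def v_def ttN using S(10)[OF that] V_terminal[OF \<nu>PS[of N] that] by simp
  have QN: "Q N \<ge> 0"
  proof -
    have "Q N = pairing n (\<lambda>i. gn (m N) i - gn (\<nu> N) i) (\<lambda>i. m N i - \<nu> N i)"
      unfolding Q_def \<mu>_def by (intro pairing_cong zN) auto
    then show ?thesis using gn_mono[OF mM[of N] \<nu>M[of N]] by simp
  qed
  \<comment> \<open>Backward recursion in which the weights of all gaps are lowered to the common
    value \<open>q ^ l\<close> and those of the errors raised to 1.\<close>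
  have Qsum: "q ^ l * (\<Sum>k=N-l..<N. \<tau> * gp k) - real l * (\<tau> * (K0 * eps)) \<le> Q (N - l)" if "l \<le> N" for l
    using that
  proof (induction l)
    case 0 then show ?case using QN by simp
  next
    case (Suc l)
    let ?k = "N - Suc l"
    have k: "?k < N" "Suc ?k = N - l" using Suc.prems by auto
    have IH: "q ^ l * (\<Sum>k=N-l..<N. \<tau> * gp k) - real l * (\<tau> * (K0 * eps)) \<le> Q (N - l)" using Suc by auto
    have sum: "(\<Sum>k=?k..<N. \<tau> * gp k) = \<tau> * gp ?k + (\<Sum>k=N-l..<N. \<tau> * gp k)"
      using sum.atLeast_Suc_lessThan[OF k(1), of "\<lambda>k. \<tau> * gp k"] k(2) by simp
    have "q * (q ^ l * (\<Sum>k=N-l..<N. \<tau> * gp k) - real l * (\<tau> * (K0 * eps))) \<le> q * Q (N - l)"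
      using IH q01 by (intro mult_left_mono) auto
    moreover have "q * (real l * (\<tau> * (K0 * eps))) \<le> 1 * (real l * (\<tau> * (K0 * eps)))"
      using q01 \<tau>p K_nonneg(1) pars by (intro mult_right_mono) auto
    moreover have "q ^ Suc l * (\<tau> * gp ?k) \<le> 1 * (\<tau> * gp ?k)"
      using q01 \<tau>p gp0[of ?k] by (intro mult_right_mono power_le_one) auto
    moreover have "q * Q (N - l) + \<tau> * gp ?k - \<tau> * (K0 * eps) \<le> Q ?k"
      using LLstep[OF k(1)] k(2) by simp
    ultimately show ?case unfolding sum by (simp add: algebra_simps)
  qed
  have gp_sum: "(\<Sum>k<N. \<tau> * gp k) \<le> K1 * eps"
  proof -
    \<comment> \<open>Both flows of measures start from \<open>m0\<close>. Together with
      \<open>Q N \<ge> 0\<close> this leaves the accumulated gap bounded by errors alone.\<close>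
    have Q0: "Q 0 = 0" unfolding Q_def \<mu>_def using S(4) \<nu>0 by (simp add: pairing_def)
    have sum0: "(\<Sum>k<N. \<tau> * gp k) \<ge> 0" using gp0 \<tau>p by (intro sum_nonneg) auto
    have "q ^ N * (\<Sum>k=0..<N. \<tau> * gp k) \<le> real N * \<tau> * (K0 * eps)"
      using Qsum[of N] Q0 by simp
    also have "\<dots> \<le> T * (K0 * eps)" using N\<tau>T K_nonneg(1) pars by (intro mult_right_mono) auto
    finally have "q ^ N * (\<Sum>k<N. \<tau> * gp k) \<le> T * (K0 * eps)" by (simp add: atLeast0LessThan)
    moreover have "rho * (\<Sum>k<N. \<tau> * gp k) \<le> q ^ N * (\<Sum>k<N. \<tau> * gp k)"
      using qN sum0 by (intro mult_right_mono) auto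
    ultimately have "rho * (\<Sum>k<N. \<tau> * gp k) \<le> T * (K0 * eps)" by linarith
    then show ?thesis unfolding K1_def using K_nonneg(2) by (simp add: pos_le_divide_eq mult.commute mult.left_commute)
  qed
  \<comment> \<open>A jump covers the distance \<open>1 / n\<close>, so differences of rates divided
    by \<open>n\<close> are differences of drifts.\<close>
  define x1 where "x1 = (\<lambda>k j. \<bar>al (u (Suc k)) j - al (v (Suc k)) j\<bar> / real n)"
  define x2 where "x2 = (\<lambda>k j. \<bar>be (u (Suc k)) j - be (v (Suc k)) j\<bar> / real n)"
  define dr where "dr = (\<lambda>k. \<Sum>j=1..n. m k j * (x1 k j + x2 k j))"
  have x0: "x1 k j \<ge> 0" "x2 k j \<ge> 0" for k j unfolding x1_def x2_def by simp_all
  have dr0: "dr k \<ge> 0" if "k \<le> N" for k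
    unfolding dr_def using M2S_nonneg[OF mM[OF that]] x0 by (intro sum_nonneg mult_nonneg_nonneg add_nonneg_nonneg) auto
  \<comment> \<open>The parameter \<open>s = sqrt eps\<close> balances the two terms of
    \<open>min_square_le\<close>: the first contributes \<open>s\<close>, the second the accumulated
    gap, of order \<open>eps\<close>, divided by \<open>s\<close>.\<close>
  define kap where "kap = (1 + 1 / s) / c0"
  have kap0: "kap \<ge> 0" unfolding kap_def using s0 pars by simp
  have kaps: "kap * s = (s + 1) / c0"
  proof -
    have "(1 + 1 / s) * s = s + 1" using s0 by (simp add: distrib_right)
    then show ?thesis unfolding kap_def times_divide_eq_left by simp
  qed
  have dr_le: "dr k \<le> 2 * s + kap * gp k" if k: "k < N" for k
  proof -
    have kN: "k \<le> N" "Suc k \<le> N" using k by auto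
    have "dr k \<le> (\<Sum>j=1..n. m k j * (2 * s + kap * gap (u (Suc k)) (v (Suc k)) j))"
      unfolding dr_def
    proof (intro sum_mono mult_left_mono M2S_nonneg[OF mM[OF kN(1)]])
      fix j assume j: "j \<in> {1..n}"
      have "c0 * (min (x1 k j) ((x1 k j)\<^sup>2) + min (x2 k j) ((x2 k j)\<^sup>2)) \<le> gap (u (Suc k)) (v (Suc k)) j"
        unfolding v_def by (rule gap_lower[OF tt[OF kN(2)] \<nu>PS[OF kN(2)] j]) (auto simp: x1_def x2_def v_def)
      then have "min (x1 k j) ((x1 k j)\<^sup>2) + min (x2 k j) ((x2 k j)\<^sup>2) \<le> gap (u (Suc k)) (v (Suc k)) j / c0"
        using pars by (simp add: pos_le_divide_eq mult.commute)
      then have "(1 + 1 / s) * (min (x1 k j) ((x1 k j)\<^sup>2) + min (x2 k j) ((x2 k j)\<^sup>2)) \<le> (1 + 1 / s) * (gap (u (Suc k)) (v (Suc k)) j / c0)"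
        using s0 by (intro mult_left_mono) auto
      moreover have "(1 + 1 / s) * (gap (u (Suc k)) (v (Suc k)) j / c0) = kap * gap (u (Suc k)) (v (Suc k)) j"
        unfolding kap_def by simp
      ultimately show "x1 k j + x2 k j \<le> 2 * s + kap * gap (u (Suc k)) (v (Suc k)) j"
        using min_square_le[OF s0 x0(1), of k j] min_square_le[OF s0 x0(2), of k j]
        unfolding distrib_left[of "1 + 1 / s"] by linarith
    qed
    also have "\<dots> = (\<Sum>j=1..n. m k j * (2 * s) + kap * (m k j * gap (u (Suc k)) (v (Suc k)) j))"
      by (intro sum.cong) (auto simp: algebra_simps)
    also have "\<dots> = (\<Sum>j=1..n. m k j) * (2 * s) + kap * gp k"
      unfolding gp_def pairing_def sum.distrib sum_distrib_left sum_distrib_right ..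
    also have "(\<Sum>j=1..n. m k j) = 1" using mPS[OF kN(1)] by (simp add: PS_def)
    finally show ?thesis by simp
  qed
  have dr_sum: "(\<Sum>k<N. \<tau> * dr k) \<le> K2 * s"
  proof -
    have "(\<Sum>k<N. \<tau> * dr k) \<le> (\<Sum>k<N. \<tau> * (2 * s + kap * gp k))"
      using dr_le \<tau>p by (intro sum_mono mult_left_mono) auto
    also have "\<dots> = (\<Sum>k<N. \<tau> * (2 * s) + kap * (\<tau> * gp k))"
      by (intro sum.cong) (auto simp: algebra_simps)
    also have "\<dots> = real N * \<tau> * (2 * s) + kap * (\<Sum>k<N. \<tau> * gp k)"
      by (simp add: sum.distrib sum_distrib_left)
    also have "\<dots> \<le> T * (2 * s) + kap * (K1 * eps)"
      using N\<tau>T s0 gp_sum kap0 by (intro add_mono mult_right_mono mult_left_mono) auto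
    also have "kap * (K1 * eps) = kap * s * K1 * s" unfolding ss[symmetric] by simp
    also have "\<dots> = (s + 1) * K1 / c0 * s" unfolding kaps by simp
    also have "(s + 1) * K1 / c0 * s \<le> (sqrt E0 + 1) * K1 / c0 * s"
      using sE K_nonneg(4) s0 pars by (intro mult_right_mono divide_right_mono) auto
    finally show ?thesis unfolding K2_def by (simp add: algebra_simps)
  qed
  \<comment> \<open>Growth factor per step for the Lipschitz constant of a test function under the
    backward flow of \<open>V\<close>.\<close>
  define g where "g = 1 + 2 * Lam * \<tau>"
  have g1: "g \<ge> 1" unfolding g_def using pars \<tau>p by simp
  \<comment> \<open>Duality: pairing with the measures after a step is pairing with the test
    function transported back by one step. The test function changes from step to step, hence the
    generalisation over \<open>\<phi>\<close> and \<open>l\<close>. The difference of the two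
    generators costs \<open>l * dr k\<close>.\<close>
  have W1step: "pairing n \<phi> (\<mu> k) \<le> l * (g ^ k * (\<Sum>j<k. \<tau> * dr j)) + real k * (\<tau> * \<eta>)"
    if "grid_lipschitz n l \<phi>" "0 \<le> l" "k \<le> N" for \<phi> l k
    using that
  proof (induction k arbitrary: \<phi> l)
    case 0
    then show ?case unfolding \<mu>_def using S(4) \<nu>0 by (simp add: pairing_def)
  next
    case (Suc k)
    have k: "k < N" "k \<le> N" "Suc k \<le> N" using Suc.prems by auto
    let ?u = "u (Suc k)" and ?v = "v (Suc k)"
    define \<phi>' where "\<phi>' = (\<lambda>i. \<phi> i + \<tau> * gen ?v \<phi> i)"
    have lip: "\<bar>\<phi> (next_idx n i) - \<phi> i\<bar> \<le> l / real n" "\<bar>\<phi> i\<bar> \<le> 1" if "i \<in> {1..n}" for i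
      using Suc.prems(1) that unfolding grid_lipschitz_def by auto
    have lip': "\<bar>\<phi> (prev_idx n i) - \<phi> i\<bar> \<le> l / real n" if "i \<in> {1..n}" for i
      using lip(1)[OF prev_idx_in[OF that]] next_prev_idx[OF that] by (simp add: abs_minus_commute)
    have "grid_lipschitz n (g * l) \<phi>'"
      unfolding grid_lipschitz_def
    proof (intro conjI ballI)
      fix i assume i: "i \<in> {1..n}"
      have b: "\<phi> j \<le> 1" "- 1 \<le> \<phi> j" if "j \<in> {1..n}" for j using lip(2)[OF that] by linarith+
      note rt = rates(2)[OF vbox[OF k(3)] i i]
      have "\<phi>' i \<le> 1" unfolding \<phi>'_def by (rule euler_upper0[OF i less_imp_le[OF \<tau>p] rt b(1)])
      moreover have "- 1 \<le> \<phi>' i" unfolding \<phi>'_def by (rule euler_lower0[OF i less_imp_le[OF \<tau>p] rt b(2)])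
      ultimately show "\<bar>\<phi>' i\<bar> \<le> 1" by simp
      let ?j = "next_idx n i" and ?h = "prev_idx n i"
      have j: "?j \<in> {1..n}" by (rule next_idx_in[OF i])
      define di dj dh where "di = \<phi> ?j - \<phi> i" and "dj = \<phi> (next_idx n ?j) - \<phi> ?j" and "dh = \<phi> ?h - \<phi> i"
      have db: "\<bar>di\<bar> \<le> l / real n" "\<bar>dj\<bar> \<le> l / real n" "\<bar>dh\<bar> \<le> l / real n"
        unfolding di_def dj_def dh_def using lip(1)[OF i] lip(1)[OF j] lip'[OF i] by auto
      \<comment> \<open>The new increment in terms of the three adjacent old ones. All weights are
        nonnegative, and by \<open>V_drift\<close> they sum to at most \<open>g\<close>: only the
        one-sided variation of the rates enters, not their size.\<close>
      have eq: "\<phi>' ?j - \<phi>' i = (1 - \<tau> * (al ?v i + be ?v ?j)) * di + \<tau> * al ?v ?j * dj - \<tau> * be ?v i * dh"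
        unfolding \<phi>'_def gen_def di_def dj_def dh_def prev_next_idx[OF i] by (simp add: algebra_simps)
      have nn: "0 \<le> 1 - \<tau> * (al ?v i + be ?v ?j)" "0 \<le> \<tau> * al ?v ?j" "0 \<le> \<tau> * be ?v i"
        using rates(2)[OF vbox[OF k(3)] i j] al0[OF j] be0[OF i] \<tau>p by auto
      have "\<bar>\<phi>' ?j - \<phi>' i\<bar> \<le> (1 - \<tau> * (al ?v i + be ?v ?j)) * \<bar>di\<bar> + \<tau> * al ?v ?j * \<bar>dj\<bar> + \<tau> * be ?v i * \<bar>dh\<bar>"
      proof -
        have "\<bar>(1 - \<tau> * (al ?v i + be ?v ?j)) * di\<bar> = (1 - \<tau> * (al ?v i + be ?v ?j)) * \<bar>di\<bar>"
          "\<bar>\<tau> * al ?v ?j * dj\<bar> = \<tau> * al ?v ?j * \<bar>dj\<bar>" "\<bar>\<tau> * be ?v i * dh\<bar> = \<tau> * be ?v i * \<bar>dh\<bar>"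
          using nn by (simp_all only: abs_mult[of _ di] abs_mult[of _ dj] abs_mult[of _ dh] abs_of_nonneg)
        then show ?thesis unfolding eq by linarith
      qed
      also have "\<dots> \<le> (1 - \<tau> * (al ?v i + be ?v ?j)) * (l / real n) + \<tau> * al ?v ?j * (l / real n) + \<tau> * be ?v i * (l / real n)"
        using db nn by (intro add_mono mult_left_mono) auto
      also have "\<dots> = (1 + \<tau> * ((al ?v ?j - al ?v i) + (be ?v i - be ?v ?j))) * (l / real n)"
        by (simp add: algebra_simps)
      also have "\<dots> \<le> g * (l / real n)"
      proof (intro mult_right_mono)
        have "(al ?v ?j - al ?v i) + (be ?v i - be ?v ?j) \<le> 2 * Lam"
          using V_drift[OF tt[OF k(3)] \<nu>PS[OF k(3)] i] unfolding v_def by linarith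
        then have "\<tau> * ((al ?v ?j - al ?v i) + (be ?v i - be ?v ?j)) \<le> \<tau> * (2 * Lam)" using \<tau>p by (intro mult_left_mono) auto
        then show "1 + \<tau> * ((al ?v ?j - al ?v i) + (be ?v i - be ?v ?j)) \<le> g" unfolding g_def by (simp add: algebra_simps)
      qed (use Suc.prems(2) in simp)
      finally show "\<bar>\<phi>' ?j - \<phi>' i\<bar> \<le> g * l / real n" by simp
    qed
    then have IH: "pairing n \<phi>' (\<mu> k) \<le> g * l * (g ^ k * (\<Sum>j<k. \<tau> * dr j)) + real k * (\<tau> * \<eta>)"
      using Suc.prems g1 k(2) by (intro Suc.IH) auto
    have eq: "pairing n \<phi> (\<mu> (Suc k)) = pairing n \<phi>' (\<mu> k)
        + \<tau> * pairing n (\<lambda>i. gen ?u \<phi> i - gen ?v \<phi> i) (m k) + \<tau> * pairing n \<phi> (r k)"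
    proof -
      have "pairing n \<phi> (m (Suc k)) = pairing n (\<lambda>i. \<phi> i + \<tau> * gen ?u \<phi> i) (m k)"
        unfolding S(7)[OF k(1)] by (rule pairing_fp_step)
      moreover have "pairing n \<phi> (\<nu> (Suc k)) = pairing n (\<lambda>i. \<phi> i + \<tau> * gen ?v \<phi> i) (\<nu> k) - \<tau> * pairing n \<phi> (r k)"
      proof -
        have "pairing n \<phi> (\<nu> (Suc k)) = pairing n \<phi> (\<lambda>i. fp_step \<tau> (\<nu> k) ?v i - \<tau> * r k i)"
          by (intro pairing_cong) (auto simp: \<nu>k fp_step_def algebra_simps)
        also have "\<dots> = pairing n \<phi> (fp_step \<tau> (\<nu> k) ?v) - \<tau> * pairing n \<phi> (r k)"
          unfolding pairing_diff_right pairing_scale_right ..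
        finally show ?thesis unfolding pairing_fp_step .
      qed
      ultimately show ?thesis
        unfolding \<mu>_def \<phi>'_def pairing_diff_left pairing_diff_right pairing_add_left pairing_scale_left
        by (simp add: algebra_simps)
    qed
    have 1: "pairing n (\<lambda>i. gen ?u \<phi> i - gen ?v \<phi> i) (m k) \<le> l * dr k"
    proof -
      have "pairing n (\<lambda>i. gen ?u \<phi> i - gen ?v \<phi> i) (m k) \<le> (\<Sum>i=1..n. l * (x1 k i + x2 k i) * m k i)"
        unfolding pairing_def
      proof (intro sum_mono mult_right_mono M2S_nonneg[OF mM[OF k(2)]])
        fix i assume i: "i \<in> {1..n}"
        have "gen ?u \<phi> i - gen ?v \<phi> i = (al ?u i - al ?v i) * (\<phi> (next_idx n i) - \<phi> i) + (be ?u i - be ?v i) * (\<phi> (prev_idx n i) - \<phi> i)"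
          by (simp add: gen_def algebra_simps)
        also have "\<dots> \<le> \<bar>al ?u i - al ?v i\<bar> * (l / real n) + \<bar>be ?u i - be ?v i\<bar> * (l / real n)"
          by (rule add_mono[OF mult_le_abs_mult[OF lip(1)[OF i]] mult_le_abs_mult[OF lip'[OF i]]])
        also have "\<dots> = l * (x1 k i + x2 k i)" unfolding x1_def x2_def by (simp add: algebra_simps)
        finally show "gen ?u \<phi> i - gen ?v \<phi> i \<le> l * (x1 k i + x2 k i)" .
      qed
      also have "\<dots> = l * dr k" unfolding dr_def sum_distrib_left by (intro sum.cong) (auto simp: algebra_simps)
      finally show ?thesis .
    qed
    have 2: "pairing n \<phi> (r k) \<le> \<eta>"
      using abs_pairing_le[of n \<phi> 1 "r k" \<eta>] lip(2) r_sum[OF k(1)] by (auto simp: abs_le_iff)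
    have "\<tau> * pairing n (\<lambda>i. gen ?u \<phi> i - gen ?v \<phi> i) (m k) \<le> \<tau> * (l * dr k)" "\<tau> * pairing n \<phi> (r k) \<le> \<tau> * \<eta>"
      using 1 2 \<tau>p by (intro mult_left_mono; simp)+
    moreover have "1 * (\<tau> * (l * dr k)) \<le> g ^ Suc k * (\<tau> * (l * dr k))"
      using g1 \<tau>p Suc.prems(2) dr0[OF k(2)] by (intro mult_right_mono one_le_power mult_nonneg_nonneg) auto
    ultimately have "pairing n \<phi> (\<mu> (Suc k)) \<le> g * l * (g ^ k * (\<Sum>j<k. \<tau> * dr j)) + real k * (\<tau> * \<eta>)
        + g ^ Suc k * (\<tau> * (l * dr k)) + \<tau> * \<eta>"
      unfolding eq using IH by linarith
    also have "\<dots> = l * (g ^ Suc k * (\<Sum>j<Suc k. \<tau> * dr j)) + real (Suc k) * (\<tau> * \<eta>)"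
      by (simp add: algebra_simps)
    finally show ?case .
  qed
  define w where "w = K3 * s"
  have w0: "w \<ge> 0" unfolding w_def using K_nonneg s0 by simp
  have W1: "W1_close n (m k) (\<nu> k) w" if k: "k \<le> N" for k
    unfolding W1_close_def
  proof (intro allI impI)
    fix \<phi> assume \<phi>: "grid_lipschitz n 1 \<phi>"
    have "pairing n \<phi> (\<mu> k) \<le> 1 * (g ^ k * (\<Sum>j<k. \<tau> * dr j)) + real k * (\<tau> * \<eta>)"
      using W1step[OF \<phi> _ k] by simp
    also have "\<dots> \<le> exp (2 * Lam * T) * (K2 * s) + T * \<eta>"
    proof (rule add_mono)
      have "real k * \<tau> \<le> real N * \<tau>" using k \<tau>p by (intro mult_right_mono) auto
      then have kT: "real k * \<tau> \<le> T" using N\<tau>T by linarith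
      then show "real k * (\<tau> * \<eta>) \<le> T * \<eta>" using \<eta>0 mult_right_mono[of "real k * \<tau>" T \<eta>] by simp
      have "g \<le> exp (2 * Lam * \<tau>)" unfolding g_def by (rule exp_ge_add_one_self)
      then have "g ^ k \<le> exp (2 * Lam * \<tau>) ^ k" using g1 by (intro power_mono) auto
      also have "\<dots> = exp (2 * Lam * (real k * \<tau>))" by (simp add: exp_of_nat_mult[symmetric] algebra_simps)
      also have "\<dots> \<le> exp (2 * Lam * T)" using kT pars by (simp add: mult_left_mono)
      finally have gk: "g ^ k \<le> exp (2 * Lam * T)" .
      have "(\<Sum>j<k. \<tau> * dr j) \<le> (\<Sum>j<N. \<tau> * dr j)"
        using k dr0 \<tau>p by (intro sum_mono2) auto
      then have "(\<Sum>j<k. \<tau> * dr j) \<le> K2 * s" using dr_sum by linarith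
      moreover have "0 \<le> (\<Sum>j<k. \<tau> * dr j)" using k dr0 \<tau>p by (intro sum_nonneg) auto
      ultimately show "1 * (g ^ k * (\<Sum>j<k. \<tau> * dr j)) \<le> exp (2 * Lam * T) * (K2 * s)"
        using gk by (simp add: mult_mono)
    qed
    also have "\<dots> \<le> w" unfolding w_def K3_def using \<eta>3 by (simp add: algebra_simps)
    finally show "pairing n \<phi> (\<lambda>i. m k i - \<nu> k i) \<le> w" unfolding \<mu>_def .
  qed
  \<comment> \<open>Sources in the equation for \<open>u - v\<close> apart from \<open>Ebar\<close>:
    shift of the jump target, change of the coupling, residual.\<close>
  define X where "X = lam * (CV * (CA * w)) + CV * w + 2 * eps"
  have X0: "X \<ge> 0" unfolding X_def using lam0 pars w0 by simp
  \<comment> \<open>Maximum principle backwards in time. The upper bound linearises \<open>B\<close>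
    at \<open>v\<close>, the lower bound at \<open>u\<close>. One step maps the bound to
    \<open>q\<close> times itself plus \<open>(1 - q) * Ebar\<close>, since
    \<open>\<tau> * lam = 1 - q\<close>; thus the weight of \<open>Ebar\<close> after
    \<open>l\<close> steps is \<open>1 - q ^ l\<close>.\<close>
  have Zbound: "\<forall>i\<in>{1..n}. \<bar>z (N - l) i\<bar> \<le> (1 - q ^ l) * Ebar + CV * w + real l * (\<tau> * X)" if "l \<le> N" for l
    using that
  proof (induction l)
    case 0
    show ?case
    proof
      fix i assume i: "i \<in> {1..n}"
      show "\<bar>z (N - 0) i\<bar> \<le> (1 - q ^ 0) * Ebar + CV * w + real 0 * (\<tau> * X)"
        using zN[OF i] gn_lip[OF mPS[of N] \<nu>PS[of N] W1[of N] i] by simp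
    qed
  next
    case (Suc l)
    let ?k = "N - Suc l"
    have k: "?k < N" "Suc ?k = N - l" "?k \<le> N" "Suc ?k \<le> N" using Suc.prems by auto
    let ?u = "u (Suc ?k)" and ?v = "v (Suc ?k)"
    define Z where "Z = (1 - q ^ l) * Ebar + CV * w + real l * (\<tau> * X)"
    have Zb: "\<bar>z (Suc ?k) i\<bar> \<le> Z" if "i \<in> {1..n}" for i
      unfolding Z_def k(2) using Suc that by auto
    show ?case
    proof
      fix i assume i: "i \<in> {1..n}"
      define H where "H = fn (m ?k) i - fn (\<nu> ?k) i + lam * As (\<lambda>j. y ?k j - y' ?k j) i - e ?k i"
      have zk: "z ?k i = z (Suc ?k) i + \<tau> * ((B ?u i - B ?v i) - lam * z (Suc ?k) i) + \<tau> * H"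
        unfolding z_def As_diff H_def using uk[OF k(1) i] vk[of ?k i] unfolding G_def by (simp add: algebra_simps)
      have "\<bar>y ?k j - y' ?k j\<bar> \<le> Ebar + CV * (CA * w)" if j: "j \<in> {1..n}" for j
      proof -
        have "\<bar>W (tt ?k) (A (m ?k)) j - V (tt ?k) (A (m ?k)) j\<bar> \<le> Ebar"
          by (rule Ebar[OF tt[OF k(3)] A_PS[OF mPS[OF k(3)]] j])
        moreover have "\<bar>V (tt ?k) (A (m ?k)) j - V (tt ?k) (A (\<nu> ?k)) j\<bar> \<le> CV * (CA * w)"
          by (rule V_lip[OF tt[OF k(3)] A_PS[OF mPS[OF k(3)]] A_PS[OF \<nu>PS[OF k(3)]] A_lip[OF mPS[OF k(3)] \<nu>PS[OF k(3)] W1[OF k(3)]] j])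
        ultimately show ?thesis unfolding y_def y'_def by linarith
      qed
      then have "\<bar>As (\<lambda>j. y ?k j - y' ?k j) i\<bar> \<le> Ebar + CV * (CA * w)" by (intro As_bound i) auto
      then have "\<bar>lam * As (\<lambda>j. y ?k j - y' ?k j) i\<bar> \<le> lam * (Ebar + CV * (CA * w))" using lam0 by (simp add: abs_mult)
      then have "\<bar>H\<bar> \<le> lam * Ebar + X"
        using fn_lip[OF mPS[OF k(3)] \<nu>PS[OF k(3)] W1[OF k(3)] i] e_bd2[OF k(1) i]
        unfolding H_def X_def distrib_left by linarith
      then have H: "\<bar>\<tau> * H\<bar> \<le> \<tau> * (lam * Ebar + X)" using \<tau>p by (simp add: abs_mult)
      have up: "z (Suc ?k) i + \<tau> * ((B ?u i - B ?v i) - lam * z (Suc ?k) i) \<le> q * Z"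
      proof -
        have "(B ?u i - B ?v i) - lam * z (Suc ?k) i \<le> gen ?v (z (Suc ?k)) i - lam * z (Suc ?k) i"
          using B_gen_le[OF i, of ?u ?v] unfolding z_def by simp
        then have "\<tau> * ((B ?u i - B ?v i) - lam * z (Suc ?k) i) \<le> \<tau> * (gen ?v (z (Suc ?k)) i - lam * z (Suc ?k) i)"
          using \<tau>p by (intro mult_left_mono) auto
        moreover have "z (Suc ?k) i + \<tau> * (gen ?v (z (Suc ?k)) i - lam * z (Suc ?k) i) \<le> (1 - \<tau> * lam) * Z"
          using \<tau>p rates(1)[OF vbox[OF k(4)] i i] Zb by (intro euler_upper[OF i]) (auto simp: abs_le_iff)
        ultimately show ?thesis unfolding q_def by linarith
      qed
      have lo: "- (q * Z) \<le> z (Suc ?k) i + \<tau> * ((B ?u i - B ?v i) - lam * z (Suc ?k) i)"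
      proof -
        have "gen ?u (z (Suc ?k)) i - lam * z (Suc ?k) i \<le> (B ?u i - B ?v i) - lam * z (Suc ?k) i"
          using B_gen_ge[OF i, of ?u ?v] unfolding z_def by simp
        then have "\<tau> * (gen ?u (z (Suc ?k)) i - lam * z (Suc ?k) i) \<le> \<tau> * ((B ?u i - B ?v i) - lam * z (Suc ?k) i)"
          using \<tau>p by (intro mult_left_mono) auto
        moreover have "(1 - \<tau> * lam) * (- Z) \<le> z (Suc ?k) i + \<tau> * (gen ?u (z (Suc ?k)) i - lam * z (Suc ?k) i)"
        proof (rule euler_lower[OF i])
          fix j assume "j \<in> {1..n}" from Zb[OF this] show "- Z \<le> z (Suc ?k) j" by linarith
        qed (use \<tau>p rates(1)[OF ubox[OF k(4)] i i] in auto)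
        ultimately show ?thesis unfolding q_def by simp
      qed
      have "\<bar>z ?k i\<bar> \<le> q * Z + \<tau> * (lam * Ebar + X)" unfolding zk using up lo H by linarith
      also have "\<dots> \<le> (1 - q ^ Suc l) * Ebar + CV * w + real (Suc l) * (\<tau> * X)"
      proof -
        have "q * (CV * w + real l * (\<tau> * X)) \<le> 1 * (CV * w + real l * (\<tau> * X))"
          using q01 pars w0 \<tau>p X0 by (intro mult_right_mono) auto
        moreover have "\<tau> * lam = 1 - q" by (simp add: q_def)
        then have "\<tau> * (lam * Ebar) = (1 - q) * Ebar" by (metis mult.assoc)
        ultimately show ?thesis unfolding Z_def by (simp add: algebra_simps)
      qed
      finally show "\<bar>z ?k i\<bar> \<le> (1 - q ^ Suc l) * Ebar + CV * w + real (Suc l) * (\<tau> * X)" .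
    qed
  qed
  have "\<bar>z 0 i0\<bar> \<le> (1 - q ^ N) * Ebar + CV * w + real N * \<tau> * X" using bspec[OF Zbound[of N] i0] by (simp add: mult.assoc)
  also have "\<dots> \<le> (1 - rho) * Ebar + CV * w + T * X"
    using qN Ebar0 N\<tau>T X0 by (intro add_mono mult_right_mono order_refl) auto
  also have "\<dots> \<le> (1 - rho) * Ebar + K4 * s"
  proof -
    have "eps \<le> sqrt E0 * s" unfolding ss[symmetric] using sE s0 by (intro mult_right_mono) auto
    then have "T * (2 * eps) \<le> T * (2 * (sqrt E0 * s))" using T0 by (intro mult_left_mono) auto
    then show ?thesis unfolding K4_def X_def w_def by (simp add: algebra_simps)
  qed
  finally have "\<bar>u 0 i0 - V t0 m0 i0\<bar> \<le> (1 - rho) * Ebar + K4 * s"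
    unfolding z_def v_def \<nu>0 tt_def by simp
  moreover have "\<bar>u 0 i0 - W t0 m0 i0\<bar> \<le> \<zeta>"
    using init[rule_format, OF scheme _ i0] \<tau>le2 \<tau>2_le(2) by linarith
  ultimately show ?thesis unfolding s_def by linarith
qed

text \<open>The largest deviation \<open>Ebar\<close> is attained, and near the point of maximum
  \<open>interior_estimate\<close> bounds it by \<open>(1 - rho) * Ebar\<close> plus the desired
  error. Absorbing the first term divides by \<open>rho\<close>.\<close>

lemma W_V_estimate:
  assumes t: "t \<in> {0..T}" and m: "m \<in> PS n" and i: "i \<in> {1..n}"
  shows "\<bar>W t m i - V t m i\<bar> \<le> K4 / rho * sqrt eps"
proof -
  have cont: "continuous_on ({0..T} \<times> PS n) (\<lambda>z. \<bar>W (fst z) (snd z) i - V (fst z) (snd z) i\<bar>)" if "i \<in> {1..n}" for i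
  proof -
    have "continuous_on ({0..T} \<times> PS n) (\<lambda>z. W (fst z) (snd z) i)"
      using PS_M2S by (intro W_cont_compose continuous_on_fst continuous_on_snd continuous_on_id that) auto
    then show ?thesis using V_cont[OF that] by (intro continuous_on_rabs continuous_on_diff) (auto simp: case_prod_beta')
  qed
  have "\<forall>i\<in>{1..n}. \<exists>z\<in>{0..T} \<times> PS n. \<forall>w\<in>{0..T} \<times> PS n. \<bar>W (fst w) (snd w) i - V (fst w) (snd w) i\<bar> \<le> \<bar>W (fst z) (snd z) i - V (fst z) (snd z) i\<bar>"
  proof
    fix i assume "i \<in> {1..n}"
    show "\<exists>z\<in>{0..T} \<times> PS n. \<forall>w\<in>{0..T} \<times> PS n. \<bar>W (fst w) (snd w) i - V (fst w) (snd w) i\<bar> \<le> \<bar>W (fst z) (snd z) i - V (fst z) (snd z) i\<bar>"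
      using t m by (intro continuous_attains_sup compact_Times compact_Icc compact_PS cont \<open>i \<in> {1..n}\<close>) auto
  qed
  from bchoice[OF this[unfolded Bex_def]] obtain zz where zz: "\<forall>i\<in>{1..n}. zz i \<in> {0..T} \<times> PS n \<and>
     (\<forall>w\<in>{0..T} \<times> PS n. \<bar>W (fst w) (snd w) i - V (fst w) (snd w) i\<bar> \<le> \<bar>W (fst (zz i)) (snd (zz i)) i - V (fst (zz i)) (snd (zz i)) i\<bar>)"
    by blast
  define E where "E = (\<lambda>i. \<bar>W (fst (zz i)) (snd (zz i)) i - V (fst (zz i)) (snd (zz i)) i\<bar>)"
  define Ebar where "Ebar = Max (E ` {1..n})"
  have Ebar: "\<bar>W t m i - V t m i\<bar> \<le> Ebar" if "t \<in> {0..T}" "m \<in> PS n" "i \<in> {1..n}" for t m i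
  proof -
    have "\<bar>W t m i - V t m i\<bar> \<le> E i" unfolding E_def using bspec[OF zz that(3)] that by (metis SigmaI fst_conv snd_conv)
    also have "\<dots> \<le> Ebar" unfolding Ebar_def using that by (intro Max_ge) auto
    finally show ?thesis .
  qed
  have "Ebar \<in> E ` {1..n}" unfolding Ebar_def using i by (intro Max_in) auto
  then obtain i0 where i0: "i0 \<in> {1..n}" "Ebar = E i0" by blast
  define t0 where "t0 = fst (zz i0)"
  define m0 where "m0 = snd (zz i0)"
  have z0: "t0 \<in> {0..T}" "m0 \<in> PS n" and E0: "Ebar = \<bar>W t0 m0 i0 - V t0 m0 i0\<bar>"
    using bspec[OF zz i0(1)] i0(2) unfolding t0_def m0_def E_def by auto
  have le: "Ebar \<le> (1 - rho) * Ebar + K4 * sqrt eps"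
  proof (cases "t0 = T")
    case True
    then have "Ebar = 0" using E0 W_terminal[OF PS_M2S[OF z0(2)] i0(1)] V_terminal[OF z0(2) i0(1)] by simp
    then show ?thesis using K_nonneg pars by simp
  next
    case False
    then have t0: "t0 \<in> {0..<T}" using z0 by auto
    have "\<exists>d>0. \<forall>x\<in>PS n. \<forall>y\<in>PS n. (\<Sum>j=1..n. \<bar>x j - y j\<bar>) < d \<longrightarrow>
       \<bar>\<bar>W t0 x i0 - V t0 x i0\<bar> - \<bar>W t0 y i0 - V t0 y i0\<bar>\<bar> < \<zeta>" if \<zeta>: "\<zeta> > 0" for \<zeta>
    proof (rule l1_unif_cont[OF _ compact_PS _ _ \<zeta>])
      have "continuous_on (PS n) (\<lambda>x. \<bar>W (fst (t0, x)) (snd (t0, x)) i0 - V (fst (t0, x)) (snd (t0, x)) i0\<bar>)"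
        by (rule continuous_on_compose2[OF cont[OF i0(1)], where f="\<lambda>x. (t0, x)"])
          (use z0 in \<open>auto intro: continuous_on_Pair continuous_on_const continuous_on_id\<close>)
      then show "continuous_on (PS n) (\<lambda>x. \<bar>W t0 x i0 - V t0 x i0\<bar>)" by simp
    qed (auto simp: PS_def MS_def)
    note uc = this
    show ?thesis
    proof (rule field_le_epsilon)
      fix e :: real assume e: "e > 0"
      obtain d where d: "d > 0" "\<forall>x\<in>PS n. \<forall>y\<in>PS n. (\<Sum>j=1..n. \<bar>x j - y j\<bar>) < d \<longrightarrow>
         \<bar>\<bar>W t0 x i0 - V t0 x i0\<bar> - \<bar>W t0 y i0 - V t0 y i0\<bar>\<bar> < e / 2" using uc[of "e / 2"] e by auto
      \<comment> \<open>A slight mixture with the uniform measure makes every entry positive; two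
        probability measures have l1 distance at most 2, so \<open>d / 4\<close> keeps the mixture
        within \<open>d\<close>.\<close>
      define \<theta> where "\<theta> = min (1 / 2) (d / 4)"
      have \<theta>: "0 < \<theta>" "\<theta> \<le> 1" "\<theta> \<le> d / 4" unfolding \<theta>_def using d by auto
      define un where "un = (\<lambda>i. if i \<in> {1..n} then 1 / real n else 0)"
      have un: "un \<in> PS n" unfolding PS_def MS_def un_def using n1 by auto
      define x where "x = (\<lambda>i. m0 i + \<theta> * (un i - m0 i))"
      have x: "x \<in> PS n" unfolding x_def using \<theta> by (intro PS_convex z0 un) auto
      have xpos: "x i > 0" if "i \<in> {1..n}" for i
      proof -
        have "x i = (1 - \<theta>) * m0 i + \<theta> * (1 / real n)" unfolding x_def un_def using that by (simp add: algebra_simps)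
        moreover have "(1 - \<theta>) * m0 i \<ge> 0" using \<theta> M2S_nonneg[OF PS_M2S[OF z0(2)]] by simp
        moreover have "\<theta> * (1 / real n) > 0" using \<theta> n1 by simp
        ultimately show ?thesis by linarith
      qed
      have "(\<Sum>j=1..n. \<bar>x j - m0 j\<bar>) = (\<Sum>j=1..n. \<theta> * \<bar>un j - m0 j\<bar>)"
        unfolding x_def using \<theta> by (intro sum.cong) (auto simp: abs_mult)
      also have "\<dots> = \<theta> * (\<Sum>j=1..n. \<bar>un j - m0 j\<bar>)" by (simp add: sum_distrib_left)
      also have "\<dots> \<le> \<theta> * 2" using \<theta> PS_diff_abs_le[OF un z0(2)] by (intro mult_left_mono) auto
      also have "\<dots> < d" using \<theta> d by linarith
      finally have "\<bar>\<bar>W t0 x i0 - V t0 x i0\<bar> - \<bar>W t0 m0 i0 - V t0 m0 i0\<bar>\<bar> < e / 2" using d(2) x z0(2) by blast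
      moreover have "\<bar>W t0 x i0 - V t0 x i0\<bar> \<le> (1 - rho) * Ebar + K4 * sqrt eps + e / 2"
        by (rule interior_estimate[OF t0 x xpos _ Ebar i0(1)]) (use e in auto)
      ultimately show "Ebar \<le> (1 - rho) * Ebar + K4 * sqrt eps + e" unfolding E0[symmetric] using E0 by linarith
    qed
  qed
  then have "rho * Ebar \<le> K4 * sqrt eps" by (simp add: algebra_simps)
  then have "Ebar \<le> K4 / rho * sqrt eps" using K_nonneg(2) by (simp add: field_simps)
  then show ?thesis using Ebar[OF t m i] by linarith
qed

end

section \<open>Truncated Hamiltonians\<close>

lemma periodic_int:
  assumes "periodic \<phi>" shows "\<phi> (x + of_int k) = \<phi> x"
proof -
  have nat: "\<phi> (x + real m) = \<phi> x" for x m
  proof (induction m)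
    case (Suc m)
    have "\<phi> (x + real (Suc m)) = \<phi> ((x + real m) + 1)" by (simp add: algebra_simps)
    then show ?case using assms Suc unfolding periodic_def by simp
  qed simp
  show ?thesis
  proof (cases "k \<ge> 0")
    case True
    then show ?thesis using nat[of x "nat k"] by simp
  next
    case False
    then have "x = (x + of_int k) + real (nat (- k))" by simp
    then show ?thesis using nat[of "x + of_int k" "nat (- k)"] by metis
  qed
qed

lemma periodic_frac: "periodic \<phi> \<Longrightarrow> \<phi> (frac x) = \<phi> x"
  using periodic_int[of \<phi> "frac x" "\<lfloor>x\<rfloor>"] by (simp add: frac_def)

lemma C_k_continuous: "C_k k F \<Longrightarrow> continuous_on UNIV F"
proof (cases k)
  case (Suc j)
  assume "C_k k F"
  then obtain F' where "\<forall>z. (F has_derivative F' z) (at z)" unfolding Suc by auto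
  then show ?thesis by (meson continuous_at_imp_continuous_on has_derivative_continuous)
qed simp

text \<open>Covers \<open>L\<close> and its reflection in the control at once, so that the two
  one-sided Hamiltonians share one theory. The range \<open>{0..2}\<close> holds a grid point in
  \<open>{0..1}\<close> together with its right neighbour.\<close>

locale coercive_lagrangian =
  fixes l :: "real \<Rightarrow> real \<Rightarrow> real"
  assumes coercive: "\<exists>C. \<forall>x a. P * \<bar>a\<bar> - C \<le> l x a"
    and convex: "uniformly_convex_on_compacts l"
    and cont: "continuous_on UNIV (l x)"
    and zero_bounded: "\<exists>C. \<forall>x. \<bar>l x 0\<bar> \<le> C"
    and mixed: "\<exists>C\<ge>0. \<forall>x\<in>{0..2}. \<forall>y\<in>{0..2}. \<forall>a\<in>{-R..R}. \<forall>b\<in>{-R..R}.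
        \<bar>(l x b - l x a) - (l y b - l y a)\<bar> \<le> C * \<bar>x - y\<bar> * \<bar>a - b\<bar>"
begin

text \<open>Coercivity with slope \<open>R + 1\<close> beats the linear term of slope at most
  \<open>R\<close> and leaves \<open>\<bar>a\<bar>\<close> bounded by constants.\<close>

lemma sublevel_bound:
  "\<exists>A>0. \<forall>x p a. \<bar>p\<bar> \<le> R \<longrightarrow> l x a + a * p \<le> l x 0 \<longrightarrow> \<bar>a\<bar> \<le> A"
proof -
  obtain C where C: "\<And>x a. (R + 1) * \<bar>a\<bar> - C \<le> l x a" using coercive by blast
  obtain C' where C': "\<And>x. \<bar>l x 0\<bar> \<le> C'" using zero_bounded by blast
  show ?thesis
  proof (intro exI[of _ "\<bar>C\<bar> + \<bar>C'\<bar> + 1"] conjI allI impI)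
    fix x p a :: real assume p: "\<bar>p\<bar> \<le> R" and a: "l x a + a * p \<le> l x 0"
    have "- (R * \<bar>a\<bar>) \<le> a * p"
    proof -
      have "\<bar>a * p\<bar> \<le> R * \<bar>a\<bar>" using mult_right_mono[OF p, of "\<bar>a\<bar>"] by (simp add: abs_mult mult.commute)
      then show ?thesis by linarith
    qed
    moreover have "(R + 1) * \<bar>a\<bar> = R * \<bar>a\<bar> + \<bar>a\<bar>" by (simp add: distrib_right)
    ultimately show "\<bar>a\<bar> \<le> \<bar>C\<bar> + \<bar>C'\<bar> + 1" using a C[of a x] C'[of x] by linarith
  qed simp
qed

definition is_amin :: "real \<Rightarrow> real \<Rightarrow> real \<Rightarrow> bool" where
  "is_amin x p a \<longleftrightarrow> 0 \<le> a \<and> (\<forall>b\<ge>0. l x a + a * p \<le> l x b + b * p)"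

definition amin :: "real \<Rightarrow> real \<Rightarrow> real" where "amin x p = (SOME a. is_amin x p a)"

lemma is_amin_amin: "is_amin x p (amin x p)"
proof -
  obtain A where A: "A > 0" "\<And>a. l x a + a * p \<le> l x 0 \<Longrightarrow> \<bar>a\<bar> \<le> A"
    using sublevel_bound[of "\<bar>p\<bar>"] by blast
  have "continuous_on {0..A} (\<lambda>a. l x a + a * p)"
    by (intro continuous_intros continuous_on_subset[OF cont]) auto
  from continuous_attains_inf[OF compact_Icc _ this] A(1)
  obtain a where a: "a \<in> {0..A}" "\<And>b. b \<in> {0..A} \<Longrightarrow> l x a + a * p \<le> l x b + b * p" by auto
  have "is_amin x p a"
    unfolding is_amin_def
  proof (intro conjI allI impI)
    fix b :: real assume b: "0 \<le> b"
    show "l x a + a * p \<le> l x b + b * p"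
    proof (cases "b \<le> A")
      case False
      then have "l x b + b * p > l x 0" using A(2)[of b] b by linarith
      then show ?thesis using a(2)[of 0] A(1) by simp
    qed (use a b in auto)
  qed (use a in auto)
  then show ?thesis unfolding amin_def by (rule someI)
qed

lemma amin_nonneg: "amin x p \<ge> 0"
  and amin_le: "0 \<le> b \<Longrightarrow> l x (amin x p) + amin x p * p \<le> l x b + b * p"
  using is_amin_amin unfolding is_amin_def by auto

lemma amin_bounded: "\<exists>A>0. \<forall>x p. \<bar>p\<bar> \<le> R \<longrightarrow> amin x p \<le> A"
proof -
  obtain A where A: "A > 0" "\<And>x p a. \<bar>p\<bar> \<le> R \<Longrightarrow> l x a + a * p \<le> l x 0 \<Longrightarrow> \<bar>a\<bar> \<le> A"
    using sublevel_bound by blast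
  have "amin x p \<le> A" if "\<bar>p\<bar> \<le> R" for x p
    using A(2)[OF that, of x "amin x p"] amin_le[of 0 x p] by simp
  then show ?thesis using A(1) by blast
qed

text \<open>Strong convexity at the midpoint of the minimiser and \<open>b\<close>: minimality turns
  the convexity deficit into quadratic growth, with half the constant.\<close>

lemma amin_growth:
  "\<exists>c>0. \<forall>x p b. \<bar>p\<bar> \<le> R \<longrightarrow> 0 \<le> b \<longrightarrow> b \<le> A \<longrightarrow> amin x p \<le> A \<longrightarrow>
     c * (amin x p - b)\<^sup>2 \<le> (l x b + b * p) - (l x (amin x p) + amin x p * p)"
proof -
  obtain c where c: "c > 0" "\<And>x a b s. a \<in> {-(\<bar>A\<bar>+1)..\<bar>A\<bar>+1} \<Longrightarrow> b \<in> {-(\<bar>A\<bar>+1)..\<bar>A\<bar>+1} \<Longrightarrow> s \<in> {0..1} \<Longrightarrow>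
        l x (s * a + (1 - s) * b) \<le> s * l x a + (1 - s) * l x b - c * s * (1 - s) * (a - b)\<^sup>2"
  proof -
    have "\<bar>A\<bar> + 1 > 0" by simp
    from convex[unfolded uniformly_convex_on_compacts_def, rule_format, OF this] show ?thesis using that by blast
  qed
  show ?thesis
  proof (intro exI[of _ "c / 2"] conjI allI impI)
    show "c / 2 > 0" using c by simp
    fix x p b assume b: "0 \<le> b" "b \<le> A" and a: "amin x p \<le> A"
    let ?a = "amin x p"
    have a0: "?a \<ge> 0" by (rule amin_nonneg)
    have "l x ?a + ?a * p \<le> l x (1/2 * ?a + (1 - 1/2) * b) + (1/2 * ?a + (1 - 1/2) * b) * p"
      using a0 b by (intro amin_le) auto
    also have "l x (1/2 * ?a + (1 - 1/2) * b) \<le> 1/2 * l x ?a + (1 - 1/2) * l x b - c * (1/2) * (1 - 1/2) * (?a - b)\<^sup>2"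
      using a a0 b by (intro c) auto
    finally show "c / 2 * (?a - b)\<^sup>2 \<le> (l x b + b * p) - (l x ?a + ?a * p)" by (simp add: algebra_simps)
  qed
qed

text \<open>Each minimiser is a competitor for the other. Adding the two growth inequalities bounds
  the squared distance by the mixed difference of \<open>l\<close> plus the product of distance and
  \<open>\<bar>p - q\<bar>\<close>; one factor cancels.\<close>

lemma amin_lipschitz:
  "\<exists>C>0. \<forall>x\<in>{0..2}. \<forall>y\<in>{0..2}. \<forall>p q. \<bar>p\<bar> \<le> R \<longrightarrow> \<bar>q\<bar> \<le> R \<longrightarrow>
      \<bar>amin x p - amin y q\<bar> \<le> C * (\<bar>x - y\<bar> + \<bar>p - q\<bar>)"
  and amin_lipschitz_p:
  "\<exists>C>0. \<forall>x p q. \<bar>p\<bar> \<le> R \<longrightarrow> \<bar>q\<bar> \<le> R \<longrightarrow> \<bar>amin x p - amin x q\<bar> \<le> C * \<bar>p - q\<bar>"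
proof -
  obtain A where A: "A > 0" "\<And>x p. \<bar>p\<bar> \<le> R \<Longrightarrow> amin x p \<le> A" using amin_bounded by blast
  obtain c where c: "c > 0" "\<And>x p b. \<bar>p\<bar> \<le> R \<Longrightarrow> 0 \<le> b \<Longrightarrow> b \<le> A \<Longrightarrow> amin x p \<le> A \<Longrightarrow>
     c * (amin x p - b)\<^sup>2 \<le> (l x b + b * p) - (l x (amin x p) + amin x p * p)"
    using amin_growth[of R A] by blast
  obtain M where M: "M \<ge> 0" "\<And>x y a b. x\<in>{0..2} \<Longrightarrow> y\<in>{0..2} \<Longrightarrow> a\<in>{-A..A} \<Longrightarrow> b\<in>{-A..A} \<Longrightarrow>
        \<bar>(l x b - l x a) - (l y b - l y a)\<bar> \<le> M * \<bar>x - y\<bar> * \<bar>a - b\<bar>"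
    using mixed[of A] by blast
  have cancel: "d \<le> r" if "2 * c * d\<^sup>2 \<le> 2 * c * r * d" "d \<ge> 0" "r \<ge> 0" for d r :: real
  proof (cases "d = 0")
    case False
    then have pos: "2 * c * d > 0" using that c(1) by simp
    have "(2 * c * d) * d \<le> (2 * c * d) * r" using that(1) by (simp add: power2_eq_square algebra_simps)
    then show ?thesis using pos by (simp only: mult_le_cancel_left_pos)
  qed (use that in simp)
  have key: "2 * c * \<bar>amin x p - amin y q\<bar>\<^sup>2 \<le> \<bar>(l x (amin y q) - l x (amin x p)) - (l y (amin y q) - l y (amin x p))\<bar>
      + \<bar>amin x p - amin y q\<bar> * \<bar>p - q\<bar>" if "\<bar>p\<bar> \<le> R" "\<bar>q\<bar> \<le> R" for x y p q
  proof -
    let ?a = "amin x p" and ?b = "amin y q"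
    have 1: "c * (?a - ?b)\<^sup>2 \<le> (l x ?b + ?b * p) - (l x ?a + ?a * p)"
      using c(2)[OF that(1) amin_nonneg A(2)[OF that(2)] A(2)[OF that(1)]] by simp
    have 2: "c * (?b - ?a)\<^sup>2 \<le> (l y ?a + ?a * q) - (l y ?b + ?b * q)"
      using c(2)[OF that(2) amin_nonneg A(2)[OF that(1)] A(2)[OF that(2)]] by simp
    have 3: "(?b - ?a) * (p - q) \<le> \<bar>?a - ?b\<bar> * \<bar>p - q\<bar>"
      using abs_ge_self[of "(?b - ?a) * (p - q)"] by (simp add: abs_mult abs_minus_commute)
    have 4: "2 * c * d\<^sup>2 \<le> X + Y" if "c * d\<^sup>2 \<le> X" "c * d\<^sup>2 \<le> Y" for d X Y :: real
      using that by linarith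
    have "2 * c * (?a - ?b)\<^sup>2 \<le> ((l x ?b + ?b * p) - (l x ?a + ?a * p)) + ((l y ?a + ?a * q) - (l y ?b + ?b * q))"
      by (rule 4[OF 1 2[unfolded power2_commute[of ?b ?a]]])
    also have "\<dots> = ((l x ?b - l x ?a) - (l y ?b - l y ?a)) + (?b - ?a) * (p - q)"
      by (simp add: algebra_simps)
    finally show ?thesis using 3 unfolding power2_abs by linarith
  qed
  show "\<exists>C>0. \<forall>x p q. \<bar>p\<bar> \<le> R \<longrightarrow> \<bar>q\<bar> \<le> R \<longrightarrow> \<bar>amin x p - amin x q\<bar> \<le> C * \<bar>p - q\<bar>"
  proof (intro exI[of _ "1 / (2 * c)"] conjI allI impI)
    show "1 / (2 * c) > 0" using c by simp
    fix x p q assume pq: "\<bar>p\<bar> \<le> R" "\<bar>q\<bar> \<le> R"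
    show "\<bar>amin x p - amin x q\<bar> \<le> 1 / (2 * c) * \<bar>p - q\<bar>"
    proof (rule cancel)
      show "2 * c * \<bar>amin x p - amin x q\<bar>\<^sup>2 \<le> 2 * c * (1 / (2 * c) * \<bar>p - q\<bar>) * \<bar>amin x p - amin x q\<bar>"
        using key[OF pq, of x x] c(1) by (simp add: mult.commute)
    qed (use c(1) in auto)
  qed
  show "\<exists>C>0. \<forall>x\<in>{0..2}. \<forall>y\<in>{0..2}. \<forall>p q. \<bar>p\<bar> \<le> R \<longrightarrow> \<bar>q\<bar> \<le> R \<longrightarrow>
      \<bar>amin x p - amin y q\<bar> \<le> C * (\<bar>x - y\<bar> + \<bar>p - q\<bar>)"
  proof (intro exI[of _ "(M + 1) / (2 * c)"] conjI ballI allI impI)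
    show "(M + 1) / (2 * c) > 0" using c M by simp
    fix x y p q :: real assume xy: "x \<in> {0..2}" "y \<in> {0..2}" and pq: "\<bar>p\<bar> \<le> R" "\<bar>q\<bar> \<le> R"
    let ?d = "\<bar>amin x p - amin y q\<bar>"
    have ab: "amin x p \<in> {-A..A}" "amin y q \<in> {-A..A}"
      using A(2)[OF pq(1), of x] A(2)[OF pq(2), of y] amin_nonneg[of x p] amin_nonneg[of y q] A(1) by auto
    have "\<bar>(l x (amin y q) - l x (amin x p)) - (l y (amin y q) - l y (amin x p))\<bar> \<le> M * \<bar>x - y\<bar> * ?d"
      by (rule M(2)[OF xy ab])
    then have "2 * c * ?d\<^sup>2 \<le> (M * \<bar>x - y\<bar> + \<bar>p - q\<bar>) * ?d"
      using key[OF pq, of x y] by (simp add: algebra_simps)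
    also have "\<dots> \<le> ((M + 1) * (\<bar>x - y\<bar> + \<bar>p - q\<bar>)) * ?d"
      using M(1) by (intro mult_right_mono) (auto simp: algebra_simps)
    also have "\<dots> = 2 * c * ((M + 1) / (2 * c) * (\<bar>x - y\<bar> + \<bar>p - q\<bar>)) * ?d" using c(1) by simp
    finally show "?d \<le> (M + 1) / (2 * c) * (\<bar>x - y\<bar> + \<bar>p - q\<bar>)"
      by (rule cancel) (use c M in auto)
  qed
qed

definition h :: "real \<Rightarrow> real \<Rightarrow> real" where "h x p = Ham_up l x p"

lemma h_eq: "h x p = - (l x (amin x p) + amin x p * p)"
proof -
  have "(INF a\<in>{0..}. l x a + a * p) = l x (amin x p) + amin x p * p"
    by (rule cInf_eq_minimum) (use amin_nonneg amin_le in auto)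
  then show ?thesis unfolding h_def Ham_up_def by simp
qed

lemma h_subgradient: "h x p - amin x p * (q - p) \<le> h x q"
  unfolding h_eq using amin_le[OF amin_nonneg, of x q x p] by (simp add: algebra_simps)

lemma amin_cont: "continuous_on UNIV (amin x)"
proof (rule continuous_at_imp_continuous_on, intro ballI)
  fix p :: real
  obtain C where C: "C > 0" "\<And>p' q. \<bar>p'\<bar> \<le> \<bar>p\<bar> + 1 \<Longrightarrow> \<bar>q\<bar> \<le> \<bar>p\<bar> + 1 \<Longrightarrow> \<bar>amin x p' - amin x q\<bar> \<le> C * \<bar>p' - q\<bar>"
    using amin_lipschitz_p[of "\<bar>p\<bar> + 1"] by blast
  have "((\<lambda>q. amin x q - amin x p) \<longlongrightarrow> 0) (at p)"
  proof (rule Lim_null_comparison)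
    have "\<forall>\<^sub>F q in at p. dist q p < 1" by (auto simp: eventually_at intro: exI[of _ 1])
    then show "\<forall>\<^sub>F q in at p. norm (amin x q - amin x p) \<le> C * \<bar>q - p\<bar>"
    proof eventually_elim
      case (elim q)
      then have "\<bar>q - p\<bar> < 1" by (simp add: dist_real_def)
      then show ?case using C(2)[of q p] by auto
    qed
    have "((\<lambda>q. C * \<bar>q - p\<bar>) \<longlongrightarrow> C * \<bar>p - p\<bar>) (at p)" by (intro tendsto_intros)
    then show "((\<lambda>q. C * \<bar>q - p\<bar>) \<longlongrightarrow> 0) (at p)" by simp
  qed
  then show "isCont (amin x) p" unfolding isCont_def by (simp add: LIM_zero_iff)
qed

text \<open>Envelope theorem: the subgradient inequalities at \<open>p\<close> and at
  \<open>q\<close> enclose the difference quotient, and \<open>amin\<close> is continuous.\<close>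

lemma h_deriv: "(h x has_real_derivative - amin x p) (at p)"
proof -
  have "((\<lambda>q. (h x q - h x p) / (q - p) - (- amin x p)) \<longlongrightarrow> 0) (at p)"
  proof (rule Lim_null_comparison)
    have "\<forall>\<^sub>F q in at p. q \<noteq> p" by (simp add: eventually_neq_at_within)
    then show "\<forall>\<^sub>F q in at p. norm ((h x q - h x p) / (q - p) - (- amin x p)) \<le> \<bar>amin x q - amin x p\<bar>"
    proof eventually_elim
      case (elim q)
      have 1: "- amin x p * (q - p) \<le> h x q - h x p" using h_subgradient[of x p q] by simp
      have 2: "h x q - h x p \<le> - amin x q * (q - p)" using h_subgradient[of x q p] by (simp add: algebra_simps)
      have "\<bar>(h x q - h x p) + amin x p * (q - p)\<bar> \<le> \<bar>(amin x q - amin x p) * (q - p)\<bar>"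
        using 1 2 by (simp add: algebra_simps abs_le_iff)
      then have "\<bar>(h x q - h x p) + amin x p * (q - p)\<bar> / \<bar>q - p\<bar> \<le> \<bar>amin x q - amin x p\<bar>"
        using elim by (simp add: abs_mult divide_le_eq)
      moreover have "(h x q - h x p) / (q - p) - (- amin x p) = ((h x q - h x p) + amin x p * (q - p)) / (q - p)"
        using elim by (simp add: field_simps)
      ultimately show ?case by simp
    qed
    have "isCont (amin x) p" using amin_cont by (simp add: continuous_on_eq_continuous_at)
    then have "((\<lambda>q. amin x q - amin x p) \<longlongrightarrow> 0) (at p)" unfolding isCont_def by (simp add: LIM_zero_iff)
    then show "((\<lambda>q. \<bar>amin x q - amin x p\<bar>) \<longlongrightarrow> 0) (at p)" by (rule tendsto_rabs_zero)
  qed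
  then show ?thesis unfolding has_field_derivative_iff by (rule LIM_zero_cancel)
qed

text \<open>The gap in the subgradient inequality at an arbitrary base point \<open>p\<close> controls the difference of
  the drifts, using the Lipschitz bound of the drift only near the bounded point \<open>q\<close>.\<close>

lemma h_gap:
  "\<exists>c>0. \<forall>x p q. \<bar>q\<bar> \<le> R \<longrightarrow> c * min \<bar>amin x p - amin x q\<bar> (\<bar>amin x p - amin x q\<bar>\<^sup>2)
     \<le> h x q - h x p + amin x p * (q - p)"
proof -
  obtain C0 where C0: "C0 > 0" "\<And>x p q. \<bar>p\<bar> \<le> R + 1 \<Longrightarrow> \<bar>q\<bar> \<le> R + 1 \<Longrightarrow> \<bar>amin x p - amin x q\<bar> \<le> C0 * \<bar>p - q\<bar>"
    using amin_lipschitz_p[of "R + 1"] by blast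
  define C where "C = max 1 C0"
  have C1: "C \<ge> 1" unfolding C_def by simp
  have C: "\<bar>amin x p - amin x q\<bar> \<le> C * \<bar>p - q\<bar>" if "\<bar>p\<bar> \<le> R + 1" "\<bar>q\<bar> \<le> R + 1" for x p q
  proof -
    have "C0 * \<bar>p - q\<bar> \<le> C * \<bar>p - q\<bar>" unfolding C_def by (intro mult_right_mono) auto
    then show ?thesis using C0(2)[OF that, of x] by linarith
  qed
  show ?thesis
  proof (intro exI[of _ "1 / (4 * C)"] conjI allI impI)
    show "1 / (4 * C) > 0" using C1 by simp
    fix x p q :: real assume q: "\<bar>q\<bar> \<le> R"
    define D where "D = \<bar>amin x p - amin x q\<bar>"
    have D0: "D \<ge> 0" unfolding D_def by simp
    have mono: "(amin x p - amin x q) * (p - q) \<le> 0"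
      using h_subgradient[of x p q] h_subgradient[of x q p] by (simp add: algebra_simps)
    \<comment> \<open>Three-point inequality: the auxiliary point \<open>q'\<close> may be chosen
      near \<open>q\<close> even if \<open>p\<close> is far away.\<close>
    have main: "(amin x p - amin x q') * (q - q') \<le> h x q - h x p + amin x p * (q - p)" for q'
      using h_subgradient[of x q' q] h_subgradient[of x p q'] by (simp add: algebra_simps)
    \<comment> \<open>Moving from \<open>q\<close> towards \<open>p\<close> by \<open>t\<close>
      changes the drift by at most \<open>D / 2\<close>, and \<open>t \<le> 1\<close> stays where
      the Lipschitz constant \<open>C\<close> holds. The product \<open>t * (D / 2)\<close> is
      \<open>D\<^sup>2 / (4 * C)\<close> or \<open>D / 2\<close>, which explains the constant and
      the minimum.\<close>
    define t where "t = min 1 (D / (2 * C))"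
    have t: "0 \<le> t" "t \<le> 1" "C * t \<le> D / 2"
    proof -
      show "0 \<le> t" "t \<le> 1" unfolding t_def using D0 C1 by auto
      have "C * t \<le> C * (D / (2 * C))" unfolding t_def using C1 by (intro mult_left_mono) auto
      then show "C * t \<le> D / 2" using C1 by simp
    qed
    have "t * (D / 2) \<le> h x q - h x p + amin x p * (q - p)"
    proof (cases "p \<ge> q")
      case True
      have "D = amin x q - amin x p"
      proof (cases "p = q")
        case False
        then have "amin x p - amin x q \<le> 0" using mono True by (simp add: mult_le_0_iff)
        then show ?thesis unfolding D_def by simp
      qed (simp add: D_def)
      moreover have "\<bar>amin x (q + t) - amin x q\<bar> \<le> C * \<bar>q + t - q\<bar>" using q t by (intro C) auto
      then have "\<bar>amin x (q + t) - amin x q\<bar> \<le> D / 2" using t by simp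
      ultimately have "D / 2 \<le> amin x (q + t) - amin x p" by linarith
      then have "t * (D / 2) \<le> t * (amin x (q + t) - amin x p)" using t by (intro mult_left_mono) auto
      then show ?thesis using main[of "q + t"] by (simp add: algebra_simps)
    next
      case False
      then have "amin x p - amin x q \<ge> 0" using mono by (simp add: mult_le_0_iff)
      then have "D = amin x p - amin x q" unfolding D_def by simp
      moreover have "\<bar>amin x (q - t) - amin x q\<bar> \<le> C * \<bar>q - t - q\<bar>" using q t by (intro C) auto
      then have "\<bar>amin x (q - t) - amin x q\<bar> \<le> D / 2" using t by simp
      ultimately have "D / 2 \<le> amin x p - amin x (q - t)" by linarith
      then have "t * (D / 2) \<le> t * (amin x p - amin x (q - t))" using t by (intro mult_left_mono) auto
      then show ?thesis using main[of "q - t"] by (simp add: algebra_simps)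
    qed
    moreover have "1 / (4 * C) * min D (D\<^sup>2) \<le> t * (D / 2)"
    proof (cases "D / (2 * C) \<le> 1")
      case True
      then have "t * (D / 2) = 1 / (4 * C) * D\<^sup>2" unfolding t_def by (simp add: power2_eq_square)
      then show ?thesis using C1 by (simp add: divide_right_mono)
    next
      case False
      then have "t * (D / 2) = D / 2" unfolding t_def by simp
      moreover have "1 / (4 * C) * min D (D\<^sup>2) \<le> 1 / 2 * D" using C1 D0 by (intro mult_mono) (auto simp: divide_simps)
      ultimately show ?thesis by linarith
    qed
    ultimately show "1 / (4 * C) * min \<bar>amin x p - amin x q\<bar> (\<bar>amin x p - amin x q\<bar>\<^sup>2)
     \<le> h x q - h x p + amin x p * (q - p)" unfolding D_def by linarith
  qed
qed

lemma amin_periodic: "(\<And>a. l (x + 1) a = l x a) \<Longrightarrow> amin (x + 1) p = amin x p"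
  unfolding amin_def is_amin_def by simp

end

section \<open>The Lagrangian and its reflection as instances\<close>

lemma smooth_mixed_difference:
  fixes L :: "real \<Rightarrow> real \<Rightarrow> real"
  assumes "smooth (\<lambda>(x, a). L x a)"
  shows "\<exists>C\<ge>0. \<forall>x\<in>{0..2}. \<forall>y\<in>{0..2}. \<forall>a\<in>{-R..R}. \<forall>b\<in>{-R..R}.
        \<bar>(L x b - L x a) - (L y b - L y a)\<bar> \<le> C * \<bar>x - y\<bar> * \<bar>a - b\<bar>"
proof -
  let ?F = "\<lambda>z::real\<times>real. L (fst z) (snd z)"
  have "C_k (Suc (Suc 0)) ?F" using assms unfolding smooth_def by (simp only: case_prod_beta')
  then obtain F' where F': "\<And>z. (?F has_derivative F' z) (at z)" "\<And>v. C_k (Suc 0) (\<lambda>z. F' z v)"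
    by (simp only: C_k.simps) blast
  from F'(2)[of "(0, 1)"] obtain F'' where F'': "\<And>z. ((\<lambda>z. F' z (0, 1)) has_derivative F'' z) (at z)"
    "\<And>v. continuous_on UNIV (\<lambda>z. F'' z v)" by (simp only: C_k.simps) blast
  have Da: "((\<lambda>a. L x a) has_real_derivative F' (x, a) (0, 1)) (at a)" for x a
  proof -
    have "((\<lambda>a. (x, a)) has_derivative (\<lambda>h. (0, h))) (at a)"
      by (intro has_derivative_Pair has_derivative_const has_derivative_ident)
    from has_derivative_compose[OF this F'(1)[of "(x, a)"]]
    have d: "((\<lambda>a. L x a) has_derivative (\<lambda>h. F' (x, a) (0, h))) (at a)" by (simp only: fst_conv snd_conv)
    have lin: "F' (x, a) (0, h) = F' (x, a) (0, 1) * h" for h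
    proof -
      have "linear (F' (x, a))" by (rule has_derivative_linear[OF F'(1)])
      from linear_scale[OF this, of h "(0, 1)"] show ?thesis by simp
    qed
    have e: "(\<lambda>h. F' (x, a) (0, h)) = (*) (F' (x, a) (0, 1))" by (rule ext) (rule lin)
    show ?thesis using d unfolding has_field_derivative_def e .
  qed
  have Dx: "((\<lambda>x. F' (x, a) (0, 1)) has_real_derivative F'' (x, a) (1, 0)) (at x)" for x a
  proof -
    have "((\<lambda>x. (x, a)) has_derivative (\<lambda>h. (h, 0))) (at x)"
      by (intro has_derivative_Pair has_derivative_const has_derivative_ident)
    from has_derivative_compose[OF this F''(1)[of "(x, a)"]]
    have d: "((\<lambda>x. F' (x, a) (0, 1)) has_derivative (\<lambda>h. F'' (x, a) (h, 0))) (at x)" .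
    have lin: "F'' (x, a) (h, 0) = F'' (x, a) (1, 0) * h" for h
    proof -
      have "linear (F'' (x, a))" by (rule has_derivative_linear[OF F''(1)])
      from linear_scale[OF this, of h "(1, 0)"] show ?thesis by simp
    qed
    have e: "(\<lambda>h. F'' (x, a) (h, 0)) = (*) (F'' (x, a) (1, 0))" by (rule ext) (rule lin)
    show ?thesis using d unfolding has_field_derivative_def e .
  qed
  \<comment> \<open>The mixed second derivative is bounded on the rectangle; the mean value
    inequality is then applied once in each variable.\<close>
  have "compact ((\<lambda>z. F'' z (1, 0)) ` ({0..2} \<times> {-R..R}))"
    by (intro compact_continuous_image continuous_on_subset[OF F''(2)] compact_Times compact_Icc) auto
  then have "bounded ((\<lambda>z. F'' z (1, 0)) ` ({0..2} \<times> {-R..R}))" by (rule compact_imp_bounded)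
  then obtain C where "\<forall>y\<in>(\<lambda>z. F'' z (1, 0)) ` ({0..2} \<times> {-R..R}). norm y \<le> C" unfolding bounded_iff by blast
  then have C: "\<And>x a. x \<in> {0..2} \<Longrightarrow> a \<in> {-R..R} \<Longrightarrow> \<bar>F'' (x, a) (1, 0)\<bar> \<le> C" by simp
  have D1: "\<bar>F' (x, a) (0, 1) - F' (y, a) (0, 1)\<bar> \<le> max 0 C * \<bar>x - y\<bar>" if "x \<in> {0..2}" "y \<in> {0..2}" "a \<in> {-R..R}" for x y a
  proof -
    have "norm (F' (x, a) (0, 1) - F' (y, a) (0, 1)) \<le> max 0 C * norm (x - y)"
    proof (rule field_differentiable_bound[of "{0..2}"])
      show "((\<lambda>x. F' (x, a) (0, 1)) has_field_derivative F'' (z, a) (1, 0)) (at z within {0..2})" for z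
        by (rule has_field_derivative_at_within[OF Dx])
      show "norm (F'' (z, a) (1, 0)) \<le> max 0 C" if "z \<in> {0..2}" for z
        using C[OF that \<open>a \<in> {-R..R}\<close>] by simp
    qed (use that in auto)
    then show ?thesis by simp
  qed
  show ?thesis
  proof (intro exI[of _ "max 0 C"] conjI ballI)
    fix x y a b :: real assume xy: "x \<in> {0..2}" "y \<in> {0..2}" and ab: "a \<in> {-R..R}" "b \<in> {-R..R}"
    have "norm ((L x b - L y b) - (L x a - L y a)) \<le> max 0 C * \<bar>x - y\<bar> * norm (b - a)"
    proof (rule field_differentiable_bound[of "{-R..R}"])
      show "((\<lambda>a. L x a - L y a) has_field_derivative (F' (x, z) (0, 1) - F' (y, z) (0, 1))) (at z within {-R..R})" for z
        by (intro has_field_derivative_at_within[OF DERIV_diff] Da)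
      show "norm (F' (x, z) (0, 1) - F' (y, z) (0, 1)) \<le> max 0 C * \<bar>x - y\<bar>" if "z \<in> {-R..R}" for z
        using D1[OF xy that] by simp
    qed (use ab in auto)
    then show "\<bar>(L x b - L x a) - (L y b - L y a)\<bar> \<le> max 0 C * \<bar>x - y\<bar> * \<bar>a - b\<bar>"
      by (simp add: algebra_simps abs_minus_commute)
  qed simp
qed

text \<open>Coercivity comes from the Hamiltonian: \<open>- a * p - L x a \<le> Ham L x p\<close> at
  \<open>p = P\<close> and \<open>p = - P\<close>, where \<open>Ham L\<close> is bounded in
  \<open>x\<close> by continuity and periodicity.\<close>

lemma coercive_lagrangian_forward:
  assumes "Lagrangian_assms L" shows "coercive_lagrangian L"
proof
  have per: "periodic L" and sm: "smooth (\<lambda>(x, a). L x a)" and uc: "uniformly_convex_on_compacts L"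
    and bdd: "\<And>x p. bdd_above (range (\<lambda>a. - a * p - L x a))" and HC: "C_k 2 (\<lambda>(x, p). Ham L x p)"
    using assms unfolding Lagrangian_assms_def by auto
  show "uniformly_convex_on_compacts L" by (rule uc)
  have "C_k 0 (\<lambda>(x, a). L x a)" using sm unfolding smooth_def by blast
  then have contL: "continuous_on UNIV (\<lambda>z. L (fst z) (snd z))" by (simp add: case_prod_beta')
  show "continuous_on UNIV (L x)" for x
    by (rule continuous_on_compose2[OF contL, of UNIV "\<lambda>a. (x, a)", simplified]) (intro continuous_intros)
  show "\<exists>C\<ge>0. \<forall>x\<in>{0..2}. \<forall>y\<in>{0..2}. \<forall>a\<in>{-R..R}. \<forall>b\<in>{-R..R}.
        \<bar>(L x b - L x a) - (L y b - L y a)\<bar> \<le> C * \<bar>x - y\<bar> * \<bar>a - b\<bar>" for R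
    by (rule smooth_mixed_difference[OF sm])
  have bounded: "\<exists>C. \<forall>x. \<bar>\<phi> x\<bar> \<le> C" if "periodic \<phi>" "continuous_on UNIV \<phi>" for \<phi> :: "real \<Rightarrow> real"
  proof -
    have "compact (\<phi> ` {0..1})" by (intro compact_continuous_image continuous_on_subset[OF that(2)]) auto
    then have "bounded (\<phi> ` {0..1})" by (rule compact_imp_bounded)
    then obtain C where "\<forall>y\<in>\<phi> ` {0..1}. norm y \<le> C" unfolding bounded_iff by blast
    then have C: "\<And>x. x \<in> {0..1} \<Longrightarrow> \<bar>\<phi> x\<bar> \<le> C" by simp
    have "\<bar>\<phi> x\<bar> \<le> C" for x using C[of "frac x"] periodic_frac[OF that(1), of x] frac_lt_1[of x] by (simp add: less_imp_le)
    then show ?thesis by blast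
  qed
  show "\<exists>C. \<forall>x. \<bar>L x 0\<bar> \<le> C"
  proof (rule bounded)
    show "periodic (\<lambda>x. L x 0)" using per unfolding periodic_def by auto
    show "continuous_on UNIV (\<lambda>x. L x 0)"
      by (rule continuous_on_compose2[OF contL, of UNIV "\<lambda>x. (x, 0)", simplified]) (intro continuous_intros)
  qed
  have contH: "continuous_on UNIV (\<lambda>z. Ham L (fst z) (snd z))"
    using C_k_continuous[OF HC] by (simp add: case_prod_beta')
  have Hb: "\<exists>C. \<forall>x. \<bar>Ham L x p\<bar> \<le> C" for p
  proof (rule bounded)
    show "periodic (\<lambda>x. Ham L x p)" using per unfolding periodic_def Ham_def by auto
    show "continuous_on UNIV (\<lambda>x. Ham L x p)"
      by (rule continuous_on_compose2[OF contH, of UNIV "\<lambda>x. (x, p)", simplified]) (intro continuous_intros)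
  qed
  show "\<exists>C. \<forall>x a. P * \<bar>a\<bar> - C \<le> L x a" for P
  proof -
    obtain C1 C2 where C: "\<And>x. \<bar>Ham L x P\<bar> \<le> C1" "\<And>x. \<bar>Ham L x (- P)\<bar> \<le> C2" using Hb by metis
    have "P * \<bar>a\<bar> - (C1 + C2) \<le> L x a" for x a
    proof -
      have 1: "- a * p - L x a \<le> Ham L x p" for p
        unfolding Ham_def by (rule cSUP_upper[OF _ bdd]) auto
      have "C1 \<ge> 0" "C2 \<ge> 0" using C[of x] by linarith+
      then show ?thesis using 1[of P] 1[of "- P"] C[of x] by (cases "a \<ge> 0") (auto simp: algebra_simps abs_le_iff)
    qed
    then show ?thesis by blast
  qed
qed

lemma coercive_lagrangian_backward:
  assumes "coercive_lagrangian L" shows "coercive_lagrangian (\<lambda>x a. L x (- a))"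
proof -
  interpret L: coercive_lagrangian L by fact
  show ?thesis
  proof
    show "\<exists>C. \<forall>x a. P * \<bar>a\<bar> - C \<le> L x (- a)" for P
    proof -
      obtain C where "\<And>x a. P * \<bar>a\<bar> - C \<le> L x a" using L.coercive by blast
      then show ?thesis by (metis abs_minus_cancel)
    qed
    show "uniformly_convex_on_compacts (\<lambda>x a. L x (- a))"
      unfolding uniformly_convex_on_compacts_def
    proof (intro allI impI)
      fix R :: real assume "R > 0"
      from L.convex[unfolded uniformly_convex_on_compacts_def, rule_format, OF this]
      obtain c where c: "c > 0" "\<And>x a b s. a \<in> {-R..R} \<Longrightarrow> b \<in> {-R..R} \<Longrightarrow> s \<in> {0..1} \<Longrightarrow>
        L x (s * a + (1 - s) * b) \<le> s * L x a + (1 - s) * L x b - c * s * (1 - s) * (a - b)\<^sup>2" by blast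
      show "\<exists>c>0. \<forall>x. \<forall>a\<in>{-R..R}. \<forall>b\<in>{-R..R}. \<forall>s\<in>{0..1}.
        L x (- (s * a + (1 - s) * b)) \<le> s * L x (- a) + (1 - s) * L x (- b) - c * s * (1 - s) * (a - b)\<^sup>2"
      proof (intro exI[of _ c] conjI c(1) allI ballI)
        fix x a b s :: real assume "a \<in> {-R..R}" "b \<in> {-R..R}" "s \<in> {0..1}"
        then have "L x (s * (- a) + (1 - s) * (- b)) \<le> s * L x (- a) + (1 - s) * L x (- b) - c * s * (1 - s) * (- a - - b)\<^sup>2"
          by (intro c) auto
        moreover have "s * (- a) + (1 - s) * (- b) = - (s * a + (1 - s) * b)" "(- a - - b)\<^sup>2 = (a - b)\<^sup>2"
          by (simp_all add: power2_eq_square algebra_simps)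
        ultimately show "L x (- (s * a + (1 - s) * b)) \<le> s * L x (- a) + (1 - s) * L x (- b) - c * s * (1 - s) * (a - b)\<^sup>2"
          by simp
      qed
    qed
    show "continuous_on UNIV (\<lambda>a. L x (- a))" for x
      by (rule continuous_on_compose2[OF L.cont]) (auto intro: continuous_intros)
    show "\<exists>C. \<forall>x. \<bar>L x (- 0)\<bar> \<le> C" using L.zero_bounded by simp
    show "\<exists>C\<ge>0. \<forall>x\<in>{0..2}. \<forall>y\<in>{0..2}. \<forall>a\<in>{-R..R}. \<forall>b\<in>{-R..R}.
        \<bar>(L x (- b) - L x (- a)) - (L y (- b) - L y (- a))\<bar> \<le> C * \<bar>x - y\<bar> * \<bar>a - b\<bar>" for R
    proof -
      obtain C where C: "C \<ge> 0" "\<And>x y a b. x\<in>{0..2} \<Longrightarrow> y\<in>{0..2} \<Longrightarrow> a\<in>{-R..R} \<Longrightarrow> b\<in>{-R..R} \<Longrightarrow>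
        \<bar>(L x b - L x a) - (L y b - L y a)\<bar> \<le> C * \<bar>x - y\<bar> * \<bar>a - b\<bar>" using L.mixed by blast
      show ?thesis
      proof (intro exI[of _ C] conjI C(1) ballI)
        fix x y a b :: real assume "x \<in> {0..2}" "y \<in> {0..2}" "a \<in> {-R..R}" "b \<in> {-R..R}"
        then have "\<bar>(L x (- b) - L x (- a)) - (L y (- b) - L y (- a))\<bar> \<le> C * \<bar>x - y\<bar> * \<bar>- a - - b\<bar>"
          by (intro C) auto
        then show "\<bar>(L x (- b) - L x (- a)) - (L y (- b) - L y (- a))\<bar> \<le> C * \<bar>x - y\<bar> * \<bar>a - b\<bar>"
          by (simp add: abs_minus_commute)
      qed
    qed
  qed
qed

lemma Ham_down_eq: "Ham_down L x p = Ham_up (\<lambda>x a. L x (- a)) x (- p) + L x 0"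
  unfolding Ham_down_def Ham_up_def by simp

section \<open>Measures on the grid\<close>

lemma sets_emb [simp]: "sets (emb n m) = sets borel"
  by (simp add: emb_def)

lemma space_emb [simp]: "space (emb n m) = UNIV"
  by (simp add: emb_def)

lemma emeasure_emb:
  assumes "m \<in> MS n" "S \<in> sets borel"
  shows "emeasure (emb n m) S = ennreal (\<Sum>j=1..n. m j * indicator S (frac (grid n j)))"
proof -
  let ?X = "(\<lambda>j. frac (grid n j)) -` S \<inter> {1..n}"
  have "emeasure (emb n m) S = emeasure (point_measure {1..n} (\<lambda>j. ennreal (m j))) ?X"
    unfolding emb_def using assms(2)
    by (subst emeasure_distr) (auto simp: space_point_measure measurable_def sets_point_measure)
  also have "\<dots> = (\<Sum>j\<in>?X. ennreal (m j))"
    by (intro emeasure_point_measure_finite) auto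
  also have "\<dots> = ennreal (\<Sum>j\<in>?X. m j)"
    using assms(1) by (intro sum_ennreal) (auto simp: MS_def)
  also have "(\<Sum>j\<in>?X. m j) = (\<Sum>j=1..n. if frac (grid n j) \<in> S then m j else 0)"
    by (subst sum.inter_filter[symmetric]) (auto intro!: sum.cong)
  also have "\<dots> = (\<Sum>j=1..n. m j * indicator S (frac (grid n j)))"
    by (intro sum.cong) (auto simp: indicator_def)
  finally show ?thesis .
qed

lemma frac_unit: "frac x \<in> {0..<1::real}"
  using frac_lt_1[of x] by simp

lemma emb_M2T:
  assumes "m \<in> M2S n" shows "emb n m \<in> M2T"
proof -
  have m: "m \<in> MS n" using assms by (simp add: M2S_def)
  have "emeasure (emb n m) (- {0..<1}) = 0"
    using frac_unit by (subst emeasure_emb[OF m]) (auto simp: indicator_def)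
  moreover have "emeasure (emb n m) UNIV = ennreal (\<Sum>j=1..n. m j)"
    by (subst emeasure_emb[OF m]) auto
  moreover have "ennreal (\<Sum>j=1..n. m j) \<le> 2"
    using M2S_mass[OF assms] ennreal_leI by fastforce
  ultimately show ?thesis unfolding M2T_def MT_def by (auto simp: top.not_eq_extremum)
qed

lemma integral_emb:
  assumes "m \<in> MS n" "\<phi> \<in> borel_measurable borel"
  shows "(LINT x|emb n m. \<phi> x) = (\<Sum>j=1..n. m j * \<phi> (frac (grid n j)))"
proof -
  have "(LINT x|emb n m. \<phi> x) = (LINT j|point_measure {1..n} (\<lambda>j. ennreal (m j)). \<phi> (frac (grid n j)))"
    unfolding emb_def by (intro integral_distr assms(2)) (auto simp: measurable_def space_point_measure sets_point_measure)
  also have "\<dots> = (\<Sum>j=1..n. m j * \<phi> (frac (grid n j)))"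
    using assms(1) by (subst lebesgue_integral_point_measure_finite) (auto simp: MS_def)
  finally show ?thesis .
qed

definition toward :: "(nat \<Rightarrow> real) \<Rightarrow> nat \<Rightarrow> real \<Rightarrow> nat \<Rightarrow> real" where
  "toward m k \<theta> = (\<lambda>i. (1 - \<theta>) * m i + \<theta> * (if i = k then 1 else 0))"

lemma lincomb_emb:
  assumes m: "m \<in> MS n" and k: "k \<in> {1..n}" and \<theta>: "0 \<le> \<theta>" "\<theta> \<le> 1"
  shows "lincomb (1 - \<theta>) (emb n m) \<theta> (dirac (grid n k)) = emb n (toward m k \<theta>)"
proof -
  have t: "toward m k \<theta> \<in> MS n"
    using m k \<theta> unfolding MS_def toward_def by auto
  have "lincomb (1 - \<theta>) (emb n m) \<theta> (dirac (grid n k)) = measure_of UNIV (sets borel) (emeasure (emb n (toward m k \<theta>)))"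
    unfolding lincomb_def
  proof (rule measure_of_eq)
    show "sets borel \<subseteq> Pow (UNIV::real set)" by simp
    fix S :: "real set" assume "S \<in> sigma_sets UNIV (sets borel)"
    then have S: "S \<in> sets borel" using sets.sigma_sets_eq[of "borel::real measure"] by simp
    have "(\<Sum>j=1..n. toward m k \<theta> j * indicator S (frac (grid n j)))
      = (1 - \<theta>) * (\<Sum>j=1..n. m j * indicator S (frac (grid n j)))
        + \<theta> * (\<Sum>j=1..n. if j = k then indicator S (frac (grid n j)) else 0)"
      unfolding toward_def sum_distrib_left sum.distrib[symmetric]
      by (intro sum.cong) (auto simp: algebra_simps)
    also have "(\<Sum>j=1..n. if j = k then indicator S (frac (grid n j)) else 0) = (indicator S (frac (grid n k)) :: real)"
      using k by simp
    finally have eq: "(\<Sum>j=1..n. toward m k \<theta> j * indicator S (frac (grid n j)))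
      = (1 - \<theta>) * (\<Sum>j=1..n. m j * indicator S (frac (grid n j))) + \<theta> * indicator S (frac (grid n k))" .
    have nn: "(\<Sum>j=1..n. m j * indicator S (frac (grid n j))) \<ge> 0"
      using m unfolding MS_def by (intro sum_nonneg) (auto simp: indicator_def)
    have "emeasure (dirac (grid n k)) S = ennreal (indicator S (frac (grid n k)))"
      unfolding dirac_def using S by (simp add: indicator_def)
    then show "ennreal (1 - \<theta>) * emeasure (emb n m) S + ennreal \<theta> * emeasure (dirac (grid n k)) S
       = emeasure (emb n (toward m k \<theta>)) S"
      unfolding emeasure_emb[OF m S] emeasure_emb[OF t S] eq
      using nn \<theta> by (simp add: ennreal_plus ennreal_mult)
  qed
  also have "\<dots> = emb n (toward m k \<theta>)"
    using measure_of_of_measure[of "emb n (toward m k \<theta>)"] by simp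
  finally show ?thesis .
qed

lemma grid_bounds: "i \<in> {1..n} \<Longrightarrow> 0 \<le> grid n i \<and> grid n i \<le> 1"
  by (auto simp: grid_def divide_le_eq)

lemma periodic_next:
  assumes "periodic \<phi>" "i \<in> {1..n}"
  shows "\<phi> (grid n (next_idx n i)) = \<phi> (grid n i + 1 / real n)"
proof (cases "i = n")
  case True
  then have "grid n i = 1" "grid n (next_idx n i) = 1 / real n" using assms by (auto simp: grid_def next_idx_def)
  then show ?thesis using assms(1) unfolding periodic_def by (metis add.commute)
next
  case False
  then show ?thesis by (simp add: grid_def next_idx_def add_divide_distrib add.commute)
qed

lemma periodic_prev:
  assumes "periodic \<phi>" "i \<in> {1..n}"
  shows "\<phi> (grid n (prev_idx n i)) = \<phi> (grid n i - 1 / real n)"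
proof (cases "i = 1")
  case True
  then have "grid n i = 1 / real n" "grid n (prev_idx n i) = 0 + 1" using assms by (auto simp: grid_def prev_idx_def)
  then show ?thesis using assms(1) unfolding periodic_def by (metis diff_self)
next
  case False
  then have "real (prev_idx n i) = real i - 1" using assms by (auto simp: prev_idx_def of_nat_diff)
  then show ?thesis by (simp add: grid_def diff_divide_distrib)
qed

section \<open>The distance \<open>W1\<close> on grid measures\<close>

lemma test_function_grid_lipschitz:
  assumes n: "n \<ge> 1" and \<phi>: "periodic \<phi>" "1-lipschitz_on UNIV \<phi>" "\<phi> 0 = 0"
  shows "grid_lipschitz n 1 (\<lambda>i. \<phi> (grid n i))"
proof -
  have lip: "\<bar>\<phi> x - \<phi> y\<bar> \<le> \<bar>x - y\<bar>" for x y
    using lipschitz_onD[OF \<phi>(2), of x y] by (simp add: dist_real_def)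
  show ?thesis
    unfolding grid_lipschitz_def
  proof (intro conjI ballI)
    fix i assume i: "i \<in> {1..n}"
    show "\<bar>\<phi> (grid n (next_idx n i)) - \<phi> (grid n i)\<bar> \<le> 1 / real n"
      unfolding periodic_next[OF \<phi>(1) i] using lip[of "grid n i + 1 / real n" "grid n i"] by simp
    show "\<bar>\<phi> (grid n i)\<bar> \<le> 1" using lip[of "grid n i" 0] grid_bounds[OF i] \<phi>(3) by simp
  qed
qed

lemma integral_emb_test:
  assumes m: "m \<in> MS n" and \<phi>: "periodic \<phi>" "1-lipschitz_on UNIV \<phi>"
  shows "(LINT x|emb n m. \<phi> x) = pairing n (\<lambda>i. \<phi> (grid n i)) m"
proof -
  have "continuous_on UNIV \<phi>" using \<phi>(2) by (rule lipschitz_on_continuous_on)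
  then have "\<phi> \<in> borel_measurable borel" by (rule borel_measurable_continuous_onI)
  from integral_emb[OF m this] show ?thesis unfolding pairing_def using periodic_frac[OF \<phi>(1)]
    by (simp add: mult.commute)
qed

lemma W1_test_nonempty: "(\<lambda>_. 0) \<in> {\<phi>::real\<Rightarrow>real. periodic \<phi> \<and> 1-lipschitz_on UNIV \<phi> \<and> \<phi> 0 = 0}"
  by (auto simp: periodic_def lipschitz_on_def)

text \<open>\<open>W1\<close> is a \<open>SUP\<close> of reals and says something only if the set is
  bounded above; the estimate by \<open>w\<close> supplies this bound too.\<close>

lemma W1_emb:
  assumes n: "n \<ge> 1" and m: "m \<in> M2S n" "m' \<in> M2S n" and w: "W1_close n m m' w"
  shows "0 \<le> W1 (emb n m) (emb n m')" "W1 (emb n m) (emb n m') \<le> w"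
proof -
  let ?S = "{\<phi>::real\<Rightarrow>real. periodic \<phi> \<and> 1-lipschitz_on UNIV \<phi> \<and> \<phi> 0 = 0}"
  let ?v = "\<lambda>\<phi>. (LINT x|emb n m. \<phi> x) - (LINT x|emb n m'. \<phi> x)"
  have ms: "m \<in> MS n" "m' \<in> MS n" using m by (auto simp: M2S_def)
  have le: "?v \<phi> \<le> w" if "\<phi> \<in> ?S" for \<phi>
  proof -
    have \<phi>: "periodic \<phi>" "1-lipschitz_on UNIV \<phi>" "\<phi> 0 = 0" using that by auto
    have "?v \<phi> = pairing n (\<lambda>i. \<phi> (grid n i)) (\<lambda>i. m i - m' i)"
      unfolding integral_emb_test[OF ms(1) \<phi>(1,2)] integral_emb_test[OF ms(2) \<phi>(1,2)] pairing_diff_right ..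
    also have "\<dots> \<le> w" using w test_function_grid_lipschitz[OF n \<phi>] unfolding W1_close_def by blast
    finally show ?thesis .
  qed
  then have bdd: "bdd_above (?v ` ?S)" by (intro bdd_aboveI2[where M=w])
  show "W1 (emb n m) (emb n m') \<le> w" unfolding W1_def by (intro cSUP_least le) (use W1_test_nonempty in blast)
  have "?v (\<lambda>_. 0) \<le> W1 (emb n m) (emb n m')" unfolding W1_def by (intro cSUP_upper W1_test_nonempty bdd)
  then show "0 \<le> W1 (emb n m) (emb n m')" by simp
qed

lemma W1_close_l1: "W1_close n m m' (\<Sum>i=1..n. \<bar>m i - m' i\<bar>)"
  unfolding W1_close_def
proof (intro allI impI)
  fix \<phi> assume "grid_lipschitz n 1 \<phi>"
  then have "\<bar>pairing n \<phi> (\<lambda>i. m i - m' i)\<bar> \<le> 1 * (\<Sum>i=1..n. \<bar>m i - m' i\<bar>)"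
    by (intro abs_pairing_le) (auto simp: grid_lipschitz_def)
  then show "pairing n \<phi> (\<lambda>i. m i - m' i) \<le> (\<Sum>i=1..n. \<bar>m i - m' i\<bar>)" by linarith
qed

lemma W1_close_nonneg:
  assumes "W1_close n m \<nu> w" shows "0 \<le> w"
proof -
  have "grid_lipschitz n 1 (\<lambda>_. 0)" unfolding grid_lipschitz_def by simp
  then show ?thesis using assms unfolding W1_close_def pairing_def by fastforce
qed

lemma W1_close_sym: "W1_close n m m' w \<Longrightarrow> W1_close n m' m w"
  unfolding W1_close_def
proof (intro allI impI)
  fix \<phi> assume a: "\<forall>\<phi>. grid_lipschitz n 1 \<phi> \<longrightarrow> pairing n \<phi> (\<lambda>i. m i - m' i) \<le> w" and \<phi>: "grid_lipschitz n 1 \<phi>"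
  have "\<bar>- \<phi> (next_idx n i) - - \<phi> i\<bar> = \<bar>\<phi> (next_idx n i) - \<phi> i\<bar>" for i by simp
  then have "grid_lipschitz n 1 (\<lambda>i. - \<phi> i)" using \<phi> unfolding grid_lipschitz_def by simp
  then have "pairing n (\<lambda>i. - \<phi> i) (\<lambda>i. m i - m' i) \<le> w" using a by blast
  then show "pairing n \<phi> (\<lambda>i. m' i - m i) \<le> w" unfolding pairing_uminus_left pairing_diff_right by simp
qed

lemma W1_emb_l1:
  assumes "n \<ge> 1" "m \<in> M2S n" "m' \<in> M2S n"
  shows "0 \<le> W1 (emb n m) (emb n m')" "W1 (emb n m) (emb n m') \<le> (\<Sum>i=1..n. \<bar>m i - m' i\<bar>)"
  using W1_emb[OF assms W1_close_l1] by auto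

lemma null_measure_M2T: "null_measure borel \<in> M2T"
  unfolding M2T_def MT_def by (simp add: emeasure_null_measure)

lemma W1_null:
  assumes n: "n \<ge> 1" and m: "m \<in> M2S n"
  shows "W1 (emb n m) (null_measure borel) \<le> 2" "0 \<le> W1 (emb n m) (null_measure borel)"
proof -
  let ?S = "{\<phi>::real\<Rightarrow>real. periodic \<phi> \<and> 1-lipschitz_on UNIV \<phi> \<and> \<phi> 0 = 0}"
  let ?v = "\<lambda>\<phi>. (LINT x|emb n m. \<phi> x) - (LINT x|null_measure borel. \<phi> x)"
  have ms: "m \<in> MS n" using m by (auto simp: M2S_def)
  have le: "?v \<phi> \<le> 2" if "\<phi> \<in> ?S" for \<phi>
  proof -
    have \<phi>: "periodic \<phi>" "1-lipschitz_on UNIV \<phi>" "\<phi> 0 = 0" using that by auto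
    have "?v \<phi> = pairing n (\<lambda>i. \<phi> (grid n i)) m"
      unfolding integral_emb_test[OF ms \<phi>(1,2)] by simp
    also have "\<dots> \<le> 1 * 2"
      using abs_pairing_le[OF _ M2S_abs_mass[OF m], of "\<lambda>i. \<phi> (grid n i)" 1] test_function_grid_lipschitz[OF n \<phi>]
      by (auto simp: grid_lipschitz_def abs_le_iff)
    finally show ?thesis by simp
  qed
  then have bdd: "bdd_above (?v ` ?S)" by (intro bdd_aboveI2[where M=2])
  show "W1 (emb n m) (null_measure borel) \<le> 2" unfolding W1_def by (intro cSUP_least le) (use W1_test_nonempty in blast)
  have "?v (\<lambda>_. 0) \<le> W1 (emb n m) (null_measure borel)" unfolding W1_def by (intro cSUP_upper W1_test_nonempty bdd)
  then show "0 \<le> W1 (emb n m) (null_measure borel)" by simp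
qed

text \<open>The null measure is a reference point at distance at most 2 from every grid measure, for
  all \<open>n\<close> at once. The state distance is then at most \<open>T + 3 + 3 + 2\<close>, and
  the modulus at \<open>T + 8\<close> gives a bound independent of \<open>n\<close>.\<close>

lemma modulus_of_bound:
  assumes \<omega>: "modulus \<omega>" and Fn: "modulus_of T \<omega> Fn" and T: "T > 0"
  shows "\<exists>C\<ge>0. \<forall>n\<ge>1. \<forall>m\<in>M2S n. \<forall>t\<in>{0..T}. \<forall>x\<in>{-3..3}. \<forall>y\<in>{-3..3}. \<bar>Fn t x (emb n m) y\<bar> \<le> C"
proof (intro exI conjI allI impI ballI)
  let ?C = "\<bar>Fn 0 0 (null_measure borel) 0\<bar> + \<bar>\<omega> (T + 8)\<bar>"
  show "0 \<le> ?C" by simp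
  fix n :: nat and m t x y
  assume n: "n \<ge> 1" and m: "m \<in> M2S n" and t: "t \<in> {0..T}" and x: "x \<in> {-3..3::real}" and y: "y \<in> {-3..3::real}"
  have "\<bar>Fn t x (emb n m) y - Fn 0 0 (null_measure borel) 0\<bar> \<le> \<omega> (state_dist t x (emb n m) y 0 0 (null_measure borel) 0)"
    using Fn t T emb_M2T[OF m] null_measure_M2T unfolding modulus_of_def by auto
  also have "\<dots> \<le> \<omega> (T + 8)"
  proof -
    have "mono_on {0..} \<omega>" using \<omega> by (simp add: modulus_def)
    moreover have "0 \<le> state_dist t x (emb n m) y 0 0 (null_measure borel) 0" "state_dist t x (emb n m) y 0 0 (null_measure borel) 0 \<le> T + 8"
      using W1_null[OF n m] t x y unfolding state_dist_def by auto
    ultimately show ?thesis using T by (auto simp: mono_on_def)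
  qed
  finally show "\<bar>Fn t x (emb n m) y\<bar> \<le> ?C" by linarith
qed

lemma continuous_on_emb:
  assumes n: "n \<ge> 1" and Fn: "continuous_in_args T Fn"
  shows "continuous_on ({0..T} \<times> M2S n) (\<lambda>(t, m). Fn t x (emb n m) y)"
  unfolding continuous_on_def
proof (intro ballI tendstoI)
  fix z and e :: real assume z: "z \<in> {0..T} \<times> M2S n" and e: "e > 0"
  obtain t m where tm: "z = (t, m)" by fastforce
  have tm': "t \<in> {0..T}" "m \<in> M2S n" using z tm by auto
  from Fn[unfolded continuous_in_args_def, rule_format, OF tm'(1) emb_M2T[OF tm'(2)] e, of x y]
  obtain d where d: "d > 0" "\<forall>t'\<in>{0..T}. \<forall>x'. \<forall>m'\<in>M2T. \<forall>y'. state_dist t x (emb n m) y t' x' m' y' < d \<longrightarrow> \<bar>Fn t x (emb n m) y - Fn t' x' m' y'\<bar> < e"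
    by blast
  have c: "continuous_on ({0..T} \<times> M2S n) (\<lambda>z'. \<bar>t - fst z'\<bar> + (\<Sum>i=1..n. \<bar>m i - snd z' i\<bar>))"
    by (intro continuous_on_add continuous_on_rabs continuous_on_diff continuous_on_const continuous_on_sum
      continuous_on_coord continuous_on_fst continuous_on_snd continuous_on_id)
  have "((\<lambda>z'. \<bar>t - fst z'\<bar> + (\<Sum>i=1..n. \<bar>m i - snd z' i\<bar>)) \<longlongrightarrow> 0) (at z within {0..T} \<times> M2S n)"
    using c[unfolded continuous_on_def, rule_format, OF z] unfolding tm by simp
  then have "\<forall>\<^sub>F z' in at z within {0..T} \<times> M2S n. \<bar>t - fst z'\<bar> + (\<Sum>i=1..n. \<bar>m i - snd z' i\<bar>) < d"
    using d(1) by (rule order_tendstoD(2))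
  moreover have "\<forall>\<^sub>F z' in at z within {0..T} \<times> M2S n. z' \<in> {0..T} \<times> M2S n"
    by (simp add: eventually_at_filter)
  ultimately show "\<forall>\<^sub>F z' in at z within {0..T} \<times> M2S n.
     dist (case z' of (t, m) \<Rightarrow> Fn t x (emb n m) y) (case z of (t, m) \<Rightarrow> Fn t x (emb n m) y) < e"
  proof eventually_elim
    case (elim z')
    obtain t' m' where z': "z' = (t', m')" by fastforce
    have t': "t' \<in> {0..T}" "m' \<in> M2S n" using elim(2) z' by auto
    have "state_dist t x (emb n m) y t' x (emb n m') y < d"
      using elim(1) W1_emb_l1(2)[OF n tm'(2) t'(2)] unfolding state_dist_def z' by simp
    then have "\<bar>Fn t x (emb n m) y - Fn t' x (emb n m') y\<bar> < e" using d(2) t' emb_M2T by blast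
    then show ?case unfolding tm z' by (simp add: dist_real_def abs_minus_commute)
  qed
qed

section \<open>Differentiability on the simplex\<close>

definition mass :: "nat \<Rightarrow> (nat \<Rightarrow> real) \<Rightarrow> real" where
  "mass n a = (\<Sum>i=1..n. a i)"

definition normalize :: "nat \<Rightarrow> (nat \<Rightarrow> real) \<Rightarrow> nat \<Rightarrow> real" where
  "normalize n a = (\<lambda>i. a i / mass n a)"

lemma normalize_PS: "a \<in> MS n \<Longrightarrow> mass n a > 0 \<Longrightarrow> normalize n a \<in> PS n"
  unfolding PS_def MS_def normalize_def mass_def by (auto simp: sum_divide_distrib[symmetric])

lemma mass_upd: "k \<in> {1..n} \<Longrightarrow> mass n (a(k := a k + s)) = mass n a + s"
proof -
  assume k: "k \<in> {1..n}"
  have "mass n (a(k := a k + s)) = (\<Sum>i=1..n. a i + (if i = k then s else 0))"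
    unfolding mass_def by (intro sum.cong) auto
  then show ?thesis using k by (simp add: sum.distrib mass_def)
qed

lemma MS_upd: "a \<in> MS n \<Longrightarrow> k \<in> {1..n} \<Longrightarrow> s \<ge> 0 \<Longrightarrow> a(k := a k + s) \<in> MS n"
  unfolding MS_def by auto

lemma normalize_upd:
  assumes "k \<in> {1..n}" "mass n a > 0" "r > 0"
  shows "normalize n (a(k := a k + r)) = toward (normalize n a) k (r / (mass n a + r))"
proof
  fix i
  have "1 - r / (mass n a + r) = mass n a / (mass n a + r)" using assms by (simp add: field_simps)
  then show "normalize n (a(k := a k + r)) i = toward (normalize n a) k (r / (mass n a + r)) i"
    unfolding normalize_def toward_def mass_upd[OF assms(1)] using assms(2,3)
    by (auto simp: add_divide_distrib)
qed

text \<open>In the homogeneous coordinates \<open>a\<close> with \<open>m = normalize a\<close>, moving \<open>m\<close> towards a Dirac mass is moving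
  along a coordinate axis, so the derivatives towards Dirac masses become right partial derivatives.\<close>

lemma coordinate_increment:
  fixes u :: "(nat \<Rightarrow> real) \<Rightarrow> real"
  assumes k: "k \<in> {1..n}" and a: "a \<in> MS n" "mass n a > 0" and s: "s \<ge> 0"
    and cont: "continuous_on (PS n) u"
    and der: "\<And>m. m \<in> PS n \<Longrightarrow> ((\<lambda>\<theta>. (u (toward m k \<theta>) - u m) / \<theta>) \<longlongrightarrow> d m) (at_right 0)"
    and bd: "\<And>\<sigma>. 0 \<le> \<sigma> \<Longrightarrow> \<sigma> \<le> s \<Longrightarrow>
        \<bar>d (normalize n (a(k := a k + \<sigma>))) / mass n (a(k := a k + \<sigma>)) - c\<bar> \<le> e"
  shows "\<bar>u (normalize n (a(k := a k + s))) - u (normalize n a) - c * s\<bar> \<le> e * s"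
proof -
  let ?b = "\<lambda>\<sigma>. a(k := a k + \<sigma>)"
  have b: "?b \<sigma> \<in> MS n" "mass n (?b \<sigma>) > 0" "normalize n (?b \<sigma>) \<in> PS n" if "\<sigma> \<ge> 0" for \<sigma>
  proof -
    show 1: "?b \<sigma> \<in> MS n" by (rule MS_upd[OF a(1) k that])
    show 2: "mass n (?b \<sigma>) > 0" unfolding mass_upd[OF k] using a(2) that by simp
    show "normalize n (?b \<sigma>) \<in> PS n" by (rule normalize_PS[OF 1 2])
  qed
  have "\<bar>u (normalize n (?b s)) - u (normalize n (?b 0)) - c * (s - 0)\<bar> \<le> e * (s - 0)"
  proof (rule right_derivative_abs_bound[OF s, where D="\<lambda>\<sigma>. d (normalize n (?b \<sigma>)) / mass n (?b \<sigma>)"])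
    show "continuous_on {0..s} (\<lambda>\<sigma>. u (normalize n (?b \<sigma>)))"
    proof (rule continuous_on_compose2[OF cont])
      show "continuous_on {0..s} (\<lambda>\<sigma>. normalize n (?b \<sigma>))"
        unfolding normalize_def mass_upd[OF k]
      proof (intro continuous_on_coordinatewise_then_product continuous_on_divide continuous_on_add continuous_on_const continuous_on_id)
        show "continuous_on {0..s} (\<lambda>\<sigma>. (?b \<sigma>) i)" for i
          by (cases "i = k") (auto intro: continuous_intros)
      qed (use a(2) in auto)
      show "(\<lambda>\<sigma>. normalize n (?b \<sigma>)) ` {0..s} \<subseteq> PS n" using b(3) by auto
    qed
  next
    fix \<sigma> assume \<sigma>: "\<sigma> \<in> {0..<s}"
    define S where "S = mass n (?b \<sigma>)"
    define m where "m = normalize n (?b \<sigma>)"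
    have S0: "S > 0" and m: "m \<in> PS n" unfolding S_def m_def using b \<sigma> by auto
    have th: "filterlim (\<lambda>r. r / (S + r)) (at_right 0) (at_right 0)"
      unfolding filterlim_at
    proof
      have "((\<lambda>r. r / (S + r)) \<longlongrightarrow> 0 / (S + 0)) (at_right 0)" using S0 by (intro tendsto_intros) auto
      then show "((\<lambda>r. r / (S + r)) \<longlongrightarrow> 0) (at_right 0)" by simp
      have "\<forall>\<^sub>F r in at_right (0::real). r > 0" by (simp add: eventually_at_right_less)
      then show "\<forall>\<^sub>F r in at_right 0. r / (S + r) \<in> {0<..} \<and> r / (S + r) \<noteq> 0"
        by eventually_elim (use S0 in auto)
    qed
    have "((\<lambda>r. (u (toward m k (r / (S + r))) - u m) / (r / (S + r)) * (1 / (S + r))) \<longlongrightarrow> d m * (1 / (S + 0))) (at_right 0)"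
      using S0 by (intro tendsto_mult filterlim_compose[OF der[OF m] th] tendsto_intros) auto
    then have "((\<lambda>r. (u (toward m k (r / (S + r))) - u m) / (r / (S + r)) * (1 / (S + r))) \<longlongrightarrow> d m / S) (at_right 0)"
      by simp
    then show "((\<lambda>r. (u (normalize n (?b (\<sigma> + r))) - u (normalize n (?b \<sigma>))) / r) \<longlongrightarrow> d (normalize n (?b \<sigma>)) / mass n (?b \<sigma>)) (at_right 0)"
      unfolding S_def[symmetric] m_def[symmetric]
    proof (rule Lim_transform_eventually)
      have "\<forall>\<^sub>F r in at_right (0::real). r > 0" by (simp add: eventually_at_right_less)
      then show "\<forall>\<^sub>F r in at_right 0. (u (toward m k (r / (S + r))) - u m) / (r / (S + r)) * (1 / (S + r))
          = (u (normalize n (?b (\<sigma> + r))) - u m) / r"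
      proof eventually_elim
        case (elim r)
        have "?b (\<sigma> + r) = (?b \<sigma>)(k := (?b \<sigma>) k + r)" by (auto simp: fun_eq_iff)
        then have "normalize n (?b (\<sigma> + r)) = toward m k (r / (S + r))"
          using normalize_upd[OF k _ elim, of "?b \<sigma>"] S0 unfolding S_def m_def by simp
        then show ?case using S0 elim by simp
      qed
    qed
  next
    fix \<sigma> assume "\<sigma> \<in> {0..<s}"
    then show "\<bar>d (normalize n (?b \<sigma>)) / mass n (?b \<sigma>) - c\<bar> \<le> e" by (intro bd) auto
  qed
  then show ?thesis by simp
qed

text \<open>The entries of \<open>m\<close> are replaced by those of \<open>m'\<close> one at a
  time, each replacement being a coordinate increment. Intermediate vectors have mass different from
  1, which \<open>normalize\<close> absorbs. Continuity of \<open>d\<close> on a compact set makes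
  the remainder uniform in \<open>t\<close> and \<open>m\<close>.\<close>

lemma simplex_uniform_differentiability:
  fixes u :: "real \<Rightarrow> (nat \<Rightarrow> real) \<Rightarrow> real" and d :: "nat \<Rightarrow> real \<Rightarrow> (nat \<Rightarrow> real) \<Rightarrow> real"
  assumes n: "n \<ge> 1"
    and u_cont: "\<And>t. t \<in> {0..T} \<Longrightarrow> continuous_on (PS n) (u t)"
    and d_cont: "\<And>k. k \<in> {1..n} \<Longrightarrow> continuous_on ({0..T} \<times> PS n) (\<lambda>(t, m). d k t m)"
    and der: "\<And>t m k. t \<in> {0..T} \<Longrightarrow> m \<in> PS n \<Longrightarrow> k \<in> {1..n} \<Longrightarrow>
        ((\<lambda>\<theta>. (u t (toward m k \<theta>) - u t m) / \<theta>) \<longlongrightarrow> d k t m) (at_right 0)"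
    and e: "e > 0"
  shows "\<exists>\<delta>>0. \<forall>t\<in>{0..T}. \<forall>m\<in>PS n. \<forall>m'\<in>PS n. (\<Sum>i=1..n. \<bar>m' i - m i\<bar>) < \<delta> \<longrightarrow>
    \<bar>u t m' - u t m - (\<Sum>k=1..n. d k t m * (m' k - m k))\<bar> \<le> e * (\<Sum>i=1..n. \<bar>m' i - m i\<bar>)"
proof -
  have dc: "continuous_on ({0..T} \<times> PS n) (\<lambda>z. d k (fst z) (snd z))" if "k \<in> {1..n}" for k
    using d_cont[OF that] by (simp add: case_prod_beta')
  obtain D where D: "D \<ge> 0" "\<And>k t m. k \<in> {1..n} \<Longrightarrow> t \<in> {0..T} \<Longrightarrow> m \<in> PS n \<Longrightarrow> \<bar>d k t m\<bar> \<le> D"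
  proof -
    have "\<exists>C\<ge>0. \<forall>k\<in>{1..n}. \<forall>z\<in>{0..T} \<times> PS n. \<bar>d k (fst z) (snd z)\<bar> \<le> C"
    proof (rule finite_bound)
      fix k assume "k \<in> {1..n}"
      from real_has_max_bound[OF compact_Times[OF compact_Icc compact_PS] dc[OF this]]
      show "\<exists>C. \<forall>z\<in>{0..T} \<times> PS n. \<bar>d k (fst z) (snd z)\<bar> \<le> C" by blast
    qed simp
    then show ?thesis using that by fastforce
  qed
  obtain \<delta>0 where \<delta>0: "\<delta>0 > 0" "\<And>t m m' k. t \<in> {0..T} \<Longrightarrow> m \<in> PS n \<Longrightarrow> m' \<in> PS n \<Longrightarrow> k \<in> {1..n} \<Longrightarrow>
      (\<Sum>i=1..n. \<bar>m i - m' i\<bar>) < \<delta>0 \<Longrightarrow> \<bar>d k t m - d k t m'\<bar> < e / 4"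
  proof -
    define K where "K = {0..T} \<times> PS n \<times> PS n"
    have "\<exists>\<delta>>0. \<forall>z\<in>K. (\<Sum>i=1..n. \<bar>fst (snd z) i - snd (snd z) i\<bar>) < \<delta> \<longrightarrow>
        (\<Sum>k=1..n. \<bar>d k (fst z) (fst (snd z)) - d k (fst z) (snd (snd z))\<bar>) < e / 4"
    proof (rule compact_gauge)
      show "compact K" unfolding K_def by (intro compact_Times compact_Icc compact_PS)
      have p: "continuous_on K (\<lambda>z. (fst z, fst (snd z)))" "continuous_on K (\<lambda>z. (fst z, snd (snd z)))"
        by (intro continuous_on_Pair continuous_on_fst continuous_on_snd continuous_on_id)+
      have "continuous_on K (\<lambda>z. d k (fst z) (fst (snd z)))" "continuous_on K (\<lambda>z. d k (fst z) (snd (snd z)))" if "k \<in> {1..n}" for k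
      proof -
        show "continuous_on K (\<lambda>z. d k (fst z) (fst (snd z)))"
          using continuous_on_compose2[OF dc[OF that] p(1)] by (simp add: K_def image_subset_iff)
        show "continuous_on K (\<lambda>z. d k (fst z) (snd (snd z)))"
          using continuous_on_compose2[OF dc[OF that] p(2)] by (simp add: K_def image_subset_iff)
      qed
      then show "continuous_on K (\<lambda>z. \<Sum>k=1..n. \<bar>d k (fst z) (fst (snd z)) - d k (fst z) (snd (snd z))\<bar>)"
        by (intro continuous_on_sum continuous_on_rabs continuous_on_diff) auto
      show "continuous_on K (\<lambda>z. \<Sum>i=1..n. \<bar>fst (snd z) i - snd (snd z) i\<bar>)"
        by (intro continuous_on_sum continuous_on_rabs continuous_on_diff continuous_on_coord
          continuous_on_fst continuous_on_snd continuous_on_id)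
      show "0 < e / 4" using e by simp
      fix z assume z: "z \<in> K"
      show "0 \<le> (\<Sum>i=1..n. \<bar>fst (snd z) i - snd (snd z) i\<bar>)" by (intro sum_nonneg) auto
      assume "(\<Sum>i=1..n. \<bar>fst (snd z) i - snd (snd z) i\<bar>) = 0"
      then have "fst (snd z) i = snd (snd z) i" if "i \<in> {1..n}" for i using that by (simp add: sum_nonneg_eq_0_iff)
      moreover have "fst (snd z) i = snd (snd z) i" if "i \<notin> {1..n}" for i
        using z that unfolding K_def PS_def MS_def by auto
      ultimately have "fst (snd z) = snd (snd z)" by (metis ext)
      then show "(\<Sum>k=1..n. \<bar>d k (fst z) (fst (snd z)) - d k (fst z) (snd (snd z))\<bar>) \<le> 0" by simp
    qed
    then obtain \<delta> where \<delta>: "\<delta> > 0" "\<forall>z\<in>K. (\<Sum>i=1..n. \<bar>fst (snd z) i - snd (snd z) i\<bar>) < \<delta> \<longrightarrow>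
        (\<Sum>k=1..n. \<bar>d k (fst z) (fst (snd z)) - d k (fst z) (snd (snd z))\<bar>) < e / 4" by blast
    show ?thesis
    proof (rule that[OF \<delta>(1)])
      fix t m m' k assume a: "t \<in> {0..T}" "m \<in> PS n" "m' \<in> PS n" "k \<in> {1..n}" "(\<Sum>i=1..n. \<bar>m i - m' i\<bar>) < \<delta>"
      have "\<bar>d k t m - d k t m'\<bar> \<le> (\<Sum>k=1..n. \<bar>d k t m - d k t m'\<bar>)"
        using a(4) by (intro member_le_sum[of k]) auto
      also have "\<dots> < e / 4" using \<delta>(2)[rule_format, of "(t, m, m')"] a by (simp add: K_def)
      finally show "\<bar>d k t m - d k t m'\<bar> < e / 4" .
    qed
  qed
  \<comment> \<open>\<open>1 / 2\<close> keeps the mass above 1/2. \<open>\<delta>0 / 2\<close>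
    allows for normalisation, which moves a vector by no more than its mass defect. The last bound
    controls the division by the mass.\<close>
  define \<delta> where "\<delta> = min (1 / 2) (min (\<delta>0 / 2) (e / (8 * (D + 1))))"
  have \<delta>: "\<delta> > 0" unfolding \<delta>_def using \<delta>0 e D by simp
  have \<delta>le: "\<delta> \<le> 1 / 2" "\<delta> \<le> \<delta>0 / 2" "\<delta> \<le> e / (8 * (D + 1))"
    unfolding \<delta>_def by (simp_all only: min.cobounded1 min.coboundedI2 min.cobounded2)
  have near: "mass n b > 0 \<and> \<bar>d k t (normalize n b) / mass n b - d k t m\<bar> \<le> e"
    if t: "t \<in> {0..T}" and m: "m \<in> PS n" and k: "k \<in> {1..n}" and b: "b \<in> MS n" and l: "(\<Sum>i=1..n. \<bar>b i - m i\<bar>) < \<delta>" for t m k b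
  proof -
    define S where "S = mass n b"
    have "S - 1 = (\<Sum>i=1..n. b i - m i)" using m unfolding S_def mass_def PS_def by (simp add: sum_subtractf)
    then have S1: "\<bar>S - 1\<bar> \<le> (\<Sum>i=1..n. \<bar>b i - m i\<bar>)" by (metis sum_abs)
    then have S\<delta>: "\<bar>S - 1\<bar> < \<delta>" using l by linarith
    then have S2: "S \<ge> 1 / 2" "S > 0" using \<delta>le(1) by linarith+
    have nb: "normalize n b \<in> PS n" using normalize_PS[OF b] S2 unfolding S_def by simp
    have "(\<Sum>i=1..n. \<bar>normalize n b i - m i\<bar>) \<le> (\<Sum>i=1..n. \<bar>normalize n b i - b i\<bar> + \<bar>b i - m i\<bar>)"
      by (intro sum_mono) linarith
    also have "\<dots> = (\<Sum>i=1..n. \<bar>normalize n b i - b i\<bar>) + (\<Sum>i=1..n. \<bar>b i - m i\<bar>)" by (rule sum.distrib)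
    also have "(\<Sum>i=1..n. \<bar>normalize n b i - b i\<bar>) = \<bar>S - 1\<bar>"
    proof -
      have "\<bar>normalize n b i - b i\<bar> = \<bar>1 - S\<bar> * normalize n b i" if "i \<in> {1..n}" for i
      proof -
        have "normalize n b i - b i = (1 - S) * normalize n b i" unfolding normalize_def S_def[symmetric] using S2 by (simp add: field_simps)
        then show ?thesis using M2S_nonneg[OF PS_M2S[OF nb], of i] by (simp add: abs_mult)
      qed
      then have "(\<Sum>i=1..n. \<bar>normalize n b i - b i\<bar>) = \<bar>1 - S\<bar> * (\<Sum>i=1..n. normalize n b i)"
        by (simp add: sum_distrib_left)
      then show ?thesis using nb by (simp add: PS_def abs_minus_commute)
    qed
    finally have "(\<Sum>i=1..n. \<bar>normalize n b i - m i\<bar>) < \<delta>0" using S1 l \<delta>le(2) by linarith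
    from \<delta>0(2)[OF t nb m k this] have 1: "\<bar>d k t (normalize n b) - d k t m\<bar> < e / 4" .
    have eq: "d k t (normalize n b) / S - d k t m = ((d k t (normalize n b) - d k t m) + d k t m * (1 - S)) / S"
      using S2 by (simp add: field_simps)
    have 2: "\<bar>d k t m * (1 - S)\<bar> \<le> e / 4"
    proof -
      have "\<bar>d k t m * (1 - S)\<bar> \<le> (D + 1) * (e / (8 * (D + 1)))"
        unfolding abs_mult using D(2)[OF k t m] S\<delta> \<delta>le(3) D(1) by (intro mult_mono) auto
      also have "\<dots> = e / 8"
      proof -
        have "D + 1 \<noteq> 0" using D(1) by linarith
        then show ?thesis by (simp only: times_divide_eq_right mult.commute[of "D + 1" e] mult_divide_mult_cancel_right simp_thms)
      qed
      finally show ?thesis using e by linarith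
    qed
    have "\<bar>d k t (normalize n b) / S - d k t m\<bar> = \<bar>(d k t (normalize n b) - d k t m) + d k t m * (1 - S)\<bar> / S"
      unfolding eq using S2 by simp
    also have "\<dots> \<le> (e / 2) / (1 / 2)" using 1 2 S2 e by (intro frac_le) linarith+
    finally show ?thesis using S2(2) unfolding S_def by simp
  qed
  show ?thesis
  proof (intro exI[of _ \<delta>] conjI \<delta> ballI impI)
    fix t m m' assume t: "t \<in> {0..T}" and m: "m \<in> PS n" and m': "m' \<in> PS n" and l: "(\<Sum>i=1..n. \<bar>m' i - m i\<bar>) < \<delta>"
    \<comment> \<open>The first \<open>j\<close> entries come from \<open>m'\<close>, the others
      from \<open>m\<close>.\<close>
    define a where "a = (\<lambda>j i. if i \<le> j then m' i else m i)"
    have mn: "m i \<ge> 0" "m' i \<ge> 0" for i using M2S_nonneg PS_M2S m m' by blast+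
    have mo: "m i = 0" "m' i = 0" if "i \<notin> {1..n}" for i using m m' that unfolding PS_def MS_def by auto
    have pw: "b \<in> MS n \<and> (\<Sum>i=1..n. \<bar>b i - m i\<bar>) < \<delta>"
      if "\<And>i. min (m i) (m' i) \<le> b i \<and> b i \<le> max (m i) (m' i)" for b
    proof
      have "b i \<ge> 0" for i using that[of i] mn[of i] by linarith
      moreover have "b i = 0" if "i \<notin> {1..n}" for i using \<open>\<And>i. min (m i) (m' i) \<le> b i \<and> b i \<le> max (m i) (m' i)\<close>[of i] mo[OF that] by simp
      ultimately show "b \<in> MS n" unfolding MS_def by blast
      have "\<bar>b i - m i\<bar> \<le> \<bar>m' i - m i\<bar>" for i using that[of i] by linarith
      then have "(\<Sum>i=1..n. \<bar>b i - m i\<bar>) \<le> (\<Sum>i=1..n. \<bar>m' i - m i\<bar>)" by (intro sum_mono)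
      then show "(\<Sum>i=1..n. \<bar>b i - m i\<bar>) < \<delta>" using l by linarith
    qed
    have step: "\<bar>u t (normalize n (a (Suc j))) - u t (normalize n (a j)) - d (Suc j) t m * (m' (Suc j) - m (Suc j))\<bar>
        \<le> e * \<bar>m' (Suc j) - m (Suc j)\<bar>" if j: "j < n" for j
    proof -
      let ?k = "Suc j"
      have k: "?k \<in> {1..n}" using j by auto
      have inc: "\<bar>u t (normalize n (b(?k := b ?k + s))) - u t (normalize n b) - d ?k t m * s\<bar> \<le> e * s"
        if s: "s \<ge> 0" and bb: "\<And>\<sigma> i. 0 \<le> \<sigma> \<Longrightarrow> \<sigma> \<le> s \<Longrightarrow> min (m i) (m' i) \<le> (b(?k := b ?k + \<sigma>)) i \<and> (b(?k := b ?k + \<sigma>)) i \<le> max (m i) (m' i)" for b s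
      proof (rule coordinate_increment[OF k _ _ s u_cont[OF t] der[OF t _ k]])
        have "b(?k := b ?k + 0) \<in> MS n \<and> (\<Sum>i=1..n. \<bar>(b(?k := b ?k + 0)) i - m i\<bar>) < \<delta>"
          by (rule pw[OF bb]) (use s in auto)
        then have b0: "b \<in> MS n" "(\<Sum>i=1..n. \<bar>b i - m i\<bar>) < \<delta>" by auto
        then show "b \<in> MS n" "mass n b > 0" using near[OF t m k b0] by auto
        fix \<sigma> assume \<sigma>: "0 \<le> \<sigma>" "\<sigma> \<le> s"
        have "b(?k := b ?k + \<sigma>) \<in> MS n \<and> (\<Sum>i=1..n. \<bar>(b(?k := b ?k + \<sigma>)) i - m i\<bar>) < \<delta>" by (rule pw[OF bb[OF \<sigma>]])
        then show "\<bar>d ?k t (normalize n (b(?k := b ?k + \<sigma>))) / mass n (b(?k := b ?k + \<sigma>)) - d ?k t m\<bar> \<le> e"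
          using near[OF t m k] by blast
      qed
      show ?thesis
      proof (cases "m' ?k \<ge> m ?k")
        case True
        have eq: "a (Suc j) = (a j)(?k := a j ?k + (m' ?k - m ?k))" unfolding a_def by (auto simp: fun_eq_iff)
        have "\<bar>u t (normalize n ((a j)(?k := a j ?k + (m' ?k - m ?k)))) - u t (normalize n (a j)) - d ?k t m * (m' ?k - m ?k)\<bar> \<le> e * (m' ?k - m ?k)"
          by (rule inc) (use True in \<open>auto simp: a_def\<close>)
        then show ?thesis unfolding eq using True by simp
      next
        case False
        \<comment> \<open>Only right derivatives are available, so a decreasing entry is read as the
          increase from \<open>a (Suc j)\<close> back to \<open>a j\<close>.\<close>
        have eq: "a j = (a (Suc j))(?k := a (Suc j) ?k + (m ?k - m' ?k))" unfolding a_def by (auto simp: fun_eq_iff)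
        have "\<bar>u t (normalize n ((a (Suc j))(?k := a (Suc j) ?k + (m ?k - m' ?k)))) - u t (normalize n (a (Suc j))) - d ?k t m * (m ?k - m' ?k)\<bar> \<le> e * (m ?k - m' ?k)"
          by (rule inc) (use False in \<open>auto simp: a_def\<close>)
        then show ?thesis unfolding eq[symmetric] using False by (simp add: algebra_simps abs_minus_commute abs_le_iff)
      qed
    qed
    have ends: "normalize n (a 0) = m" "normalize n (a n) = m'"
    proof -
      have "a 0 = m" "a n = m'" unfolding a_def using mo by (auto simp: fun_eq_iff)
      moreover have "mass n m = 1" "mass n m' = 1" using m m' by (auto simp: mass_def PS_def)
      ultimately show "normalize n (a 0) = m" "normalize n (a n) = m'" unfolding normalize_def by auto
    qed
    have reindex: "(\<Sum>k=1..n. f k) = (\<Sum>j<n. f (Suc j))" for f :: "nat \<Rightarrow> real"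
      using sum.atLeast1_atMost_eq[of f n] by simp
    have "u t m' - u t m = (\<Sum>j<n. u t (normalize n (a (Suc j))) - u t (normalize n (a j)))"
      using sum_lessThan_telescope[of "\<lambda>j. u t (normalize n (a j))" n] ends by simp
    then have "u t m' - u t m - (\<Sum>k=1..n. d k t m * (m' k - m k))
       = (\<Sum>j<n. u t (normalize n (a (Suc j))) - u t (normalize n (a j)) - d (Suc j) t m * (m' (Suc j) - m (Suc j)))"
      unfolding reindex by (simp add: sum_subtractf)
    also have "\<bar>\<dots>\<bar> \<le> (\<Sum>j<n. e * \<bar>m' (Suc j) - m (Suc j)\<bar>)"
      by (intro order.trans[OF sum_abs] sum_mono step) auto
    also have "\<dots> = e * (\<Sum>i=1..n. \<bar>m' i - m i\<bar>)" unfolding reindex by (simp add: sum_distrib_left)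
    finally show "\<bar>u t m' - u t m - (\<Sum>k=1..n. d k t m * (m' k - m k))\<bar> \<le> e * (\<Sum>i=1..n. \<bar>m' i - m i\<bar>)" .
  qed
qed

text \<open>Integration along the segment from \<open>m\<close> to \<open>m'\<close>, which remains
  in the simplex. The lower mean value inequality is applied to \<open>- u\<close>.\<close>

lemma simplex_increment_le:
  fixes u :: "(nat \<Rightarrow> real) \<Rightarrow> real" and d :: "nat \<Rightarrow> (nat \<Rightarrow> real) \<Rightarrow> real"
  assumes n: "n \<ge> 1" and cont: "continuous_on (PS n) u"
    and d_cont: "\<And>k. k \<in> {1..n} \<Longrightarrow> continuous_on (PS n) (d k)"
    and der: "\<And>m k. m \<in> PS n \<Longrightarrow> k \<in> {1..n} \<Longrightarrow>
        ((\<lambda>\<theta>. (u (toward m k \<theta>) - u m) / \<theta>) \<longlongrightarrow> d k m) (at_right 0)"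
    and m: "m \<in> PS n" "m' \<in> PS n"
    and bd: "\<And>x. x \<in> PS n \<Longrightarrow> (\<Sum>k=1..n. d k x * (m' k - m k)) \<le> c"
  shows "u m' - u m \<le> c"
proof -
  define x where "x = (\<lambda>r i. m i + r * (m' i - m i))"
  have x: "x r \<in> PS n" if "0 \<le> r" "r \<le> 1" for r
  proof -
    have "x r i \<ge> 0" for i
    proof -
      have "m i \<ge> 0" "m' i \<ge> 0" using M2S_nonneg PS_M2S m by blast+
      then have "(1 - r) * m i + r * m' i \<ge> 0" using that by simp
      then show ?thesis unfolding x_def by (simp add: algebra_simps)
    qed
    moreover have "x r i = 0" if "i \<notin> {1..n}" for i using m that unfolding x_def PS_def MS_def by auto
    moreover have "(\<Sum>i=1..n. x r i) = 1" using m unfolding x_def PS_def by (simp add: sum.distrib sum_distrib_left[symmetric] sum_subtractf)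
    ultimately show ?thesis unfolding PS_def MS_def by blast
  qed
  define l where "l = (\<Sum>i=1..n. \<bar>m' i - m i\<bar>)"
  have l0: "l \<ge> 0" unfolding l_def by (intro sum_nonneg) auto
  have d_cont': "continuous_on ({0..0::real} \<times> PS n) (\<lambda>(t, m). d k m)" if "k \<in> {1..n}" for k
  proof -
    have "continuous_on ({0..0::real} \<times> PS n) (\<lambda>z. d k (snd z))"
      by (rule continuous_on_compose2[OF d_cont[OF that]]) (auto intro: continuous_on_snd continuous_on_id)
    then show ?thesis by (simp add: case_prod_beta')
  qed
  have "- c * (1 - 0) \<le> (\<lambda>r. - u (x r)) 1 - (\<lambda>r. - u (x r)) 0"
  proof (rule right_derivative_lower_bound[where D="\<lambda>r. - (\<Sum>k=1..n. d k (x r) * (m' k - m k))"])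
    have "continuous_on {0..1} (\<lambda>r. u (x r))"
    proof (rule continuous_on_compose2[OF cont])
      show "continuous_on {0..1} x" unfolding x_def
        by (intro continuous_on_coordinatewise_then_product continuous_intros)
    qed (use x in auto)
    then show "continuous_on {0..1} (\<lambda>r. - u (x r))" by (rule continuous_on_minus)
    fix r :: real assume r: "r \<in> {0..<1}"
    show "- c \<le> - (\<Sum>k=1..n. d k (x r) * (m' k - m k))" using bd[OF x] r by auto
    show "((\<lambda>s. (- u (x (r + s)) - - u (x r)) / s) \<longlongrightarrow> - (\<Sum>k=1..n. d k (x r) * (m' k - m k))) (at_right 0)"
    proof (rule tendstoI)
      fix e :: real assume e: "e > 0"
      define e' where "e' = e / (l + 1)"
      have e': "e' > 0" "e' * l < e" unfolding e'_def using e l0 by (auto simp: field_simps)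
      \<comment> \<open>A degenerate time interval turns the uniform statement into one for a single
        function.\<close>
      from simplex_uniform_differentiability[where T=0 and u="\<lambda>_. u" and d="\<lambda>k _. d k", OF n cont d_cont' der e'(1)]
      obtain \<delta> where \<delta>: "\<delta> > 0" "\<And>y z. y \<in> PS n \<Longrightarrow> z \<in> PS n \<Longrightarrow> (\<Sum>i=1..n. \<bar>z i - y i\<bar>) < \<delta> \<Longrightarrow>
        \<bar>u z - u y - (\<Sum>k=1..n. d k y * (z k - y k))\<bar> \<le> e' * (\<Sum>i=1..n. \<bar>z i - y i\<bar>)" by auto
      have "\<forall>\<^sub>F s in at_right 0. s < 1 - r" "\<forall>\<^sub>F s in at_right 0. s < \<delta> / (l + 1)"
        using r \<delta>(1) l0 by (intro order_tendstoD(2)[OF tendsto_ident_at]; simp)+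
      moreover have "\<forall>\<^sub>F s in at_right (0::real). s > 0" by (simp add: eventually_at_right_less)
      ultimately show "\<forall>\<^sub>F s in at_right 0. dist ((- u (x (r + s)) - - u (x r)) / s) (- (\<Sum>k=1..n. d k (x r) * (m' k - m k))) < e"
      proof eventually_elim
        case (elim s)
        have diff: "x (r + s) i - x r i = s * (m' i - m i)" for i unfolding x_def by (simp add: algebra_simps)
        have sl: "(\<Sum>i=1..n. \<bar>x (r + s) i - x r i\<bar>) = s * l"
          unfolding diff l_def sum_distrib_left using elim by (simp add: abs_mult)
        have "s * (l + 1) < \<delta>" using elim(2) l0 by (simp add: pos_less_divide_eq)
        then have "s * l < \<delta>" using elim(3) by (simp add: distrib_left)
        then have "\<bar>u (x (r + s)) - u (x r) - (\<Sum>k=1..n. d k (x r) * (x (r + s) k - x r k))\<bar> \<le> e' * (s * l)"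
          using \<delta>(2)[of "x r" "x (r + s)"] x[of r] x[of "r + s"] r elim unfolding sl by auto
        moreover have "(\<Sum>k=1..n. d k (x r) * (x (r + s) k - x r k)) = s * (\<Sum>k=1..n. d k (x r) * (m' k - m k))"
          unfolding diff sum_distrib_left by (intro sum.cong) auto
        ultimately have "\<bar>u (x (r + s)) - u (x r) - s * (\<Sum>k=1..n. d k (x r) * (m' k - m k))\<bar> \<le> s * (e' * l)"
          by (simp add: algebra_simps)
        moreover have "u (x (r + s)) - u (x r) - s * (\<Sum>k=1..n. d k (x r) * (m' k - m k))
           = s * ((u (x (r + s)) - u (x r)) / s - (\<Sum>k=1..n. d k (x r) * (m' k - m k)))" using elim by (simp only: right_diff_distrib times_divide_eq_right nonzero_mult_div_cancel_left)
            (simp add: diff_divide_distrib right_diff_distrib)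
        ultimately have "s * \<bar>(u (x (r + s)) - u (x r)) / s - (\<Sum>k=1..n. d k (x r) * (m' k - m k))\<bar> \<le> s * (e' * l)"
          using elim by (simp add: abs_mult)
        then have "\<bar>(u (x (r + s)) - u (x r)) / s - (\<Sum>k=1..n. d k (x r) * (m' k - m k))\<bar> < e" using elim e'(2) by simp
        moreover have "(- u (x (r + s)) - - u (x r)) / s = - ((u (x (r + s)) - u (x r)) / s)"
          by (simp add: diff_divide_distrib)
        ultimately show ?case by (simp add: dist_real_def abs_minus_commute)
      qed
    qed
  qed simp
  then show ?thesis unfolding x_def by simp
qed

section \<open>Application to the master equation\<close>

text \<open>\<open>K4 / rho\<close> spelled out outside the locale, which makes visible that neither
  \<open>n\<close> nor the solutions occur in it.\<close>

definition rate_const :: "real \<Rightarrow> real \<Rightarrow> real \<Rightarrow> real \<Rightarrow> real \<Rightarrow> real \<Rightarrow> real \<Rightarrow> real" where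
  "rate_const lam T c0 Lam CV CA E0 =
     (let rho = exp (- 2 * (lam * T));
          K2 = 2 * T + (sqrt E0 + 1) * (T * (4 * lam * T + 3) / rho) / c0;
          K3 = exp (2 * Lam * T) * K2 + 1
      in (CV * K3 + T * (lam * (CV * (CA * K3)) + CV * K3 + 2 * sqrt E0)) / rho)"

lemma (in approx_classical) W_V_rate:
  assumes "t \<in> {0..T}" "m \<in> PS n" "i \<in> {1..n}"
  shows "\<bar>W t m i - V t m i\<bar> \<le> rate_const lam T c0 Lam CV CA E0 * sqrt eps"
proof -
  have "rate_const lam T c0 Lam CV CA E0 = K4 / rho"
    unfolding rate_const_def Let_def K4_def K3_def K2_def K1_def K0_def rho_def ..
  then show ?thesis using W_V_estimate[OF assms] by simp
qed

lemma coupling_emb_lipschitz: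
  assumes "coupling_assms \<gamma> f"
  shows "\<exists>C\<ge>0. \<forall>n\<ge>1. \<forall>m\<in>M2S n. \<forall>m'\<in>M2S n. \<forall>w x. W1_close n m m' w \<longrightarrow> \<bar>f x (emb n m) - f x (emb n m')\<bar> \<le> C * w"
proof -
  from assms obtain C where C: "\<And>x m \<nu>. m \<in> M2T \<Longrightarrow> \<nu> \<in> M2T \<Longrightarrow> \<bar>f x m - f x \<nu>\<bar> \<le> C * W1 m \<nu>"
    unfolding coupling_assms_def by blast
  have "\<bar>f x (emb n m) - f x (emb n m')\<bar> \<le> \<bar>C\<bar> * w"
    if n: "n \<ge> 1" and m: "m \<in> M2S n" "m' \<in> M2S n" and w: "W1_close n m m' w" for n m m' w x
  proof -
    note W = W1_emb[OF n m w]
    have "\<bar>f x (emb n m) - f x (emb n m')\<bar> \<le> C * W1 (emb n m) (emb n m')" by (rule C[OF emb_M2T[OF m(1)] emb_M2T[OF m(2)]])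
    also have "\<dots> \<le> \<bar>C\<bar> * w" using W by (intro mult_mono) auto
    finally show ?thesis .
  qed
  then show ?thesis by (intro exI[of _ "\<bar>C\<bar>"]) auto
qed

lemma coupling_emb_continuous:
  assumes f: "coupling_assms \<gamma> f" and n: "n \<ge> 1"
  shows "continuous_on (M2S n) (\<lambda>m. f x (emb n m))"
proof -
  obtain C where C: "C \<ge> 0" "\<forall>n\<ge>1. \<forall>m\<in>M2S n. \<forall>m'\<in>M2S n. \<forall>w x. W1_close n m m' w \<longrightarrow> \<bar>f x (emb n m) - f x (emb n m')\<bar> \<le> C * w"
    using coupling_emb_lipschitz[OF f] by (elim exE conjE)
  show ?thesis
    unfolding continuous_on_def
  proof (intro ballI)
    fix m assume m: "m \<in> M2S n"
    have "((\<lambda>m'. f x (emb n m') - f x (emb n m)) \<longlongrightarrow> 0) (at m within M2S n)"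
    proof (rule Lim_null_comparison)
      have "\<forall>\<^sub>F m' in at m within M2S n. m' \<in> M2S n" by (simp add: eventually_at_filter)
      then show "\<forall>\<^sub>F m' in at m within M2S n. norm (f x (emb n m') - f x (emb n m)) \<le> C * (\<Sum>i=1..n. \<bar>m' i - m i\<bar>)"
        by eventually_elim (use C(2) n m W1_close_l1 in auto)
      have "continuous_on (M2S n) (\<lambda>m'. C * (\<Sum>i=1..n. \<bar>m' i - m i\<bar>))"
        by (intro continuous_on_mult continuous_on_const continuous_on_sum continuous_on_rabs continuous_on_diff continuous_coord)
      from this[unfolded continuous_on_def, rule_format, OF m]
      show "((\<lambda>m'. C * (\<Sum>i=1..n. \<bar>m' i - m i\<bar>)) \<longlongrightarrow> 0) (at m within M2S n)" by simp
    qed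
    then show "((\<lambda>m. f x (emb n m)) \<longlongrightarrow> f x (emb n m)) (at m within M2S n)" by (simp add: LIM_zero_iff)
  qed
qed

lemma coupling_emb_monotone:
  assumes f: "coupling_assms \<gamma> f" and m: "m \<in> M2S n" "m' \<in> M2S n"
  shows "0 \<le> pairing n (\<lambda>i. f (grid n i) (emb n m) - f (grid n i) (emb n m')) (\<lambda>i. m i - m' i)"
proof -
  have ms: "m \<in> MS n" "m' \<in> MS n" using m by (auto simp: M2S_def)
  have reg: "periodic (\<lambda>x. f x \<mu>) \<and> continuous_on UNIV (\<lambda>x. f x \<mu>)" if "\<mu> \<in> M2T" for \<mu>
  proof -
    have "holder_norm 0 \<gamma> (\<lambda>x. f x \<mu>) < \<top>" using f that unfolding coupling_assms_def by blast
    then have "periodic (\<lambda>x. f x \<mu>) \<and> C_k 0 (\<lambda>x. f x \<mu>)" unfolding holder_norm_def by (auto split: if_splits)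
    then show ?thesis by simp
  qed
  define \<phi> where "\<phi> = (\<lambda>x. f x (emb n m) - f x (emb n m'))"
  have per: "periodic \<phi>" using reg[OF emb_M2T[OF m(1)]] reg[OF emb_M2T[OF m(2)]] unfolding \<phi>_def periodic_def by simp
  have "continuous_on UNIV \<phi>" using reg[OF emb_M2T[OF m(1)]] reg[OF emb_M2T[OF m(2)]] unfolding \<phi>_def by (intro continuous_on_diff) auto
  then have meas: "\<phi> \<in> borel_measurable borel" by (rule borel_measurable_continuous_onI)
  have "0 \<le> (LINT x|emb n m. \<phi> x) - (LINT x|emb n m'. \<phi> x)"
    using f emb_M2T[OF m(1)] emb_M2T[OF m(2)] unfolding coupling_assms_def monotone_coupling_def \<phi>_def by auto
  also have "\<dots> = pairing n (\<lambda>i. \<phi> (grid n i)) (\<lambda>i. m i - m' i)"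
    unfolding integral_emb[OF ms(1) meas] integral_emb[OF ms(2) meas] periodic_frac[OF per] pairing_def
    by (simp add: sum_subtractf right_diff_distrib mult.commute)
  finally show ?thesis unfolding \<phi>_def .
qed

text \<open>The two halves of \<open>\<eta>\<close> are the remainders of the measure increment and
  of the time increment; \<open>D\<close> is the defect.\<close>

lemma consistency_remainder:
  fixes h :: real
  assumes "\<bar>a - b - - h * S\<bar> \<le> h * (\<eta> / 2)" "\<bar>h * (p - q)\<bar> \<le> h * (\<eta> / 2)" "c - a = h * p" "\<bar>h * D\<bar> \<le> h * e"
  shows "\<bar>c - b + h * (- D - q + S)\<bar> \<le> h * (e + \<eta>)"
proof -
  have "c - b + h * (- D - q + S) = (a - b - - h * S) + h * (p - q) - h * D"
    using assms(3) by (simp add: algebra_simps)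
  moreover have "h * (e + \<eta>) = h * (\<eta> / 2) + h * (\<eta> / 2) + h * e" by (simp add: algebra_simps)
  ultimately show ?thesis using assms(1,2,4) by linarith
qed

locale master_setting =
  fixes \<sigma> lam T \<gamma> :: real
    and L K :: "real \<Rightarrow> real \<Rightarrow> real"
    and f g :: "real \<Rightarrow> real measure \<Rightarrow> real"
    and Kn :: "nat \<Rightarrow> nat \<Rightarrow> nat \<Rightarrow> real"
    and U Ut Ux Uxx :: "real \<Rightarrow> real \<Rightarrow> real measure \<Rightarrow> real"
    and dU DU DyDU :: "real \<Rightarrow> real \<Rightarrow> real measure \<Rightarrow> real \<Rightarrow> real"
    and \<omega> :: "real \<Rightarrow> real"
  assumes \<sigma>0: "\<sigma> > 0" and lam0: "lam > 0" and T0: "T > 0"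
    and Lagr: "Lagrangian_assms L"
    and f_coupling: "coupling_assms \<gamma> f" and g_coupling: "coupling_assms \<gamma> g"
    and classical: "classical_solution T \<sigma> lam L K f g U Ut Ux Uxx dU DU DyDU"
    and \<omega>: "modulus \<omega>"
    and Ux_mod: "modulus_of T \<omega> (\<lambda>t x m y. Ux t x m)" and Uxx_mod: "modulus_of T \<omega> (\<lambda>t x m y. Uxx t x m)"
    and DU_mod: "modulus_of T \<omega> DU"
    and discr: "discretization K Kn"
begin

sublocale up: coercive_lagrangian L
  by (rule coercive_lagrangian_forward[OF Lagr])

sublocale dn: coercive_lagrangian "\<lambda>x a. L x (- a)"
  by (rule coercive_lagrangian_backward[OF up.coercive_lagrangian_axioms])

section \<open>The discrete master equation as an instance of the abstract problem\<close>

definition b1 :: "nat \<Rightarrow> nat \<Rightarrow> real \<Rightarrow> real" where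
  "b1 n j x = - up.h (grid n j) (real n * x) + \<sigma> * (real n)\<^sup>2 * x"
text \<open>The second difference is shared equally between the two neighbours, hence
  \<open>\<sigma> * (real n)\<^sup>2 * x\<close> in both functions. The summand \<open>L x 0\<close>
  of \<open>Ham_down\<close> is placed here.\<close>

definition b2 :: "nat \<Rightarrow> nat \<Rightarrow> real \<Rightarrow> real" where
  "b2 n j x = - dn.h (grid n j) (real n * x) - L (grid n j) 0 + \<sigma> * (real n)\<^sup>2 * x"
definition ca :: "nat \<Rightarrow> nat \<Rightarrow> real \<Rightarrow> real" where
  "ca n j x = real n * up.amin (grid n j) (real n * x) + \<sigma> * (real n)\<^sup>2"
definition cb :: "nat \<Rightarrow> nat \<Rightarrow> real \<Rightarrow> real" where
  "cb n j x = real n * dn.amin (grid n j) (real n * x) + \<sigma> * (real n)\<^sup>2"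
definition fn :: "nat \<Rightarrow> (nat \<Rightarrow> real) \<Rightarrow> nat \<Rightarrow> real" where
  "fn n m i = f (grid n i) (emb n m)"
definition gn :: "nat \<Rightarrow> (nat \<Rightarrow> real) \<Rightarrow> nat \<Rightarrow> real" where
  "gn n m i = g (grid n i) (emb n m)"

lemma b1_deriv: "(b1 n j has_real_derivative ca n j x) (at x)"
proof -
  have "((\<lambda>x. up.h (grid n j) (real n * x)) has_real_derivative - up.amin (grid n j) (real n * x) * real n) (at x)"
    by (rule DERIV_chain2[OF up.h_deriv]) (auto intro!: derivative_eq_intros)
  then show ?thesis unfolding b1_def[abs_def] ca_def by (auto intro!: derivative_eq_intros)
qed

lemma b2_deriv: "(b2 n j has_real_derivative cb n j x) (at x)"
proof -
  have "((\<lambda>x. dn.h (grid n j) (real n * x)) has_real_derivative - dn.amin (grid n j) (real n * x) * real n) (at x)"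
    by (rule DERIV_chain2[OF dn.h_deriv]) (auto intro!: derivative_eq_intros)
  then show ?thesis unfolding b2_def[abs_def] cb_def by (auto intro!: derivative_eq_intros)
qed

lemma b1_gap: "b1 n j x - b1 n j y - ca n j x * (x - y)
    = up.h (grid n j) (real n * y) - up.h (grid n j) (real n * x) + up.amin (grid n j) (real n * x) * (real n * y - real n * x)"
  unfolding b1_def ca_def by (simp add: algebra_simps)

lemma b2_gap: "b2 n j x - b2 n j y - cb n j x * (x - y)
    = dn.h (grid n j) (real n * y) - dn.h (grid n j) (real n * x) + dn.amin (grid n j) (real n * x) * (real n * y - real n * x)"
  unfolding b2_def cb_def by (simp add: algebra_simps)

lemma Kn_facts:
  assumes "n \<ge> 1"
  shows "i \<in> {1..n} \<Longrightarrow> j \<in> {1..n} \<Longrightarrow> Kn n i j \<ge> 0" "j \<in> {1..n} \<Longrightarrow> (\<Sum>i=1..n. Kn n i j) = real n"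
  using discr assms unfolding discretization_def by auto

lemma discrete_mfg_n:
  assumes n: "n \<ge> 1"
  shows "discrete_mfg n lam T (fn n) (b1 n) (b2 n) (ca n) (cb n) (Kn n)"
proof
  show "n \<ge> 1" "lam > 0" "T > 0" using n lam0 T0 by auto
  fix i j x y
  show "ca n i x \<ge> 0" unfolding ca_def using up.amin_nonneg \<sigma>0 by simp
  show "cb n i x \<ge> 0" unfolding cb_def using dn.amin_nonneg \<sigma>0 by simp
  show "continuous_on UNIV (ca n i)" unfolding ca_def[abs_def]
    by (intro continuous_intros continuous_on_compose2[OF up.amin_cont]) auto
  show "continuous_on UNIV (cb n i)" unfolding cb_def[abs_def]
    by (intro continuous_intros continuous_on_compose2[OF dn.amin_cont]) auto
  show "continuous_on UNIV (b1 n i)" by (meson DERIV_isCont b1_deriv continuous_at_imp_continuous_on)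
  show "continuous_on UNIV (b2 n i)" by (meson DERIV_isCont b2_deriv continuous_at_imp_continuous_on)
  show "b1 n i x - b1 n i y \<le> ca n i y * (x - y)"
    using b1_gap[of n i y x] up.h_subgradient[of "grid n i" "real n * y" "real n * x"] by (simp add: algebra_simps)
  show "b2 n i x - b2 n i y \<le> cb n i y * (x - y)"
    using b2_gap[of n i y x] dn.h_subgradient[of "grid n i" "real n * y" "real n * x"] by (simp add: algebra_simps)
  show "continuous_on (M2S n) (\<lambda>m. fn n m i)" unfolding fn_def by (rule coupling_emb_continuous[OF f_coupling n])
  show "0 \<le> pairing n (\<lambda>i. fn n m i - fn n m' i) (\<lambda>i. m i - m' i)" if "m \<in> M2S n" "m' \<in> M2S n" for m m'
    unfolding fn_def by (rule coupling_emb_monotone[OF f_coupling that])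
  show "Kn n i j \<ge> 0" if "i \<in> {1..n}" "j \<in> {1..n}" using Kn_facts[OF n] that by blast
  show "(\<Sum>i=1..n. Kn n i j) = real n" if "j \<in> {1..n}" using Kn_facts[OF n] that by blast
qed

lemma G_disc_eq:
  assumes n: "n \<ge> 1"
  shows "G_disc \<sigma> L f n m p i = discrete_mfg.G n (fn n) (b1 n) (b2 n) m p i"
proof -
  interpret D: discrete_mfg n lam T "fn n" "b1 n" "b2 n" "ca n" "cb n" "Kn n" by (rule discrete_mfg_n[OF n])
  have e: "D_plus n p i = real n * (p (next_idx n i) - p i)" "D_minus n p i = real n * (p (prev_idx n i) - p i)"
    "D_two n p i = (real n)\<^sup>2 * (p (next_idx n i) - p i) + (real n)\<^sup>2 * (p (prev_idx n i) - p i)"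
    unfolding D_plus_def D_minus_def D_two_def using n by (simp_all add: power_divide algebra_simps)
  show ?thesis
    unfolding G_disc_def D.G_def D.B_def Ham_down_eq e fn_def b1_def b2_def up.h_def dn.h_def by (simp add: algebra_simps)
qed

lemma F_disc_eq:
  assumes n: "n \<ge> 1"
  shows "F_disc \<sigma> L f n m p i = discrete_mfg.F n (ca n) (cb n) m p i"
proof -
  interpret D: discrete_mfg n lam T "fn n" "b1 n" "b2 n" "ca n" "cb n" "Kn n" by (rule discrete_mfg_n[OF n])
  have co: "((\<lambda>s. (p(i := s)) j) has_real_derivative (if j = i then 1 else 0)) (at (p i))" for j
    by (cases "j = i") auto
  have "((\<lambda>s. G_disc \<sigma> L f n m (p(i := s)) j) has_real_derivative D.gen p (\<lambda>k. if k = i then 1 else 0) j) (at (p i))" for j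
  proof -
    have "((\<lambda>s. b1 n j ((p(i := s)) (next_idx n j) - (p(i := s)) j)) has_real_derivative
        ca n j ((p(i := p i)) (next_idx n j) - (p(i := p i)) j) * ((if next_idx n j = i then 1 else 0) - (if j = i then 1 else 0))) (at (p i))"
      by (rule DERIV_chain2[OF b1_deriv]) (rule DERIV_diff[OF co co])
    moreover have "((\<lambda>s. b2 n j ((p(i := s)) (prev_idx n j) - (p(i := s)) j)) has_real_derivative
        cb n j ((p(i := p i)) (prev_idx n j) - (p(i := p i)) j) * ((if prev_idx n j = i then 1 else 0) - (if j = i then 1 else 0))) (at (p i))"
      by (rule DERIV_chain2[OF b2_deriv]) (rule DERIV_diff[OF co co])
    ultimately have "((\<lambda>s. fn n m j + (b1 n j ((p(i := s)) (next_idx n j) - (p(i := s)) j) + b2 n j ((p(i := s)) (prev_idx n j) - (p(i := s)) j)))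
       has_real_derivative 0 + (ca n j ((p(i := p i)) (next_idx n j) - (p(i := p i)) j) * ((if next_idx n j = i then 1 else 0) - (if j = i then 1 else 0))
       + cb n j ((p(i := p i)) (prev_idx n j) - (p(i := p i)) j) * ((if prev_idx n j = i then 1 else 0) - (if j = i then 1 else 0)))) (at (p i))"
      by (intro DERIV_add DERIV_const)
    then show ?thesis unfolding G_disc_eq[OF n] D.G_def D.B_def D.gen_def D.al_def D.be_def fun_upd_triv add_0 .
  qed
  then have "deriv (\<lambda>s. G_disc \<sigma> L f n m (p(i := s)) j) (p i) = D.gen p (\<lambda>k. if k = i then 1 else 0) j" for j
    by (rule DERIV_imp_deriv)
  then show ?thesis unfolding F_disc_def D.F_def by simp
qed

lemma discrete_solution_n:
  assumes n: "n \<ge> 1" and W: "monotone_solution T \<sigma> lam L Kn f g n W"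
  shows "discrete_solution n lam T (fn n) (b1 n) (b2 n) (ca n) (cb n) (Kn n) W (gn n)"
proof -
  interpret D: discrete_mfg n lam T "fn n" "b1 n" "b2 n" "ca n" "cb n" "Kn n" by (rule discrete_mfg_n[OF n])
  note WW = W[unfolded monotone_solution_def]
  show ?thesis
  proof
    show "continuous_on ({0..T} \<times> M2S n) (\<lambda>(t, m). W t m i)" if "i \<in> {1..n}" for i using WW that by blast
    show "W T m i = gn n m i" if "m \<in> M2S n" "i \<in> {1..n}" for m i using WW that unfolding gn_def by blast
    show "0 \<le> pairing n (\<lambda>i. gn n m i - gn n m' i) (\<lambda>i. m i - m' i)" if "m \<in> M2S n" "m' \<in> M2S n" for m m'
      unfolding gn_def by (rule coupling_emb_monotone[OF g_coupling that])
    show "D.test_property ({0..T} \<times> M2S n) W (\<lambda>t m. W t (A_disc (Kn n) n m)) 0 R" for R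
      unfolding D.test_property_def
    proof (intro ballI allI impI)
      fix \<mu> a \<psi> \<psi>' t m
      assume \<mu>: "\<mu> \<in> M2S n" and d: "\<forall>t\<in>{0..T}. (\<psi> has_real_derivative \<psi>' t) (at t within {0..T})" "continuous_on {0..T} \<psi>'"
        and tm: "(t, m) \<in> {0..T} \<times> M2S n" "t < T"
        and min: "strict_min_on (\<lambda>(t, m). pairing n (\<lambda>i. W t m i - a i) (\<lambda>i. m i - \<mu> i) - \<psi> t) ({0..T} \<times> M2S n) (t, m)"
      have \<mu>': "\<mu> \<in> MS n" using \<mu> by (simp add: M2S_def)
      have t: "t \<in> {0..<T}" "m \<in> M2S n" using tm by auto
      have "pairing n (G_disc \<sigma> L f n m (W t m)) (\<lambda>i. m i - \<mu> i) + pairing n (F_disc \<sigma> L f n m (W t m)) (\<lambda>i. W t m i - a i)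
        \<le> - \<psi>' t + lam * pairing n (\<lambda>i. W t m i - A_disc_adj (Kn n) n (W t (A_disc (Kn n) n m)) i) (\<lambda>i. m i - \<mu> i)"
        using WW[THEN conjunct2, THEN conjunct2, rule_format, OF \<mu>' _ d(2) t min] d(1) by blast
      then show "pairing n (D.G m (W t m)) (\<lambda>i. m i - \<mu> i) + pairing n (D.F m (W t m)) (\<lambda>i. W t m i - a i)
        \<le> - \<psi>' t + lam * pairing n (\<lambda>i. W t m i - A_disc_adj (Kn n) n (W t (A_disc (Kn n) n m)) i) (\<lambda>i. m i - \<mu> i) + 0"
        unfolding G_disc_eq[OF n, abs_def] F_disc_eq[OF n, abs_def] by simp
    qed
  qed
qed

section \<open>The restriction of \<open>U\<close> to the grid and bounds uniform in
  \<open>n\<close>\<close>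

lemma solution_facts:
  assumes "t \<in> {0..T}" "m \<in> M2T"
  shows "periodic (\<lambda>x. U t x m)" "((\<lambda>s. U s x m) has_real_derivative Ut t x m) (at t within {0..T})"
    "((\<lambda>z. U t z m) has_real_derivative Ux t x m) (at x)" "((\<lambda>z. Ux t z m) has_real_derivative Uxx t x m) (at x)"
    "((\<lambda>\<theta>. (U t x (lincomb (1 - \<theta>) m \<theta> (dirac y)) - U t x m) / \<theta>) \<longlongrightarrow> dU t x m y) (at_right 0)"
    "((\<lambda>z. dU t x m z) has_real_derivative DU t x m y) (at y)"
  using classical assms unfolding classical_solution_def has_master_derivatives_def by blast+

lemma solution_continuity:
  "continuous_in_args T (\<lambda>t x m y. U t x m)" "continuous_in_args T (\<lambda>t x m y. Ut t x m)" "continuous_in_args T dU"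
  "m \<in> M2T \<Longrightarrow> U T x m = g x m"
  using classical unfolding classical_solution_def by blast+

lemma dU_periodic:
  assumes "t \<in> {0..T}" "m \<in> M2T" shows "periodic (dU t x m)"
  unfolding periodic_def
proof
  fix y :: real
  have "frac (y + 1) = frac y" by (simp add: frac_def)
  then have e: "dirac (y + 1) = dirac y" by (simp add: dirac_def)
  show "dU t x m (y + 1) = dU t x m y"
    using tendsto_unique[OF _ solution_facts(5)[OF assms, of x "y + 1", unfolded e] solution_facts(5)[OF assms, of x y]]
    by simp
qed

text \<open>Set to 0 off the index set, so that its values lie in a box of functions;
  \<open>V_disc\<close> would evaluate \<open>U\<close> at every natural number.\<close>

definition Vn :: "nat \<Rightarrow> real \<Rightarrow> (nat \<Rightarrow> real) \<Rightarrow> nat \<Rightarrow> real" where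
  "Vn n t m i = (if i \<in> {1..n} then V_disc U n t m i else 0)"

lemma U_emb_cont: "n \<ge> 1 \<Longrightarrow> continuous_on ({0..T} \<times> M2S n) (\<lambda>(t, m). U t x (emb n m))"
  and Ut_emb_cont: "n \<ge> 1 \<Longrightarrow> continuous_on ({0..T} \<times> M2S n) (\<lambda>(t, m). Ut t x (emb n m))"
  and dU_emb_cont: "n \<ge> 1 \<Longrightarrow> continuous_on ({0..T} \<times> M2S n) (\<lambda>(t, m). dU t x (emb n m) y)"
  using continuous_on_emb[OF _ solution_continuity(1)] continuous_on_emb[OF _ solution_continuity(2)]
    continuous_on_emb[OF _ solution_continuity(3)] by blast+

lemma slice_cont:
  assumes "continuous_on ({0..T} \<times> M2S n) (\<lambda>(t, m). h t m)" "t \<in> {0..T}"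
  shows "continuous_on (PS n) (h t)"
proof -
  have "continuous_on ({0..T} \<times> M2S n) (\<lambda>z. h (fst z) (snd z))" using assms(1) by (simp add: case_prod_beta')
  then have "continuous_on (PS n) (\<lambda>m. h (fst (t, m)) (snd (t, m)))"
    by (rule continuous_on_compose2) (use assms(2) PS_M2S in \<open>auto intro: continuous_on_Pair continuous_on_const continuous_on_id\<close>)
  then show ?thesis by simp
qed

lemma PS_sub: "{0..T} \<times> PS n \<subseteq> {0..T} \<times> M2S n"
  using PS_M2S by auto

lemma toward_derivative:
  assumes t: "t \<in> {0..T}" and m: "m \<in> PS n" and k: "k \<in> {1..n}"
  shows "((\<lambda>\<theta>. (U t x (emb n (toward m k \<theta>)) - U t x (emb n m)) / \<theta>) \<longlongrightarrow> dU t x (emb n m) (grid n k)) (at_right 0)"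
proof (rule Lim_transform_eventually[OF solution_facts(5)[OF t emb_M2T[OF PS_M2S[OF m]], of x "grid n k"]])
  have ms: "m \<in> MS n" using m by (simp add: PS_def)
  have "\<forall>\<^sub>F \<theta> in at_right (0::real). \<theta> < 1" by (intro order_tendstoD(2)[OF tendsto_ident_at]) auto
  moreover have "\<forall>\<^sub>F \<theta> in at_right (0::real). \<theta> > 0" by (simp add: eventually_at_right_less)
  ultimately show "\<forall>\<^sub>F \<theta> in at_right 0. (U t x (lincomb (1 - \<theta>) (emb n m) \<theta> (dirac (grid n k))) - U t x (emb n m)) / \<theta>
      = (U t x (emb n (toward m k \<theta>)) - U t x (emb n m)) / \<theta>"
    by eventually_elim (simp add: lincomb_emb[OF ms k])
qed

lemma increment_bound:
  fixes \<phi> \<phi>' :: "real \<Rightarrow> real"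
  assumes "\<And>z. (\<phi> has_real_derivative \<phi>' z) (at z)" "\<And>z. z \<in> {a..b} \<Longrightarrow> \<bar>\<phi>' z\<bar> \<le> C" "x \<in> {a..b}" "y \<in> {a..b}"
  shows "\<bar>\<phi> x - \<phi> y\<bar> \<le> C * \<bar>x - y\<bar>"
proof -
  have "norm (\<phi> x - \<phi> y) \<le> C * norm (x - y)"
    by (rule field_differentiable_bound[of "{a..b}" \<phi> \<phi>'])
      (use assms in \<open>auto intro: has_field_derivative_at_within\<close>)
  then show ?thesis by simp
qed

text \<open>The derivative of \<open>U\<close> in the measure is itself the test function.
  Boundedness of \<open>DU\<close> makes it Lipschitz in \<open>y\<close>, uniformly in
  \<open>n\<close>, and \<open>simplex_increment_le\<close> integrates it from \<open>m\<close> to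
  \<open>\<nu>\<close>.\<close>

lemma V_lipschitz:
  "\<exists>C\<ge>0. \<forall>n\<ge>1. \<forall>t\<in>{0..T}. \<forall>m\<in>PS n. \<forall>\<nu>\<in>PS n. \<forall>w i. W1_close n m \<nu> w \<longrightarrow> i \<in> {1..n} \<longrightarrow>
     \<bar>Vn n t m i - Vn n t \<nu> i\<bar> \<le> C * w"
proof -
  from modulus_of_bound[OF \<omega> DU_mod T0] obtain CD where CD: "CD \<ge> 0"
    "\<And>n m t x y. n \<ge> 1 \<Longrightarrow> m \<in> M2S n \<Longrightarrow> t \<in> {0..T} \<Longrightarrow> x \<in> {-3..3} \<Longrightarrow> y \<in> {-3..3} \<Longrightarrow> \<bar>DU t x (emb n m) y\<bar> \<le> CD"
    by auto
  have one: "Vn n t \<nu> i - Vn n t m i \<le> (CD + 1) * w"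
    if n: "n \<ge> 1" and t: "t \<in> {0..T}" and m: "m \<in> PS n" "\<nu> \<in> PS n" and w: "W1_close n \<nu> m w" and i: "i \<in> {1..n}" for n t m \<nu> w i
  proof -
    let ?x = "grid n i"
    have x: "?x \<in> {-3..3}" using grid_bounds[OF i] by auto
    have "U t ?x (emb n \<nu>) - U t ?x (emb n m) \<le> (CD + 1) * w"
    proof (rule simplex_increment_le[OF n _ _ toward_derivative[OF t] m])
      show "continuous_on (PS n) (\<lambda>m. U t ?x (emb n m))" by (rule slice_cont[OF U_emb_cont[OF n] t])
      show "continuous_on (PS n) (\<lambda>m. dU t ?x (emb n m) (grid n k))" for k by (rule slice_cont[OF dU_emb_cont[OF n] t])
      fix q assume q: "q \<in> PS n"
      let ?\<phi> = "dU t ?x (emb n q)"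
      have der: "(?\<phi> has_real_derivative DU t ?x (emb n q) z) (at z)" for z
        by (rule solution_facts(6)[OF t emb_M2T[OF PS_M2S[OF q]]])
      have lip: "\<bar>?\<phi> a - ?\<phi> b\<bar> \<le> CD * \<bar>a - b\<bar>" if "a \<in> {-3..3}" "b \<in> {-3..3}" for a b
        by (rule increment_bound[OF der CD(2)[OF n PS_M2S[OF q] t x] that])
      have per: "periodic ?\<phi>" by (rule dU_periodic[OF t emb_M2T[OF PS_M2S[OF q]]])
      \<comment> \<open>Subtracting a constant changes nothing against a difference of equal masses
        and makes the function bounded; division by \<open>CD + 1\<close> puts it into the class of
        \<open>grid_lipschitz\<close>.\<close>
      define \<psi> where "\<psi> = (\<lambda>k. (?\<phi> (grid n k) - ?\<phi> 1) / (CD + 1))"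
      have C1: "CD + 1 > 0" using CD(1) by simp
      have "grid_lipschitz n 1 \<psi>"
        unfolding grid_lipschitz_def
      proof (intro conjI ballI)
        fix k assume k: "k \<in> {1..n}"
        have gk: "0 \<le> grid n k" "grid n k \<le> 1" using grid_bounds[OF k] by auto
        have n1: "1 / real n \<le> 1" "1 / real n > 0" using n by auto
        have "\<bar>?\<phi> (grid n k + 1 / real n) - ?\<phi> (grid n k)\<bar> \<le> CD * \<bar>grid n k + 1 / real n - grid n k\<bar>"
          by (rule lip) (unfold atLeastAtMost_iff, use gk n1 in linarith, use gk in linarith)
        also have "\<dots> \<le> (CD + 1) * (1 / real n)" using n1 by (simp add: divide_right_mono)
        finally have "\<bar>?\<phi> (grid n (next_idx n k)) - ?\<phi> (grid n k)\<bar> \<le> (CD + 1) * (1 / real n)"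
          unfolding periodic_next[OF per k] .
        moreover have "\<psi> (next_idx n k) - \<psi> k = (?\<phi> (grid n (next_idx n k)) - ?\<phi> (grid n k)) / (CD + 1)"
          unfolding \<psi>_def by (simp add: diff_divide_distrib)
        ultimately show "\<bar>\<psi> (next_idx n k) - \<psi> k\<bar> \<le> 1 / real n"
          using C1 by (simp add: pos_divide_le_eq mult.commute)
        have "\<bar>?\<phi> (grid n k) - ?\<phi> 1\<bar> \<le> CD * \<bar>grid n k - 1\<bar>" using gk by (intro lip) auto
        also have "\<dots> \<le> CD * 1" using gk CD(1) by (intro mult_left_mono) auto
        finally show "\<bar>\<psi> k\<bar> \<le> 1" unfolding \<psi>_def using C1 by (simp add: pos_divide_le_eq)
      qed
      then have pw: "pairing n \<psi> (\<lambda>k. \<nu> k - m k) \<le> w" using w unfolding W1_close_def by blast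
      have zero: "(\<Sum>k=1..n. \<nu> k - m k) = 0" using m by (simp add: sum_subtractf PS_def)
      have "(\<Sum>k=1..n. ?\<phi> (grid n k) * (\<nu> k - m k)) = (\<Sum>k=1..n. (CD + 1) * (\<psi> k * (\<nu> k - m k)) + ?\<phi> 1 * (\<nu> k - m k))"
        unfolding \<psi>_def using C1 by (intro sum.cong) (auto simp: field_simps)
      also have "\<dots> = (CD + 1) * pairing n \<psi> (\<lambda>k. \<nu> k - m k) + ?\<phi> 1 * (\<Sum>k=1..n. \<nu> k - m k)"
        by (simp only: sum.distrib sum_distrib_left pairing_def)
      also have "\<dots> \<le> (CD + 1) * w" unfolding zero using pw C1 by (simp add: mult_left_mono)
      finally show "(\<Sum>k=1..n. dU t ?x (emb n q) (grid n k) * (\<nu> k - m k)) \<le> (CD + 1) * w" .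
    qed
    then show ?thesis using i by (simp add: Vn_def V_disc_def)
  qed
  show ?thesis
  proof (intro exI[of _ "CD + 1"] conjI allI impI ballI)
    show "0 \<le> CD + 1" using CD by simp
    fix n :: nat and t m \<nu> w i
    assume a: "n \<ge> 1" "t \<in> {0..T}" "m \<in> PS n" "\<nu> \<in> PS n" "W1_close n m \<nu> w" "i \<in> {1..n}"
    show "\<bar>Vn n t m i - Vn n t \<nu> i\<bar> \<le> (CD + 1) * w"
      using one[OF a(1,2) a(4,3) a(5,6)] one[OF a(1,2,3,4) W1_close_sym[OF a(5)] a(6)] by (simp add: abs_le_iff)
  qed
qed

text \<open>Duality: the adjoint averages test functions, which keeps their bound, and bounded first
  difference quotients of the kernel in its second index make the result Lipschitz.\<close>

lemma A_lipschitz: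
  "\<exists>C\<ge>0. \<forall>n\<ge>1. \<forall>m\<in>PS n. \<forall>\<nu>\<in>PS n. \<forall>w. W1_close n m \<nu> w \<longrightarrow> W1_close n (A_disc (Kn n) n m) (A_disc (Kn n) n \<nu>) (C * w)"
proof -
  obtain C where C: "\<And>n i j. n \<ge> 1 \<Longrightarrow> i \<in> {1..n} \<Longrightarrow> j \<in> {1..n} \<Longrightarrow> \<bar>diff_quot2 n (Kn n) i j\<bar> \<le> C"
  proof -
    have "\<exists>B. \<forall>n\<ge>1. \<forall>i\<in>{1..n}. \<forall>j\<in>{1..n}. \<bar>((diff_quot1 n ^^ 0) ((diff_quot2 n ^^ 1) (Kn n))) i j\<bar> \<le> B"
      using discr unfolding discretization_def by blast
    then obtain B where B: "\<forall>n\<ge>1. \<forall>i\<in>{1..n}. \<forall>j\<in>{1..n}. \<bar>((diff_quot1 n ^^ 0) ((diff_quot2 n ^^ 1) (Kn n))) i j\<bar> \<le> B" ..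
    show ?thesis
    proof (rule that[of B])
      fix n i j :: nat assume "n \<ge> 1" "i \<in> {1..n}" "j \<in> {1..n}"
      from B[rule_format, OF this] show "\<bar>diff_quot2 n (Kn n) i j\<bar> \<le> B" by simp
    qed
  qed
  define C1 where "C1 = \<bar>C\<bar> + 1"
  have C1: "C1 \<ge> 1" "C \<le> C1" unfolding C1_def by auto
  show ?thesis
  proof (intro exI[of _ C1] conjI allI impI ballI)
    show "0 \<le> C1" using C1 by simp
    fix n :: nat and m \<nu> w
    assume n: "n \<ge> 1" and m: "m \<in> PS n" "\<nu> \<in> PS n" and w: "W1_close n m \<nu> w"
    interpret D: discrete_mfg n lam T "fn n" "b1 n" "b2 n" "ca n" "cb n" "Kn n" by (rule discrete_mfg_n[OF n])
    show "W1_close n (A_disc (Kn n) n m) (A_disc (Kn n) n \<nu>) (C1 * w)"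
      unfolding W1_close_def
    proof (intro allI impI)
      fix \<phi> assume \<phi>: "grid_lipschitz n 1 \<phi>"
      have \<phi>1: "\<bar>\<phi> i\<bar> \<le> 1" if "i \<in> {1..n}" for i using \<phi> that unfolding grid_lipschitz_def by blast
      define \<psi> where "\<psi> = (\<lambda>j. D.As \<phi> j / C1)"
      have "grid_lipschitz n 1 \<psi>"
        unfolding grid_lipschitz_def
      proof (intro conjI ballI)
        fix j assume j: "j \<in> {1..n}"
        have "\<bar>D.As \<phi> j\<bar> \<le> 1" by (rule D.As_bound[OF \<phi>1 j])
        then have "\<bar>D.As \<phi> j\<bar> / C1 \<le> 1 / 1" using C1 by (intro frac_le) auto
        then show "\<bar>\<psi> j\<bar> \<le> 1" unfolding \<psi>_def using C1 by simp
        let ?j = "next_idx n j"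
        have "\<bar>Kn n i ?j - Kn n i j\<bar> \<le> C1 / real n" if i: "i \<in> {1..n}" for i
        proof -
          have "diff_quot2 n (Kn n) i j = real n * (Kn n i ?j - Kn n i j)"
            unfolding diff_quot2_def D_plus_def using n by (simp add: field_simps)
          then have "real n * \<bar>Kn n i ?j - Kn n i j\<bar> \<le> C1" using C[OF n i j] C1 by (simp add: abs_mult)
          then show ?thesis using n by (simp add: pos_le_divide_eq mult.commute)
        qed
        then have "\<bar>(Kn n i ?j - Kn n i j) * \<phi> i\<bar> \<le> C1 / real n * 1" if "i \<in> {1..n}" for i
          unfolding abs_mult using \<phi>1 that C1 by (intro mult_mono) auto
        then have "(\<Sum>i=1..n. \<bar>(Kn n i ?j - Kn n i j) * \<phi> i\<bar>) \<le> (\<Sum>i=1..n. C1 / real n * 1)" by (intro sum_mono) auto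
        also have "\<dots> = C1" using n by simp
        finally have S: "\<bar>\<Sum>i=1..n. (Kn n i ?j - Kn n i j) * \<phi> i\<bar> \<le> C1" by (rule order.trans[OF sum_abs])
        have "\<psi> ?j - \<psi> j = (\<Sum>i=1..n. (Kn n i ?j - Kn n i j) * \<phi> i) / (real n * C1)"
          unfolding \<psi>_def A_disc_adj_def by (simp add: left_diff_distrib sum_subtractf diff_divide_distrib)
        then have "\<bar>\<psi> ?j - \<psi> j\<bar> = \<bar>\<Sum>i=1..n. (Kn n i ?j - Kn n i j) * \<phi> i\<bar> / \<bar>real n * C1\<bar>"
          by (simp only: abs_divide)
        also have "\<dots> \<le> C1 / \<bar>real n * C1\<bar>" by (rule divide_right_mono[OF S abs_ge_zero])
        also have "\<bar>real n * C1\<bar> = real n * C1" using C1 by (simp only: abs_of_nonneg mult_nonneg_nonneg of_nat_0_le_iff)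
        finally have "\<bar>\<psi> ?j - \<psi> j\<bar> \<le> C1 / (real n * C1)" .
        then show "\<bar>\<psi> ?j - \<psi> j\<bar> \<le> 1 / real n" using C1 by simp
      qed
      then have pw: "pairing n \<psi> (\<lambda>i. m i - \<nu> i) \<le> w" using w unfolding W1_close_def by blast
      have "pairing n \<phi> (\<lambda>i. D.A m i - D.A \<nu> i) = pairing n (D.As \<phi>) (\<lambda>i. m i - \<nu> i)"
        unfolding D.pairing_As_diff ..
      also have "\<dots> = pairing n (\<lambda>i. C1 * \<psi> i) (\<lambda>i. m i - \<nu> i)" unfolding \<psi>_def using C1 by (intro pairing_cong) auto
      also have "\<dots> \<le> C1 * w" unfolding pairing_scale_left using pw C1 by (intro mult_left_mono) auto
      finally show "pairing n \<phi> (\<lambda>i. D.A m i - D.A \<nu> i) \<le> C1 * w" .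
    qed
  qed
qed

text \<open>Mean value inequality for first and second differences. The range of \<open>x\<close>
  extends to -1 because increments to the left neighbour are increments to the right from
  \<open>x - 1 / n\<close>.\<close>

lemma V_increments:
  "\<exists>R\<ge>0. \<exists>C\<ge>0. \<forall>n\<ge>1. \<forall>t\<in>{0..T}. \<forall>m\<in>M2S n. \<forall>x\<in>{-1..1}.
     \<bar>real n * (U t (x + 1 / real n) (emb n m) - U t x (emb n m))\<bar> \<le> R \<and>
     \<bar>real n * (U t (x + 2 / real n) (emb n m) - U t (x + 1 / real n) (emb n m))
       - real n * (U t (x + 1 / real n) (emb n m) - U t x (emb n m))\<bar> \<le> C / real n"
proof -
  from modulus_of_bound[OF \<omega> Ux_mod T0] obtain R where R: "R \<ge> 0"
    "\<And>n m t x. n \<ge> 1 \<Longrightarrow> m \<in> M2S n \<Longrightarrow> t \<in> {0..T} \<Longrightarrow> x \<in> {-3..3} \<Longrightarrow> \<bar>Ux t x (emb n m)\<bar> \<le> R"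
    by fastforce
  from modulus_of_bound[OF \<omega> Uxx_mod T0] obtain C where C: "C \<ge> 0"
    "\<And>n m t x. n \<ge> 1 \<Longrightarrow> m \<in> M2S n \<Longrightarrow> t \<in> {0..T} \<Longrightarrow> x \<in> {-3..3} \<Longrightarrow> \<bar>Uxx t x (emb n m)\<bar> \<le> C"
    by fastforce
  have main: "\<bar>real n * (U t (x + 1 / real n) (emb n m) - U t x (emb n m))\<bar> \<le> R \<and>
     \<bar>real n * (U t (x + 2 / real n) (emb n m) - U t (x + 1 / real n) (emb n m))
       - real n * (U t (x + 1 / real n) (emb n m) - U t x (emb n m))\<bar> \<le> C / real n"
    if n: "n \<ge> 1" and t: "t \<in> {0..T}" and m: "m \<in> M2S n" and x: "x \<in> {-1..1}" for n t m x
  proof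
    define e where "e = 1 / real n"
    have e: "0 < e" "e \<le> 1" "real n * e = 1" "2 / real n = 2 * e" unfolding e_def using n by auto
    let ?u = "\<lambda>z. U t z (emb n m)"
    note d1 = solution_facts(3)[OF t emb_M2T[OF m]] and d2 = solution_facts(4)[OF t emb_M2T[OF m]]
    have "\<bar>?u (x + e) - ?u x\<bar> \<le> R * \<bar>x + e - x\<bar>"
      by (rule increment_bound[of _ _ "-3" 3, OF d1 R(2)[OF n m t]]) (use x e in auto)
    then have "real n * \<bar>?u (x + e) - ?u x\<bar> \<le> real n * (R * e)" using e n by (intro mult_left_mono) auto
    also have "\<dots> = R" using e(3) by (metis mult.left_commute mult.right_neutral)
    finally show "\<bar>real n * (U t (x + 1 / real n) (emb n m) - U t x (emb n m))\<bar> \<le> R"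
      unfolding e_def[symmetric] by (simp add: abs_mult)
    let ?k = "\<lambda>z. ?u (z + e) - ?u z"
    have "\<bar>?k (x + e) - ?k x\<bar> \<le> (C * e) * \<bar>x + e - x\<bar>"
    proof (rule increment_bound[of _ "\<lambda>z. Ux t (z + e) (emb n m) - Ux t z (emb n m)" "-1" 2])
      show "(?k has_real_derivative Ux t (z + e) (emb n m) - Ux t z (emb n m)) (at z)" for z
      proof (rule DERIV_diff[OF _ d1])
        have "((\<lambda>z. ?u (z + e)) has_real_derivative Ux t (z + e) (emb n m) * 1) (at z)"
          by (rule DERIV_chain2[OF d1]) (auto intro!: derivative_eq_intros)
        then show "((\<lambda>z. ?u (z + e)) has_real_derivative Ux t (z + e) (emb n m)) (at z)" by simp
      qed
      show "\<bar>Ux t (z + e) (emb n m) - Ux t z (emb n m)\<bar> \<le> C * e" if "z \<in> {- 1..2}" for z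
      proof -
        have "\<bar>Ux t (z + e) (emb n m) - Ux t z (emb n m)\<bar> \<le> C * \<bar>z + e - z\<bar>"
          by (rule increment_bound[of _ _ "-3" 3, OF d2 C(2)[OF n m t]]) (use that e in auto)
        then show ?thesis using e by simp
      qed
    qed (use x e in auto)
    then have "real n * \<bar>?k (x + e) - ?k x\<bar> \<le> real n * (C * e * e)" using e n by (intro mult_left_mono) auto
    also have "\<dots> = C * e" using e(3) by (metis mult.assoc mult.commute mult.right_neutral)
    also have "real n * \<bar>?k (x + e) - ?k x\<bar> = \<bar>real n * ?k (x + e) - real n * ?k x\<bar>"
      unfolding right_diff_distrib[symmetric] abs_mult by simp
    finally show "\<bar>real n * (U t (x + 2 / real n) (emb n m) - U t (x + 1 / real n) (emb n m))
       - real n * (U t (x + 1 / real n) (emb n m) - U t x (emb n m))\<bar> \<le> C / real n"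
      unfolding e(4) e_def[symmetric] by (simp add: add.assoc e_def)
  qed
  show ?thesis by (intro exI[of _ R] exI[of _ C] conjI R(1) C(1) allI impI ballI main)
qed

lemma Vn_next:
  assumes t: "t \<in> {0..T}" and m: "m \<in> M2S n" and i: "i \<in> {1..n}"
  shows "Vn n t m (next_idx n i) = U t (grid n i + 1 / real n) (emb n m)"
    "Vn n t m (prev_idx n i) = U t (grid n i - 1 / real n) (emb n m)"
    "Vn n t m (next_idx n (next_idx n i)) = U t (grid n i + 2 / real n) (emb n m)"
    "Vn n t m i = U t (grid n i) (emb n m)"
proof -
  have per: "periodic (\<lambda>x. U t x (emb n m))" by (rule solution_facts(1)[OF t emb_M2T[OF m]])
  have per': "periodic (\<lambda>x. U t (x + 1 / real n) (emb n m))"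
    unfolding periodic_def
  proof
    fix x :: real
    have "x + 1 + 1 / real n = x + 1 / real n + 1" by simp
    then show "U t (x + 1 + 1 / real n) (emb n m) = U t (x + 1 / real n) (emb n m)"
      using per unfolding periodic_def by (simp only:)
  qed
  note ni = next_idx_in[OF i]
  show "Vn n t m (next_idx n i) = U t (grid n i + 1 / real n) (emb n m)"
    using ni periodic_next[OF per i] by (simp add: Vn_def V_disc_def)
  show "Vn n t m (prev_idx n i) = U t (grid n i - 1 / real n) (emb n m)"
    using prev_idx_in[OF i] periodic_prev[OF per i] by (simp add: Vn_def V_disc_def)
  have "Vn n t m (next_idx n (next_idx n i)) = U t (grid n (next_idx n i) + 1 / real n) (emb n m)"
    using next_idx_in[OF ni] periodic_next[OF per ni] by (simp add: Vn_def V_disc_def)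
  also have "\<dots> = U t (grid n i + 1 / real n + 1 / real n) (emb n m)" by (rule periodic_next[OF per' i])
  finally show "Vn n t m (next_idx n (next_idx n i)) = U t (grid n i + 2 / real n) (emb n m)"
    by (simp add: add.assoc add_divide_distrib[symmetric])
  show "Vn n t m i = U t (grid n i) (emb n m)" using i by (simp add: Vn_def V_disc_def)
qed

text \<open>The diffusive parts \<open>\<sigma> * (real n)\<^sup>2\<close> agree at neighbouring
  points and cancel. The rest is \<open>n\<close> times a Lipschitz function of the point and of the
  difference quotient of \<open>V\<close>, both of which change by order
  \<open>1 / n\<close>.\<close>

lemma drift_spread:
  "\<exists>Lam\<ge>0. \<forall>n\<ge>1. \<forall>t\<in>{0..T}. \<forall>m\<in>M2S n. \<forall>i\<in>{1..n}.
     discrete_mfg.al n (ca n) (Vn n t m) (next_idx n i) \<le> discrete_mfg.al n (ca n) (Vn n t m) i + Lam \<and>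
     discrete_mfg.be n (cb n) (Vn n t m) i \<le> discrete_mfg.be n (cb n) (Vn n t m) (next_idx n i) + Lam"
proof -
  obtain R C where R: "R \<ge> 0" "C \<ge> 0"
    "\<forall>n\<ge>1. \<forall>t\<in>{0..T}. \<forall>m\<in>M2S n. \<forall>x\<in>{-1..1}.
     \<bar>real n * (U t (x + 1 / real n) (emb n m) - U t x (emb n m))\<bar> \<le> R \<and>
     \<bar>real n * (U t (x + 2 / real n) (emb n m) - U t (x + 1 / real n) (emb n m))
       - real n * (U t (x + 1 / real n) (emb n m) - U t x (emb n m))\<bar> \<le> C / real n"
    using V_increments by (elim exE conjE)
  obtain Cu where Cu: "Cu > 0" "\<forall>x\<in>{0..2}. \<forall>y\<in>{0..2}. \<forall>p q. \<bar>p\<bar> \<le> R + C \<longrightarrow> \<bar>q\<bar> \<le> R + C \<longrightarrow>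
      \<bar>up.amin x p - up.amin y q\<bar> \<le> Cu * (\<bar>x - y\<bar> + \<bar>p - q\<bar>)" using up.amin_lipschitz[of "R + C"] by (elim exE conjE)
  obtain Cd where Cd: "Cd > 0" "\<forall>x\<in>{0..2}. \<forall>y\<in>{0..2}. \<forall>p q. \<bar>p\<bar> \<le> R + C \<longrightarrow> \<bar>q\<bar> \<le> R + C \<longrightarrow>
      \<bar>dn.amin x p - dn.amin y q\<bar> \<le> Cd * (\<bar>x - y\<bar> + \<bar>p - q\<bar>)" using dn.amin_lipschitz[of "R + C"] by (elim exE conjE)
  have Lper: "L (x + 1) a = L x a" for x a
    using Lagr unfolding Lagrangian_assms_def periodic_def by simp
  have main: "discrete_mfg.al n (ca n) (Vn n t m) (next_idx n i) \<le> discrete_mfg.al n (ca n) (Vn n t m) i + (Cu + Cd) * (1 + C) \<and>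
     discrete_mfg.be n (cb n) (Vn n t m) i \<le> discrete_mfg.be n (cb n) (Vn n t m) (next_idx n i) + (Cu + Cd) * (1 + C)"
    if n: "n \<ge> 1" and t: "t \<in> {0..T}" and m: "m \<in> M2S n" and i: "i \<in> {1..n}" for n t m i
  proof -
    interpret D: discrete_mfg n lam T "fn n" "b1 n" "b2 n" "ca n" "cb n" "Kn n" by (rule discrete_mfg_n[OF n])
    let ?x = "grid n i" and ?u = "\<lambda>z. U t z (emb n m)"
    define e where "e = 1 / real n"
    have e: "0 < e" "e \<le> 1" "real n * e = 1" "2 / real n = 2 * e" "C / real n = C * e" unfolding e_def using n by auto
    have x: "0 \<le> ?x" "?x \<le> 1" using grid_bounds[OF i] by auto
    have inc: "\<bar>real n * (?u (y + e) - ?u y)\<bar> \<le> R"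
      "\<bar>real n * (?u (y + 2 * e) - ?u (y + e)) - real n * (?u (y + e) - ?u y)\<bar> \<le> C * e" if "-1 \<le> y" "y \<le> 1" for y
      using R(3)[rule_format, OF n t m, of y] that unfolding e(4,5) e_def[symmetric] by auto
    have Ce: "C * e \<le> C" using mult_left_mono[OF e(2) R(2)] by simp
    note vals = Vn_next[OF t m i, unfolded e(4), folded e_def]
    have cancel: "real n * a \<le> real n * b + (Cu + Cd) * (1 + C)"
      if "\<bar>a - b\<bar> \<le> K * (e + C * e)" "K \<le> Cu + Cd" for a b K
    proof -
      have "real n * (a - b) \<le> real n * (K * (e + C * e))" using that by (intro mult_left_mono) auto
      also have "\<dots> = K * (real n * e) * (1 + C)" by (simp add: algebra_simps)
      also have "\<dots> \<le> (Cu + Cd) * (1 + C)" unfolding e(3) using that R(2) by (simp add: mult_right_mono)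
      finally show ?thesis by (simp add: right_diff_distrib)
    qed
    have up_per: "periodic (\<lambda>x. up.amin x p)" for p unfolding periodic_def using up.amin_periodic Lper by blast
    have dn_per: "periodic (\<lambda>x. dn.amin x p)" for p unfolding periodic_def using dn.amin_periodic Lper by blast
    let ?p2 = "real n * (?u (?x + 2 * e) - ?u (?x + e))" and ?p1 = "real n * (?u (?x + e) - ?u ?x)"
    have b: "\<bar>?p1\<bar> \<le> R" "\<bar>?p2 - ?p1\<bar> \<le> C * e" using inc[of ?x] x by auto
    have dom: "?x + e \<in> {0..2}" "?x \<in> {0..2}" using x e(1,2) by auto
    have "\<bar>?p2\<bar> \<le> R + C" "\<bar>?p1\<bar> \<le> R + C" using b Ce R(2) by linarith+
    then have "\<bar>up.amin (?x + e) ?p2 - up.amin ?x ?p1\<bar> \<le> Cu * (\<bar>?x + e - ?x\<bar> + \<bar>?p2 - ?p1\<bar>)"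
      by (rule Cu(2)[rule_format, OF dom])
    also have "\<dots> \<le> Cu * (e + C * e)" using Cu(1) e(1) b by (intro mult_left_mono) auto
    finally have upd: "\<bar>up.amin (?x + e) ?p2 - up.amin ?x ?p1\<bar> \<le> Cu * (e + C * e)" .
    have "D.al (Vn n t m) (next_idx n i) = real n * up.amin (?x + e) ?p2 + \<sigma> * (real n)\<^sup>2"
      unfolding D.al_def ca_def vals periodic_next[OF up_per i] e_def[symmetric] ..
    moreover have "D.al (Vn n t m) i = real n * up.amin ?x ?p1 + \<sigma> * (real n)\<^sup>2"
      unfolding D.al_def ca_def vals ..
    ultimately have 1: "D.al (Vn n t m) (next_idx n i) \<le> D.al (Vn n t m) i + (Cu + Cd) * (1 + C)"
      using cancel[OF upd] Cd(1) by simp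
    let ?q2 = "real n * (?u ?x - ?u (?x + e))" and ?q1 = "real n * (?u (?x - e) - ?u ?x)"
    have y: "?x - e + e = ?x" "?x - e + 2 * e = ?x + e" by auto
    have "\<bar>real n * (?u ?x - ?u (?x - e))\<bar> \<le> R"
      "\<bar>real n * (?u (?x + e) - ?u ?x) - real n * (?u ?x - ?u (?x - e))\<bar> \<le> C * e"
      using inc[of "?x - e", unfolded y] x e by auto
    then have b': "\<bar>?q1\<bar> \<le> R" "\<bar>?q1 - ?q2\<bar> \<le> C * e" by (auto simp: right_diff_distrib abs_le_iff)
    have "\<bar>?q1\<bar> \<le> R + C" "\<bar>?q2\<bar> \<le> R + C" using b' Ce R(2) by linarith+
    then have "\<bar>dn.amin ?x ?q1 - dn.amin (?x + e) ?q2\<bar> \<le> Cd * (\<bar>?x - (?x + e)\<bar> + \<bar>?q1 - ?q2\<bar>)"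
      by (rule Cd(2)[rule_format, OF dom(2,1)])
    also have "\<dots> \<le> Cd * (e + C * e)" using Cd(1) e(1) b' by (intro mult_left_mono) auto
    finally have dnd: "\<bar>dn.amin ?x ?q1 - dn.amin (?x + e) ?q2\<bar> \<le> Cd * (e + C * e)" .
    have "D.be (Vn n t m) (next_idx n i) = real n * dn.amin (?x + e) ?q2 + \<sigma> * (real n)\<^sup>2"
      unfolding D.be_def cb_def prev_next_idx[OF i] vals periodic_next[OF dn_per i] e_def[symmetric] ..
    moreover have "D.be (Vn n t m) i = real n * dn.amin ?x ?q1 + \<sigma> * (real n)\<^sup>2"
      unfolding D.be_def cb_def vals ..
    ultimately have 2: "D.be (Vn n t m) i \<le> D.be (Vn n t m) (next_idx n i) + (Cu + Cd) * (1 + C)"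
      using cancel[OF dnd] Cu(1) by simp
    from 1 2 show ?thesis ..
  qed
  have pos: "(Cu + Cd) * (1 + C) \<ge> 0" using Cu(1) Cd(1) R(2) by simp
  show ?thesis by (rule exI, rule conjI[OF pos], intro allI impI ballI, rule main)
qed

text \<open>The difference quotients of \<open>V\<close> are bounded and serve as the points
  \<open>q\<close> in \<open>h_gap\<close>, while \<open>p\<close> is arbitrary. Division by
  \<open>n\<close> turns rates into optimal controls and cancels the diffusive part.\<close>

lemma gap_quadratic_growth:
  "\<exists>c0>0. \<forall>n\<ge>1. \<forall>t\<in>{0..T}. \<forall>m\<in>M2S n. \<forall>i\<in>{1..n}. \<forall>p x y.
     x = \<bar>discrete_mfg.al n (ca n) p i - discrete_mfg.al n (ca n) (Vn n t m) i\<bar> / real n \<longrightarrow>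
     y = \<bar>discrete_mfg.be n (cb n) p i - discrete_mfg.be n (cb n) (Vn n t m) i\<bar> / real n \<longrightarrow>
     c0 * (min x (x\<^sup>2) + min y (y\<^sup>2)) \<le> discrete_mfg.gap n (b1 n) (b2 n) (ca n) (cb n) p (Vn n t m) i"
proof -
  obtain R C where R: "R \<ge> 0" "C \<ge> 0"
    "\<forall>n\<ge>1. \<forall>t\<in>{0..T}. \<forall>m\<in>M2S n. \<forall>x\<in>{-1..1}.
     \<bar>real n * (U t (x + 1 / real n) (emb n m) - U t x (emb n m))\<bar> \<le> R \<and>
     \<bar>real n * (U t (x + 2 / real n) (emb n m) - U t (x + 1 / real n) (emb n m))
       - real n * (U t (x + 1 / real n) (emb n m) - U t x (emb n m))\<bar> \<le> C / real n"
    using V_increments by (elim exE conjE)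
  obtain cu where cu: "cu > 0" "\<forall>x p q. \<bar>q\<bar> \<le> R \<longrightarrow> cu * min \<bar>up.amin x p - up.amin x q\<bar> (\<bar>up.amin x p - up.amin x q\<bar>\<^sup>2)
     \<le> up.h x q - up.h x p + up.amin x p * (q - p)" using up.h_gap[of R] by (elim exE conjE)
  obtain cd where cd: "cd > 0" "\<forall>x p q. \<bar>q\<bar> \<le> R \<longrightarrow> cd * min \<bar>dn.amin x p - dn.amin x q\<bar> (\<bar>dn.amin x p - dn.amin x q\<bar>\<^sup>2)
     \<le> dn.h x q - dn.h x p + dn.amin x p * (q - p)" using dn.h_gap[of R] by (elim exE conjE)
  have main: "min cu cd * (min X (X\<^sup>2) + min Y (Y\<^sup>2)) \<le> discrete_mfg.gap n (b1 n) (b2 n) (ca n) (cb n) p (Vn n t m) i"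
    if n: "n \<ge> 1" and t: "t \<in> {0..T}" and m: "m \<in> M2S n" and i: "i \<in> {1..n}"
      and X: "X = \<bar>discrete_mfg.al n (ca n) p i - discrete_mfg.al n (ca n) (Vn n t m) i\<bar> / real n"
      and Y: "Y = \<bar>discrete_mfg.be n (cb n) p i - discrete_mfg.be n (cb n) (Vn n t m) i\<bar> / real n" for n t m i p X Y
  proof -
    interpret D: discrete_mfg n lam T "fn n" "b1 n" "b2 n" "ca n" "cb n" "Kn n" by (rule discrete_mfg_n[OF n])
    let ?x = "grid n i" and ?V = "Vn n t m"
    define P where "P = real n * (p (next_idx n i) - p i)"
    define Q where "Q = real n * (?V (next_idx n i) - ?V i)"
    define P' where "P' = real n * (p (prev_idx n i) - p i)"
    define Q' where "Q' = real n * (?V (prev_idx n i) - ?V i)"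
    note vals = Vn_next[OF t m i]
    have n': "1 / real n \<le> 1" "1 / real n > 0" using n by auto
    have x: "?x \<in> {-1..1}" "?x - 1 / real n \<in> {-1..1}"
      unfolding atLeastAtMost_iff using grid_bounds[OF i] n' by linarith+
    have Q: "\<bar>Q\<bar> \<le> R" unfolding Q_def vals using R(3)[rule_format, OF n t m x(1)] by blast
    have "\<bar>- Q'\<bar> \<le> R" unfolding Q'_def vals
      using R(3)[rule_format, OF n t m x(2)] by (simp add: algebra_simps)
    then have Q': "\<bar>Q'\<bar> \<le> R" by simp
    have sc: "\<bar>(real n * a + c) - (real n * b + c)\<bar> / real n = \<bar>a - b\<bar>" for a b c :: real
      using n by (simp add: right_diff_distrib[symmetric] abs_mult)
    have XX: "X = \<bar>up.amin ?x P - up.amin ?x Q\<bar>" unfolding X D.al_def ca_def P_def Q_def sc ..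
    have YY: "Y = \<bar>dn.amin ?x P' - dn.amin ?x Q'\<bar>" unfolding Y D.be_def cb_def P'_def Q'_def sc ..
    have pos: "min X (X\<^sup>2) \<ge> 0" "min Y (Y\<^sup>2) \<ge> 0" unfolding XX YY by auto
    have "min cu cd * (min X (X\<^sup>2) + min Y (Y\<^sup>2)) \<le> cu * min X (X\<^sup>2) + cd * min Y (Y\<^sup>2)"
      unfolding distrib_left using pos by (intro add_mono mult_right_mono) auto
    also have "\<dots> \<le> (up.h ?x Q - up.h ?x P + up.amin ?x P * (Q - P)) + (dn.h ?x Q' - dn.h ?x P' + dn.amin ?x P' * (Q' - P'))"
      unfolding XX YY using cu(2)[rule_format, OF Q, of ?x P] cd(2)[rule_format, OF Q', of ?x P'] by linarith
    also have "\<dots> = D.gap p ?V i"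
      unfolding P_def Q_def P'_def Q'_def b1_gap[symmetric] b2_gap[symmetric] D.gap_def D.B_def D.gen_def D.al_def D.be_def
      by (simp add: algebra_simps)
    finally show ?thesis .
  qed
  have pos: "min cu cd > 0" using cu(1) cd(1) by simp
  show ?thesis by (rule exI, rule conjI[OF pos], intro allI impI ballI, rule main)
qed

text \<open>The increment is split into a change of measure at fixed time and a change of time at
  the new measure. To first order the former is the transport term and the latter the time
  derivative, so their sum is the discrete equation up to its defect.\<close>

lemma V_expansion:
  assumes n: "n \<ge> 1" and \<eta>: "\<eta> > 0"
    and def: "\<And>t m i. t \<in> {0..T} \<Longrightarrow> m \<in> M2S n \<Longrightarrow> i \<in> {1..n} \<Longrightarrow> \<bar>defect \<sigma> lam L Kn f U Ut dU n t m i\<bar> \<le> eps"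
  shows "\<exists>h0>0. \<forall>s h \<nu>. 0 \<le> s \<longrightarrow> 0 < h \<longrightarrow> h \<le> h0 \<longrightarrow> s + h \<le> T \<longrightarrow> \<nu> \<in> PS n \<longrightarrow>
        discrete_mfg.fp_step n (ca n) (cb n) h \<nu> (Vn n s \<nu>) \<in> PS n \<and>
        (\<forall>i\<in>{1..n}. \<bar>Vn n (s + h) (discrete_mfg.fp_step n (ca n) (cb n) h \<nu> (Vn n s \<nu>)) i - Vn n s \<nu> i
          + h * (discrete_mfg.G n (fn n) (b1 n) (b2 n) \<nu> (Vn n s \<nu>) i
                 - lam * (Vn n s \<nu> i - A_disc_adj (Kn n) n (Vn n s (A_disc (Kn n) n \<nu>)) i))\<bar> \<le> h * (eps + \<eta>))"
proof -
  interpret D: discrete_mfg n lam T "fn n" "b1 n" "b2 n" "ca n" "cb n" "Kn n" by (rule discrete_mfg_n[OF n])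
  have "\<exists>R\<ge>0. \<forall>i\<in>{1..n}. \<forall>z\<in>{0..T} \<times> PS n. \<bar>U (fst z) (grid n i) (emb n (snd z))\<bar> \<le> R"
  proof (rule finite_bound)
    fix i
    from real_has_max_bound[OF compact_Times[OF compact_Icc compact_PS] continuous_on_subset[OF U_emb_cont[OF n] PS_sub]]
    show "\<exists>C. \<forall>z\<in>{0..T} \<times> PS n. \<bar>U (fst z) (grid n i) (emb n (snd z))\<bar> \<le> C" by (simp add: case_prod_beta') blast
  qed simp
  then obtain R where R: "R \<ge> 0" "\<forall>i\<in>{1..n}. \<forall>z\<in>{0..T} \<times> PS n. \<bar>U (fst z) (grid n i) (emb n (snd z))\<bar> \<le> R"
    by (elim exE conjE)
  obtain C where C: "C \<ge> 0" "\<forall>p. (\<forall>i\<in>{1..n}. \<bar>p i\<bar> \<le> R) \<longrightarrow> (\<forall>i\<in>{1..n}. D.al p i \<le> C \<and> D.be p i \<le> C)"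
    using D.rates_bounded[of R] by (elim exE conjE)
  have rates: "D.al (Vn n s \<nu>) i \<le> C" "D.be (Vn n s \<nu>) i \<le> C" if "s \<in> {0..T}" "\<nu> \<in> PS n" "i \<in> {1..n}" for s \<nu> i
  proof -
    have "\<bar>Vn n s \<nu> j\<bar> \<le> R" if "j \<in> {1..n}" for j
      using R(2)[rule_format, OF that, of "(s, \<nu>)"] \<open>s \<in> {0..T}\<close> \<open>\<nu> \<in> PS n\<close> that by (simp add: Vn_def V_disc_def)
    then have "\<forall>j\<in>{1..n}. \<bar>Vn n s \<nu> j\<bar> \<le> R" ..
    with C(2) that(3) show "D.al (Vn n s \<nu>) i \<le> C" "D.be (Vn n s \<nu>) i \<le> C" by blast+
  qed
  define CF where "CF = real n * (4 * C)"
  have CF0: "CF \<ge> 0" unfolding CF_def using C(1) by simp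
  have Fsum: "(\<Sum>k=1..n. \<bar>D.F \<nu> (Vn n s \<nu>) k\<bar>) \<le> CF" if s: "s \<in> {0..T}" and \<nu>: "\<nu> \<in> PS n" for s \<nu>
  proof -
    have "\<bar>D.F \<nu> (Vn n s \<nu>) k\<bar> \<le> 4 * C" if "k \<in> {1..n}" for k
    proof -
      have "\<bar>pairing n (D.gen (Vn n s \<nu>) (\<lambda>j. if j = k then 1 else 0)) \<nu>\<bar> \<le> (4 * C * 1) * 1"
      proof (rule abs_pairing_le)
        show "\<bar>D.gen (Vn n s \<nu>) (\<lambda>j. if j = k then 1 else 0) i\<bar> \<le> 4 * C * 1" if "i \<in> {1..n}" for i
          by (rule D.gen_bound[OF that rates[OF s \<nu> that]]) simp
        show "(\<Sum>i = 1..n. \<bar>\<nu> i\<bar>) \<le> 1" using \<nu> by (simp add: PS_def MS_def)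
      qed (use C in simp)
      then show ?thesis unfolding D.F_def pairing_def by simp
    qed
    then have "(\<Sum>k=1..n. \<bar>D.F \<nu> (Vn n s \<nu>) k\<bar>) \<le> (\<Sum>k=1..n. 4 * C)" by (intro sum_mono) auto
    then show ?thesis unfolding CF_def by simp
  qed
  have ev: "\<forall>\<^sub>F h in at_right 0. h * c < r" if "r > 0" for r c :: real
  proof -
    have "((\<lambda>h. h * c) \<longlongrightarrow> 0 * c) (at_right 0)" by (intro tendsto_intros)
    then show ?thesis using that by (intro order_tendstoD(2)) auto
  qed
  have ev0: "\<forall>\<^sub>F h in at_right (0::real). h > 0" by (simp add: eventually_at_right_less)
  let ?Q = "\<lambda>i h. \<forall>s \<nu>. 0 \<le> s \<longrightarrow> s + h \<le> T \<longrightarrow> \<nu> \<in> PS n \<longrightarrow>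
        D.fp_step h \<nu> (Vn n s \<nu>) \<in> PS n \<and>
        \<bar>Vn n (s + h) (D.fp_step h \<nu> (Vn n s \<nu>)) i - Vn n s \<nu> i
          + h * (D.G \<nu> (Vn n s \<nu>) i - lam * (Vn n s \<nu> i - D.As (Vn n s (D.A \<nu>)) i))\<bar> \<le> h * (eps + \<eta>)"
  have step: "\<forall>\<^sub>F h in at_right 0. ?Q i h" if i: "i \<in> {1..n}" for i
  proof -
    let ?x = "grid n i"
    define u where "u = (\<lambda>t m. U t ?x (emb n m))"
    define d where "d = (\<lambda>k t m. dU t ?x (emb n m) (grid n k))"
    define v where "v = (\<lambda>t m. Ut t ?x (emb n m))"
    \<comment> \<open>The measure moves by at most \<open>h * CF\<close> in the l1 norm, so this
      precision leaves a remainder of at most \<open>h * (\<eta> / 2)\<close>.\<close>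
    have e1: "\<eta> / (2 * (CF + 1)) > 0" using \<eta> CF0 by simp
    have "\<exists>\<delta>>0. \<forall>t\<in>{0..T}. \<forall>m\<in>PS n. \<forall>m'\<in>PS n. (\<Sum>i=1..n. \<bar>m' i - m i\<bar>) < \<delta> \<longrightarrow>
      \<bar>u t m' - u t m - (\<Sum>k=1..n. d k t m * (m' k - m k))\<bar> \<le> \<eta> / (2 * (CF + 1)) * (\<Sum>i=1..n. \<bar>m' i - m i\<bar>)"
    proof (rule simplex_uniform_differentiability[OF n _ _ _ e1])
      show "continuous_on (PS n) (u t)" if "t \<in> {0..T}" for t
        unfolding u_def by (rule slice_cont[OF U_emb_cont[OF n] that])
      show "continuous_on ({0..T} \<times> PS n) (\<lambda>(t, m). d k t m)" for k
        unfolding d_def by (rule continuous_on_subset[OF dU_emb_cont[OF n] PS_sub])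
      show "((\<lambda>\<theta>. (u t (toward m k \<theta>) - u t m) / \<theta>) \<longlongrightarrow> d k t m) (at_right 0)"
        if "t \<in> {0..T}" "m \<in> PS n" "k \<in> {1..n}" for t m k
        unfolding u_def d_def by (rule toward_derivative[OF that])
    qed
    then obtain \<delta>1 where \<delta>1: "\<delta>1 > 0" "\<forall>t\<in>{0..T}. \<forall>m\<in>PS n. \<forall>m'\<in>PS n. (\<Sum>i=1..n. \<bar>m' i - m i\<bar>) < \<delta>1 \<longrightarrow>
      \<bar>u t m' - u t m - (\<Sum>k=1..n. d k t m * (m' k - m k))\<bar> \<le> \<eta> / (2 * (CF + 1)) * (\<Sum>i=1..n. \<bar>m' i - m i\<bar>)"
      by (elim exE conjE)
    let ?K = "({0..T} \<times> PS n) \<times> ({0..T} \<times> PS n)"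
    have vc: "continuous_on ({0..T} \<times> PS n) (\<lambda>z. v (fst z) (snd z))"
      using continuous_on_subset[OF Ut_emb_cont[OF n] PS_sub] unfolding v_def by (simp add: case_prod_beta')
    have "\<exists>\<delta>>0. \<forall>z\<in>?K. \<bar>fst (fst z) - fst (snd z)\<bar> + (\<Sum>i=1..n. \<bar>snd (fst z) i - snd (snd z) i\<bar>) < \<delta> \<longrightarrow>
        \<bar>v (fst (fst z)) (snd (fst z)) - v (fst (snd z)) (snd (snd z))\<bar> < \<eta> / 2"
    proof (rule compact_gauge)
      show "compact ?K" by (intro compact_Times compact_Icc compact_PS)
      show "continuous_on ?K (\<lambda>z. \<bar>v (fst (fst z)) (snd (fst z)) - v (fst (snd z)) (snd (snd z))\<bar>)"
        by (intro continuous_on_rabs continuous_on_diff continuous_on_compose2[OF vc]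
            continuous_on_fst continuous_on_snd continuous_on_id) auto
      show "continuous_on ?K (\<lambda>z. \<bar>fst (fst z) - fst (snd z)\<bar> + (\<Sum>i=1..n. \<bar>snd (fst z) i - snd (snd z) i\<bar>))"
        by (intro continuous_on_add continuous_on_sum continuous_on_rabs continuous_on_diff continuous_on_coord
            continuous_on_fst continuous_on_snd continuous_on_id)
      fix z assume z: "z \<in> ?K" and 0: "\<bar>fst (fst z) - fst (snd z)\<bar> + (\<Sum>i=1..n. \<bar>snd (fst z) i - snd (snd z) i\<bar>) = 0"
      have s0: "(\<Sum>i=1..n. \<bar>snd (fst z) i - snd (snd z) i\<bar>) \<ge> 0" by (intro sum_nonneg) auto
      then have "(\<Sum>i=1..n. \<bar>snd (fst z) i - snd (snd z) i\<bar>) = 0" and f: "fst (fst z) = fst (snd z)" using 0 by linarith+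
      then have "\<forall>i\<in>{1..n}. snd (fst z) i = snd (snd z) i" by (subst (asm) sum_nonneg_eq_0_iff) auto
      moreover have "snd (fst z) i = snd (snd z) i" if "i \<notin> {1..n}" for i
        using z that by (auto simp: PS_def MS_def)
      ultimately have "snd (fst z) = snd (snd z)" by blast
      then show "\<bar>v (fst (fst z)) (snd (fst z)) - v (fst (snd z)) (snd (snd z))\<bar> \<le> 0" using f by simp
    next
      fix z :: "(real \<times> (nat \<Rightarrow> real)) \<times> real \<times> (nat \<Rightarrow> real)"
      show "0 \<le> \<bar>fst (fst z) - fst (snd z)\<bar> + (\<Sum>i=1..n. \<bar>snd (fst z) i - snd (snd z) i\<bar>)"
        by (intro add_nonneg_nonneg sum_nonneg) auto
    qed (use \<eta> in simp)
    then obtain \<delta>2 where \<delta>2: "\<delta>2 > 0" "\<forall>z\<in>?K. \<bar>fst (fst z) - fst (snd z)\<bar> + (\<Sum>i=1..n. \<bar>snd (fst z) i - snd (snd z) i\<bar>) < \<delta>2 \<longrightarrow>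
        \<bar>v (fst (fst z)) (snd (fst z)) - v (fst (snd z)) (snd (snd z))\<bar> < \<eta> / 2" by (elim exE conjE)
    from ev0 ev[of 1 "2 * C", OF zero_less_one] ev[OF \<delta>1(1), of CF] ev[OF \<delta>2(1), of "1 + CF"]
    have "\<forall>\<^sub>F h in at_right 0. 0 < h \<and> h * (2 * C) < 1 \<and> h * CF < \<delta>1 \<and> h * (1 + CF) < \<delta>2"
      by (simp only: eventually_conj_iff zero_less_one simp_thms)
    then show ?thesis
    proof (rule eventually_mono, intro allI impI)
      fix h s \<nu> assume h: "0 < h \<and> h * (2 * C) < 1 \<and> h * CF < \<delta>1 \<and> h * (1 + CF) < \<delta>2"
        and s0: "0 \<le> s" and sh: "s + h \<le> T" and \<nu>: "\<nu> \<in> PS n"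
      have s: "s \<in> {0..T}" "s + h \<in> {0..T}" unfolding atLeastAtMost_iff using s0 sh h by linarith+
      let ?p = "Vn n s \<nu>" and ?\<nu>' = "D.fp_step h \<nu> (Vn n s \<nu>)"
      have \<nu>': "?\<nu>' \<in> PS n"
      proof (rule D.fp_step_PS[OF \<nu>])
        fix j assume "j \<in> {1..n}"
        then have "h * (D.al ?p j + D.be ?p j) \<le> h * (2 * C)"
          unfolding mult_2 using rates[OF s(1) \<nu>] h by (intro mult_left_mono add_mono) auto
        then show "h * (D.al ?p j + D.be ?p j) \<le> 1" using h by linarith
      qed (use h in simp)
      have diff: "?\<nu>' k - \<nu> k = - h * D.F \<nu> ?p k" for k unfolding D.fp_step_def by simp
      have l1: "(\<Sum>k=1..n. \<bar>?\<nu>' k - \<nu> k\<bar>) \<le> h * CF"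
        unfolding diff using h mult_left_mono[OF Fsum[OF s(1) \<nu>], of h] by (simp add: abs_mult sum_distrib_left)
      have "\<bar>u s ?\<nu>' - u s \<nu> - (\<Sum>k=1..n. d k s \<nu> * (?\<nu>' k - \<nu> k))\<bar> \<le> \<eta> / (2 * (CF + 1)) * (\<Sum>k=1..n. \<bar>?\<nu>' k - \<nu> k\<bar>)"
        using \<delta>1(2)[rule_format, OF s(1) \<nu> \<nu>'] l1 h by linarith
      also have "\<dots> \<le> \<eta> / (2 * (CF + 1)) * (h * (CF + 1))"
      proof (intro mult_left_mono)
        have "h * CF \<le> h * (CF + 1)" using h by (intro mult_left_mono) auto
        then show "(\<Sum>k=1..n. \<bar>?\<nu>' k - \<nu> k\<bar>) \<le> h * (CF + 1)" using l1 by linarith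
      qed (use e1 in simp)
      also have "\<dots> = h * (\<eta> / 2)" using CF0 by (simp add: field_simps)
      finally have space: "\<bar>u s ?\<nu>' - u s \<nu> - (\<Sum>k=1..n. d k s \<nu> * (?\<nu>' k - \<nu> k))\<bar> \<le> h * (\<eta> / 2)" .
      \<comment> \<open>The time derivative appears at an intermediate time and at the new measure,
        which is why its modulus was taken jointly in both.\<close>
      have "\<exists>\<xi>\<in>{s..s+h}. u (s + h) ?\<nu>' - u s ?\<nu>' = (\<lambda>r. r * v \<xi> ?\<nu>') ((s + h) - s)"
      proof (rule mvt_very_simple)
        show "s \<le> s + h" using h by simp
        fix r assume r: "s \<le> r" "r \<le> s + h"
        then have "((\<lambda>r. u r ?\<nu>') has_real_derivative v r ?\<nu>') (at r within {0..T})"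
          unfolding u_def v_def using s by (intro solution_facts(2) emb_M2T PS_M2S \<nu>') auto
        then have "((\<lambda>r. u r ?\<nu>') has_real_derivative v r ?\<nu>') (at r within {s..s+h})"
          by (rule DERIV_subset) (use s in auto)
        then show "((\<lambda>r. u r ?\<nu>') has_derivative (\<lambda>z. z * v r ?\<nu>')) (at r within {s..s+h})"
          by (simp add: has_field_derivative_def mult_commute_abs)
      qed
      then obtain \<xi> where \<xi>: "s \<le> \<xi>" "\<xi> \<le> s + h" "u (s + h) ?\<nu>' - u s ?\<nu>' = h * v \<xi> ?\<nu>'" by auto
      have "\<bar>v \<xi> ?\<nu>' - v s \<nu>\<bar> < \<eta> / 2"
      proof -
        have "((\<xi>, ?\<nu>'), (s, \<nu>)) \<in> ?K" using \<xi> s \<nu> \<nu>' by auto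
        moreover have "\<bar>\<xi> - s\<bar> + (\<Sum>k=1..n. \<bar>?\<nu>' k - \<nu> k\<bar>) < \<delta>2"
          using \<xi> l1 h by (simp add: distrib_left)
        ultimately show ?thesis using \<delta>2(2)[rule_format, of "((\<xi>, ?\<nu>'), (s, \<nu>))"] by simp
      qed
      then have time: "\<bar>h * (v \<xi> ?\<nu>' - v s \<nu>)\<bar> \<le> h * (\<eta> / 2)" using h by (simp add: abs_mult)
      have cong: "D.gen (V_disc U n s \<nu>) q j = D.gen ?p q j" "D.B (V_disc U n s \<nu>) j = D.B ?p j" if "j \<in> {1..n}" for q j
        using D.gen_cong[OF that, of "V_disc U n s \<nu>" ?p] by (auto simp: Vn_def)
      have Fc: "D.F \<nu> (V_disc U n s \<nu>) k = D.F \<nu> ?p k" for k unfolding D.F_def using cong by simp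
      have Asc: "D.As (V_disc U n s (D.A \<nu>)) i = D.As (Vn n s (D.A \<nu>)) i"
        unfolding A_disc_adj_def by (simp add: Vn_def)
      have "defect \<sigma> lam L Kn f U Ut dU n s \<nu> i = - v s \<nu> + (\<Sum>k=1..n. D.F \<nu> ?p k * d k s \<nu>)
          + lam * (?p i - D.As (Vn n s (D.A \<nu>)) i) - D.G \<nu> ?p i"
        unfolding defect_def F_disc_eq[OF n] G_disc_eq[OF n] Fc Asc v_def d_def D.G_def cong(2)[OF i]
        using i by (simp add: Vn_def)
      then have id: "D.G \<nu> ?p i - lam * (?p i - D.As (Vn n s (D.A \<nu>)) i)
          = - defect \<sigma> lam L Kn f U Ut dU n s \<nu> i - v s \<nu> + (\<Sum>k=1..n. D.F \<nu> ?p k * d k s \<nu>)" by linarith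
      have lin: "(\<Sum>k=1..n. d k s \<nu> * (?\<nu>' k - \<nu> k)) = - h * (\<Sum>k=1..n. D.F \<nu> ?p k * d k s \<nu>)"
        unfolding diff sum_distrib_left by (intro sum.cong) auto
      have vu: "Vn n (s + h) ?\<nu>' i = u (s + h) ?\<nu>'" "?p i = u s \<nu>" using i by (simp_all add: Vn_def V_disc_def u_def)
      have "\<bar>h * defect \<sigma> lam L Kn f U Ut dU n s \<nu> i\<bar> \<le> h * eps"
        using def[OF s(1) PS_M2S[OF \<nu>] i] h by (simp add: abs_mult)
      then have "\<bar>Vn n (s + h) ?\<nu>' i - ?p i
          + h * (D.G \<nu> ?p i - lam * (?p i - D.As (Vn n s (D.A \<nu>)) i))\<bar> \<le> h * (eps + \<eta>)"
        unfolding id unfolding vu by (rule consistency_remainder[OF space[unfolded lin] time \<xi>(3)])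
      with \<nu>' show "?\<nu>' \<in> PS n \<and> \<bar>Vn n (s + h) ?\<nu>' i - ?p i
          + h * (D.G \<nu> ?p i - lam * (?p i - D.As (Vn n s (D.A \<nu>)) i))\<bar> \<le> h * (eps + \<eta>)" ..
    qed
  qed
  \<comment> \<open>Finitely many indices, so one threshold for \<open>h\<close> serves all of
    them.\<close>
  have "\<forall>\<^sub>F h in at_right 0. \<forall>i\<in>{1..n}. ?Q i h" using step by (intro eventually_ball_finite) auto
  then obtain b where b: "b > 0" "\<And>h. 0 < h \<Longrightarrow> h < b \<Longrightarrow> \<forall>i\<in>{1..n}. ?Q i h"
    unfolding eventually_at_right_field by blast
  have one: "1 \<in> {1..n}" using n by simp
  show ?thesis
  proof (intro exI[of _ "b / 2"] conjI allI impI)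
    show "b / 2 > 0" using b by simp
    fix s h \<nu> assume a: "0 \<le> s" "0 < h" "h \<le> b / 2" "s + h \<le> T" "\<nu> \<in> PS n"
    have hb: "h < b" using a by simp
    note Q = b(2)[OF a(2) hb, rule_format, OF _ a(1,4,5)]
    show "D.fp_step h \<nu> (Vn n s \<nu>) \<in> PS n" using Q[OF one] by (rule conjunct1)
    show "\<forall>i\<in>{1..n}. \<bar>Vn n (s + h) (D.fp_step h \<nu> (Vn n s \<nu>)) i - Vn n s \<nu> i
          + h * (D.G \<nu> (Vn n s \<nu>) i - lam * (Vn n s \<nu> i - D.As (Vn n s (D.A \<nu>)) i))\<bar> \<le> h * (eps + \<eta>)"
      by (intro ballI conjunct2[OF Q])
  qed
qed

section \<open>From the abstract estimate to the rate\<close>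

lemma \<omega>_bounds: "0 \<le> \<omega> (1 / real n)" "n \<ge> 1 \<Longrightarrow> \<omega> (1 / real n) \<le> \<omega> 1"
proof -
  have mono: "mono_on {0..} \<omega>" and 0: "\<omega> 0 = 0" using \<omega> unfolding modulus_def by auto
  show "0 \<le> \<omega> (1 / real n)" using mono_onD[OF mono, of 0 "1 / real n"] 0 by simp
  show "\<omega> (1 / real n) \<le> \<omega> 1" if "n \<ge> 1" by (rule mono_onD[OF mono]) (use that in auto)
qed

lemma square_root_rate:
  assumes def: "\<forall>n\<ge>1. \<forall>t\<in>{0..T}. \<forall>m\<in>M2S n. \<forall>i\<in>{1..n}.
           \<bar>defect \<sigma> lam L Kn f U Ut dU n t m i\<bar> \<le> B * \<omega> (1 / real n)"
  shows "\<exists>C\<ge>0. \<forall>n\<ge>1. \<forall>W. monotone_solution T \<sigma> lam L Kn f g n W \<longrightarrow>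
    (\<forall>t\<in>{0..T}. \<forall>i\<in>{1..n}. \<forall>m\<in>PS n. \<bar>W t m i - Vn n t m i\<bar> \<le> C * sqrt (\<bar>B\<bar> * \<omega> (1 / real n)))"
proof -
  obtain c0 where c0: "c0 > 0" "\<forall>n\<ge>1. \<forall>t\<in>{0..T}. \<forall>m\<in>M2S n. \<forall>i\<in>{1..n}. \<forall>p x y.
     x = \<bar>discrete_mfg.al n (ca n) p i - discrete_mfg.al n (ca n) (Vn n t m) i\<bar> / real n \<longrightarrow>
     y = \<bar>discrete_mfg.be n (cb n) p i - discrete_mfg.be n (cb n) (Vn n t m) i\<bar> / real n \<longrightarrow>
     c0 * (min x (x\<^sup>2) + min y (y\<^sup>2)) \<le> discrete_mfg.gap n (b1 n) (b2 n) (ca n) (cb n) p (Vn n t m) i"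
    using gap_quadratic_growth by (elim exE conjE)
  obtain Lam where Lam: "Lam \<ge> 0" "\<forall>n\<ge>1. \<forall>t\<in>{0..T}. \<forall>m\<in>M2S n. \<forall>i\<in>{1..n}.
     discrete_mfg.al n (ca n) (Vn n t m) (next_idx n i) \<le> discrete_mfg.al n (ca n) (Vn n t m) i + Lam \<and>
     discrete_mfg.be n (cb n) (Vn n t m) i \<le> discrete_mfg.be n (cb n) (Vn n t m) (next_idx n i) + Lam"
    using drift_spread by (elim exE conjE)
  obtain C1 where C1: "C1 \<ge> 0" "\<forall>n\<ge>1. \<forall>t\<in>{0..T}. \<forall>m\<in>PS n. \<forall>\<nu>\<in>PS n. \<forall>w i. W1_close n m \<nu> w \<longrightarrow> i \<in> {1..n} \<longrightarrow>
     \<bar>Vn n t m i - Vn n t \<nu> i\<bar> \<le> C1 * w" using V_lipschitz by (elim exE conjE)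
  obtain C2 where C2: "C2 \<ge> 0" "\<forall>n\<ge>1. \<forall>m\<in>M2S n. \<forall>m'\<in>M2S n. \<forall>w x. W1_close n m m' w \<longrightarrow> \<bar>f x (emb n m) - f x (emb n m')\<bar> \<le> C2 * w"
    using coupling_emb_lipschitz[OF f_coupling] by (elim exE conjE)
  obtain C3 where C3: "C3 \<ge> 0" "\<forall>n\<ge>1. \<forall>m\<in>M2S n. \<forall>m'\<in>M2S n. \<forall>w x. W1_close n m m' w \<longrightarrow> \<bar>g x (emb n m) - g x (emb n m')\<bar> \<le> C3 * w"
    using coupling_emb_lipschitz[OF g_coupling] by (elim exE conjE)
  obtain CA where CA: "CA \<ge> 0" "\<forall>n\<ge>1. \<forall>m\<in>PS n. \<forall>\<nu>\<in>PS n. \<forall>w. W1_close n m \<nu> w \<longrightarrow> W1_close n (A_disc (Kn n) n m) (A_disc (Kn n) n \<nu>) (CA * w)"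
    using A_lipschitz by (elim exE conjE)
  define CV where "CV = C1 + C2 + C3"
  have CV: "CV \<ge> 0" "C1 \<le> CV" "C2 \<le> CV" "C3 \<le> CV" unfolding CV_def using C1 C2 C3 by auto
  \<comment> \<open>A common upper bound for all defects, as
    \<open>\<omega> (1 / n) \<le> \<omega> 1\<close>; the summand 1 leaves room for the shift
    \<open>e < 1\<close> below.\<close>
  define E0 where "E0 = \<bar>B\<bar> * \<omega> 1 + 1"
  define C where "C = \<bar>rate_const lam T c0 Lam CV CA E0\<bar>"
  have main: "\<bar>W t m i - Vn n t m i\<bar> \<le> C * sqrt (\<bar>B\<bar> * \<omega> (1 / real n))"
    if n: "n \<ge> 1" and W: "monotone_solution T \<sigma> lam L Kn f g n W" and t: "t \<in> {0..T}" and i: "i \<in> {1..n}" and m: "m \<in> PS n"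
    for n W t m i
  proof -
    let ?X = "\<bar>B\<bar> * \<omega> (1 / real n)"
    have X: "0 \<le> ?X" "?X \<le> \<bar>B\<bar> * \<omega> 1" using \<omega>_bounds[of n] n by (auto intro: mult_left_mono)
    \<comment> \<open>The abstract estimate requires a positive \<open>eps\<close>, while
      \<open>?X\<close> may be 0; the shift \<open>e\<close> is sent to 0 afterwards.\<close>
    have bnd: "\<bar>W t m i - Vn n t m i\<bar> \<le> C * sqrt (?X + e)" if e: "0 < e" "e < 1" for e
    proof -
      interpret S: discrete_solution n lam T "fn n" "b1 n" "b2 n" "ca n" "cb n" "Kn n" W "gn n"
        by (rule discrete_solution_n[OF n W])
      interpret V: approx_classical n lam T "fn n" "b1 n" "b2 n" "ca n" "cb n" "Kn n" W "gn n" "Vn n" "?X + e" E0 c0 Lam CV CA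
      proof
        fix k assume k: "k \<in> {1..n}"
        have "continuous_on ({0..T} \<times> PS n) (\<lambda>(t, m). U t (grid n k) (emb n m))"
          by (rule continuous_on_subset[OF U_emb_cont[OF n] PS_sub])
        then show "continuous_on ({0..T} \<times> PS n) (\<lambda>(t, m). Vn n t m k)" using k by (simp add: Vn_def V_disc_def)
      next
        fix k t m assume "k \<notin> {1..n}" then show "Vn n t m k = 0" unfolding Vn_def by (rule if_not_P)
      next
        fix \<mu> k assume "\<mu> \<in> PS n" "k \<in> {1..n}"
        then show "Vn n T \<mu> k = gn n \<mu> k"
          using solution_continuity(4)[OF emb_M2T[OF PS_M2S]] by (simp add: Vn_def V_disc_def gn_def)
      next
        fix \<eta> :: real assume \<eta>: "\<eta> > 0"
        show "\<exists>h0>0. \<forall>s h \<nu>. 0 \<le> s \<longrightarrow> 0 < h \<longrightarrow> h \<le> h0 \<longrightarrow> s + h \<le> T \<longrightarrow> \<nu> \<in> PS n \<longrightarrow>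
          S.fp_step h \<nu> (Vn n s \<nu>) \<in> PS n \<and> (\<forall>i\<in>{1..n}. \<bar>Vn n (s + h) (S.fp_step h \<nu> (Vn n s \<nu>)) i - Vn n s \<nu> i
          + h * (S.G \<nu> (Vn n s \<nu>) i - lam * (Vn n s \<nu> i - S.As (Vn n s (S.A \<nu>)) i))\<bar> \<le> h * (?X + e + \<eta>))"
        proof (rule V_expansion[OF n \<eta>])
          fix t m i assume "t \<in> {0..T}" "m \<in> M2S n" "i \<in> {1..n}"
          from def[rule_format, OF n this] have "\<bar>defect \<sigma> lam L Kn f U Ut dU n t m i\<bar> \<le> B * \<omega> (1 / real n)" .
          also have "\<dots> \<le> ?X" using \<omega>_bounds(1) by (intro mult_right_mono) auto
          finally show "\<bar>defect \<sigma> lam L Kn f U Ut dU n t m i\<bar> \<le> ?X + e" using e by simp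
        qed
      next
        fix s \<mu> \<nu> w k assume a: "s \<in> {0..T}" "\<mu> \<in> PS n" "\<nu> \<in> PS n" and w: "W1_close n \<mu> \<nu> w" and k: "k \<in> {1..n}"
        have "0 \<le> w" by (rule W1_close_nonneg[OF w])
        then have "C1 * w \<le> CV * w" by (intro mult_right_mono CV)
        then show "\<bar>Vn n s \<mu> k - Vn n s \<nu> k\<bar> \<le> CV * w" using C1(2)[rule_format, OF n a w k] by linarith
      next
        fix \<mu> \<nu> w k assume a: "\<mu> \<in> PS n" "\<nu> \<in> PS n" and w: "W1_close n \<mu> \<nu> w"
        have w0: "0 \<le> w" by (rule W1_close_nonneg[OF w])
        then have "C2 * w \<le> CV * w" by (intro mult_right_mono CV)
        then show "\<bar>fn n \<mu> k - fn n \<nu> k\<bar> \<le> CV * w"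
          unfolding fn_def using C2(2)[rule_format, OF n PS_M2S[OF a(1)] PS_M2S[OF a(2)] w, of "grid n k"] by linarith
        have "C3 * w \<le> CV * w" using w0 by (intro mult_right_mono CV)
        then show "\<bar>gn n \<mu> k - gn n \<nu> k\<bar> \<le> CV * w"
          unfolding gn_def using C3(2)[rule_format, OF n PS_M2S[OF a(1)] PS_M2S[OF a(2)] w, of "grid n k"] by linarith
      next
        fix \<mu> \<nu> w assume "\<mu> \<in> PS n" "\<nu> \<in> PS n" "W1_close n \<mu> \<nu> w"
        then show "W1_close n (S.A \<mu>) (S.A \<nu>) (CA * w)" by (rule CA(2)[rule_format, OF n])
      next
        fix s \<mu> k assume a: "s \<in> {0..T}" "\<mu> \<in> PS n" "k \<in> {1..n}"
        show "S.al (Vn n s \<mu>) (next_idx n k) \<le> S.al (Vn n s \<mu>) k + Lam \<and> S.be (Vn n s \<mu>) k \<le> S.be (Vn n s \<mu>) (next_idx n k) + Lam"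
          by (rule Lam(2)[rule_format, OF n a(1) PS_M2S[OF a(2)] a(3)])
      next
        fix s \<mu> k p x y assume a: "s \<in> {0..T}" "\<mu> \<in> PS n" "k \<in> {1..n}"
          and "x = \<bar>S.al p k - S.al (Vn n s \<mu>) k\<bar> / real n" "y = \<bar>S.be p k - S.be (Vn n s \<mu>) k\<bar> / real n"
        then show "c0 * (min x (x\<^sup>2) + min y (y\<^sup>2)) \<le> S.gap p (Vn n s \<mu>) k"
          by (intro c0(2)[rule_format, OF n a(1) PS_M2S[OF a(2)] a(3)])
      qed (use X e c0(1) Lam(1) CV(1) CA(1) in \<open>auto simp: E0_def\<close>)
      have "\<bar>W t m i - Vn n t m i\<bar> \<le> rate_const lam T c0 Lam CV CA E0 * sqrt (?X + e)" by (rule V.W_V_rate[OF t m i])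
      also have "\<dots> \<le> C * sqrt (?X + e)" unfolding C_def using X e by (intro mult_right_mono) auto
      finally show ?thesis .
    qed
    have "((\<lambda>e. C * sqrt (?X + e)) \<longlongrightarrow> C * sqrt (?X + 0)) (at_right 0)" by (intro tendsto_intros)
    moreover have "\<forall>\<^sub>F e in at_right 0. \<bar>W t m i - Vn n t m i\<bar> \<le> C * sqrt (?X + e)"
      unfolding eventually_at_right_field using bnd zero_less_one by blast
    ultimately have "\<bar>W t m i - Vn n t m i\<bar> \<le> C * sqrt (?X + 0)" by (rule tendsto_lowerbound) simp
    then show ?thesis by simp
  qed
  have C0: "C \<ge> 0" unfolding C_def by simp
  show ?thesis by (rule exI, rule conjI[OF C0], intro allI impI ballI, rule main)
qed

lemma cube_root_rate:
  assumes def: "\<forall>n\<ge>1. \<forall>t\<in>{0..T}. \<forall>m\<in>M2S n. \<forall>i\<in>{1..n}.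
           \<bar>defect \<sigma> lam L Kn f U Ut dU n t m i\<bar> \<le> B * \<omega> (1 / real n)"
  shows "\<exists>C>0. \<forall>n\<ge>1. \<forall>W. monotone_solution T \<sigma> lam L Kn f g n W \<longrightarrow>
           (SUP (t, i, m)\<in>{0..T} \<times> {1..n} \<times> PS n.
              ereal \<bar>W t m i - V_disc U n t m i\<bar>)
           \<le> ereal (C * (\<omega> (1 / real n)) powr (1 / 3))"
proof -
  obtain C where C: "C \<ge> 0" "\<forall>n\<ge>1. \<forall>W. monotone_solution T \<sigma> lam L Kn f g n W \<longrightarrow>
    (\<forall>t\<in>{0..T}. \<forall>i\<in>{1..n}. \<forall>m\<in>PS n. \<bar>W t m i - Vn n t m i\<bar> \<le> C * sqrt (\<bar>B\<bar> * \<omega> (1 / real n)))"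
    using square_root_rate[OF def] by (elim exE conjE)
  \<comment> \<open>The factor \<open>\<omega> 1 powr (1 / 6)\<close> absorbs the surplus exponent
    1/2 - 1/3; the summand 1 makes the constant positive.\<close>
  define C' where "C' = C * sqrt \<bar>B\<bar> * \<omega> 1 powr (1 / 6) + 1"
  have C': "C' > 0" unfolding C'_def using C(1) by (intro add_nonneg_pos mult_nonneg_nonneg) auto
  have "\<bar>W t m i - V_disc U n t m i\<bar> \<le> C' * \<omega> (1 / real n) powr (1 / 3)"
    if n: "n \<ge> 1" and W: "monotone_solution T \<sigma> lam L Kn f g n W" and tim: "t \<in> {0..T}" "i \<in> {1..n}" "m \<in> PS n" for n W t i m
  proof -
    let ?w = "\<omega> (1 / real n)"
    have w: "0 \<le> ?w" "?w \<le> \<omega> 1" using \<omega>_bounds[of n] n by auto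
    have "\<bar>W t m i - V_disc U n t m i\<bar> \<le> C * sqrt (\<bar>B\<bar> * ?w)"
      using C(2)[rule_format, OF n W tim] tim by (simp add: Vn_def)
    also have "\<dots> = C * sqrt \<bar>B\<bar> * sqrt ?w" by (simp add: real_sqrt_mult)
    also have "sqrt ?w = ?w powr (1 / 6) * ?w powr (1 / 3)"
      using powr_half_sqrt[OF w(1)] by (simp add: powr_add[symmetric])
    also have "\<dots> \<le> \<omega> 1 powr (1 / 6) * ?w powr (1 / 3)" using w by (intro mult_right_mono powr_mono2) auto
    also have "C * sqrt \<bar>B\<bar> * (\<omega> 1 powr (1 / 6) * ?w powr (1 / 3)) \<le> C' * ?w powr (1 / 3)"
      unfolding C'_def by (simp add: algebra_simps)
    finally show ?thesis using C(1) by (simp add: mult_left_mono)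
  qed
  then show ?thesis using C' by (intro exI[of _ C'] conjI allI impI SUP_least) (auto split: prod.splits)
qed

end

theorem theorem4p16:
  fixes \<sigma> lam T \<gamma> \<alpha> \<theta> :: real
    and L K :: "real \<Rightarrow> real \<Rightarrow> real"
    and f g :: "real \<Rightarrow> real measure \<Rightarrow> real"
    and df dg :: "real \<Rightarrow> real measure \<Rightarrow> real \<Rightarrow> real"
    and Kn :: "nat \<Rightarrow> nat \<Rightarrow> nat \<Rightarrow> real"
    and U Ut Ux Uxx :: "real \<Rightarrow> real \<Rightarrow> real measure \<Rightarrow> real"
    and dU DU DyDU :: "real \<Rightarrow> real \<Rightarrow> real measure \<Rightarrow> real \<Rightarrow> real"
    and \<omega> :: "real \<Rightarrow> real"
  assumes "\<sigma> > 0" and "lam > 0" and "T > 0"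
    and "Lagrangian_assms L"
    and "0 < \<gamma>" and "\<gamma> < 1"
    and "coupling_assms \<gamma> f" and "coupling_assms \<gamma> g"
    and "\<exists>B. \<forall>m\<in>M2T. \<forall>x x'. \<bar>f x m - f x' m\<bar> \<le> B * \<bar>x - x'\<bar>"
    and "\<exists>B. \<forall>m\<in>M2T. holder_norm 2 \<gamma> (\<lambda>x. g x m) \<le> ennreal B"
    and "kernel_assms K"
    and "0 < \<alpha>" and "\<alpha> \<le> 1"
    and "holder_W1_lipschitz 1 \<alpha> f" and "holder_W1_lipschitz 2 \<alpha> g"
    and "differentiable_coupling f df" and "differentiable_coupling g dg"
    and "\<theta> > 0"
    and "strongly_monotone_derivative df \<theta>" and "strongly_monotone_derivative dg \<theta>"
    and "classical_solution T \<sigma> lam L K f g U Ut Ux Uxx dU DU DyDU"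
    and "modulus \<omega>"
    and "modulus_of T \<omega> (\<lambda>t x m y. Ux t x m)" and "modulus_of T \<omega> (\<lambda>t x m y. Uxx t x m)"
    and "modulus_of T \<omega> DU" and "modulus_of T \<omega> DyDU"
    and "discretization K Kn"
    and "\<exists>B. \<forall>n\<ge>1. \<forall>t\<in>{0..T}. \<forall>m\<in>M2S n. \<forall>i\<in>{1..n}.
           \<bar>defect \<sigma> lam L Kn f U Ut dU n t m i\<bar> \<le> B * \<omega> (1 / real n)"
  shows "\<exists>C>0. \<forall>n\<ge>1. \<forall>W. monotone_solution T \<sigma> lam L Kn f g n W \<longrightarrow>
           (SUP (t, i, m)\<in>{0..T} \<times> {1..n} \<times> PS n.
              ereal \<bar>W t m i - V_disc U n t m i\<bar>)
           \<le> ereal (C * (\<omega> (1 / real n)) powr (1 / 3))"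
proof -
  obtain B where B: "\<forall>n\<ge>1. \<forall>t\<in>{0..T}. \<forall>m\<in>M2S n. \<forall>i\<in>{1..n}.
           \<bar>defect \<sigma> lam L Kn f U Ut dU n t m i\<bar> \<le> B * \<omega> (1 / real n)"
    using assms(28) by (elim exE)
  interpret master_setting \<sigma> lam T \<gamma> L K f g Kn U Ut Ux Uxx dU DU DyDU \<omega>
    by (rule master_setting.intro) (rule assms)+
  show ?thesis by (rule cube_root_rate[OF B])
qed

end
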